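(* Let $k$ be a commutative unital ring, $m\ge2$, $n=m+1$, let $X$ be a finite nonempty $C_m$-set, $A=k^X$, and $\sigma$ the automorphism of $k^X$ induced by a generator $g$ of $C_m$. For every orbit $O\subseteq X\times X$ of the diagonal $C_m$-action choose $x_O\in O$ and put $H_O=\mathrm{Stab}_{C_m}(x_O)$. Then, after choosing orbit representatives, there is an isomorphism of $k$-algebras $$\mathsf U^{\mathrm{an}}(k^X,\sigma,n)\cong\prod_{O\in(X\times X)/C_m}M_{|O|}(kH_O).$$ In particular, the Morita class of the anchored envelope $\mathsf U^{\mathrm{an}}(k^X,\sigma,n)$ is determined by the stabilizers $H_O$ of the diagonal orbits.
   Context: $C_m$ is the cyclic group of order $m$; $k^X$ is the algebra of functions $X\to k$ with pointwise multiplication; $\sigma$ sends the characteristic function of $x$ to that of $gx$, so $\sigma^m=1$. Anchored envelope: for a unital associative $k$-algebra $A$ and $\sigma\in\mathrm{Aut}_k(A)$ with $\sigma^m=1$, let $\mu(a_0,\ldots,a_m)=a_0\sigma(a_1)\cdots\sigma^{m-1}(a_{m-1})a_m$, a totally associative $n$-ary product. A one-hole context is a finite planar rooted full $n$-ary tree (every internal vertex has exactly $n$ ordered inputs) with one distinguished leaf labelled $\star$ (the hole) and all other (ordinary) leaves labelled by elements of $A$. Take the free $k$-module on one-hole contexts modulo: multilinearity in the ordinary leaf labels; scalar contraction (a vertex all of whose inputs are ordinary leaves $a_0,\ldots,a_m$ may be replaced by one ordinary leaf labelled $\mu(a_0,\ldots,a_m)$); and total associativity (rebracketing of two adjacent vertices).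 Grafting makes this an associative unital algebra: $CD$ is obtained by grafting $D$ into the hole of $C$, and the unit is the trivial tree $\star$. Imposing moreover (as algebra relations) that the one-vertex contexts with inputs $(\star,1,\ldots,1)$ and $(1,\ldots,1,\star)$ both equal the unit gives the anchored envelope $\mathsf U^{\mathrm{an}}(A,\sigma,n)$. *)

theory Defs
  imports
    "HOL-Algebra.Module"
    "HOL-Algebra.QuotRing"
    "HOL-Algebra.Generated_Groups"
    "HOL-Algebra.Group_Action"
begin

text \<open>Unital associative, not necessarily commutative, algebras over a commutative ring
  \<open>K\<close> are records of type \<^typ>\<open>('k, 'a) module\<close>, using all of its fields
  (the library locale \<open>algebra\<close> covers commutative algebras only).\<close>

section \<open>Constructions of algebras\<close>

definition algebra_iso ::
    "('k, 'e) ring_scheme \<Rightarrow> ('k, 'a) module \<Rightarrow> ('k, 'b) module \<Rightarrow> ('a \<Rightarrow> 'b) set" where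
  "algebra_iso K A B =
    {h \<in> ring_iso A B. \<forall>c \<in> carrier K. \<forall>a \<in> carrier A. h (c \<odot>\<^bsub>A\<^esub> a) = c \<odot>\<^bsub>B\<^esub> h a}"

definition algebra_isomorphic ::
    "('k, 'e) ring_scheme \<Rightarrow> ('k, 'a) module \<Rightarrow> ('k, 'b) module \<Rightarrow> bool" where
  "algebra_isomorphic K A B \<longleftrightarrow> algebra_iso K A B \<noteq> {}"

definition function_algebra :: "('k, 'e) ring_scheme \<Rightarrow> 'x set \<Rightarrow> ('k, 'x \<Rightarrow> 'k) module" where
  "function_algebra K X =
    \<lparr>carrier = X \<rightarrow>\<^sub>E carrier K,
     mult = (\<lambda>f h. \<lambda>x\<in>X. f x \<otimes>\<^bsub>K\<^esub> h x),
     one = (\<lambda>x\<in>X. \<one>\<^bsub>K\<^esub>),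
     zero = (\<lambda>x\<in>X. \<zero>\<^bsub>K\<^esub>),
     add = (\<lambda>f h. \<lambda>x\<in>X. f x \<oplus>\<^bsub>K\<^esub> h x),
     smult = (\<lambda>c f. \<lambda>x\<in>X. c \<otimes>\<^bsub>K\<^esub> f x)\<rparr>"

definition product_algebra :: "'i set \<Rightarrow> ('i \<Rightarrow> ('k, 'a) module) \<Rightarrow> ('k, 'i \<Rightarrow> 'a) module" where
  "product_algebra I A =
    \<lparr>carrier = (\<Pi>\<^sub>E i\<in>I. carrier (A i)),
     mult = (\<lambda>f h. \<lambda>i\<in>I. f i \<otimes>\<^bsub>A i\<^esub> h i),
     one = (\<lambda>i\<in>I. \<one>\<^bsub>A i\<^esub>),
     zero = (\<lambda>i\<in>I. \<zero>\<^bsub>A i\<^esub>),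
     add = (\<lambda>f h. \<lambda>i\<in>I. f i \<oplus>\<^bsub>A i\<^esub> h i),
     smult = (\<lambda>c f. \<lambda>i\<in>I. c \<odot>\<^bsub>A i\<^esub> f i)\<rparr>"

definition matrix_algebra :: "nat \<Rightarrow> ('k, 'a) module \<Rightarrow> ('k, nat \<times> nat \<Rightarrow> 'a) module" where
  "matrix_algebra d R =
    \<lparr>carrier = {..<d} \<times> {..<d} \<rightarrow>\<^sub>E carrier R,
     mult = (\<lambda>M N. \<lambda>(i, j)\<in>{..<d} \<times> {..<d}. \<Oplus>\<^bsub>R\<^esub>l\<in>{..<d}. M (i, l) \<otimes>\<^bsub>R\<^esub> N (l, j)),
     one = (\<lambda>(i, j)\<in>{..<d} \<times> {..<d}. if i = j then \<one>\<^bsub>R\<^esub> else \<zero>\<^bsub>R\<^esub>),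
     zero = (\<lambda>p\<in>{..<d} \<times> {..<d}. \<zero>\<^bsub>R\<^esub>),
     add = (\<lambda>M N. \<lambda>p\<in>{..<d} \<times> {..<d}. M p \<oplus>\<^bsub>R\<^esub> N p),
     smult = (\<lambda>c M. \<lambda>p\<in>{..<d} \<times> {..<d}. c \<odot>\<^bsub>R\<^esub> M p)\<rparr>"

text \<open>The free \<open>K\<close>-module on the carrier of a monoid \<open>S\<close>, with the multiplication of
  \<open>S\<close> extended bilinearly. Elements are functions of finite support that vanish outside
  the carrier of \<open>S\<close>.\<close>

definition fsupp :: "('k, 'e) ring_scheme \<Rightarrow> ('s \<Rightarrow> 'k) \<Rightarrow> 's set" where
  "fsupp K f = {s. f s \<noteq> \<zero>\<^bsub>K\<^esub>}"

definition monoid_algebra ::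
    "('k, 'e) ring_scheme \<Rightarrow> ('s, 'f) monoid_scheme \<Rightarrow> ('k, 's \<Rightarrow> 'k) module" where
  "monoid_algebra K S =
    \<lparr>carrier = {f. range f \<subseteq> carrier K \<and> finite (fsupp K f) \<and> fsupp K f \<subseteq> carrier S},
     mult = (\<lambda>f h s. \<Oplus>\<^bsub>K\<^esub>p\<in>{p \<in> fsupp K f \<times> fsupp K h. fst p \<otimes>\<^bsub>S\<^esub> snd p = s}.
               f (fst p) \<otimes>\<^bsub>K\<^esub> h (snd p)),
     one = (\<lambda>s. if s = \<one>\<^bsub>S\<^esub> then \<one>\<^bsub>K\<^esub> else \<zero>\<^bsub>K\<^esub>),
     zero = (\<lambda>s. \<zero>\<^bsub>K\<^esub>),
     add = (\<lambda>f h s. f s \<oplus>\<^bsub>K\<^esub> h s),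
     smult = (\<lambda>c f s. c \<otimes>\<^bsub>K\<^esub> f s)\<rparr>"

definition basis_element :: "('k, 'e) ring_scheme \<Rightarrow> 's \<Rightarrow> 's \<Rightarrow> 'k" where
  "basis_element K t = (\<lambda>s. if s = t then \<one>\<^bsub>K\<^esub> else \<zero>\<^bsub>K\<^esub>)"

definition group_algebra ::
    "('k, 'e) ring_scheme \<Rightarrow> ('g, 'f) monoid_scheme \<Rightarrow> 'g set \<Rightarrow> ('k, 'g \<Rightarrow> 'k) module" where
  "group_algebra K G H = monoid_algebra K (G\<lparr>carrier := H\<rparr>)"

text \<open>For a two-sided ideal \<open>I\<close>, the scalar \<open>c\<close> sends \<open>I + x\<close> to \<open>I + c x\<close>.\<close>

definition quotient_algebra :: "('k, 'a) module \<Rightarrow> 'a set \<Rightarrow> ('k, 'a set) module" where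
  "quotient_algebra R I =
    \<lparr>carrier = carrier (R Quot I), mult = mult (R Quot I), one = one (R Quot I),
     zero = zero (R Quot I), add = add (R Quot I),
     smult = (\<lambda>c C. \<Union>x\<in>C. I +>\<^bsub>R\<^esub> (c \<odot>\<^bsub>R\<^esub> x))\<rparr>"


section \<open>One-hole contexts and the anchored envelope\<close>

datatype 'a tree = Leaf 'a | Hole | Node "'a tree list"

fun full_tree :: "nat \<Rightarrow> 'a set \<Rightarrow> 'a tree \<Rightarrow> bool" where
  "full_tree n S (Leaf a) \<longleftrightarrow> a \<in> S"
| "full_tree n S Hole \<longleftrightarrow> True"
| "full_tree n S (Node ts) \<longleftrightarrow> length ts = n \<and> (\<forall>t \<in> set ts. full_tree n S t)"

fun holes :: "'a tree \<Rightarrow> nat" where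
  "holes (Leaf a) = 0"
| "holes Hole = 1"
| "holes (Node ts) = sum_list (map holes ts)"

definition contexts :: "nat \<Rightarrow> 'a set \<Rightarrow> 'a tree set" where
  "contexts n S = {t. full_tree n S t \<and> holes t = 1}"

fun graft :: "'a tree \<Rightarrow> 'a tree \<Rightarrow> 'a tree" where
  "graft (Leaf a) D = Leaf a"
| "graft Hole D = D"
| "graft (Node ts) D = Node (map (\<lambda>t. graft t D) ts)"

definition context_monoid :: "nat \<Rightarrow> 'a set \<Rightarrow> 'a tree monoid" where
  "context_monoid n S = \<lparr>carrier = contexts n S, mult = graft, one = Hole\<rparr>"

text \<open>A frame is a tree with one marked position, viewed as the map inserting its argument
  there. Frames let a relation be applied at an arbitrary position of a tree; the hole of
  the resulting context may lie inside or outside the inserted subtree.\<close>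

inductive_set frames :: "('a tree \<Rightarrow> 'a tree) set" where
  here: "(\<lambda>t. t) \<in> frames"
| below: "F \<in> frames \<Longrightarrow> (\<lambda>t. Node (us @ F t # vs)) \<in> frames"

text \<open>For \<open>as = [a\<^sub>0, \<dots>, a\<^sub>m]\<close> with \<open>m = n - 1\<close> this is
  \<open>a\<^sub>0 \<sigma>(a\<^sub>1) \<dots> \<sigma>\<^sup>m\<^sup>-\<^sup>1(a\<^sub>m\<^sub>-\<^sub>1) a\<^sub>m\<close>; the last factor is not twisted.\<close>

definition twisted_product ::
    "('k, 'a) module \<Rightarrow> ('a \<Rightarrow> 'a) \<Rightarrow> nat \<Rightarrow> 'a list \<Rightarrow> 'a" where
  "twisted_product A \<sigma> n as =
    foldr (\<lambda>i p. (\<sigma> ^^ i) (as ! i) \<otimes>\<^bsub>A\<^esub> p) [0..<n - 1] (as ! (n - 1))"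

definition context_algebra ::
    "('k, 'e) ring_scheme \<Rightarrow> ('k, 'a) module \<Rightarrow> nat \<Rightarrow> ('k, 'a tree \<Rightarrow> 'k) module" where
  "context_algebra K A n = monoid_algebra K (context_monoid n (carrier A))"

inductive_set envelope_relations ::
    "('k, 'e) ring_scheme \<Rightarrow> ('k, 'a) module \<Rightarrow> ('a \<Rightarrow> 'a) \<Rightarrow> nat \<Rightarrow> ('a tree \<Rightarrow> 'k) set"
  for K :: "('k, 'e) ring_scheme" and A :: "('k, 'a) module" and \<sigma> :: "'a \<Rightarrow> 'a" and n :: nat
where
  additive:
    "\<lbrakk>F \<in> frames; a \<in> carrier A; b \<in> carrier A; F (Leaf (a \<oplus>\<^bsub>A\<^esub> b)) \<in> contexts n (carrier A)\<rbrakk>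
     \<Longrightarrow> basis_element K (F (Leaf (a \<oplus>\<^bsub>A\<^esub> b))) \<ominus>\<^bsub>context_algebra K A n\<^esub>
           (basis_element K (F (Leaf a)) \<oplus>\<^bsub>context_algebra K A n\<^esub> basis_element K (F (Leaf b)))
         \<in> envelope_relations K A \<sigma> n"
| homogeneous:
    "\<lbrakk>F \<in> frames; c \<in> carrier K; a \<in> carrier A; F (Leaf (c \<odot>\<^bsub>A\<^esub> a)) \<in> contexts n (carrier A)\<rbrakk>
     \<Longrightarrow> basis_element K (F (Leaf (c \<odot>\<^bsub>A\<^esub> a))) \<ominus>\<^bsub>context_algebra K A n\<^esub>
           (c \<odot>\<^bsub>context_algebra K A n\<^esub> basis_element K (F (Leaf a)))
         \<in> envelope_relations K A \<sigma> n"
| contraction: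
    "\<lbrakk>F \<in> frames; length as = n; set as \<subseteq> carrier A;
      F (Node (map Leaf as)) \<in> contexts n (carrier A)\<rbrakk>
     \<Longrightarrow> basis_element K (F (Node (map Leaf as))) \<ominus>\<^bsub>context_algebra K A n\<^esub>
           basis_element K (F (Leaf (twisted_product A \<sigma> n as)))
         \<in> envelope_relations K A \<sigma> n"
| associativity:
    "\<lbrakk>F \<in> frames; us @ vs @ ws = us' @ vs' @ ws'; length vs = n; length vs' = n;
      F (Node (us @ Node vs # ws)) \<in> contexts n (carrier A);
      F (Node (us' @ Node vs' # ws')) \<in> contexts n (carrier A)\<rbrakk>
     \<Longrightarrow> basis_element K (F (Node (us @ Node vs # ws))) \<ominus>\<^bsub>context_algebra K A n\<^esub>
           basis_element K (F (Node (us' @ Node vs' # ws')))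
         \<in> envelope_relations K A \<sigma> n"

definition anchor_relations ::
    "('k, 'e) ring_scheme \<Rightarrow> ('k, 'a) module \<Rightarrow> nat \<Rightarrow> ('a tree \<Rightarrow> 'k) set" where
  "anchor_relations K A n =
    {basis_element K (Node (Hole # replicate (n - 1) (Leaf \<one>\<^bsub>A\<^esub>)))
       \<ominus>\<^bsub>context_algebra K A n\<^esub> basis_element K Hole,
     basis_element K (Node (replicate (n - 1) (Leaf \<one>\<^bsub>A\<^esub>) @ [Hole]))
       \<ominus>\<^bsub>context_algebra K A n\<^esub> basis_element K Hole}"

text \<open>The linear span of \<^const>\<open>envelope_relations\<close> is stable under grafting on either side,
  hence is already a two-sided ideal. Dividing by the ideal generated by both kinds of
  relations therefore agrees with first forming the quotient module and then
  imposing the anchors as algebra relations.\<close>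

definition anchored_envelope ::
    "('k, 'e) ring_scheme \<Rightarrow> ('k, 'a) module \<Rightarrow> ('a \<Rightarrow> 'a) \<Rightarrow> nat
      \<Rightarrow> ('k, ('a tree \<Rightarrow> 'k) set) module" where
  "anchored_envelope K A \<sigma> n =
    quotient_algebra (context_algebra K A n)
      (genideal (context_algebra K A n) (envelope_relations K A \<sigma> n \<union> anchor_relations K A n))"


section \<open>Permutation automorphisms and the diagonal action\<close>

text \<open>The inverse makes the characteristic function of \<open>x\<close> go to that of \<open>g x\<close>.\<close>

definition induced_automorphism ::
    "('g, 'f) monoid_scheme \<Rightarrow> 'x set \<Rightarrow> ('g \<Rightarrow> 'x \<Rightarrow> 'x) \<Rightarrow> 'g \<Rightarrow> ('x \<Rightarrow> 'k) \<Rightarrow> 'x \<Rightarrow> 'k" where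
  "induced_automorphism G X \<phi> g f = (\<lambda>x\<in>X. f (\<phi> (inv\<^bsub>G\<^esub> g) x))"

lemma induced_automorphism_characteristic:
  assumes "group_action G X \<phi>" "g \<in> carrier G" "x \<in> X"
  shows "induced_automorphism G X \<phi> g (\<lambda>y\<in>X. if y = x then \<one>\<^bsub>K\<^esub> else \<zero>\<^bsub>K\<^esub>)
       = (\<lambda>y\<in>X. if y = \<phi> g x then \<one>\<^bsub>K\<^esub> else \<zero>\<^bsub>K\<^esub>)"
proof -
  interpret group_action G X \<phi> by fact
  interpret group G using group_hom unfolding group_hom_def by simp
  have mem: "\<phi> (inv\<^bsub>G\<^esub> g) y \<in> X" if "y \<in> X" for y
    using element_image[of "inv\<^bsub>G\<^esub> g" y] assms(2) that by simp
  have eq: "\<phi> (inv\<^bsub>G\<^esub> g) y = x \<longleftrightarrow> y = \<phi> g x" if "y \<in> X" for y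
    using assms that orbit_sym_aux[of g x y] orbit_sym_aux[of "inv\<^bsub>G\<^esub> g" y x] by auto
  show ?thesis
    unfolding induced_automorphism_def by (auto simp: fun_eq_iff restrict_def mem eq)
qed

definition diagonal_action :: "'x set \<Rightarrow> ('g \<Rightarrow> 'x \<Rightarrow> 'x) \<Rightarrow> 'g \<Rightarrow> 'x \<times> 'x \<Rightarrow> 'x \<times> 'x" where
  "diagonal_action X \<phi> h = (\<lambda>(x, y)\<in>X \<times> X. (\<phi> h x, \<phi> h y))"

definition diagonal_orbits ::
    "('g, 'f) monoid_scheme \<Rightarrow> 'x set \<Rightarrow> ('g \<Rightarrow> 'x \<Rightarrow> 'x) \<Rightarrow> ('x \<times> 'x) set set" where
  "diagonal_orbits G X \<phi> = orbits G (X \<times> X) (diagonal_action X \<phi>)"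

definition diagonal_stabilizer ::
    "('g, 'f) monoid_scheme \<Rightarrow> 'x set \<Rightarrow> ('g \<Rightarrow> 'x \<Rightarrow> 'x) \<Rightarrow> 'x \<times> 'x \<Rightarrow> 'g set" where
  "diagonal_stabilizer G X \<phi> p = stabilizer G (diagonal_action X \<phi>) p"

definition permutation_envelope ::
    "('k, 'e) ring_scheme \<Rightarrow> ('g, 'f) monoid_scheme \<Rightarrow> 'x set \<Rightarrow> ('g \<Rightarrow> 'x \<Rightarrow> 'x) \<Rightarrow> 'g \<Rightarrow> nat
      \<Rightarrow> ('k, (('x \<Rightarrow> 'k) tree \<Rightarrow> 'k) set) module" where
  "permutation_envelope K G X \<phi> g n =
    anchored_envelope K (function_algebra K X) (induced_automorphism G X \<phi> g) n"


section \<open>Morita equivalence\<close>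

locale left_module = R?: ring R + M?: abelian_group M
  for R (structure) and M (structure) +
  assumes smult_closed:
      "\<lbrakk>a \<in> carrier R; x \<in> carrier M\<rbrakk> \<Longrightarrow> a \<odot>\<^bsub>M\<^esub> x \<in> carrier M"
    and smult_l_distr:
      "\<lbrakk>a \<in> carrier R; b \<in> carrier R; x \<in> carrier M\<rbrakk>
       \<Longrightarrow> (a \<oplus>\<^bsub>R\<^esub> b) \<odot>\<^bsub>M\<^esub> x = a \<odot>\<^bsub>M\<^esub> x \<oplus>\<^bsub>M\<^esub> b \<odot>\<^bsub>M\<^esub> x"
    and smult_r_distr:
      "\<lbrakk>a \<in> carrier R; x \<in> carrier M; y \<in> carrier M\<rbrakk>
       \<Longrightarrow> a \<odot>\<^bsub>M\<^esub> (x \<oplus>\<^bsub>M\<^esub> y) = a \<odot>\<^bsub>M\<^esub> x \<oplus>\<^bsub>M\<^esub> a \<odot>\<^bsub>M\<^esub> y"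
    and smult_assoc:
      "\<lbrakk>a \<in> carrier R; b \<in> carrier R; x \<in> carrier M\<rbrakk>
       \<Longrightarrow> (a \<otimes>\<^bsub>R\<^esub> b) \<odot>\<^bsub>M\<^esub> x = a \<odot>\<^bsub>M\<^esub> (b \<odot>\<^bsub>M\<^esub> x)"
    and smult_one:
      "x \<in> carrier M \<Longrightarrow> \<one>\<^bsub>R\<^esub> \<odot>\<^bsub>M\<^esub> x = x"

text \<open>The category of left \<open>R\<close>-modules whose underlying set is a subset of the type \<open>'u\<close>.
  Morphisms are extensional functions, so that their equality is equality on the source. The
  \<open>mult\<close> and \<open>one\<close> fields of a module record play no role.\<close>

definition left_modules :: "('k, 'r) module \<Rightarrow> ('r, 'u) module set" where
  "left_modules R = {M. left_module R M}"

definition module_homs ::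
    "('k, 'r) module \<Rightarrow> ('r, 'u) module \<Rightarrow> ('r, 'u) module \<Rightarrow> ('u \<Rightarrow> 'u) set" where
  "module_homs R M N = {f \<in> carrier M \<rightarrow>\<^sub>E carrier N.
     (\<forall>x \<in> carrier M. \<forall>y \<in> carrier M. f (x \<oplus>\<^bsub>M\<^esub> y) = f x \<oplus>\<^bsub>N\<^esub> f y) \<and>
     (\<forall>a \<in> carrier R. \<forall>x \<in> carrier M. f (a \<odot>\<^bsub>M\<^esub> x) = a \<odot>\<^bsub>N\<^esub> f x)}"

definition hom_add ::
    "('r, 'u) module \<Rightarrow> ('r, 'u) module \<Rightarrow> ('u \<Rightarrow> 'u) \<Rightarrow> ('u \<Rightarrow> 'u) \<Rightarrow> 'u \<Rightarrow> 'u" where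
  "hom_add M N f h = (\<lambda>x\<in>carrier M. f x \<oplus>\<^bsub>N\<^esub> h x)"

text \<open>\<open>K\<close> acts on an \<open>R\<close>-module through \<open>c \<mapsto> c \<cdot> 1\<^sub>R\<close>.\<close>

definition hom_smult ::
    "('k, 'r) module \<Rightarrow> ('r, 'u) module \<Rightarrow> ('r, 'u) module \<Rightarrow> 'k \<Rightarrow> ('u \<Rightarrow> 'u) \<Rightarrow> 'u \<Rightarrow> 'u" where
  "hom_smult R M N c f = (\<lambda>x\<in>carrier M. (c \<odot>\<^bsub>R\<^esub> \<one>\<^bsub>R\<^esub>) \<odot>\<^bsub>N\<^esub> f x)"

definition linear_functor ::
    "('k, 'e) ring_scheme \<Rightarrow> ('k, 'r) module \<Rightarrow> ('k, 's) module
      \<Rightarrow> (('r, 'u) module \<Rightarrow> ('s, 'u) module)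
      \<Rightarrow> (('r, 'u) module \<Rightarrow> ('r, 'u) module \<Rightarrow> ('u \<Rightarrow> 'u) \<Rightarrow> ('u \<Rightarrow> 'u)) \<Rightarrow> bool" where
  "linear_functor K R S Fo Fm \<longleftrightarrow>
     (\<forall>M \<in> left_modules R. Fo M \<in> left_modules S) \<and>
     (\<forall>M \<in> left_modules R. \<forall>N \<in> left_modules R. \<forall>f \<in> module_homs R M N.
        Fm M N f \<in> module_homs S (Fo M) (Fo N)) \<and>
     (\<forall>M \<in> left_modules R. Fm M M (\<lambda>x\<in>carrier M. x) = (\<lambda>x\<in>carrier (Fo M). x)) \<and>
     (\<forall>L \<in> left_modules R. \<forall>M \<in> left_modules R. \<forall>N \<in> left_modules R.
      \<forall>f \<in> module_homs R L M. \<forall>h \<in> module_homs R M N.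
        Fm L N (compose (carrier L) h f) = compose (carrier (Fo L)) (Fm M N h) (Fm L M f)) \<and>
     (\<forall>M \<in> left_modules R. \<forall>N \<in> left_modules R. \<forall>f \<in> module_homs R M N. \<forall>h \<in> module_homs R M N.
        Fm M N (hom_add M N f h) = hom_add (Fo M) (Fo N) (Fm M N f) (Fm M N h)) \<and>
     (\<forall>M \<in> left_modules R. \<forall>N \<in> left_modules R. \<forall>c \<in> carrier K. \<forall>f \<in> module_homs R M N.
        Fm M N (hom_smult R M N c f) = hom_smult S (Fo M) (Fo N) c (Fm M N f))"

text \<open>A natural isomorphism from the endofunctor \<open>(Eo, Em)\<close> of the module category to the
  identity functor. Bijective module homomorphisms are exactly the isomorphisms.\<close>

definition natural_iso_to_id ::
    "('k, 'r) module \<Rightarrow> (('r, 'u) module \<Rightarrow> ('r, 'u) module)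
      \<Rightarrow> (('r, 'u) module \<Rightarrow> ('r, 'u) module \<Rightarrow> ('u \<Rightarrow> 'u) \<Rightarrow> ('u \<Rightarrow> 'u))
      \<Rightarrow> (('r, 'u) module \<Rightarrow> 'u \<Rightarrow> 'u) \<Rightarrow> bool" where
  "natural_iso_to_id R Eo Em \<eta> \<longleftrightarrow>
     (\<forall>M \<in> left_modules R.
        \<eta> M \<in> module_homs R (Eo M) M \<and> bij_betw (\<eta> M) (carrier (Eo M)) (carrier M)) \<and>
     (\<forall>M \<in> left_modules R. \<forall>N \<in> left_modules R. \<forall>f \<in> module_homs R M N.
        compose (carrier (Eo M)) (\<eta> N) (Em M N f) = compose (carrier (Eo M)) f (\<eta> M))"

text \<open>\<open>K\<close>-linear equivalence of the categories of left modules. As HOL has no category of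
  all modules, the universe of underlying sets is a type parameter; statements should be
  made for every infinite type \<open>'u\<close> (for finite \<open>'u\<close> the category is not even closed
  under finite direct sums).\<close>

definition morita_equivalent ::
    "'u itself \<Rightarrow> ('k, 'e) ring_scheme \<Rightarrow> ('k, 'r) module \<Rightarrow> ('k, 's) module \<Rightarrow> bool" where
  "morita_equivalent _ K R S \<longleftrightarrow>
     (\<exists>(Fo :: ('r, 'u) module \<Rightarrow> ('s, 'u) module) Fm
       (Go :: ('s, 'u) module \<Rightarrow> ('r, 'u) module) Gm \<eta> \<epsilon>.
        linear_functor K R S Fo Fm \<and> linear_functor K S R Go Gm \<and>
        natural_iso_to_id R (\<lambda>M. Go (Fo M)) (\<lambda>M N f. Gm (Fo M) (Fo N) (Fm M N f)) \<eta> \<and>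
        natural_iso_to_id S (\<lambda>N. Fo (Go N)) (\<lambda>M N f. Fm (Go M) (Go N) (Gm M N f)) \<epsilon>)"

end

theory Submission
  imports Defs "HOL-Algebra.Multiplicative_Group"
begin

text \<open>Why the theorem is true. By total associativity and contraction, a one-hole context is
  determined by the word \<open>a\<^sub>0 \<dots> a\<^sub>p\<^sub>-\<^sub>1 \<star> b\<^sub>0 \<dots> b\<^sub>q\<^sub>-\<^sub>1\<close> of its leaves,
  where \<open>p + q\<close> is a multiple of \<open>m\<close>, and it behaves like the operator
  \<open>x \<mapsto> L \<sigma>\<^sup>p(x) R\<close> with \<open>L = a\<^sub>0 \<sigma>(a\<^sub>1) \<sigma>\<^sup>2(a\<^sub>2) \<dots>\<close> and
  \<open>R = \<sigma>\<^sup>p\<^sup>+\<^sup>1(b\<^sub>0) \<sigma>\<^sup>p\<^sup>+\<^sup>2(b\<^sub>1) \<dots>\<close>. In the envelope this becomes a normal form. Put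
  \<open>l\<^sub>a = (a, 1, \<dots>, 1, \<star>)\<close>, \<open>r\<^sub>b = (\<star>, 1, \<dots>, 1, b)\<close> and
  \<open>s = (1, \<star>, 1, \<dots>, 1)\<close>. Rebracketing gives \<open>l\<^sub>a l\<^sub>b = l\<^sub>a\<^sub>b\<close>,
  \<open>r\<^sub>a r\<^sub>b = r\<^sub>b\<^sub>a\<close>, \<open>l\<^sub>a r\<^sub>b = r\<^sub>b l\<^sub>a\<close>,
  \<open>s l\<^sub>a = l\<^sub>\<sigma>\<^sub>(\<^sub>a\<^sub>) s\<close> and \<open>s r\<^sub>b = r\<^sub>\<sigma>\<^sub>(\<^sub>b\<^sub>) s\<close>; the anchors say
  \<open>l\<^sub>1 = r\<^sub>1 = 1\<close> and thereby also give \<open>s\<^sup>m = 1\<close>. Every context is a monomial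
  \<open>l\<^sub>L r\<^sub>R s\<^sup>p\<close> (\<open>context_is_monomial\<close>).

  For \<open>A = k\<^sup>X\<close> these are the relations of the skew group algebra of \<open>C\<^sub>m\<close> over
  \<open>A \<otimes> A\<^sup>o\<^sup>p = k\<^sup>X\<^sup>\<times>\<^sup>X\<close> (\<open>transformation_algebra\<close>), so the envelope is this algebra. The
  map \<open>\<Phi>\<close> sends a context to the function \<open>L(x) R(y)\<close> times the group element
  \<open>g\<^sup>p\<close>; it respects grafting and all relations because \<open>L\<close>, \<open>R\<close> and
  \<open>p\<close> modulo \<open>m\<close> do. Conversely \<open>\<Psi>\<close> sends \<open>\<delta>\<^sub>(\<^sub>x\<^sub>,\<^sub>y\<^sub>) g\<^sup>i\<close> to the monomial
  \<open>l\<^sub>\<delta>\<^sub>x r\<^sub>\<delta>\<^sub>y s\<^sup>i\<close>. As every class is a combination of monomials with characteristic functions,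
  \<open>\<Psi>\<close> recovers the class of \<open>f\<close> from \<open>\<Phi> f\<close>, and the kernel of \<open>\<Phi>\<close> is exactly the
  ideal of relations (\<open>kernel_eq\<close>, \<open>envelope_iso\<close>).

  The transformation algebra of an action on \<open>Z\<close> is the convolution algebra of its action
  groupoid, whose arrows with target \<open>z\<close> are the group elements \<open>h\<close>, with source
  \<open>h\<^sup>-\<^sup>1 z\<close>. A connected groupoid is, after choosing an arrow \<open>\<gamma>\<^sub>x\<close> from a base point
  to every \<open>x\<close>, the product of the isotropy group with an indiscrete groupoid: arrows from
  \<open>y\<close> to \<open>x\<close> are \<open>\<gamma>\<^sub>x h \<gamma>\<^sub>y\<^sup>-\<^sup>1\<close> for a unique \<open>h\<close> in the stabilizer of the base point. On
  convolution algebras this is a matrix algebra over the group algebra of the stabilizer, one for each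
  orbit (\<open>Theta_iso\<close>).

  For the Morita class, the group algebras of the stabilizers form the corner \<open>e T e\<close> of the
  transformation algebra \<open>T\<close>, where \<open>e\<close> is the sum of the identity arrows at the base points, and
  this corner is full because \<open>\<Sum> \<gamma>\<^sub>x e \<gamma>\<^sub>x\<^sup>-\<^sup>1 = 1\<close> (\<open>stabilizer_corner\<close>). A full corner is
  Morita equivalent to the whole ring (\<open>corner_morita\<close>): \<open>M \<mapsto> e M\<close> has the inverse
  \<open>N \<mapsto> T e \<otimes> N\<close>, realized without tensor products as the image of an idempotent matrix on finite
  tuples in \<open>N\<close>. An isomorphism is the case \<open>e = 1\<close>, so Morita equivalences compose to the last
  claim.\<close>

section \<open>Finite sums in abelian monoids\<close>

lemma (in abelian_monoid) finsum_fibres: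
  assumes "finite P" "finite D" "\<pi> ` P \<subseteq> D" "F \<in> P \<rightarrow> carrier G"
  shows "(\<Oplus>s\<in>D. \<Oplus>p\<in>{p \<in> P. \<pi> p = s}. F p) = (\<Oplus>p\<in>P. F p)"
proof -
  have "(\<Oplus>s\<in>D. \<Oplus>p\<in>{p \<in> P. \<pi> p = s}. F p) = finsum G F (\<Union>s\<in>D. {p \<in> P. \<pi> p = s})"
    using assms by (intro add.finprod_UN_disjoint[symmetric]) (auto simp: pairwise_def disjnt_def)
  also have "(\<Union>s\<in>D. {p \<in> P. \<pi> p = s}) = P"
    using assms(3) by auto
  finally show ?thesis .
qed

lemma (in abelian_monoid) finsum_product:
  assumes "finite A" "finite B" "\<And>a b. a \<in> A \<Longrightarrow> b \<in> B \<Longrightarrow> F a b \<in> carrier G"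
  shows "(\<Oplus>a\<in>A. \<Oplus>b\<in>B. F a b) = (\<Oplus>p\<in>A \<times> B. F (fst p) (snd p))"
proof -
  have "(\<Oplus>a\<in>A. \<Oplus>b\<in>B. F a b) = (\<Oplus>a\<in>A. \<Oplus>p\<in>{p \<in> A \<times> B. fst p = a}. F (fst p) (snd p))"
  proof (rule finsum_cong', goal_cases)
    case (3 a)
    have eq: "{p \<in> A \<times> B. fst p = a} = Pair a ` B"
      using 3 by auto
    show ?case
      unfolding eq using assms 3 by (subst finsum_reindex) (auto simp: inj_on_def)
  qed (use assms in \<open>auto intro!: finsum_closed\<close>)
  also have "\<dots> = (\<Oplus>p\<in>A \<times> B. F (fst p) (snd p))"
    using assms by (intro finsum_fibres) auto
  finally show ?thesis .
qed

lemma (in abelian_monoid) finsum_swap: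
  assumes "finite A" "finite B" "\<And>a b. a \<in> A \<Longrightarrow> b \<in> B \<Longrightarrow> F a b \<in> carrier G"
  shows "(\<Oplus>a\<in>A. \<Oplus>b\<in>B. F a b) = (\<Oplus>b\<in>B. \<Oplus>a\<in>A. F a b)"
proof -
  have "(\<Oplus>b\<in>B. \<Oplus>a\<in>A. F a b) = (\<Oplus>p\<in>B \<times> A. F (snd p) (fst p))"
    using assms by (intro finsum_product) auto
  also have "\<dots> = (\<Oplus>p\<in>prod.swap ` (A \<times> B). F (snd p) (fst p))"
    by (rule arg_cong[where f = "finsum G _"]) force
  also have "\<dots> = (\<Oplus>p\<in>A \<times> B. F (fst p) (snd p))"
    using assms by (subst finsum_reindex) auto
  finally show ?thesis
    using assms by (simp add: finsum_product)
qed

lemma (in abelian_monoid) finsum_single_term: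
  assumes "finite A" "i \<in> A" "f i \<in> carrier G" "\<And>j. j \<in> A \<Longrightarrow> j \<noteq> i \<Longrightarrow> f j = \<zero>"
  shows "finsum G f A = f i"
proof -
  have "finsum G f A = (\<Oplus>j\<in>A. if i = j then (\<lambda>_. f i) j else \<zero>)"
    using assms by (intro finsum_cong') auto
  also have "\<dots> = f i"
    using assms by (subst finsum_singleton) auto
  finally show ?thesis .
qed

lemma (in abelian_monoid) finsum_superset:
  assumes "finite B" "A \<subseteq> B" "\<And>j. j \<in> A \<Longrightarrow> f j \<in> carrier G" "\<And>j. j \<in> B - A \<Longrightarrow> f j = \<zero>"
  shows "finsum G f B = finsum G f A"
proof -
  have "f j \<in> carrier G" if "j \<in> B" for j
    using assms(3,4)[of j] that by (cases "j \<in> A") auto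
  thus ?thesis
    using assms by (intro add.finprod_mono_neutral_cong_right) auto
qed

lemma finsum_additive_map:
  assumes "abelian_monoid M" "abelian_monoid N" "finite A" "f \<in> A \<rightarrow> carrier M"
    and "h \<in> carrier M \<rightarrow> carrier N" "h \<zero>\<^bsub>M\<^esub> = \<zero>\<^bsub>N\<^esub>"
    and "\<And>x y. x \<in> carrier M \<Longrightarrow> y \<in> carrier M \<Longrightarrow> h (x \<oplus>\<^bsub>M\<^esub> y) = h x \<oplus>\<^bsub>N\<^esub> h y"
  shows "h (finsum M f A) = (\<Oplus>\<^bsub>N\<^esub>a\<in>A. h (f a))"
proof -
  interpret M: abelian_monoid M by fact
  interpret N: abelian_monoid N by fact
  show ?thesis
    using assms(3,4)
  proof (induction A)
    case (insert a A)
    have "h (finsum M f (insert a A)) = h (f a \<oplus>\<^bsub>M\<^esub> finsum M f A)"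
      using insert by (subst M.finsum_insert) auto
    also have "\<dots> = h (f a) \<oplus>\<^bsub>N\<^esub> h (finsum M f A)"
      using insert by (intro assms(7)) auto
    finally show ?case
      using insert assms(5) by (subst N.finsum_insert) (auto simp: Pi_iff)
  qed (use assms(6) in auto)
qed

section \<open>Monoid algebras\<close>

locale monoid_algebra_setting = K?: cring K + S: monoid S 
  for K :: "('k, 'e) ring_scheme" (structure) and S :: "('s, 'f) monoid_scheme"
begin

abbreviation \<A> where "\<A> \<equiv> monoid_algebra K S"

text \<open>The linear functional on the free module that extends a function on the monoid.
  Convolution sums over fibres of the multiplication are awkward to manipulate; tested against all
  such functionals, they become iterated sums.\<close>

definition pairing :: "('s \<Rightarrow> 'k) \<Rightarrow> ('s \<Rightarrow> 'k) \<Rightarrow> 'k" where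
  "pairing \<chi> f = (\<Oplus>t\<in>fsupp K f. f t \<otimes> \<chi> t)"

lemma carrierD:
  assumes "f \<in> carrier \<A>"
  shows "f t \<in> carrier K" "finite (fsupp K f)" "fsupp K f \<subseteq> carrier S" "t \<notin> fsupp K f \<Longrightarrow> f t = \<zero>"
    "t \<notin> carrier S \<Longrightarrow> f t = \<zero>"
  using assms by (auto simp: monoid_algebra_def fsupp_def)

lemma carrierI:
  assumes "\<And>t. f t \<in> carrier K" "finite D" "D \<subseteq> carrier S" "\<And>t. t \<notin> D \<Longrightarrow> f t = \<zero>"
  shows "f \<in> carrier \<A>"
proof -
  have "fsupp K f \<subseteq> D"
    using assms(4) by (auto simp: fsupp_def)
  thus ?thesis
    using assms by (auto simp: monoid_algebra_def intro: finite_subset)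
qed

lemma pairing_superset:
  assumes "f \<in> carrier \<A>" "\<chi> \<in> carrier S \<rightarrow> carrier K" "finite D" "fsupp K f \<subseteq> D" "D \<subseteq> carrier S"
  shows "pairing \<chi> f = (\<Oplus>t\<in>D. f t \<otimes> \<chi> t)"
proof -
  have "\<chi> t \<in> carrier K" if "t \<in> D" for t
    using that assms by auto
  thus ?thesis
    unfolding pairing_def using assms carrierD[OF assms(1)]
    by (intro finsum_superset[symmetric]) auto
qed

lemma pairing_closed:
  assumes "f \<in> carrier \<A>" "\<chi> \<in> carrier S \<rightarrow> carrier K"
  shows "pairing \<chi> f \<in> carrier K"
proof -
  have "\<chi> t \<in> carrier K" if "t \<in> fsupp K f" for t
    using that carrierD[OF assms(1)] assms(2) by auto
  thus ?thesis
    unfolding pairing_def using carrierD[OF assms(1)] by (auto intro!: finsum_closed)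
qed

lemma pairing_cong:
  assumes "f \<in> carrier \<A>" "\<chi>' \<in> carrier S \<rightarrow> carrier K" "\<And>t. t \<in> carrier S \<Longrightarrow> \<chi> t = \<chi>' t"
  shows "pairing \<chi> f = pairing \<chi>' f"
proof -
  have "\<chi> t = \<chi>' t \<and> \<chi>' t \<in> carrier K" if "t \<in> fsupp K f" for t
    using that carrierD[OF assms(1)] assms by auto
  thus ?thesis
    unfolding pairing_def using carrierD[OF assms(1)] by (intro finsum_cong') auto
qed

lemma pairing_add_right:
  assumes "f \<in> carrier \<A>" "\<chi> \<in> carrier S \<rightarrow> carrier K" "\<chi>' \<in> carrier S \<rightarrow> carrier K"
  shows "pairing (\<lambda>t. \<chi> t \<oplus> \<chi>' t) f = pairing \<chi> f \<oplus> pairing \<chi>' f"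
proof -
  have c: "\<chi> t \<in> carrier K" "\<chi>' t \<in> carrier K" if "t \<in> fsupp K f" for t
    using that carrierD[OF assms(1)] assms by auto
  have "pairing (\<lambda>t. \<chi> t \<oplus> \<chi>' t) f = (\<Oplus>t\<in>fsupp K f. f t \<otimes> \<chi> t \<oplus> f t \<otimes> \<chi>' t)"
    unfolding pairing_def using carrierD[OF assms(1)] c by (intro finsum_cong') (auto simp: r_distr)
  thus ?thesis
    unfolding pairing_def using carrierD[OF assms(1)] c by (simp add: finsum_addf Pi_iff)
qed

lemma pairing_smult_right:
  assumes "f \<in> carrier \<A>" "\<chi> \<in> carrier S \<rightarrow> carrier K" "c \<in> carrier K"
  shows "pairing (\<lambda>t. c \<otimes> \<chi> t) f = c \<otimes> pairing \<chi> f"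
proof -
  have c: "\<chi> t \<in> carrier K" if "t \<in> fsupp K f" for t
    using that carrierD[OF assms(1)] assms by auto
  have "pairing (\<lambda>t. c \<otimes> \<chi> t) f = (\<Oplus>t\<in>fsupp K f. c \<otimes> (f t \<otimes> \<chi> t))"
    unfolding pairing_def using carrierD[OF assms(1)] c assms(3)
    by (intro finsum_cong') (auto simp: m_lcomm)
  thus ?thesis
    unfolding pairing_def using carrierD[OF assms(1)] c assms(3)
    by (subst finsum_rdistr) (auto simp: Pi_iff)
qed

lemma pairing_finsum_right:
  assumes "f \<in> carrier \<A>" "finite J" "\<And>j. j \<in> J \<Longrightarrow> \<chi> j \<in> carrier S \<rightarrow> carrier K"
  shows "pairing (\<lambda>t. \<Oplus>j\<in>J. \<chi> j t) f = (\<Oplus>j\<in>J. pairing (\<chi> j) f)"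
proof -
  have c: "\<chi> j t \<in> carrier K" if "t \<in> fsupp K f" "j \<in> J" for t j
    using that carrierD[OF assms(1)] assms(3)[of j] by auto
  have "pairing (\<lambda>t. \<Oplus>j\<in>J. \<chi> j t) f = (\<Oplus>t\<in>fsupp K f. \<Oplus>j\<in>J. f t \<otimes> \<chi> j t)"
    unfolding pairing_def using carrierD[OF assms(1)] c assms(2)
    by (intro finsum_cong') (auto simp: finsum_rdistr Pi_iff intro!: finsum_closed)
  also have "\<dots> = (\<Oplus>j\<in>J. \<Oplus>t\<in>fsupp K f. f t \<otimes> \<chi> j t)"
    using carrierD[OF assms(1)] c assms(2) by (intro finsum_swap) auto
  finally show ?thesis
    unfolding pairing_def .
qed

lemma add_apply: "(f \<oplus>\<^bsub>\<A>\<^esub> h) t = f t \<oplus> h t"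
  by (simp add: monoid_algebra_def)

lemma smult_apply: "(c \<odot>\<^bsub>\<A>\<^esub> f) t = c \<otimes> f t"
  by (simp add: monoid_algebra_def)

lemma zero_apply: "\<zero>\<^bsub>\<A>\<^esub> t = \<zero>"
  by (simp add: monoid_algebra_def)

lemma add_closed_MA:
  assumes "f \<in> carrier \<A>" "h \<in> carrier \<A>"
  shows "f \<oplus>\<^bsub>\<A>\<^esub> h \<in> carrier \<A>"
  using carrierD[OF assms(1)] carrierD[OF assms(2)]
  by (intro carrierI[of _ "fsupp K f \<union> fsupp K h"]) (auto simp: add_apply)

lemma smult_closed_MA:
  assumes "c \<in> carrier K" "f \<in> carrier \<A>"
  shows "c \<odot>\<^bsub>\<A>\<^esub> f \<in> carrier \<A>"
  using carrierD[OF assms(2)] assms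
  by (intro carrierI[of _ "fsupp K f"]) (auto simp: smult_apply)

lemma zero_closed_MA: "\<zero>\<^bsub>\<A>\<^esub> \<in> carrier \<A>"
  by (intro carrierI[of _ "{}"]) (auto simp: zero_apply)

lemma basis_closed:
  assumes "t \<in> carrier S"
  shows "basis_element K t \<in> carrier \<A>"
  using assms by (intro carrierI[of _ "{t}"]) (auto simp: basis_element_def)

lemma one_eq_basis: "\<one>\<^bsub>\<A>\<^esub> = basis_element K \<one>\<^bsub>S\<^esub>"
  by (simp add: monoid_algebra_def basis_element_def)

lemma pairing_basis:
  assumes "t \<in> carrier S" "\<chi> \<in> carrier S \<rightarrow> carrier K"
  shows "pairing \<chi> (basis_element K t) = \<chi> t"
proof -
  have c: "\<chi> t \<in> carrier K" using assms by auto
  have "pairing \<chi> (basis_element K t) = (\<Oplus>s\<in>{t}. basis_element K t s \<otimes> \<chi> s)"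
    using assms basis_closed[OF assms(1)]
    by (intro pairing_superset) (auto simp: basis_element_def fsupp_def)
  also have "\<dots> = \<chi> t"
    using c by (simp add: basis_element_def finsum_insert)
  finally show ?thesis .
qed

lemma pairing_add_left:
  assumes "f \<in> carrier \<A>" "h \<in> carrier \<A>" "\<chi> \<in> carrier S \<rightarrow> carrier K"
  shows "pairing \<chi> (f \<oplus>\<^bsub>\<A>\<^esub> h) = pairing \<chi> f \<oplus> pairing \<chi> h"
proof -
  define D where "D = fsupp K f \<union> fsupp K h"
  have D: "finite D" "D \<subseteq> carrier S" "fsupp K f \<subseteq> D" "fsupp K h \<subseteq> D"
    using carrierD[OF assms(1)] carrierD[OF assms(2)] by (auto simp: D_def)
  have c: "\<chi> t \<in> carrier K" if "t \<in> D" for t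
    using that D assms(3) by auto
  have "(f \<oplus>\<^bsub>\<A>\<^esub> h) t = \<zero>" if "t \<notin> D" for t
    using that carrierD(4)[OF assms(1)] carrierD(4)[OF assms(2)] by (simp add: D_def add_apply)
  hence "fsupp K (f \<oplus>\<^bsub>\<A>\<^esub> h) \<subseteq> D"
    unfolding fsupp_def by blast
  hence "pairing \<chi> (f \<oplus>\<^bsub>\<A>\<^esub> h) = (\<Oplus>t\<in>D. (f \<oplus>\<^bsub>\<A>\<^esub> h) t \<otimes> \<chi> t)"
    using D assms by (intro pairing_superset) (auto intro: add_closed_MA)
  also have "\<dots> = (\<Oplus>t\<in>D. f t \<otimes> \<chi> t \<oplus> h t \<otimes> \<chi> t)"
    using carrierD(1)[OF assms(1)] carrierD(1)[OF assms(2)] c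
    by (intro finsum_cong') (auto simp: add_apply l_distr)
  also have "\<dots> = pairing \<chi> f \<oplus> pairing \<chi> h"
    unfolding pairing_superset[OF assms(1,3) D(1,3,2)] pairing_superset[OF assms(2,3) D(1,4,2)]
    using carrierD(1)[OF assms(1)] carrierD(1)[OF assms(2)] c by (intro finsum_addf) auto
  finally show ?thesis .
qed

lemma pairing_smult_left:
  assumes "f \<in> carrier \<A>" "c \<in> carrier K" "\<chi> \<in> carrier S \<rightarrow> carrier K"
  shows "pairing \<chi> (c \<odot>\<^bsub>\<A>\<^esub> f) = c \<otimes> pairing \<chi> f"
proof -
  have c: "\<chi> t \<in> carrier K" if "t \<in> fsupp K f" for t
    using that carrierD[OF assms(1)] assms(3) by auto
  have "(c \<odot>\<^bsub>\<A>\<^esub> f) t = \<zero>" if "t \<notin> fsupp K f" for t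
    using that carrierD(4)[OF assms(1)] assms(2) by (simp add: smult_apply)
  hence "fsupp K (c \<odot>\<^bsub>\<A>\<^esub> f) \<subseteq> fsupp K f"
    unfolding fsupp_def[of K "c \<odot>\<^bsub>\<A>\<^esub> f"] by blast
  hence "pairing \<chi> (c \<odot>\<^bsub>\<A>\<^esub> f) = (\<Oplus>t\<in>fsupp K f. (c \<odot>\<^bsub>\<A>\<^esub> f) t \<otimes> \<chi> t)"
    using carrierD[OF assms(1)] assms
    by (intro pairing_superset) (auto intro: smult_closed_MA)
  also have "\<dots> = (\<Oplus>t\<in>fsupp K f. c \<otimes> (f t \<otimes> \<chi> t))"
    using carrierD(1)[OF assms(1)] c assms(2)
    by (intro finsum_cong') (auto simp: smult_apply m_assoc)
  also have "\<dots> = c \<otimes> pairing \<chi> f"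
    unfolding pairing_def using carrierD[OF assms(1)] c assms(2)
    by (subst finsum_rdistr) (auto simp: Pi_iff)
  finally show ?thesis .
qed

text \<open>An element of the monoid algebra is determined by its pairings, because the
  coefficient at \<open>s\<close> is the pairing with the indicator of \<open>s\<close>.\<close>

lemma pairing_indicator:
  assumes "f \<in> carrier \<A>"
  shows "pairing (basis_element K s) f = f s"
proof (cases "s \<in> fsupp K f")
  case True
  hence "pairing (basis_element K s) f = f s \<otimes> basis_element K s s"
    unfolding pairing_def using carrierD[OF assms]
    by (intro finsum_single_term) (auto simp: basis_element_def)
  thus ?thesis
    using carrierD(1)[OF assms] by (simp add: basis_element_def)
next
  case False
  hence "pairing (basis_element K s) f = (\<Oplus>t\<in>fsupp K f. \<zero>)"
    unfolding pairing_def using carrierD[OF assms]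
    by (intro finsum_cong') (auto simp: basis_element_def)
  thus ?thesis
    using False by (simp add: fsupp_def)
qed

lemma basis_Pi: "basis_element K s \<in> carrier S \<rightarrow> carrier K"
  by (auto simp: basis_element_def)

lemma MA_eqI:
  assumes "f \<in> carrier \<A>" "h \<in> carrier \<A>"
    and "\<And>\<chi>. \<chi> \<in> carrier S \<rightarrow> carrier K \<Longrightarrow> pairing \<chi> f = pairing \<chi> h"
  shows "f = h"
  using assms(3)[OF basis_Pi] pairing_indicator[OF assms(1)] pairing_indicator[OF assms(2)]
  by auto

lemma mult_apply:
  assumes "f \<in> carrier \<A>" "h \<in> carrier \<A>"
  shows "(f \<otimes>\<^bsub>\<A>\<^esub> h) s =
    (\<Oplus>p\<in>{p \<in> fsupp K f \<times> fsupp K h. fst p \<otimes>\<^bsub>S\<^esub> snd p = s}. f (fst p) \<otimes> h (snd p))"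
  by (simp add: monoid_algebra_def)

lemma mult_closed_MA:
  assumes "f \<in> carrier \<A>" "h \<in> carrier \<A>"
  shows "f \<otimes>\<^bsub>\<A>\<^esub> h \<in> carrier \<A>"
proof (rule carrierI)
  let ?D = "(\<lambda>p. fst p \<otimes>\<^bsub>S\<^esub> snd p) ` (fsupp K f \<times> fsupp K h)"
  show "(f \<otimes>\<^bsub>\<A>\<^esub> h) t \<in> carrier K" for t
    unfolding mult_apply[OF assms]
    using carrierD(1)[OF assms(1)] carrierD(1)[OF assms(2)] by (intro finsum_closed) auto
  show "finite ?D" "?D \<subseteq> carrier S"
    using carrierD(2,3)[OF assms(1)] carrierD(2,3)[OF assms(2)] by (auto intro!: S.m_closed)
  fix t assume "t \<notin> ?D"
  hence "{p \<in> fsupp K f \<times> fsupp K h. fst p \<otimes>\<^bsub>S\<^esub> snd p = t} = {}"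
    by (auto simp only: image_iff)
  thus "(f \<otimes>\<^bsub>\<A>\<^esub> h) t = \<zero>"
    unfolding mult_apply[OF assms] by (simp only: finsum_empty)
qed

text \<open>Both sides are the double sum of \<open>f(a) h(b) \<chi>(ab)\<close>; on the left its
  terms are grouped by the value of the product.\<close>

lemma pairing_mult:
  assumes "f \<in> carrier \<A>" "h \<in> carrier \<A>" "\<chi> \<in> carrier S \<rightarrow> carrier K"
  shows "pairing \<chi> (f \<otimes>\<^bsub>\<A>\<^esub> h) = pairing (\<lambda>a. pairing (\<lambda>b. \<chi> (a \<otimes>\<^bsub>S\<^esub> b)) h) f"
proof -
  note f = carrierD(1,2)[OF assms(1)] and h = carrierD(1,2)[OF assms(2)]
  let ?P = "fsupp K f \<times> fsupp K h"
  let ?pi = "\<lambda>p. fst p \<otimes>\<^bsub>S\<^esub> snd p"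
  have fS: "a \<in> carrier S" if "a \<in> fsupp K f" for a
    using that carrierD(3)[OF assms(1)] by auto
  have hS: "b \<in> carrier S" if "b \<in> fsupp K h" for b
    using that carrierD(3)[OF assms(2)] by auto
  have c: "\<chi> t \<in> carrier K" if "t \<in> carrier S" for t using that assms(3) by auto
  have "fsupp K (f \<otimes>\<^bsub>\<A>\<^esub> h) \<subseteq> ?pi ` ?P"
  proof
    fix s assume s: "s \<in> fsupp K (f \<otimes>\<^bsub>\<A>\<^esub> h)"
    have "{p \<in> ?P. ?pi p = s} \<noteq> {}"
    proof
      assume *: "{p \<in> ?P. ?pi p = s} = {}"
      have "(f \<otimes>\<^bsub>\<A>\<^esub> h) s = \<zero>"
        unfolding mult_apply[OF assms(1,2)] * by simp
      thus False using s by (simp add: fsupp_def)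
    qed
    then obtain p where "p \<in> ?P" "?pi p = s" by blast
    thus "s \<in> ?pi ` ?P" by (intro image_eqI[of s ?pi p]) (simp_all only:)
  qed
  hence "pairing \<chi> (f \<otimes>\<^bsub>\<A>\<^esub> h) = (\<Oplus>s\<in>?pi ` ?P. (f \<otimes>\<^bsub>\<A>\<^esub> h) s \<otimes> \<chi> s)"
    using f(2) h(2) fS hS assms
    by (intro pairing_superset mult_closed_MA finite_imageI finite_cartesian_product)
      (auto intro!: S.m_closed)
  also have "\<dots> = (\<Oplus>s\<in>?pi ` ?P. \<Oplus>p\<in>{p \<in> ?P. ?pi p = s}.
      f (fst p) \<otimes> h (snd p) \<otimes> \<chi> (?pi p))"
  proof (rule finsum_cong', goal_cases)
    case (3 s)
    have fin: "finite {p \<in> ?P. ?pi p = s}"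
      by (rule finite_subset[OF Collect_restrict finite_cartesian_product[OF f(2) h(2)]])
    obtain p where "p \<in> ?P" "s = ?pi p" using 3 by (rule imageE) (rule that)
    hence s: "\<chi> s \<in> carrier K" using fS hS c by auto
    have "(f \<otimes>\<^bsub>\<A>\<^esub> h) s \<otimes> \<chi> s = (\<Oplus>p\<in>{p \<in> ?P. ?pi p = s}. f (fst p) \<otimes> h (snd p) \<otimes> \<chi> s)"
      unfolding mult_apply[OF assms(1,2)]
      using f(1) h(1) s fin by (intro finsum_ldistr) auto
    also have "\<dots> = (\<Oplus>p\<in>{p \<in> ?P. ?pi p = s}. f (fst p) \<otimes> h (snd p) \<otimes> \<chi> (?pi p))"
      using f(1) h(1) s by (intro finsum_cong') auto
    finally show ?case .
  qed (use f h fS hS c in \<open>auto intro!: finsum_closed\<close>)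
  also have "\<dots> = (\<Oplus>p\<in>?P. f (fst p) \<otimes> h (snd p) \<otimes> \<chi> (?pi p))"
    using f h fS hS c by (intro finsum_fibres) auto
  also have "\<dots> = (\<Oplus>a\<in>fsupp K f. \<Oplus>b\<in>fsupp K h. f a \<otimes> h b \<otimes> \<chi> (a \<otimes>\<^bsub>S\<^esub> b))"
    using f h fS hS c by (subst finsum_product) auto
  also have "\<dots> = (\<Oplus>a\<in>fsupp K f. f a \<otimes> (\<Oplus>b\<in>fsupp K h. h b \<otimes> \<chi> (a \<otimes>\<^bsub>S\<^esub> b)))"
    using f h fS hS c
    by (intro finsum_cong') (auto simp: finsum_rdistr m_assoc Pi_iff intro!: finsum_closed finsum_cong')
  finally show ?thesis
    unfolding pairing_def .
qed

lemma pairing_translate_Pi: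
  assumes "h \<in> carrier \<A>" "\<chi> \<in> carrier S \<rightarrow> carrier K"
  shows "(\<lambda>a. pairing (\<lambda>b. \<chi> (a \<otimes>\<^bsub>S\<^esub> b)) h) \<in> carrier S \<rightarrow> carrier K"
proof
  fix a assume a: "a \<in> carrier S"
  show "pairing (\<lambda>b. \<chi> (a \<otimes>\<^bsub>S\<^esub> b)) h \<in> carrier K"
    using a assms by (intro pairing_closed) auto
qed

lemma abelian_group_MA: "abelian_group \<A>"
proof (rule abelian_groupI)
  fix f assume f: "f \<in> carrier \<A>"
  have "(\<lambda>t. \<ominus> f t) \<oplus>\<^bsub>\<A>\<^esub> f = \<zero>\<^bsub>\<A>\<^esub>" "(\<lambda>t. \<ominus> f t) \<in> carrier \<A>"
    using carrierD[OF f] by (auto simp: fun_eq_iff add_apply zero_apply l_neg intro: carrierI)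
  thus "\<exists>g\<in>carrier \<A>. g \<oplus>\<^bsub>\<A>\<^esub> f = \<zero>\<^bsub>\<A>\<^esub>" by blast
qed (auto simp: fun_eq_iff add_apply zero_apply carrierD(1) a_ac intro: add_closed_MA zero_closed_MA)

text \<open>By \<open>MA_eqI\<close> the axioms may be tested against functionals, and
  \<open>pairing_mult\<close> then reduces them to the laws of the monoid.\<close>

lemma ring_MA: "ring \<A>"
proof (rule ringI)
  show "abelian_group \<A>" by (rule abelian_group_MA)
  show "Group.monoid \<A>"
  proof (rule monoidI)
    show "\<one>\<^bsub>\<A>\<^esub> \<in> carrier \<A>"
      by (simp add: one_eq_basis basis_closed)
    fix f assume f: "f \<in> carrier \<A>"
    show "\<one>\<^bsub>\<A>\<^esub> \<otimes>\<^bsub>\<A>\<^esub> f = f"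
    proof (rule MA_eqI)
      fix \<chi> assume x: "\<chi> \<in> carrier S \<rightarrow> carrier K"
      have "pairing \<chi> (\<one>\<^bsub>\<A>\<^esub> \<otimes>\<^bsub>\<A>\<^esub> f) = pairing (\<lambda>b. \<chi> (\<one>\<^bsub>S\<^esub> \<otimes>\<^bsub>S\<^esub> b)) f"
        using f x by (simp add: one_eq_basis pairing_mult pairing_basis pairing_translate_Pi basis_closed)
      also have "\<dots> = pairing \<chi> f"
        using f x by (intro pairing_cong) auto
      finally show "pairing \<chi> (\<one>\<^bsub>\<A>\<^esub> \<otimes>\<^bsub>\<A>\<^esub> f) = pairing \<chi> f" .
    qed (use f in \<open>auto intro: mult_closed_MA simp: one_eq_basis basis_closed\<close>)
    show "f \<otimes>\<^bsub>\<A>\<^esub> \<one>\<^bsub>\<A>\<^esub> = f"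
    proof (rule MA_eqI)
      fix \<chi> assume x: "\<chi> \<in> carrier S \<rightarrow> carrier K"
      have "pairing \<chi> (f \<otimes>\<^bsub>\<A>\<^esub> \<one>\<^bsub>\<A>\<^esub>)
          = pairing (\<lambda>a. pairing (\<lambda>b. \<chi> (a \<otimes>\<^bsub>S\<^esub> b)) (basis_element K \<one>\<^bsub>S\<^esub>)) f"
        using f x by (simp add: one_eq_basis pairing_mult basis_closed)
      also have "\<dots> = pairing \<chi> f"
      proof (rule pairing_cong[OF f x])
        fix a assume a: "a \<in> carrier S"
        have "pairing (\<lambda>b. \<chi> (a \<otimes>\<^bsub>S\<^esub> b)) (basis_element K \<one>\<^bsub>S\<^esub>) = \<chi> (a \<otimes>\<^bsub>S\<^esub> \<one>\<^bsub>S\<^esub>)"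
          using a x by (intro pairing_basis) auto
        thus "pairing (\<lambda>b. \<chi> (a \<otimes>\<^bsub>S\<^esub> b)) (basis_element K \<one>\<^bsub>S\<^esub>) = \<chi> a"
          using a by simp
      qed
      finally show "pairing \<chi> (f \<otimes>\<^bsub>\<A>\<^esub> \<one>\<^bsub>\<A>\<^esub>) = pairing \<chi> f" .
    qed (use f in \<open>auto intro: mult_closed_MA simp: one_eq_basis basis_closed\<close>)
    fix g h assume g: "g \<in> carrier \<A>" and h: "h \<in> carrier \<A>"
    show "f \<otimes>\<^bsub>\<A>\<^esub> g \<in> carrier \<A>"
      using f g by (rule mult_closed_MA)
    show "f \<otimes>\<^bsub>\<A>\<^esub> g \<otimes>\<^bsub>\<A>\<^esub> h = f \<otimes>\<^bsub>\<A>\<^esub> (g \<otimes>\<^bsub>\<A>\<^esub> h)"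
    proof (rule MA_eqI)
      fix \<chi> assume x: "\<chi> \<in> carrier S \<rightarrow> carrier K"
      have tr: "(\<lambda>b. \<chi> (a \<otimes>\<^bsub>S\<^esub> b)) \<in> carrier S \<rightarrow> carrier K" if "a \<in> carrier S" for a
        using x that by auto
      have "pairing \<chi> (f \<otimes>\<^bsub>\<A>\<^esub> g \<otimes>\<^bsub>\<A>\<^esub> h)
          = pairing (\<lambda>a. pairing (\<lambda>b. pairing (\<lambda>c. \<chi> (a \<otimes>\<^bsub>S\<^esub> b \<otimes>\<^bsub>S\<^esub> c)) h) g) f"
        using f g h x by (simp add: pairing_mult pairing_translate_Pi mult_closed_MA)
      also have "\<dots> = pairing (\<lambda>a. pairing (\<lambda>b. \<chi> (a \<otimes>\<^bsub>S\<^esub> b)) (g \<otimes>\<^bsub>\<A>\<^esub> h)) f"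
      proof (rule pairing_cong[OF f pairing_translate_Pi[OF mult_closed_MA[OF g h] x]])
        fix a assume a: "a \<in> carrier S"
        have "pairing (\<lambda>b. \<chi> (a \<otimes>\<^bsub>S\<^esub> b)) (g \<otimes>\<^bsub>\<A>\<^esub> h)
            = pairing (\<lambda>b. pairing (\<lambda>c. \<chi> (a \<otimes>\<^bsub>S\<^esub> (b \<otimes>\<^bsub>S\<^esub> c))) h) g"
          using pairing_mult[OF g h tr[OF a]] .
        also have "\<dots> = pairing (\<lambda>b. pairing (\<lambda>c. \<chi> (a \<otimes>\<^bsub>S\<^esub> b \<otimes>\<^bsub>S\<^esub> c)) h) g"
          using a x
          by (intro pairing_cong[OF g] pairing_cong[OF h] Pi_I pairing_closed[OF h])
            (auto simp: S.m_assoc)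
        finally show "pairing (\<lambda>b. pairing (\<lambda>c. \<chi> (a \<otimes>\<^bsub>S\<^esub> b \<otimes>\<^bsub>S\<^esub> c)) h) g
            = pairing (\<lambda>b. \<chi> (a \<otimes>\<^bsub>S\<^esub> b)) (g \<otimes>\<^bsub>\<A>\<^esub> h)" ..
      qed
      also have "\<dots> = pairing \<chi> (f \<otimes>\<^bsub>\<A>\<^esub> (g \<otimes>\<^bsub>\<A>\<^esub> h))"
        using f g h x by (simp add: pairing_mult mult_closed_MA)
      finally show "pairing \<chi> (f \<otimes>\<^bsub>\<A>\<^esub> g \<otimes>\<^bsub>\<A>\<^esub> h) = pairing \<chi> (f \<otimes>\<^bsub>\<A>\<^esub> (g \<otimes>\<^bsub>\<A>\<^esub> h))" .
    qed (use f g h in \<open>auto intro!: mult_closed_MA\<close>)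
  qed
next
  fix f g h assume f: "f \<in> carrier \<A>" and g: "g \<in> carrier \<A>" and h: "h \<in> carrier \<A>"
  show "(f \<oplus>\<^bsub>\<A>\<^esub> g) \<otimes>\<^bsub>\<A>\<^esub> h = f \<otimes>\<^bsub>\<A>\<^esub> h \<oplus>\<^bsub>\<A>\<^esub> g \<otimes>\<^bsub>\<A>\<^esub> h"
    using f g h
    by (intro MA_eqI)
      (auto simp: pairing_mult pairing_add_left pairing_translate_Pi add_closed_MA mult_closed_MA)
  show "h \<otimes>\<^bsub>\<A>\<^esub> (f \<oplus>\<^bsub>\<A>\<^esub> g) = h \<otimes>\<^bsub>\<A>\<^esub> f \<oplus>\<^bsub>\<A>\<^esub> h \<otimes>\<^bsub>\<A>\<^esub> g"
  proof (rule MA_eqI)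
    fix \<chi> assume x: "\<chi> \<in> carrier S \<rightarrow> carrier K"
    have "pairing \<chi> (h \<otimes>\<^bsub>\<A>\<^esub> (f \<oplus>\<^bsub>\<A>\<^esub> g))
        = pairing (\<lambda>a. pairing (\<lambda>b. \<chi> (a \<otimes>\<^bsub>S\<^esub> b)) (f \<oplus>\<^bsub>\<A>\<^esub> g)) h"
      using f g h x by (simp add: pairing_mult add_closed_MA)
    also have "\<dots> = pairing (\<lambda>a. pairing (\<lambda>b. \<chi> (a \<otimes>\<^bsub>S\<^esub> b)) f \<oplus> pairing (\<lambda>b. \<chi> (a \<otimes>\<^bsub>S\<^esub> b)) g) h"
    proof (rule pairing_cong[OF h])
      show "(\<lambda>a. pairing (\<lambda>b. \<chi> (a \<otimes>\<^bsub>S\<^esub> b)) f \<oplus> pairing (\<lambda>b. \<chi> (a \<otimes>\<^bsub>S\<^esub> b)) g)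
          \<in> carrier S \<rightarrow> carrier K"
        using pairing_translate_Pi[OF f x] pairing_translate_Pi[OF g x] by auto
      fix a assume "a \<in> carrier S"
      thus "pairing (\<lambda>b. \<chi> (a \<otimes>\<^bsub>S\<^esub> b)) (f \<oplus>\<^bsub>\<A>\<^esub> g)
          = pairing (\<lambda>b. \<chi> (a \<otimes>\<^bsub>S\<^esub> b)) f \<oplus> pairing (\<lambda>b. \<chi> (a \<otimes>\<^bsub>S\<^esub> b)) g"
        using x by (intro pairing_add_left[OF f g]) auto
    qed
    also have "\<dots> = pairing \<chi> (h \<otimes>\<^bsub>\<A>\<^esub> f \<oplus>\<^bsub>\<A>\<^esub> h \<otimes>\<^bsub>\<A>\<^esub> g)"
      using f g h x
      by (simp add: pairing_add_left pairing_mult mult_closed_MA pairing_add_right pairing_translate_Pi)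
    finally show "pairing \<chi> (h \<otimes>\<^bsub>\<A>\<^esub> (f \<oplus>\<^bsub>\<A>\<^esub> g)) = pairing \<chi> (h \<otimes>\<^bsub>\<A>\<^esub> f \<oplus>\<^bsub>\<A>\<^esub> h \<otimes>\<^bsub>\<A>\<^esub> g)" .
  qed (use f g h in \<open>auto intro: mult_closed_MA add_closed_MA\<close>)
qed

lemma smult_mult_MA:
  assumes "c \<in> carrier K" "f \<in> carrier \<A>" "h \<in> carrier \<A>"
  shows "(c \<odot>\<^bsub>\<A>\<^esub> f) \<otimes>\<^bsub>\<A>\<^esub> h = c \<odot>\<^bsub>\<A>\<^esub> (f \<otimes>\<^bsub>\<A>\<^esub> h)"
  using assms
  by (intro MA_eqI)
    (auto simp: pairing_mult pairing_smult_left pairing_translate_Pi smult_closed_MA mult_closed_MA)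

lemma basis_mult:
  assumes "s \<in> carrier S" "t \<in> carrier S"
  shows "basis_element K s \<otimes>\<^bsub>\<A>\<^esub> basis_element K t = basis_element K (s \<otimes>\<^bsub>S\<^esub> t)"
proof (rule MA_eqI)
  fix \<chi> assume x: "\<chi> \<in> carrier S \<rightarrow> carrier K"
  have "pairing \<chi> (basis_element K s \<otimes>\<^bsub>\<A>\<^esub> basis_element K t)
      = pairing (\<lambda>b. \<chi> (s \<otimes>\<^bsub>S\<^esub> b)) (basis_element K t)"
    using assms x by (simp add: pairing_mult basis_closed pairing_basis pairing_translate_Pi)
  also have "\<dots> = \<chi> (s \<otimes>\<^bsub>S\<^esub> t)"
    using assms x by (intro pairing_basis) auto
  finally show "pairing \<chi> (basis_element K s \<otimes>\<^bsub>\<A>\<^esub> basis_element K t)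
      = pairing \<chi> (basis_element K (s \<otimes>\<^bsub>S\<^esub> t))"
    using assms x by (simp add: pairing_basis)
qed (use assms in \<open>auto intro!: mult_closed_MA basis_closed\<close>)

lemma module_MA: "Module.module K \<A>"
proof (rule Module.moduleI, goal_cases)
  case 1 show ?case ..
next
  case 2 show ?case by (rule abelian_group_MA)
next
  case (3 c f) thus ?case by (rule smult_closed_MA)
next
  case (4 c d f) thus ?case by (simp add: fun_eq_iff add_apply smult_apply carrierD(1) l_distr)
next
  case (5 c f h) thus ?case by (simp add: fun_eq_iff add_apply smult_apply carrierD(1) r_distr)
next
  case (6 c d f) thus ?case by (simp add: fun_eq_iff smult_apply carrierD(1) m_assoc)
next
  case (7 f) thus ?case by (simp add: fun_eq_iff smult_apply carrierD(1))
qed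

lemma MA_induct [consumes 1, case_names zero add scale]:
  assumes "f \<in> carrier \<A>"
    and "P \<zero>\<^bsub>\<A>\<^esub>"
    and "\<And>f h. f \<in> carrier \<A> \<Longrightarrow> h \<in> carrier \<A> \<Longrightarrow> P f \<Longrightarrow> P h \<Longrightarrow> P (f \<oplus>\<^bsub>\<A>\<^esub> h)"
    and "\<And>c t. c \<in> carrier K \<Longrightarrow> t \<in> carrier S \<Longrightarrow> P (c \<odot>\<^bsub>\<A>\<^esub> basis_element K t)"
  shows "P f"
proof -
  have "\<And>f. f \<in> carrier \<A> \<Longrightarrow> fsupp K f \<subseteq> D \<Longrightarrow> P f" if "finite D" for D
    using that
  proof (induction D)
    case empty
    hence "f = \<zero>\<^bsub>\<A>\<^esub>" by (auto simp: fun_eq_iff fsupp_def zero_apply)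
    thus ?case using assms(2) by simp
  next
    case (insert t D)
    note f = carrierD[OF insert.prems(1)]
    show ?case
    proof (cases "t \<in> carrier S")
      case True
      let ?h = "f(t := \<zero>)"
      have h: "?h \<in> carrier \<A>"
        using f by (intro carrierI[of _ "fsupp K f"]) auto
      have "fsupp K ?h \<subseteq> D"
        using insert.prems by (auto simp: fsupp_def split: if_splits)
      hence "P ?h" using insert.IH h by blast
      hence "P (f t \<odot>\<^bsub>\<A>\<^esub> basis_element K t \<oplus>\<^bsub>\<A>\<^esub> ?h)"
        using True f(1) h by (intro assms(3,4) smult_closed_MA basis_closed) auto
      moreover have "f t \<odot>\<^bsub>\<A>\<^esub> basis_element K t \<oplus>\<^bsub>\<A>\<^esub> ?h = f"
        using f(1) by (auto simp: fun_eq_iff add_apply smult_apply basis_element_def)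
      ultimately show ?thesis
        by (simp only:)
    next
      case False
      thus ?thesis using insert f(3) by blast
    qed
  qed
  thus ?thesis using assms(1) carrierD(2)[OF assms(1)] by blast
qed

end

section \<open>Modules and linear functors\<close>

context left_module
begin

lemma smult_zero_right: "a \<in> carrier R \<Longrightarrow> a \<odot>\<^bsub>M\<^esub> \<zero>\<^bsub>M\<^esub> = \<zero>\<^bsub>M\<^esub>"
  by (metis M.add.l_cancel_one' M.l_zero M.zero_closed smult_closed smult_r_distr)

lemma smult_zero_left: "x \<in> carrier M \<Longrightarrow> \<zero>\<^bsub>R\<^esub> \<odot>\<^bsub>M\<^esub> x = \<zero>\<^bsub>M\<^esub>"
  by (metis M.add.l_cancel_one' R.l_zero R.zero_closed smult_closed smult_l_distr)

lemma smult_finsum_right: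
  assumes "finite A" "f \<in> A \<rightarrow> carrier M" "a \<in> carrier R"
  shows "a \<odot>\<^bsub>M\<^esub> (\<Oplus>\<^bsub>M\<^esub>i\<in>A. f i) = (\<Oplus>\<^bsub>M\<^esub>i\<in>A. a \<odot>\<^bsub>M\<^esub> f i)"
  using assms
  by (intro finsum_additive_map[OF M.abelian_monoid_axioms M.abelian_monoid_axioms])
    (auto simp: smult_closed smult_r_distr smult_zero_right)

lemma smult_finsum_left:
  assumes "finite A" "f \<in> A \<rightarrow> carrier R" "x \<in> carrier M"
  shows "(\<Oplus>\<^bsub>R\<^esub>i\<in>A. f i) \<odot>\<^bsub>M\<^esub> x = (\<Oplus>\<^bsub>M\<^esub>i\<in>A. f i \<odot>\<^bsub>M\<^esub> x)"
  using assms
  by (intro finsum_additive_map[OF R.abelian_monoid_axioms M.abelian_monoid_axioms,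
        where h = "\<lambda>r. r \<odot>\<^bsub>M\<^esub> x"])
    (auto simp: smult_closed smult_l_distr smult_zero_left)

lemma matrix_action_assoc:
  assumes "finite I" "finite J" "a \<in> I \<rightarrow> carrier R" "\<And>i j. i \<in> I \<Longrightarrow> j \<in> J \<Longrightarrow> b i j \<in> carrier R"
    and "n \<in> J \<rightarrow> carrier M"
  shows "(\<Oplus>\<^bsub>M\<^esub>i\<in>I. a i \<odot>\<^bsub>M\<^esub> (\<Oplus>\<^bsub>M\<^esub>j\<in>J. b i j \<odot>\<^bsub>M\<^esub> n j))
    = (\<Oplus>\<^bsub>M\<^esub>j\<in>J. (\<Oplus>\<^bsub>R\<^esub>i\<in>I. a i \<otimes>\<^bsub>R\<^esub> b i j) \<odot>\<^bsub>M\<^esub> n j)"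
proof -
  have c: "a i \<in> carrier R" "n j \<in> carrier M" if "i \<in> I" "j \<in> J" for i j
    using that assms by auto
  have "(\<Oplus>\<^bsub>M\<^esub>i\<in>I. a i \<odot>\<^bsub>M\<^esub> (\<Oplus>\<^bsub>M\<^esub>j\<in>J. b i j \<odot>\<^bsub>M\<^esub> n j))
      = (\<Oplus>\<^bsub>M\<^esub>i\<in>I. \<Oplus>\<^bsub>M\<^esub>j\<in>J. (a i \<otimes>\<^bsub>R\<^esub> b i j) \<odot>\<^bsub>M\<^esub> n j)"
    using assms c
    by (intro M.finsum_cong')
      (auto simp: smult_finsum_right smult_assoc smult_closed Pi_iff
        intro!: M.finsum_closed M.finsum_cong')
  also have "\<dots> = (\<Oplus>\<^bsub>M\<^esub>j\<in>J. \<Oplus>\<^bsub>M\<^esub>i\<in>I. (a i \<otimes>\<^bsub>R\<^esub> b i j) \<odot>\<^bsub>M\<^esub> n j)"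
    using assms c by (intro M.finsum_swap) (auto intro!: smult_closed)
  also have "\<dots> = (\<Oplus>\<^bsub>M\<^esub>j\<in>J. (\<Oplus>\<^bsub>R\<^esub>i\<in>I. a i \<otimes>\<^bsub>R\<^esub> b i j) \<odot>\<^bsub>M\<^esub> n j)"
    using assms c
    by (intro M.finsum_cong')
      (auto simp: smult_finsum_left Pi_iff intro!: M.finsum_closed R.finsum_closed smult_closed)
  finally show ?thesis .
qed

end

lemma left_modulesD: "M \<in> left_modules R \<Longrightarrow> left_module R M"
  by (simp add: left_modules_def)

lemma module_homsD:
  assumes "f \<in> module_homs R M N"
  shows "f \<in> carrier M \<rightarrow>\<^sub>E carrier N" "x \<in> carrier M \<Longrightarrow> f x \<in> carrier N"
    "x \<in> carrier M \<Longrightarrow> y \<in> carrier M \<Longrightarrow> f (x \<oplus>\<^bsub>M\<^esub> y) = f x \<oplus>\<^bsub>N\<^esub> f y"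
    "a \<in> carrier R \<Longrightarrow> x \<in> carrier M \<Longrightarrow> f (a \<odot>\<^bsub>M\<^esub> x) = a \<odot>\<^bsub>N\<^esub> f x"
  using assms by (auto simp: module_homs_def)

lemma module_homs_zero:
  assumes "left_module R M" "left_module R N" "f \<in> module_homs R M N"
  shows "f \<zero>\<^bsub>M\<^esub> = \<zero>\<^bsub>N\<^esub>"
proof -
  interpret M: left_module R M by fact
  interpret N: left_module R N by fact
  show ?thesis
    by (metis M.M.zero_closed M.M.l_zero N.M.add.l_cancel_one' module_homsD(2,3)[OF assms(3)])
qed

lemma module_homs_finsum:
  assumes "left_module R M" "left_module R N" "f \<in> module_homs R M N" "finite A" "g \<in> A \<rightarrow> carrier M"
  shows "f (\<Oplus>\<^bsub>M\<^esub>i\<in>A. g i) = (\<Oplus>\<^bsub>N\<^esub>i\<in>A. f (g i))"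
proof -
  interpret M: left_module R M by fact
  interpret N: left_module R N by fact
  show ?thesis
    using assms(4,5) module_homsD[OF assms(3)] module_homs_zero[OF assms(1-3)]
    by (intro finsum_additive_map[OF M.M.abelian_monoid_axioms N.M.abelian_monoid_axioms]) auto
qed

lemma module_homs_compose:
  assumes "left_module R L" "f \<in> module_homs R L M" "h \<in> module_homs R M N"
  shows "compose (carrier L) h f \<in> module_homs R L N"
proof -
  interpret L: left_module R L by fact
  show ?thesis
    using module_homsD[OF assms(2)] module_homsD[OF assms(3)]
    by (auto simp: module_homs_def compose_def L.M.a_closed L.smult_closed)
qed

lemma module_homs_inverse:
  assumes "left_module R M" "f \<in> module_homs R M N" "bij_betw f (carrier M) (carrier N)"
  obtains h where "h \<in> module_homs R N M"
    "compose (carrier M) h f = (\<lambda>x\<in>carrier M. x)" "compose (carrier N) f h = (\<lambda>x\<in>carrier N. x)"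
proof -
  interpret M: left_module R M by fact
  define h where "h = (\<lambda>y\<in>carrier N. inv_into (carrier M) f y)"
  have hf: "h (f x) = x" if "x \<in> carrier M" for x
    using assms(3) that module_homsD(2)[OF assms(2)] by (simp add: h_def bij_betw_inv_into_left)
  have h: "h y \<in> carrier M" "f (h y) = y" if "y \<in> carrier N" for y
    using assms(3) that
    by (auto simp: h_def bij_betw_inv_into_right intro: bij_betw_apply[OF bij_betw_inv_into])
  have "h \<in> module_homs R N M"
    unfolding module_homs_def
  proof (intro CollectI conjI ballI)
    show "h \<in> carrier N \<rightarrow>\<^sub>E carrier M"
      using h(1) by (auto simp: h_def)
    fix y z assume yz: "y \<in> carrier N" "z \<in> carrier N"
    have "y \<oplus>\<^bsub>N\<^esub> z = f (h y \<oplus>\<^bsub>M\<^esub> h z)"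
      using yz h module_homsD(3)[OF assms(2)] by simp
    thus "h (y \<oplus>\<^bsub>N\<^esub> z) = h y \<oplus>\<^bsub>M\<^esub> h z"
      using yz h hf by simp
  next
    fix a y assume ay: "a \<in> carrier R" "y \<in> carrier N"
    have "a \<odot>\<^bsub>N\<^esub> y = f (a \<odot>\<^bsub>M\<^esub> h y)"
      using ay h module_homsD(4)[OF assms(2)] by simp
    thus "h (a \<odot>\<^bsub>N\<^esub> y) = a \<odot>\<^bsub>M\<^esub> h y"
      using ay h hf M.smult_closed by simp
  qed
  thus ?thesis
    using that hf h by (auto simp: compose_def fun_eq_iff)
qed

lemma linear_functorD:
  assumes "linear_functor K R S Fo Fm"
  shows "M \<in> left_modules R \<Longrightarrow> Fo M \<in> left_modules S"
    "M \<in> left_modules R \<Longrightarrow> N \<in> left_modules R \<Longrightarrow> f \<in> module_homs R M N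
      \<Longrightarrow> Fm M N f \<in> module_homs S (Fo M) (Fo N)"
    "M \<in> left_modules R \<Longrightarrow> Fm M M (\<lambda>x\<in>carrier M. x) = (\<lambda>x\<in>carrier (Fo M). x)"
    "L \<in> left_modules R \<Longrightarrow> M \<in> left_modules R \<Longrightarrow> N \<in> left_modules R
      \<Longrightarrow> f \<in> module_homs R L M \<Longrightarrow> h \<in> module_homs R M N
      \<Longrightarrow> Fm L N (compose (carrier L) h f) = compose (carrier (Fo L)) (Fm M N h) (Fm L M f)"
    "M \<in> left_modules R \<Longrightarrow> N \<in> left_modules R
      \<Longrightarrow> f \<in> module_homs R M N \<Longrightarrow> h \<in> module_homs R M N
      \<Longrightarrow> Fm M N (hom_add M N f h) = hom_add (Fo M) (Fo N) (Fm M N f) (Fm M N h)"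
    "M \<in> left_modules R \<Longrightarrow> N \<in> left_modules R \<Longrightarrow> c \<in> carrier K
      \<Longrightarrow> f \<in> module_homs R M N
      \<Longrightarrow> Fm M N (hom_smult R M N c f) = hom_smult S (Fo M) (Fo N) c (Fm M N f)"
  using assms unfolding linear_functor_def by blast+

lemma linear_functor_compose:
  assumes F: "linear_functor K R S Fo Fm" and G: "linear_functor K S T Go Gm"
  shows "linear_functor K R T (\<lambda>M. Go (Fo M)) (\<lambda>M N f. Gm (Fo M) (Fo N) (Fm M N f))"
  unfolding linear_functor_def
  by (intro conjI ballI)
    (simp_all add: linear_functorD[OF F] linear_functorD(1-3,5,6)[OF G]
      linear_functorD(4)[OF G, of _ "Fo M" for M])

text \<open>A functor preserves inverses, hence bijective homomorphisms.\<close>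

lemma linear_functor_bij:
  assumes F: "linear_functor K R S Fo Fm" and M: "M \<in> left_modules R" and N: "N \<in> left_modules R"
    and f: "f \<in> module_homs R M N" and bij: "bij_betw f (carrier M) (carrier N)"
  shows "bij_betw (Fm M N f) (carrier (Fo M)) (carrier (Fo N))"
proof -
  obtain h where h: "h \<in> module_homs R N M"
    "compose (carrier M) h f = (\<lambda>x\<in>carrier M. x)" "compose (carrier N) f h = (\<lambda>x\<in>carrier N. x)"
    using module_homs_inverse[OF left_modulesD[OF M] f bij] .
  have Ff: "Fm M N f \<in> module_homs S (Fo M) (Fo N)" and Fh: "Fm N M h \<in> module_homs S (Fo N) (Fo M)"
    using linear_functorD(2)[OF F] M N f h by auto
  have "compose (carrier (Fo M)) (Fm N M h) (Fm M N f) = (\<lambda>x\<in>carrier (Fo M). x)"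
    using linear_functorD(4)[OF F M N M f h(1)] linear_functorD(3)[OF F M] h(2) by simp
  hence 1: "Fm N M h (Fm M N f x) = x" if "x \<in> carrier (Fo M)" for x
    using that by (metis compose_eq restrict_apply')
  have "compose (carrier (Fo N)) (Fm M N f) (Fm N M h) = (\<lambda>x\<in>carrier (Fo N). x)"
    using linear_functorD(4)[OF F N M N h(1) f] linear_functorD(3)[OF F N] h(3) by simp
  hence 2: "Fm M N f (Fm N M h x) = x" if "x \<in> carrier (Fo N)" for x
    using that by (metis compose_eq restrict_apply')
  show ?thesis
    using 1 2 module_homsD(2)[OF Ff] module_homsD(2)[OF Fh]
    by (intro bij_betw_byWitness[where f' = "Fm N M h"]) auto
qed

lemma natural_isoD:
  assumes "natural_iso_to_id R Eo Em \<eta>"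
  shows "M \<in> left_modules R \<Longrightarrow> \<eta> M \<in> module_homs R (Eo M) M"
    "M \<in> left_modules R \<Longrightarrow> bij_betw (\<eta> M) (carrier (Eo M)) (carrier M)"
    "M \<in> left_modules R \<Longrightarrow> N \<in> left_modules R \<Longrightarrow> f \<in> module_homs R M N
      \<Longrightarrow> compose (carrier (Eo M)) (\<eta> N) (Em M N f) = compose (carrier (Eo M)) f (\<eta> M)"
  using assms unfolding natural_iso_to_id_def by blast+

text \<open>The natural isomorphism of a composite equivalence: the inner one is transported by
  the outer functor and followed by the outer one.\<close>

lemma natural_iso_compose:
  fixes Fo :: "('r, 'u) module \<Rightarrow> ('s, 'u) module"
  assumes F: "linear_functor K R S Fo Fm" and G: "linear_functor K S R Go Gm"
    and E: "linear_functor K S S Eo Em"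
    and \<eta>: "natural_iso_to_id R (\<lambda>M. Go (Fo M)) (\<lambda>M N f. Gm (Fo M) (Fo N) (Fm M N f)) \<eta>"
    and \<theta>: "natural_iso_to_id S Eo Em \<theta>"
  shows "natural_iso_to_id R (\<lambda>M. Go (Eo (Fo M)))
    (\<lambda>M N f. Gm (Eo (Fo M)) (Eo (Fo N)) (Em (Fo M) (Fo N) (Fm M N f)))
    (\<lambda>M. compose (carrier (Go (Eo (Fo M)))) (\<eta> M) (Gm (Eo (Fo M)) (Fo M) (\<theta> (Fo M))))"
  unfolding natural_iso_to_id_def
proof (intro conjI ballI)
  fix M :: "('r, 'u) module" assume M: "M \<in> left_modules R"
  note FM = linear_functorD(1)[OF F M]
  note EFM = linear_functorD(1)[OF E FM]
  note t = natural_isoD(1)[OF \<theta> FM]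
  note Gt = linear_functorD(2)[OF G EFM FM t]
  note GEFM = left_modulesD[OF linear_functorD(1)[OF G EFM]]
  show "compose (carrier (Go (Eo (Fo M)))) (\<eta> M) (Gm (Eo (Fo M)) (Fo M) (\<theta> (Fo M)))
      \<in> module_homs R (Go (Eo (Fo M))) M"
    by (rule module_homs_compose[OF GEFM Gt natural_isoD(1)[OF \<eta> M]])
  have "bij_betw (\<eta> M \<circ> Gm (Eo (Fo M)) (Fo M) (\<theta> (Fo M))) (carrier (Go (Eo (Fo M)))) (carrier M)"
    using linear_functor_bij[OF G EFM FM t natural_isoD(2)[OF \<theta> FM]] natural_isoD(2)[OF \<eta> M]
    by (rule bij_betw_trans)
  thus "bij_betw (compose (carrier (Go (Eo (Fo M)))) (\<eta> M) (Gm (Eo (Fo M)) (Fo M) (\<theta> (Fo M))))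
      (carrier (Go (Eo (Fo M)))) (carrier M)"
    by (subst bij_betw_cong) (auto simp: compose_def)
  fix N :: "('r, 'u) module" and f assume N: "N \<in> left_modules R" and f: "f \<in> module_homs R M N"
  note FN = linear_functorD(1)[OF F N]
  note EFN = linear_functorD(1)[OF E FN]
  note t' = natural_isoD(1)[OF \<theta> FN]
  note Ff = linear_functorD(2)[OF F M N f]
  note EFf = linear_functorD(2)[OF E FM FN Ff]
  note GEFf = linear_functorD(2)[OF G EFM EFN EFf]
  let ?C = "carrier (Go (Eo (Fo M)))"
  let ?t = "Gm (Eo (Fo M)) (Fo M) (\<theta> (Fo M))"
  let ?t' = "Gm (Eo (Fo N)) (Fo N) (\<theta> (Fo N))"
  let ?f = "Gm (Eo (Fo M)) (Eo (Fo N)) (Em (Fo M) (Fo N) (Fm M N f))"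
  have sq: "compose ?C ?t' ?f = compose ?C (Gm (Fo M) (Fo N) (Fm M N f)) ?t"
    using linear_functorD(4)[OF G EFM EFN FN EFf t'] linear_functorD(4)[OF G EFM FM FN t Ff]
      natural_isoD(3)[OF \<theta> FM FN Ff] by simp
  show "compose ?C (compose (carrier (Go (Eo (Fo N)))) (\<eta> N) ?t') ?f
      = compose ?C f (compose ?C (\<eta> M) ?t)"
  proof
    fix x show "compose ?C (compose (carrier (Go (Eo (Fo N)))) (\<eta> N) ?t') ?f x
      = compose ?C f (compose ?C (\<eta> M) ?t) x"
    proof (cases "x \<in> ?C")
      case True
      have tx: "?t x \<in> carrier (Go (Fo M))"
        using module_homsD(2)[OF Gt True] .
      have "compose ?C (compose (carrier (Go (Eo (Fo N)))) (\<eta> N) ?t') ?f x = \<eta> N (?t' (?f x))"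
        using True module_homsD(2)[OF GEFf True] by (simp add: compose_eq)
      also have "?t' (?f x) = Gm (Fo M) (Fo N) (Fm M N f) (?t x)"
        using fun_cong[OF sq, of x] True by (simp add: compose_eq)
      also have "\<eta> N \<dots> = f (\<eta> M (?t x))"
        using fun_cong[OF natural_isoD(3)[OF \<eta> M N f], of "?t x"] tx by (simp add: compose_eq)
      finally show ?thesis
        using True by (simp add: compose_eq)
    qed (simp add: compose_def)
  qed
qed

section \<open>Morita equivalence\<close>

lemma morita_equivalent_sym:
  assumes "morita_equivalent TYPE('u) K R S"
  shows "morita_equivalent TYPE('u) K S R"
  using assms unfolding morita_equivalent_def by (elim exE conjE, intro exI conjI)

lemma morita_equivalent_trans:
  fixes R :: "('k, 'r) module" and S :: "('k, 's) module" and T :: "('k, 't) module"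
  assumes "morita_equivalent TYPE('u) K R S" "morita_equivalent TYPE('u) K S T"
  shows "morita_equivalent TYPE('u) K R T"
proof -
  from assms(1) obtain Fo :: "('r, 'u) module \<Rightarrow> ('s, 'u) module" and Fm Go Gm \<eta> \<epsilon> where
    F: "linear_functor K R S Fo Fm" and G: "linear_functor K S R Go Gm"
    and \<eta>: "natural_iso_to_id R (\<lambda>M. Go (Fo M)) (\<lambda>M N f. Gm (Fo M) (Fo N) (Fm M N f)) \<eta>"
    and \<epsilon>: "natural_iso_to_id S (\<lambda>N. Fo (Go N)) (\<lambda>M N f. Fm (Go M) (Go N) (Gm M N f)) \<epsilon>"
    unfolding morita_equivalent_def by blast
  from assms(2) obtain Fo' :: "('s, 'u) module \<Rightarrow> ('t, 'u) module" and Fm' Go' Gm' \<eta>' \<epsilon>' where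
    F': "linear_functor K S T Fo' Fm'" and G': "linear_functor K T S Go' Gm'"
    and \<eta>': "natural_iso_to_id S (\<lambda>M. Go' (Fo' M)) (\<lambda>M N f. Gm' (Fo' M) (Fo' N) (Fm' M N f)) \<eta>'"
    and \<epsilon>': "natural_iso_to_id T (\<lambda>N. Fo' (Go' N)) (\<lambda>M N f. Fm' (Go' M) (Go' N) (Gm' M N f)) \<epsilon>'"
    unfolding morita_equivalent_def by blast
  show ?thesis
    unfolding morita_equivalent_def
    by (intro exI conjI)
      (rule linear_functor_compose[OF F F'] linear_functor_compose[OF G' G]
        natural_iso_compose[OF F G linear_functor_compose[OF F' G'] \<eta> \<eta>']
        natural_iso_compose[OF G' F' linear_functor_compose[OF G F] \<epsilon>' \<epsilon>])+
qed

section \<open>Morita equivalence from a full corner\<close>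

text \<open>The module categories consist of modules whose elements lie in a fixed universe, so a
  module of tuples has to be copied into that universe. An infinite set \<open>U\<close> admits
  this because \<open>U \<times> U\<close> has the cardinality of \<open>U\<close>.\<close>

lemma finite_power_embeds:
  fixes I :: "'i set"
  assumes "finite I" "infinite (UNIV :: 'u set)"
  obtains emb :: "('i \<Rightarrow> 'u) \<Rightarrow> 'u" where "inj_on emb (I \<rightarrow>\<^sub>E UNIV)"
proof -
  have "(card_of (UNIV \<times> UNIV :: ('u \<times> 'u) set), card_of (UNIV :: 'u set)) \<in> ordIso"
    using assms(2) by (intro card_of_Times_same_infinite)
  then obtain pair :: "'u \<times> 'u \<Rightarrow> 'u" where pair: "inj pair"
    by (metis UNIV_Times_UNIV bij_betw_imp_inj_on card_of_ordIso)
  have "\<exists>emb :: ('i \<Rightarrow> 'u) \<Rightarrow> 'u. inj_on emb (I \<rightarrow>\<^sub>E UNIV)"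
    using assms(1)
  proof (induction I)
    case empty
    show ?case by (simp add: PiE_empty_domain)
  next
    case (insert i I)
    then obtain emb :: "('i \<Rightarrow> 'u) \<Rightarrow> 'u" where emb: "inj_on emb (I \<rightarrow>\<^sub>E UNIV)" by blast
    have "inj_on (\<lambda>f. pair (f i, emb (f(i := undefined)))) (insert i I \<rightarrow>\<^sub>E UNIV)"
    proof (rule inj_onI)
      fix f h :: "'i \<Rightarrow> 'u"
      assume f: "f \<in> insert i I \<rightarrow>\<^sub>E UNIV" and h: "h \<in> insert i I \<rightarrow>\<^sub>E UNIV"
        and eq: "pair (f i, emb (f(i := undefined))) = pair (h i, emb (h(i := undefined)))"
      have "f(i := undefined) \<in> I \<rightarrow>\<^sub>E UNIV" "h(i := undefined) \<in> I \<rightarrow>\<^sub>E UNIV"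
        using f h insert.hyps by (auto simp: PiE_def extensional_def)
      hence "f i = h i" "f(i := undefined) = h(i := undefined)"
        using eq pair emb by (auto dest!: injD dest: inj_onD)
      thus "f = h" by (metis fun_upd_triv fun_upd_upd)
    qed
    thus ?case by blast
  qed
  thus ?thesis using that by blast
qed

text \<open>The map \<open>\<psi>\<close> identifies \<open>S\<close> with the corner ring
  \<open>e R e\<close>, whose unit is \<open>e\<close>. The idempotent is full: the two-sided
  ideal that it generates contains \<open>1\<close>, as witnessed by the families \<open>u\<close>
  and \<open>v\<close>. The conditions on scalars make \<open>\<psi>\<close> compatible with the
  action of \<open>K\<close> through central elements.\<close>

locale corner = R: ring R + S: ring S
  for R :: "('k, 'r) module" (structure) and S :: "('k, 's) module" (structure) +
  fixes K :: "('k, 'e) ring_scheme" and \<psi> :: "'s \<Rightarrow> 'r" and e :: 'r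
    and u v :: "'i \<Rightarrow> 'r" and I :: "'i set"
  assumes psi_closed: "s \<in> carrier S \<Longrightarrow> \<psi> s \<in> carrier R"
    and psi_add: "s \<in> carrier S \<Longrightarrow> t \<in> carrier S \<Longrightarrow> \<psi> (s \<oplus>\<^bsub>S\<^esub> t) = \<psi> s \<oplus>\<^bsub>R\<^esub> \<psi> t"
    and psi_mult: "s \<in> carrier S \<Longrightarrow> t \<in> carrier S \<Longrightarrow> \<psi> (s \<otimes>\<^bsub>S\<^esub> t) = \<psi> s \<otimes>\<^bsub>R\<^esub> \<psi> t"
    and psi_one: "\<psi> \<one>\<^bsub>S\<^esub> = e"
    and psi_inj: "inj_on \<psi> (carrier S)"
    and psi_image: "a \<in> carrier R \<Longrightarrow> e \<otimes>\<^bsub>R\<^esub> a \<otimes>\<^bsub>R\<^esub> e \<in> \<psi> ` carrier S"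
    and finite_I: "finite I"
    and u_closed: "i \<in> I \<Longrightarrow> u i \<in> carrier R" and v_closed: "i \<in> I \<Longrightarrow> v i \<in> carrier R"
    and full: "(\<Oplus>\<^bsub>R\<^esub>i\<in>I. u i \<otimes>\<^bsub>R\<^esub> e \<otimes>\<^bsub>R\<^esub> v i) = \<one>\<^bsub>R\<^esub>"
    and scalar_closed: "c \<in> carrier K \<Longrightarrow> c \<odot>\<^bsub>R\<^esub> \<one>\<^bsub>R\<^esub> \<in> carrier R"
      "c \<in> carrier K \<Longrightarrow> c \<odot>\<^bsub>S\<^esub> \<one>\<^bsub>S\<^esub> \<in> carrier S"
    and scalar_central: "c \<in> carrier K \<Longrightarrow> a \<in> carrier R
      \<Longrightarrow> (c \<odot>\<^bsub>R\<^esub> \<one>\<^bsub>R\<^esub>) \<otimes>\<^bsub>R\<^esub> a = a \<otimes>\<^bsub>R\<^esub> (c \<odot>\<^bsub>R\<^esub> \<one>\<^bsub>R\<^esub>)"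
    and psi_scalar: "c \<in> carrier K \<Longrightarrow> \<psi> (c \<odot>\<^bsub>S\<^esub> \<one>\<^bsub>S\<^esub>) = (c \<odot>\<^bsub>R\<^esub> \<one>\<^bsub>R\<^esub>) \<otimes>\<^bsub>R\<^esub> e"
begin

lemma e_closed: "e \<in> carrier R"
  using psi_closed[OF S.one_closed] psi_one by simp

lemma e_psi: "s \<in> carrier S \<Longrightarrow> e \<otimes>\<^bsub>R\<^esub> \<psi> s = \<psi> s"
  using psi_mult[of "\<one>\<^bsub>S\<^esub>" s] psi_one by simp

lemma psi_e: "s \<in> carrier S \<Longrightarrow> \<psi> s \<otimes>\<^bsub>R\<^esub> e = \<psi> s"
  using psi_mult[of s "\<one>\<^bsub>S\<^esub>"] psi_one by simp

lemma ee: "e \<otimes>\<^bsub>R\<^esub> e = e"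
  using e_psi[of "\<one>\<^bsub>S\<^esub>"] psi_one by simp

lemma eex: "x \<in> carrier R \<Longrightarrow> e \<otimes>\<^bsub>R\<^esub> (e \<otimes>\<^bsub>R\<^esub> x) = e \<otimes>\<^bsub>R\<^esub> x"
  using ee e_closed by (metis R.m_assoc)

lemma psi_zero: "\<psi> \<zero>\<^bsub>S\<^esub> = \<zero>\<^bsub>R\<^esub>"
  by (metis R.add.l_cancel_one' S.zero_closed S.l_zero psi_add psi_closed)

lemma psi_finsum:
  assumes "finite A" "f \<in> A \<rightarrow> carrier S"
  shows "\<psi> (\<Oplus>\<^bsub>S\<^esub>a\<in>A. f a) = (\<Oplus>\<^bsub>R\<^esub>a\<in>A. \<psi> (f a))"
  using assms psi_add psi_closed psi_zero
  by (intro finsum_additive_map[OF S.abelian_monoid_axioms R.abelian_monoid_axioms]) auto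

definition \<tau> :: "'r \<Rightarrow> 's" where "\<tau> a = inv_into (carrier S) \<psi> (e \<otimes>\<^bsub>R\<^esub> a \<otimes>\<^bsub>R\<^esub> e)"

lemma tau_closed: "a \<in> carrier R \<Longrightarrow> \<tau> a \<in> carrier S"
  unfolding \<tau>_def using psi_image by (metis inv_into_into)

lemma psi_tau: "a \<in> carrier R \<Longrightarrow> \<psi> (\<tau> a) = e \<otimes>\<^bsub>R\<^esub> (a \<otimes>\<^bsub>R\<^esub> e)"
  unfolding \<tau>_def using psi_image e_closed by (metis f_inv_into_f R.m_assoc)

lemma psi_eqD: "\<psi> s = \<psi> t \<Longrightarrow> s \<in> carrier S \<Longrightarrow> t \<in> carrier S \<Longrightarrow> s = t"
  using psi_inj by (meson inj_onD)

text \<open>The sum is \<open>a \<cdot> (\<Sum> u\<^sub>i e v\<^sub>i) \<cdot> b\<close>, and the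
  middle factor is \<open>1\<close>.\<close>

lemma resolution:
  assumes "a \<in> carrier R" "b \<in> carrier R"
  shows "(\<Oplus>\<^bsub>R\<^esub>i\<in>I. a \<otimes>\<^bsub>R\<^esub> (u i \<otimes>\<^bsub>R\<^esub> (e \<otimes>\<^bsub>R\<^esub> (v i \<otimes>\<^bsub>R\<^esub> b)))) = a \<otimes>\<^bsub>R\<^esub> b"
proof -
  have c: "(\<lambda>i. u i \<otimes>\<^bsub>R\<^esub> e \<otimes>\<^bsub>R\<^esub> v i) \<in> I \<rightarrow> carrier R"
    using u_closed v_closed e_closed by auto
  have "a \<otimes>\<^bsub>R\<^esub> b = a \<otimes>\<^bsub>R\<^esub> ((\<Oplus>\<^bsub>R\<^esub>i\<in>I. u i \<otimes>\<^bsub>R\<^esub> e \<otimes>\<^bsub>R\<^esub> v i) \<otimes>\<^bsub>R\<^esub> b)"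
    using full assms by simp
  also have "\<dots> = a \<otimes>\<^bsub>R\<^esub> (\<Oplus>\<^bsub>R\<^esub>i\<in>I. u i \<otimes>\<^bsub>R\<^esub> e \<otimes>\<^bsub>R\<^esub> v i \<otimes>\<^bsub>R\<^esub> b)"
    using c assms finite_I by (subst R.finsum_ldistr) auto
  also have "\<dots> = (\<Oplus>\<^bsub>R\<^esub>i\<in>I. a \<otimes>\<^bsub>R\<^esub> (u i \<otimes>\<^bsub>R\<^esub> e \<otimes>\<^bsub>R\<^esub> v i \<otimes>\<^bsub>R\<^esub> b))"
    using c assms finite_I by (subst R.finsum_rdistr) (auto simp: Pi_iff)
  also have "\<dots> = (\<Oplus>\<^bsub>R\<^esub>i\<in>I. a \<otimes>\<^bsub>R\<^esub> (u i \<otimes>\<^bsub>R\<^esub> (e \<otimes>\<^bsub>R\<^esub> (v i \<otimes>\<^bsub>R\<^esub> b))))"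
    using assms u_closed v_closed e_closed by (intro R.finsum_cong') (auto simp: R.m_assoc)
  finally show ?thesis ..
qed

text \<open>The matrix over \<open>S\<close> with the entries \<open>e v\<^sub>i r u\<^sub>j
  e\<close>. It describes left multiplication by \<open>r\<close> on \<open>R e\<close> in the
  coordinates \<open>x \<mapsto> (e v\<^sub>i x)\<^sub>i\<close>, with inverse
  \<open>(x\<^sub>i)\<^sub>i \<mapsto> \<Sum> u\<^sub>i x\<^sub>i\<close>. The coordinates are
  redundant, so the matrix of \<open>1\<close> is an idempotent and in general not the identity
  matrix.\<close>

definition \<rho> :: "'r \<Rightarrow> 'i \<Rightarrow> 'i \<Rightarrow> 's" where
  "\<rho> r i j = \<tau> (v i \<otimes>\<^bsub>R\<^esub> (r \<otimes>\<^bsub>R\<^esub> u j))"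

lemma rho_closed: "r \<in> carrier R \<Longrightarrow> i \<in> I \<Longrightarrow> j \<in> I \<Longrightarrow> \<rho> r i j \<in> carrier S"
  unfolding \<rho>_def using u_closed v_closed by (intro tau_closed) auto

lemma psi_rho:
  "r \<in> carrier R \<Longrightarrow> i \<in> I \<Longrightarrow> j \<in> I
    \<Longrightarrow> \<psi> (\<rho> r i j) = e \<otimes>\<^bsub>R\<^esub> (v i \<otimes>\<^bsub>R\<^esub> (r \<otimes>\<^bsub>R\<^esub> (u j \<otimes>\<^bsub>R\<^esub> e)))"
  unfolding \<rho>_def using u_closed v_closed e_closed by (simp add: psi_tau R.m_assoc)

text \<open>As \<open>\<psi>\<close> is injective, identities in \<open>S\<close> may be checked
  in \<open>R\<close>, where the sum over the index of \<open>u\<^sub>i e v\<^sub>i\<close>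
  collapses.\<close>

lemma sum_via_resolution:
  assumes "\<And>i. i \<in> I \<Longrightarrow> x i \<in> carrier S" "\<And>i. i \<in> I \<Longrightarrow> y i \<in> carrier S" "z \<in> carrier S"
    and "a \<in> carrier R" "b \<in> carrier R" "\<psi> z = a \<otimes>\<^bsub>R\<^esub> b"
    and "\<And>i. i \<in> I \<Longrightarrow> \<psi> (x i) = a \<otimes>\<^bsub>R\<^esub> (u i \<otimes>\<^bsub>R\<^esub> e)"
    and "\<And>i. i \<in> I \<Longrightarrow> \<psi> (y i) = e \<otimes>\<^bsub>R\<^esub> (v i \<otimes>\<^bsub>R\<^esub> b)"
  shows "(\<Oplus>\<^bsub>S\<^esub>i\<in>I. x i \<otimes>\<^bsub>S\<^esub> y i) = z"
proof (rule psi_eqD)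
  have "\<psi> (\<Oplus>\<^bsub>S\<^esub>i\<in>I. x i \<otimes>\<^bsub>S\<^esub> y i) = (\<Oplus>\<^bsub>R\<^esub>i\<in>I. \<psi> (x i \<otimes>\<^bsub>S\<^esub> y i))"
    using assms finite_I by (intro psi_finsum) auto
  also have "\<dots> = (\<Oplus>\<^bsub>R\<^esub>i\<in>I. a \<otimes>\<^bsub>R\<^esub> (u i \<otimes>\<^bsub>R\<^esub> (e \<otimes>\<^bsub>R\<^esub> (v i \<otimes>\<^bsub>R\<^esub> b))))"
    using assms u_closed v_closed e_closed
    by (intro R.finsum_cong') (auto simp: psi_mult R.m_assoc eex)
  also have "\<dots> = \<psi> z"
    using assms resolution by simp
  finally show "\<psi> (\<Oplus>\<^bsub>S\<^esub>i\<in>I. x i \<otimes>\<^bsub>S\<^esub> y i) = \<psi> z" .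
qed (use assms in \<open>auto intro!: S.finsum_closed\<close>)

lemma rho_mult:
  assumes "r \<in> carrier R" "t \<in> carrier R" "i \<in> I" "k \<in> I"
  shows "(\<Oplus>\<^bsub>S\<^esub>j\<in>I. \<rho> r i j \<otimes>\<^bsub>S\<^esub> \<rho> t j k) = \<rho> (r \<otimes>\<^bsub>R\<^esub> t) i k"
  using assms u_closed v_closed e_closed
  by (intro sum_via_resolution[where a = "e \<otimes>\<^bsub>R\<^esub> (v i \<otimes>\<^bsub>R\<^esub> r)" and b = "t \<otimes>\<^bsub>R\<^esub> (u k \<otimes>\<^bsub>R\<^esub> e)"])
    (auto simp: rho_closed psi_rho R.m_assoc)

lemma rho_add:
  assumes "r \<in> carrier R" "t \<in> carrier R" "i \<in> I" "j \<in> I"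
  shows "\<rho> (r \<oplus>\<^bsub>R\<^esub> t) i j = \<rho> r i j \<oplus>\<^bsub>S\<^esub> \<rho> t i j"
  using assms u_closed v_closed e_closed
  by (intro psi_eqD) (auto simp: rho_closed psi_rho psi_add R.l_distr R.r_distr)

end

locale corner_embedded = corner R S K \<psi> e u v I
  for R :: "('k, 'r) module" (structure) and S :: "('k, 's) module" (structure)
    and K :: "('k, 'e) ring_scheme" and \<psi> :: "'s \<Rightarrow> 'r" and e :: 'r
    and u v :: "'i \<Rightarrow> 'r" and I :: "'i set" +
  fixes emb :: "('i \<Rightarrow> 'u) \<Rightarrow> 'u"
  assumes emb_inj: "inj_on emb (I \<rightarrow>\<^sub>E UNIV)"
begin

definition dec :: "'u \<Rightarrow> 'i \<Rightarrow> 'u" where "dec = inv_into (I \<rightarrow>\<^sub>E UNIV) emb"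

lemma dec_emb: "n \<in> I \<rightarrow>\<^sub>E A \<Longrightarrow> dec (emb n) = n"
  unfolding dec_def by (rule inv_into_f_f[OF emb_inj]) auto

text \<open>The functor \<open>M \<mapsto> e M\<close>; since \<open>e\<close> is idempotent, the
  elements of \<open>e M\<close> are those fixed by \<open>e\<close>.\<close>

definition Fo :: "('r, 'u) module \<Rightarrow> ('s, 'u) module" where
  "Fo M = \<lparr>carrier = {x \<in> carrier M. e \<odot>\<^bsub>M\<^esub> x = x}, mult = undefined, one = undefined,
     zero = \<zero>\<^bsub>M\<^esub>, add = add M, smult = (\<lambda>s x. \<psi> s \<odot>\<^bsub>M\<^esub> x)\<rparr>"

definition Fm :: "('r, 'u) module \<Rightarrow> ('r, 'u) module \<Rightarrow> ('u \<Rightarrow> 'u) \<Rightarrow> 'u \<Rightarrow> 'u" where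
  "Fm M N f = restrict f (carrier (Fo M))"

definition act :: "('s, 'u) module \<Rightarrow> 'r \<Rightarrow> ('i \<Rightarrow> 'u) \<Rightarrow> 'i \<Rightarrow> 'u" where
  "act N r n = (\<lambda>i\<in>I. \<Oplus>\<^bsub>N\<^esub>j\<in>I. \<rho> r i j \<odot>\<^bsub>N\<^esub> n j)"

text \<open>The image of the idempotent matrix of \<open>1\<close> acting on tuples, which is a
  copy of \<open>R e \<otimes> N\<close> over \<open>e R e\<close>: an element \<open>x \<otimes>
  n\<close> has the coordinates \<open>(e v\<^sub>i x n)\<^sub>i\<close>.\<close>

definition tuples :: "('s, 'u) module \<Rightarrow> ('i \<Rightarrow> 'u) set" where
  "tuples N = {n \<in> I \<rightarrow>\<^sub>E carrier N. act N \<one>\<^bsub>R\<^esub> n = n}"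

definition Go :: "('s, 'u) module \<Rightarrow> ('r, 'u) module" where
  "Go N = \<lparr>carrier = emb ` tuples N, mult = undefined, one = undefined,
     zero = emb (\<lambda>i\<in>I. \<zero>\<^bsub>N\<^esub>), add = (\<lambda>x y. emb (\<lambda>i\<in>I. dec x i \<oplus>\<^bsub>N\<^esub> dec y i)),
     smult = (\<lambda>r x. emb (act N r (dec x)))\<rparr>"

definition Gm :: "('s, 'u) module \<Rightarrow> ('s, 'u) module \<Rightarrow> ('u \<Rightarrow> 'u) \<Rightarrow> 'u \<Rightarrow> 'u" where
  "Gm N P f = (\<lambda>x\<in>carrier (Go N). emb (\<lambda>i\<in>I. f (dec x i)))"

text \<open>Under the identification with \<open>R e \<otimes> e M\<close> this is the evaluation
  \<open>x \<otimes> n \<mapsto> x n\<close>, because \<open>\<Sum> u\<^sub>i e v\<^sub>i x n = x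
  n\<close>. Likewise \<open>\<epsilon>\<close> is the identification of \<open>e R e \<otimes>
  N\<close> with \<open>N\<close>.\<close>

definition \<eta> :: "('r, 'u) module \<Rightarrow> 'u \<Rightarrow> 'u" where
  "\<eta> M = (\<lambda>x\<in>carrier (Go (Fo M)). \<Oplus>\<^bsub>M\<^esub>i\<in>I. u i \<odot>\<^bsub>M\<^esub> dec x i)"

definition \<epsilon> :: "('s, 'u) module \<Rightarrow> 'u \<Rightarrow> 'u" where
  "\<epsilon> N = (\<lambda>x\<in>carrier (Fo (Go N)). \<Oplus>\<^bsub>N\<^esub>i\<in>I. \<tau> (u i) \<odot>\<^bsub>N\<^esub> dec x i)"

lemma Fo_sel:
  "x \<in> carrier (Fo M) \<longleftrightarrow> x \<in> carrier M \<and> e \<odot>\<^bsub>M\<^esub> x = x" "\<zero>\<^bsub>Fo M\<^esub> = \<zero>\<^bsub>M\<^esub>"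
  "add (Fo M) = add M" "s \<odot>\<^bsub>Fo M\<^esub> x = \<psi> s \<odot>\<^bsub>M\<^esub> x"
  by (simp_all add: Fo_def)

lemma Go_sel:
  "carrier (Go N) = emb ` tuples N" "\<zero>\<^bsub>Go N\<^esub> = emb (\<lambda>i\<in>I. \<zero>\<^bsub>N\<^esub>)"
  "x \<oplus>\<^bsub>Go N\<^esub> y = emb (\<lambda>i\<in>I. dec x i \<oplus>\<^bsub>N\<^esub> dec y i)" "r \<odot>\<^bsub>Go N\<^esub> x = emb (act N r (dec x))"
  by (simp_all add: Go_def)

lemma Fo_module:
  assumes "left_module R M"
  shows "left_module S (Fo M)"
proof -
  interpret M: left_module R M by fact
  have neg: "\<ominus>\<^bsub>M\<^esub> x \<in> carrier (Fo M)" if "x \<in> carrier (Fo M)" for x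
  proof -
    have "e \<odot>\<^bsub>M\<^esub> (\<ominus>\<^bsub>M\<^esub> x) \<oplus>\<^bsub>M\<^esub> x = e \<odot>\<^bsub>M\<^esub> (\<ominus>\<^bsub>M\<^esub> x \<oplus>\<^bsub>M\<^esub> x)"
      using that e_closed by (simp add: Fo_sel M.smult_r_distr)
    also have "\<dots> = \<zero>\<^bsub>M\<^esub>"
      using that e_closed by (simp add: Fo_sel M.M.l_neg M.smult_zero_right)
    finally show ?thesis
      using that e_closed
      by (simp add: Fo_sel M.smult_closed) (metis M.M.a_inv_closed M.M.minus_equality M.smult_closed)
  qed
  show ?thesis
  proof (intro left_module.intro left_module_axioms.intro abelian_groupI)
    fix s x assume s: "s \<in> carrier S" and x: "x \<in> carrier (Fo M)"
    have "e \<odot>\<^bsub>M\<^esub> (\<psi> s \<odot>\<^bsub>M\<^esub> x) = \<psi> s \<odot>\<^bsub>M\<^esub> x"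
      using s x e_closed psi_closed by (simp add: Fo_sel e_psi flip: M.smult_assoc)
    thus "s \<odot>\<^bsub>Fo M\<^esub> x \<in> carrier (Fo M)"
      using s x by (simp add: Fo_sel psi_closed M.smult_closed)
  next
    fix x assume x: "x \<in> carrier (Fo M)"
    show "\<exists>y\<in>carrier (Fo M). y \<oplus>\<^bsub>Fo M\<^esub> x = \<zero>\<^bsub>Fo M\<^esub>"
      using neg[OF x] x by (auto simp: Fo_sel(2,3) M.M.l_neg intro!: bexI[of _ "\<ominus>\<^bsub>M\<^esub> x"]) (simp add: Fo_sel M.M.l_neg)
  qed (auto simp: Fo_sel e_closed psi_closed psi_add psi_mult psi_one M.smult_closed M.smult_l_distr
      M.smult_r_distr M.smult_assoc M.smult_zero_right M.M.a_ac S.ring_axioms)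
qed

lemma finsum_Fo:
  assumes "left_module R M" "finite A" "f \<in> A \<rightarrow> carrier (Fo M)"
  shows "finsum (Fo M) f A = finsum M f A"
proof -
  interpret M: left_module R M by fact
  interpret F: left_module S "Fo M" by (rule Fo_module) fact
  show ?thesis
    using finsum_additive_map[OF F.M.abelian_monoid_axioms M.M.abelian_monoid_axioms assms(2,3),
        of "\<lambda>x. x"]
    by (auto simp: Fo_sel)
qed

lemma Fm_hom:
  assumes "left_module R M" "f \<in> module_homs R M N"
  shows "Fm M N f \<in> module_homs S (Fo M) (Fo N)"
proof -
  interpret M: left_module R M by fact
  interpret F: left_module S "Fo M" by (rule Fo_module) fact
  have f: "f x \<in> carrier (Fo N)" if "x \<in> carrier (Fo M)" for x
    using that module_homsD(2,4)[OF assms(2)] e_closed by (auto simp: Fo_sel) metis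
  show ?thesis
    using f module_homsD(3,4)[OF assms(2)] F.smult_closed F.M.a_closed
    by (auto simp: module_homs_def Fm_def) (auto simp: Fo_sel psi_closed)
qed

lemma Fo_linear: "linear_functor K R S Fo Fm"
  unfolding linear_functor_def
proof (intro conjI ballI)
  fix L M N :: "('r, 'u) module" and f h
  assume LMN: "L \<in> left_modules R" "M \<in> left_modules R" "N \<in> left_modules R"
    and f: "f \<in> module_homs R L M" and h: "h \<in> module_homs R M N"
  note Ff = Fm_hom[OF left_modulesD[OF LMN(1)] f]
  show "Fm L N (compose (carrier L) h f) = compose (carrier (Fo L)) (Fm M N h) (Fm L M f)"
    using module_homsD(2)[OF Ff] by (auto simp: fun_eq_iff Fm_def compose_def Fo_sel(1))
next
  fix M N :: "('r, 'u) module" and f h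
  assume MN: "M \<in> left_modules R" "N \<in> left_modules R"
    and f: "f \<in> module_homs R M N" and h: "h \<in> module_homs R M N"
  show "Fm M N (hom_add M N f h) = hom_add (Fo M) (Fo N) (Fm M N f) (Fm M N h)"
    by (auto simp: fun_eq_iff Fm_def hom_add_def Fo_sel)
next
  fix M N :: "('r, 'u) module" and f c
  assume MN: "M \<in> left_modules R" "N \<in> left_modules R" and c: "c \<in> carrier K"
    and f: "f \<in> module_homs R M N"
  interpret N: left_module R N using MN(2) by (rule left_modulesD)
  show "Fm M N (hom_smult R M N c f) = hom_smult S (Fo M) (Fo N) c (Fm M N f)"
  proof
    fix x show "Fm M N (hom_smult R M N c f) x = hom_smult S (Fo M) (Fo N) c (Fm M N f) x"
    proof (cases "x \<in> carrier (Fo M)")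
      case True
      have "f x \<in> carrier (Fo N)"
        using module_homsD(2)[OF Fm_hom[OF left_modulesD[OF MN(1)] f] True] True by (simp add: Fm_def)
      hence "(c \<odot>\<^bsub>R\<^esub> \<one>\<^bsub>R\<^esub>) \<odot>\<^bsub>N\<^esub> f x = \<psi> (c \<odot>\<^bsub>S\<^esub> \<one>\<^bsub>S\<^esub>) \<odot>\<^bsub>N\<^esub> f x"
        using c scalar_closed e_closed by (simp add: psi_scalar N.smult_assoc Fo_sel)
      thus ?thesis
        using True by (simp add: Fm_def hom_smult_def Fo_sel)
    qed (simp add: Fm_def hom_smult_def)
  qed
qed (auto simp: left_modules_def Fo_module Fm_hom[unfolded Fm_def] Fm_def fun_eq_iff Fo_sel)

context
  fixes N :: "('s, 'u) module"
  assumes N: "left_module S N"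
begin

interpretation N: left_module S N by (rule N)

lemma act_closed:
  assumes "r \<in> carrier R" "n \<in> I \<rightarrow>\<^sub>E carrier N"
  shows "act N r n \<in> I \<rightarrow>\<^sub>E carrier N"
  using assms rho_closed by (auto simp: act_def intro!: N.M.finsum_closed N.smult_closed)

lemma act_mult:
  assumes "r \<in> carrier R" "t \<in> carrier R" "n \<in> I \<rightarrow>\<^sub>E carrier N"
  shows "act N r (act N t n) = act N (r \<otimes>\<^bsub>R\<^esub> t) n"
proof -
  have c: "n j \<in> carrier N" if "j \<in> I" for j
    using that assms by auto
  have "(\<Oplus>\<^bsub>N\<^esub>j\<in>I. \<rho> r i j \<odot>\<^bsub>N\<^esub> act N t n j) = (\<Oplus>\<^bsub>N\<^esub>k\<in>I. \<rho> (r \<otimes>\<^bsub>R\<^esub> t) i k \<odot>\<^bsub>N\<^esub> n k)"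
    if i: "i \<in> I" for i
  proof -
    have "(\<Oplus>\<^bsub>N\<^esub>j\<in>I. \<rho> r i j \<odot>\<^bsub>N\<^esub> act N t n j)
        = (\<Oplus>\<^bsub>N\<^esub>j\<in>I. \<rho> r i j \<odot>\<^bsub>N\<^esub> (\<Oplus>\<^bsub>N\<^esub>k\<in>I. \<rho> t j k \<odot>\<^bsub>N\<^esub> n k))"
      using i assms c rho_closed
      by (intro N.M.finsum_cong') (auto simp: act_def intro!: N.smult_closed N.M.finsum_closed)
    also have "\<dots> = (\<Oplus>\<^bsub>N\<^esub>k\<in>I. (\<Oplus>\<^bsub>S\<^esub>j\<in>I. \<rho> r i j \<otimes>\<^bsub>S\<^esub> \<rho> t j k) \<odot>\<^bsub>N\<^esub> n k)"
      using i assms c rho_closed finite_I by (intro N.matrix_action_assoc) auto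
    also have "\<dots> = (\<Oplus>\<^bsub>N\<^esub>k\<in>I. \<rho> (r \<otimes>\<^bsub>R\<^esub> t) i k \<odot>\<^bsub>N\<^esub> n k)"
      using i assms c rho_closed
      by (intro N.M.finsum_cong') (auto simp: rho_mult intro!: N.smult_closed)
    finally show ?thesis .
  qed
  thus ?thesis by (simp add: act_def[of N r] act_def[of N "r \<otimes>\<^bsub>R\<^esub> t"] cong: restrict_cong)
qed

lemma act_add_left:
  assumes "r \<in> carrier R" "t \<in> carrier R" "n \<in> I \<rightarrow>\<^sub>E carrier N"
  shows "act N (r \<oplus>\<^bsub>R\<^esub> t) n = (\<lambda>i\<in>I. act N r n i \<oplus>\<^bsub>N\<^esub> act N t n i)"
proof
  have c: "n j \<in> carrier N" if "j \<in> I" for j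
    using that assms by auto
  fix i
  have "(\<Oplus>\<^bsub>N\<^esub>j\<in>I. \<rho> (r \<oplus>\<^bsub>R\<^esub> t) i j \<odot>\<^bsub>N\<^esub> n j)
      = (\<Oplus>\<^bsub>N\<^esub>j\<in>I. \<rho> r i j \<odot>\<^bsub>N\<^esub> n j \<oplus>\<^bsub>N\<^esub> \<rho> t i j \<odot>\<^bsub>N\<^esub> n j)" if "i \<in> I"
    using that assms c rho_closed
    by (intro N.M.finsum_cong') (auto simp: rho_add N.smult_l_distr intro!: N.M.a_closed N.smult_closed)
  also have "\<dots> = (\<Oplus>\<^bsub>N\<^esub>j\<in>I. \<rho> r i j \<odot>\<^bsub>N\<^esub> n j) \<oplus>\<^bsub>N\<^esub> (\<Oplus>\<^bsub>N\<^esub>j\<in>I. \<rho> t i j \<odot>\<^bsub>N\<^esub> n j)" if "i \<in> I"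
    using that assms c rho_closed by (intro N.M.finsum_addf) (auto intro!: N.smult_closed)
  finally show "act N (r \<oplus>\<^bsub>R\<^esub> t) n i = (\<lambda>i\<in>I. act N r n i \<oplus>\<^bsub>N\<^esub> act N t n i) i"
    by (simp add: act_def)
qed

lemma act_add_right:
  assumes "r \<in> carrier R" "n \<in> I \<rightarrow>\<^sub>E carrier N" "p \<in> I \<rightarrow>\<^sub>E carrier N"
  shows "act N r (\<lambda>i\<in>I. n i \<oplus>\<^bsub>N\<^esub> p i) = (\<lambda>i\<in>I. act N r n i \<oplus>\<^bsub>N\<^esub> act N r p i)"
proof
  have c: "n j \<in> carrier N" "p j \<in> carrier N" if "j \<in> I" for j
    using that assms by auto
  fix i
  have "(\<Oplus>\<^bsub>N\<^esub>j\<in>I. \<rho> r i j \<odot>\<^bsub>N\<^esub> (\<lambda>i\<in>I. n i \<oplus>\<^bsub>N\<^esub> p i) j)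
      = (\<Oplus>\<^bsub>N\<^esub>j\<in>I. \<rho> r i j \<odot>\<^bsub>N\<^esub> n j \<oplus>\<^bsub>N\<^esub> \<rho> r i j \<odot>\<^bsub>N\<^esub> p j)" if "i \<in> I"
    using that assms c rho_closed
    by (intro N.M.finsum_cong') (auto simp: N.smult_r_distr intro!: N.M.a_closed N.smult_closed)
  also have "\<dots> = (\<Oplus>\<^bsub>N\<^esub>j\<in>I. \<rho> r i j \<odot>\<^bsub>N\<^esub> n j) \<oplus>\<^bsub>N\<^esub> (\<Oplus>\<^bsub>N\<^esub>j\<in>I. \<rho> r i j \<odot>\<^bsub>N\<^esub> p j)" if "i \<in> I"
    using that assms c rho_closed by (intro N.M.finsum_addf) (auto intro!: N.smult_closed)
  finally show "act N r (\<lambda>i\<in>I. n i \<oplus>\<^bsub>N\<^esub> p i) i = (\<lambda>i\<in>I. act N r n i \<oplus>\<^bsub>N\<^esub> act N r p i) i"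
    by (simp add: act_def)
qed

lemma act_tuples:
  assumes "r \<in> carrier R" "n \<in> I \<rightarrow>\<^sub>E carrier N"
  shows "act N r n \<in> tuples N"
  using assms act_closed act_mult[of "\<one>\<^bsub>R\<^esub>" r n] by (simp add: tuples_def)

lemma tuplesD: "n \<in> tuples N \<Longrightarrow> n \<in> I \<rightarrow>\<^sub>E carrier N" "n \<in> tuples N \<Longrightarrow> act N \<one>\<^bsub>R\<^esub> n = n"
  "n \<in> tuples N \<Longrightarrow> i \<in> I \<Longrightarrow> n i \<in> carrier N"
  by (auto simp: tuples_def)

lemma dec_emb_tuples: "n \<in> tuples N \<Longrightarrow> dec (emb n) = n"
  using dec_emb tuplesD(1) by blast

lemma tuples_add:
  assumes "n \<in> tuples N" "p \<in> tuples N"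
  shows "(\<lambda>i\<in>I. n i \<oplus>\<^bsub>N\<^esub> p i) \<in> tuples N"
  using tuplesD[OF assms(1)] tuplesD[OF assms(2)] by (auto simp: tuples_def act_add_right)

lemma act_zero_right: "r \<in> carrier R \<Longrightarrow> act N r (\<lambda>i\<in>I. \<zero>\<^bsub>N\<^esub>) = (\<lambda>i\<in>I. \<zero>\<^bsub>N\<^esub>)"
  unfolding act_def using rho_closed
  by (intro restrict_ext N.M.add.finprod_one_eqI) (auto simp: N.smult_zero_right)

lemma act_zero_left:
  assumes "n \<in> I \<rightarrow>\<^sub>E carrier N"
  shows "act N \<zero>\<^bsub>R\<^esub> n = (\<lambda>i\<in>I. \<zero>\<^bsub>N\<^esub>)"
proof
  fix i
  show "act N \<zero>\<^bsub>R\<^esub> n i = (\<lambda>i\<in>I. \<zero>\<^bsub>N\<^esub>) i"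
    using fun_cong[OF act_add_left[OF R.zero_closed R.zero_closed assms], of i]
      act_closed[OF R.zero_closed assms] N.M.add.l_cancel_one'[of "act N \<zero>\<^bsub>R\<^esub> n i" "act N \<zero>\<^bsub>R\<^esub> n i"]
    by (cases "i \<in> I") (auto simp: act_def)
qed

lemma Go_module: "left_module R (Go N)"
proof (intro left_module.intro left_module_axioms.intro abelian_groupI)
  fix x assume x: "x \<in> carrier (Go N)"
  then obtain n where n: "n \<in> tuples N" "x = emb n" by (auto simp: Go_sel)
  let ?y = "emb (act N (\<ominus>\<^bsub>R\<^esub> \<one>\<^bsub>R\<^esub>) n)"
  have t: "act N (\<ominus>\<^bsub>R\<^esub> \<one>\<^bsub>R\<^esub>) n \<in> tuples N"
    using n by (intro act_tuples tuplesD) auto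
  have "(\<lambda>i\<in>I. act N (\<ominus>\<^bsub>R\<^esub> \<one>\<^bsub>R\<^esub>) n i \<oplus>\<^bsub>N\<^esub> n i) = act N (\<ominus>\<^bsub>R\<^esub> \<one>\<^bsub>R\<^esub> \<oplus>\<^bsub>R\<^esub> \<one>\<^bsub>R\<^esub>) n"
    using n tuplesD[of n] by (subst act_add_left) auto
  also have "\<dots> = (\<lambda>i\<in>I. \<zero>\<^bsub>N\<^esub>)"
    using n tuplesD(1) by (simp add: R.l_neg act_zero_left)
  finally have "?y \<oplus>\<^bsub>Go N\<^esub> x = \<zero>\<^bsub>Go N\<^esub>"
    using n t by (simp add: Go_sel dec_emb_tuples)
  thus "\<exists>y\<in>carrier (Go N). y \<oplus>\<^bsub>Go N\<^esub> x = \<zero>\<^bsub>Go N\<^esub>"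
    using t by (auto simp: Go_sel(1))
next
  show "\<zero>\<^bsub>Go N\<^esub> \<in> carrier (Go N)"
    using act_zero_right[of "\<one>\<^bsub>R\<^esub>"] by (auto simp: Go_sel tuples_def)
next
  fix x y assume "x \<in> carrier (Go N)" "y \<in> carrier (Go N)"
  thus "x \<oplus>\<^bsub>Go N\<^esub> y \<in> carrier (Go N)" "x \<oplus>\<^bsub>Go N\<^esub> y = y \<oplus>\<^bsub>Go N\<^esub> x"
    using tuples_add by (auto simp: Go_sel dec_emb_tuples tuplesD N.M.a_comm cong: restrict_cong)
next
  fix x y z assume "x \<in> carrier (Go N)" "y \<in> carrier (Go N)" "z \<in> carrier (Go N)"
  thus "x \<oplus>\<^bsub>Go N\<^esub> y \<oplus>\<^bsub>Go N\<^esub> z = x \<oplus>\<^bsub>Go N\<^esub> (y \<oplus>\<^bsub>Go N\<^esub> z)"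
    using tuples_add
    by (auto simp: Go_sel dec_emb_tuples tuplesD N.M.a_assoc cong: restrict_cong)
next
  fix x assume "x \<in> carrier (Go N)"
  then obtain n where n: "n \<in> tuples N" "x = emb n" by (auto simp: Go_sel)
  have z: "(\<lambda>i\<in>I. \<zero>\<^bsub>N\<^esub>) \<in> tuples N"
    using act_zero_right[of "\<one>\<^bsub>R\<^esub>"] by (auto simp: tuples_def)
  have "(\<lambda>i\<in>I. \<zero>\<^bsub>N\<^esub> \<oplus>\<^bsub>N\<^esub> n i) = n"
    using tuplesD(1,3)[OF n(1)] by (auto simp: fun_eq_iff PiE_def extensional_def)
  thus "\<zero>\<^bsub>Go N\<^esub> \<oplus>\<^bsub>Go N\<^esub> x = x"
    using n z by (simp add: Go_sel dec_emb_tuples cong: restrict_cong)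
  show "\<one>\<^bsub>R\<^esub> \<odot>\<^bsub>Go N\<^esub> x = x"
    using n by (simp add: Go_sel dec_emb_tuples tuplesD)
next
  fix r x assume "r \<in> carrier R" "x \<in> carrier (Go N)"
  thus "r \<odot>\<^bsub>Go N\<^esub> x \<in> carrier (Go N)"
    by (auto simp: Go_sel dec_emb_tuples act_tuples tuplesD)
next
  fix r t x assume "r \<in> carrier R" "t \<in> carrier R" "x \<in> carrier (Go N)"
  thus "(r \<oplus>\<^bsub>R\<^esub> t) \<odot>\<^bsub>Go N\<^esub> x = r \<odot>\<^bsub>Go N\<^esub> x \<oplus>\<^bsub>Go N\<^esub> t \<odot>\<^bsub>Go N\<^esub> x"
    "(r \<otimes>\<^bsub>R\<^esub> t) \<odot>\<^bsub>Go N\<^esub> x = r \<odot>\<^bsub>Go N\<^esub> (t \<odot>\<^bsub>Go N\<^esub> x)"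
    by (auto simp: Go_sel dec_emb_tuples act_tuples tuplesD act_mult act_add_left)
next
  fix r x y assume "r \<in> carrier R" "x \<in> carrier (Go N)" "y \<in> carrier (Go N)"
  thus "r \<odot>\<^bsub>Go N\<^esub> (x \<oplus>\<^bsub>Go N\<^esub> y) = r \<odot>\<^bsub>Go N\<^esub> x \<oplus>\<^bsub>Go N\<^esub> r \<odot>\<^bsub>Go N\<^esub> y"
    by (auto simp: Go_sel dec_emb_tuples act_tuples tuplesD tuples_add act_add_right)
qed (rule R.ring_axioms)

end

lemma act_hom:
  assumes "left_module S N" "left_module S P" "f \<in> module_homs S N P" "r \<in> carrier R"
    and n: "n \<in> I \<rightarrow>\<^sub>E carrier N"
  shows "act P r (\<lambda>i\<in>I. f (n i)) = (\<lambda>i\<in>I. f (act N r n i))"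
proof -
  interpret N: left_module S N by fact
  interpret P: left_module S P by fact
  have c: "n i \<in> carrier N" if "i \<in> I" for i using n that by auto
  have "(\<Oplus>\<^bsub>P\<^esub>j\<in>I. \<rho> r i j \<odot>\<^bsub>P\<^esub> f (n j)) = f (\<Oplus>\<^bsub>N\<^esub>j\<in>I. \<rho> r i j \<odot>\<^bsub>N\<^esub> n j)" if "i \<in> I" for i
  proof -
    have "f (\<Oplus>\<^bsub>N\<^esub>j\<in>I. \<rho> r i j \<odot>\<^bsub>N\<^esub> n j) = (\<Oplus>\<^bsub>P\<^esub>j\<in>I. f (\<rho> r i j \<odot>\<^bsub>N\<^esub> n j))"
      using that c assms(4) rho_closed finite_I
      by (intro module_homs_finsum[OF assms(1-3)]) (auto intro!: N.smult_closed)
    also have "\<dots> = (\<Oplus>\<^bsub>P\<^esub>j\<in>I. \<rho> r i j \<odot>\<^bsub>P\<^esub> f (n j))"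
      using that c assms(4) rho_closed module_homsD[OF assms(3)]
      by (intro P.M.finsum_cong') (auto intro!: P.smult_closed)
    finally show ?thesis ..
  qed
  moreover have "(\<Oplus>\<^bsub>P\<^esub>j\<in>I. \<rho> r i j \<odot>\<^bsub>P\<^esub> (\<lambda>i\<in>I. f (n i)) j) = (\<Oplus>\<^bsub>P\<^esub>j\<in>I. \<rho> r i j \<odot>\<^bsub>P\<^esub> f (n j))"
    if "i \<in> I" for i
    using that c assms(4) rho_closed module_homsD[OF assms(3)]
    by (intro P.M.finsum_cong') (auto intro!: P.smult_closed)
  ultimately show ?thesis
    by (auto simp: act_def fun_eq_iff)
qed

lemma map_tuples:
  assumes "left_module S N" "left_module S P" "f \<in> module_homs S N P" "n \<in> tuples N"
  shows "(\<lambda>i\<in>I. f (n i)) \<in> tuples P"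
  using act_hom[OF assms(1-3) R.one_closed tuplesD(1)[OF assms(1,4)]] tuplesD[OF assms(1,4)]
    module_homsD(2)[OF assms(3)]
  by (simp add: tuples_def)

lemma Gm_emb: "left_module S N \<Longrightarrow> n \<in> tuples N \<Longrightarrow> Gm N P f (emb n) = emb (\<lambda>i\<in>I. f (n i))"
  by (simp add: Gm_def Go_sel dec_emb_tuples)

lemma Gm_hom:
  assumes "left_module S N" "left_module S P" "f \<in> module_homs S N P"
  shows "Gm N P f \<in> module_homs R (Go N) (Go P)"
proof -
  interpret N: left_module S N by fact
  note G = Gm_emb[OF assms(1)] and m = map_tuples[OF assms]
    and d = dec_emb_tuples[OF assms(1)] dec_emb_tuples[OF assms(2)]
    and t = tuplesD[OF assms(1)]
  show ?thesis
    unfolding module_homs_def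
  proof (intro CollectI conjI ballI)
    show "Gm N P f \<in> carrier (Go N) \<rightarrow>\<^sub>E carrier (Go P)"
    proof (intro PiE_I)
      fix x assume "x \<in> carrier (Go N)"
      thus "Gm N P f x \<in> carrier (Go P)" using G m by (auto simp: Go_sel)
    qed (simp add: Gm_def)
    fix x y assume "x \<in> carrier (Go N)" "y \<in> carrier (Go N)"
    then obtain n p where n: "n \<in> tuples N" "x = emb n" and p: "p \<in> tuples N" "y = emb p"
      by (auto simp: Go_sel)
    have "(\<lambda>i\<in>I. f ((\<lambda>i\<in>I. n i \<oplus>\<^bsub>N\<^esub> p i) i)) = (\<lambda>i\<in>I. f (n i) \<oplus>\<^bsub>P\<^esub> f (p i))"
      using n p t module_homsD(3)[OF assms(3)] by (auto simp: fun_eq_iff)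
    thus "Gm N P f (x \<oplus>\<^bsub>Go N\<^esub> y) = Gm N P f x \<oplus>\<^bsub>Go P\<^esub> Gm N P f y"
      using n p by (simp add: G Go_sel d m tuples_add[OF assms(1)] cong: restrict_cong)
  next
    fix r x assume r: "r \<in> carrier R" and "x \<in> carrier (Go N)"
    then obtain n where n: "n \<in> tuples N" "x = emb n"
      by (auto simp: Go_sel)
    show "Gm N P f (r \<odot>\<^bsub>Go N\<^esub> x) = r \<odot>\<^bsub>Go P\<^esub> Gm N P f x"
      using n r act_hom[OF assms r t(1)[OF n(1)]]
      by (simp add: G Go_sel d m act_tuples[OF assms(1)] t)
  qed
qed

text \<open>The element \<open>c \<cdot> 1\<close> is central, so its matrix is \<open>c\<close>
  times the matrix of \<open>1\<close>, and the latter fixes the tuple.\<close>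

lemma scalar_act:
  assumes "left_module S N" "c \<in> carrier K" "n \<in> tuples N"
  shows "act N (c \<odot>\<^bsub>R\<^esub> \<one>\<^bsub>R\<^esub>) n = (\<lambda>i\<in>I. (c \<odot>\<^bsub>S\<^esub> \<one>\<^bsub>S\<^esub>) \<odot>\<^bsub>N\<^esub> n i)"
proof -
  interpret N: left_module S N by fact
  note c = scalar_closed[OF assms(2)]
  note n = tuplesD[OF assms(1,3)]
  have r: "\<rho> (c \<odot>\<^bsub>R\<^esub> \<one>\<^bsub>R\<^esub>) i j = (c \<odot>\<^bsub>S\<^esub> \<one>\<^bsub>S\<^esub>) \<otimes>\<^bsub>S\<^esub> \<rho> \<one>\<^bsub>R\<^esub> i j" if ij: "i \<in> I" "j \<in> I" for i j
  proof (rule psi_eqD)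
    have "\<psi> ((c \<odot>\<^bsub>S\<^esub> \<one>\<^bsub>S\<^esub>) \<otimes>\<^bsub>S\<^esub> \<rho> \<one>\<^bsub>R\<^esub> i j)
        = (c \<odot>\<^bsub>R\<^esub> \<one>\<^bsub>R\<^esub>) \<otimes>\<^bsub>R\<^esub> ((e \<otimes>\<^bsub>R\<^esub> v i) \<otimes>\<^bsub>R\<^esub> (u j \<otimes>\<^bsub>R\<^esub> e))"
      using ij c u_closed v_closed e_closed assms(2)
      by (simp add: psi_mult rho_closed psi_rho psi_scalar R.m_assoc eex)
    also have "\<dots> = ((c \<odot>\<^bsub>R\<^esub> \<one>\<^bsub>R\<^esub>) \<otimes>\<^bsub>R\<^esub> (e \<otimes>\<^bsub>R\<^esub> v i)) \<otimes>\<^bsub>R\<^esub> (u j \<otimes>\<^bsub>R\<^esub> e)"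
      using ij c u_closed v_closed e_closed by (simp add: R.m_assoc)
    also have "(c \<odot>\<^bsub>R\<^esub> \<one>\<^bsub>R\<^esub>) \<otimes>\<^bsub>R\<^esub> (e \<otimes>\<^bsub>R\<^esub> v i) = (e \<otimes>\<^bsub>R\<^esub> v i) \<otimes>\<^bsub>R\<^esub> (c \<odot>\<^bsub>R\<^esub> \<one>\<^bsub>R\<^esub>)"
      using ij v_closed e_closed assms(2) by (intro scalar_central) auto
    finally show "\<psi> (\<rho> (c \<odot>\<^bsub>R\<^esub> \<one>\<^bsub>R\<^esub>) i j) = \<psi> ((c \<odot>\<^bsub>S\<^esub> \<one>\<^bsub>S\<^esub>) \<otimes>\<^bsub>S\<^esub> \<rho> \<one>\<^bsub>R\<^esub> i j)"
      using ij c u_closed v_closed e_closed by (simp add: psi_rho R.m_assoc)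
  qed (use ij c rho_closed in auto)
  have "(\<Oplus>\<^bsub>N\<^esub>j\<in>I. \<rho> (c \<odot>\<^bsub>R\<^esub> \<one>\<^bsub>R\<^esub>) i j \<odot>\<^bsub>N\<^esub> n j) = (c \<odot>\<^bsub>S\<^esub> \<one>\<^bsub>S\<^esub>) \<odot>\<^bsub>N\<^esub> n i" if i: "i \<in> I" for i
  proof -
    have "(\<Oplus>\<^bsub>N\<^esub>j\<in>I. \<rho> (c \<odot>\<^bsub>R\<^esub> \<one>\<^bsub>R\<^esub>) i j \<odot>\<^bsub>N\<^esub> n j)
        = (\<Oplus>\<^bsub>N\<^esub>j\<in>I. (c \<odot>\<^bsub>S\<^esub> \<one>\<^bsub>S\<^esub>) \<odot>\<^bsub>N\<^esub> (\<rho> \<one>\<^bsub>R\<^esub> i j \<odot>\<^bsub>N\<^esub> n j))"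
      using i c n rho_closed
      by (intro N.M.finsum_cong') (auto simp: r N.smult_assoc intro!: N.smult_closed)
    also have "\<dots> = (c \<odot>\<^bsub>S\<^esub> \<one>\<^bsub>S\<^esub>) \<odot>\<^bsub>N\<^esub> (\<Oplus>\<^bsub>N\<^esub>j\<in>I. \<rho> \<one>\<^bsub>R\<^esub> i j \<odot>\<^bsub>N\<^esub> n j)"
      using i c n rho_closed finite_I by (intro N.smult_finsum_right[symmetric]) (auto intro!: N.smult_closed)
    also have "(\<Oplus>\<^bsub>N\<^esub>j\<in>I. \<rho> \<one>\<^bsub>R\<^esub> i j \<odot>\<^bsub>N\<^esub> n j) = n i"
      using fun_cong[OF n(2), of i] i by (simp add: act_def)
    finally show ?thesis .
  qed
  thus ?thesis by (simp add: act_def cong: restrict_cong)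
qed

lemma Go_linear: "linear_functor K S R Go Gm"
  unfolding linear_functor_def
proof (intro conjI ballI)
  fix M :: "('s, 'u) module" assume "M \<in> left_modules S"
  thus "Go M \<in> left_modules R" by (simp add: left_modules_def Go_module)
next
  fix M N :: "('s, 'u) module" and f
  assume "M \<in> left_modules S" "N \<in> left_modules S" "f \<in> module_homs S M N"
  thus "Gm M N f \<in> module_homs R (Go M) (Go N)" by (simp add: left_modules_def Gm_hom)
next
  fix M :: "('s, 'u) module" assume "M \<in> left_modules S"
  hence M: "left_module S M" by (rule left_modulesD)
  have "(\<lambda>i\<in>I. if n i \<in> carrier M then n i else undefined) = n" if "n \<in> tuples M" for n
    using tuplesD[OF M that] by (auto simp: fun_eq_iff PiE_def extensional_def)
  thus "Gm M M (\<lambda>x\<in>carrier M. x) = (\<lambda>x\<in>carrier (Go M). x)"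
    by (auto simp: Gm_def fun_eq_iff Go_sel dec_emb_tuples[OF M] restrict_def)
next
  fix L M N :: "('s, 'u) module" and f h
  assume LMN: "L \<in> left_modules S" "M \<in> left_modules S" "N \<in> left_modules S"
    and f: "f \<in> module_homs S L M" and h: "h \<in> module_homs S M N"
  note L = left_modulesD[OF LMN(1)] and M = left_modulesD[OF LMN(2)]
  have eq: "(\<lambda>i\<in>I. compose (carrier L) h f (n i)) = (\<lambda>i\<in>I. h ((\<lambda>i\<in>I. f (n i)) i))"
    if "n \<in> tuples L" for n
    using tuplesD[OF L that] by (auto simp: fun_eq_iff compose_eq)
  show "Gm L N (compose (carrier L) h f) = compose (carrier (Go L)) (Gm M N h) (Gm L M f)"
  proof
    fix x show "Gm L N (compose (carrier L) h f) x = compose (carrier (Go L)) (Gm M N h) (Gm L M f) x"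
    proof (cases "x \<in> carrier (Go L)")
      case True
      then obtain n where n: "n \<in> tuples L" "x = emb n" by (auto simp: Go_sel)
      show ?thesis
        using True n(1) map_tuples[OF L M f n(1)]
        unfolding n(2) by (simp add: compose_eq Gm_emb[OF L] Gm_emb[OF M] eq)
    qed (simp add: Gm_def compose_def)
  qed
next
  fix M N :: "('s, 'u) module" and f h
  assume MN: "M \<in> left_modules S" "N \<in> left_modules S"
    and f: "f \<in> module_homs S M N" and h: "h \<in> module_homs S M N"
  note M = left_modulesD[OF MN(1)] and N = left_modulesD[OF MN(2)]
  show "Gm M N (hom_add M N f h) = hom_add (Go M) (Go N) (Gm M N f) (Gm M N h)"
  proof
    fix x show "Gm M N (hom_add M N f h) x = hom_add (Go M) (Go N) (Gm M N f) (Gm M N h) x"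
    proof (cases "x \<in> carrier (Go M)")
      case True
      then obtain n where n: "n \<in> tuples M" "x = emb n" by (auto simp: Go_sel)
      have "(\<lambda>i\<in>I. hom_add M N f h (n i)) = (\<lambda>i\<in>I. (\<lambda>i\<in>I. f (n i)) i \<oplus>\<^bsub>N\<^esub> (\<lambda>i\<in>I. h (n i)) i)"
        using tuplesD[OF M n(1)] by (auto simp: fun_eq_iff hom_add_def)
      thus ?thesis
        using True n(1) map_tuples[OF M N f n(1)] map_tuples[OF M N h n(1)]
        unfolding n(2) by (simp add: hom_add_def[of "Go M"] Gm_emb[OF M] Go_sel(3) dec_emb_tuples[OF N])
    qed (simp add: Gm_def hom_add_def)
  qed
next
  fix M N :: "('s, 'u) module" and f c
  assume MN: "M \<in> left_modules S" "N \<in> left_modules S" and c: "c \<in> carrier K"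
    and f: "f \<in> module_homs S M N"
  note M = left_modulesD[OF MN(1)] and N = left_modulesD[OF MN(2)]
  show "Gm M N (hom_smult S M N c f) = hom_smult R (Go M) (Go N) c (Gm M N f)"
  proof
    fix x show "Gm M N (hom_smult S M N c f) x = hom_smult R (Go M) (Go N) c (Gm M N f) x"
    proof (cases "x \<in> carrier (Go M)")
      case True
      then obtain n where n: "n \<in> tuples M" "x = emb n" by (auto simp: Go_sel)
      have "(\<lambda>i\<in>I. hom_smult S M N c f (n i)) = (\<lambda>i\<in>I. (c \<odot>\<^bsub>S\<^esub> \<one>\<^bsub>S\<^esub>) \<odot>\<^bsub>N\<^esub> (\<lambda>i\<in>I. f (n i)) i)"
        using tuplesD[OF M n(1)] by (auto simp: fun_eq_iff hom_smult_def)
      thus ?thesis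
        using True n(1) map_tuples[OF M N f n(1)] scalar_act[OF N c map_tuples[OF M N f n(1)]]
        unfolding n(2)
        by (simp add: hom_smult_def[of R "Go M"] Gm_emb[OF M] Go_sel(4) dec_emb_tuples[OF N])
    qed (simp add: Gm_def hom_smult_def)
  qed
qed

lemma eta_hom:
  assumes "left_module R M"
  shows "\<eta> M \<in> module_homs R (Go (Fo M)) M"
proof -
  interpret M: left_module R M by fact
  note F = Fo_module[OF assms]
  interpret F: left_module S "Fo M" by (rule F)
  interpret G: left_module R "Go (Fo M)" by (rule Go_module[OF F])
  note t = tuplesD[OF F] and d = dec_emb_tuples[OF F]
  have cl: "n i \<in> carrier M" if "n \<in> tuples (Fo M)" "i \<in> I" for n i
    using t(3)[OF that] by (simp add: Fo_sel)
  have eta: "\<eta> M (emb n) = (\<Oplus>\<^bsub>M\<^esub>i\<in>I. u i \<odot>\<^bsub>M\<^esub> n i)" if "n \<in> tuples (Fo M)" for n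
    using that by (simp add: \<eta>_def Go_sel d)
  show ?thesis
    unfolding module_homs_def
  proof (intro CollectI conjI ballI)
    show "\<eta> M \<in> carrier (Go (Fo M)) \<rightarrow>\<^sub>E carrier M"
    proof (intro PiE_I)
      fix x assume "x \<in> carrier (Go (Fo M))"
      thus "\<eta> M x \<in> carrier M"
        using cl u_closed by (auto simp: Go_sel eta intro!: M.M.finsum_closed M.smult_closed)
    qed (simp add: \<eta>_def)
    fix x y assume "x \<in> carrier (Go (Fo M))" "y \<in> carrier (Go (Fo M))"
    then obtain n p where n: "n \<in> tuples (Fo M)" "x = emb n" and p: "p \<in> tuples (Fo M)" "y = emb p"
      by (auto simp: Go_sel)
    have "(\<Oplus>\<^bsub>M\<^esub>i\<in>I. u i \<odot>\<^bsub>M\<^esub> (\<lambda>i\<in>I. n i \<oplus>\<^bsub>M\<^esub> p i) i)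
        = (\<Oplus>\<^bsub>M\<^esub>i\<in>I. u i \<odot>\<^bsub>M\<^esub> n i \<oplus>\<^bsub>M\<^esub> u i \<odot>\<^bsub>M\<^esub> p i)"
      using cl[OF n(1)] cl[OF p(1)] u_closed
      by (intro M.M.finsum_cong') (auto simp: M.smult_r_distr intro!: M.M.a_closed M.smult_closed)
    also have "\<dots> = (\<Oplus>\<^bsub>M\<^esub>i\<in>I. u i \<odot>\<^bsub>M\<^esub> n i) \<oplus>\<^bsub>M\<^esub> (\<Oplus>\<^bsub>M\<^esub>i\<in>I. u i \<odot>\<^bsub>M\<^esub> p i)"
      using cl[OF n(1)] cl[OF p(1)] u_closed by (intro M.M.finsum_addf) (auto intro!: M.smult_closed)
    finally show "\<eta> M (x \<oplus>\<^bsub>Go (Fo M)\<^esub> y) = \<eta> M x \<oplus>\<^bsub>M\<^esub> \<eta> M y"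
      using n p tuples_add[OF F n(1) p(1)] by (simp add: eta Go_sel d Fo_sel(3))
  next
    fix r x assume r: "r \<in> carrier R" and "x \<in> carrier (Go (Fo M))"
    then obtain n where n: "n \<in> tuples (Fo M)" "x = emb n"
      by (auto simp: Go_sel)
    let ?b = "\<lambda>i j. e \<otimes>\<^bsub>R\<^esub> (v i \<otimes>\<^bsub>R\<^esub> (r \<otimes>\<^bsub>R\<^esub> (u j \<otimes>\<^bsub>R\<^esub> e)))"
    have b: "?b i j \<in> carrier R" if "i \<in> I" "j \<in> I" for i j
      using that r u_closed v_closed e_closed by auto
    have c: "n j \<in> carrier (Fo M)" if "j \<in> I" for j
      using t(3)[OF n(1) that] .
    have "act (Fo M) r n i = (\<Oplus>\<^bsub>M\<^esub>j\<in>I. ?b i j \<odot>\<^bsub>M\<^esub> n j)" if i: "i \<in> I" for i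
    proof -
      have "act (Fo M) r n i = (\<Oplus>\<^bsub>Fo M\<^esub>j\<in>I. \<rho> r i j \<odot>\<^bsub>Fo M\<^esub> n j)"
        using i by (simp add: act_def)
      also have "\<dots> = (\<Oplus>\<^bsub>M\<^esub>j\<in>I. \<rho> r i j \<odot>\<^bsub>Fo M\<^esub> n j)"
        using i r c rho_closed finite_I
        by (intro finsum_Fo[OF assms]) (auto intro!: F.smult_closed)
      also have "\<dots> = (\<Oplus>\<^bsub>M\<^esub>j\<in>I. ?b i j \<odot>\<^bsub>M\<^esub> n j)"
        using i r cl[OF n(1)] b
        by (intro M.M.finsum_cong') (auto simp: Fo_sel(4) psi_rho intro!: M.smult_closed)
      finally show ?thesis .
    qed
    hence "\<eta> M (r \<odot>\<^bsub>Go (Fo M)\<^esub> x) = (\<Oplus>\<^bsub>M\<^esub>i\<in>I. u i \<odot>\<^bsub>M\<^esub> (\<Oplus>\<^bsub>M\<^esub>j\<in>I. ?b i j \<odot>\<^bsub>M\<^esub> n j))"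
      using n act_tuples[OF F r t(1)[OF n(1)]] cl[OF n(1)] b u_closed
      by (simp add: Go_sel d eta) (intro M.M.finsum_cong', auto intro!: M.smult_closed M.M.finsum_closed)
    also have "\<dots> = (\<Oplus>\<^bsub>M\<^esub>j\<in>I. (\<Oplus>\<^bsub>R\<^esub>i\<in>I. u i \<otimes>\<^bsub>R\<^esub> ?b i j) \<odot>\<^bsub>M\<^esub> n j)"
      using cl[OF n(1)] b u_closed finite_I by (intro M.matrix_action_assoc) auto
    also have "\<dots> = (\<Oplus>\<^bsub>M\<^esub>j\<in>I. r \<odot>\<^bsub>M\<^esub> (u j \<odot>\<^bsub>M\<^esub> n j))"
    proof (rule M.M.finsum_cong', goal_cases)
      case (3 j)
      have "(\<Oplus>\<^bsub>R\<^esub>i\<in>I. u i \<otimes>\<^bsub>R\<^esub> ?b i j) = (\<Oplus>\<^bsub>R\<^esub>i\<in>I. \<one>\<^bsub>R\<^esub> \<otimes>\<^bsub>R\<^esub> (u i \<otimes>\<^bsub>R\<^esub> ?b i j))"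
        using b 3 u_closed by (intro R.finsum_cong') auto
      also have "\<dots> = r \<otimes>\<^bsub>R\<^esub> (u j \<otimes>\<^bsub>R\<^esub> e)"
        using 3 r u_closed e_closed by (subst resolution) auto
      finally show ?case
        using c[OF 3] 3 r u_closed e_closed by (simp add: M.smult_assoc Fo_sel)
    qed (use cl[OF n(1)] r u_closed in \<open>auto intro!: M.smult_closed\<close>)
    also have "\<dots> = r \<odot>\<^bsub>M\<^esub> \<eta> M x"
      using cl[OF n(1)] r u_closed n finite_I
      by (simp add: eta M.smult_finsum_right Pi_iff M.smult_closed)
    finally show "\<eta> M (r \<odot>\<^bsub>Go (Fo M)\<^esub> x) = r \<odot>\<^bsub>M\<^esub> \<eta> M x" .
  qed
qed

text \<open>The tuple \<open>(e v\<^sub>i e y)\<^sub>i\<close> represents \<open>e \<otimes>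
  y\<close>, and the identity computes \<open>r (e \<otimes> y) = r e \<otimes> y\<close>. For
  \<open>r = 1\<close> it shows that the tuple lies in the image of the idempotent matrix, for
  \<open>r = e\<close> that \<open>e\<close> fixes it.\<close>

lemma act_resolution:
  assumes "left_module S N" "r \<in> carrier R" "y \<in> carrier N"
  shows "act N r (\<lambda>i\<in>I. \<tau> (v i) \<odot>\<^bsub>N\<^esub> y) = (\<lambda>i\<in>I. \<tau> (v i \<otimes>\<^bsub>R\<^esub> r) \<odot>\<^bsub>N\<^esub> y)"
proof -
  interpret N: left_module S N by fact
  have "(\<Oplus>\<^bsub>N\<^esub>j\<in>I. \<rho> r i j \<odot>\<^bsub>N\<^esub> (\<lambda>i\<in>I. \<tau> (v i) \<odot>\<^bsub>N\<^esub> y) j) = \<tau> (v i \<otimes>\<^bsub>R\<^esub> r) \<odot>\<^bsub>N\<^esub> y"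
    if i: "i \<in> I" for i
  proof -
    have "(\<Oplus>\<^bsub>N\<^esub>j\<in>I. \<rho> r i j \<odot>\<^bsub>N\<^esub> (\<lambda>i\<in>I. \<tau> (v i) \<odot>\<^bsub>N\<^esub> y) j)
        = (\<Oplus>\<^bsub>N\<^esub>j\<in>I. (\<rho> r i j \<otimes>\<^bsub>S\<^esub> \<tau> (v j)) \<odot>\<^bsub>N\<^esub> y)"
      using i assms rho_closed v_closed tau_closed
      by (intro N.M.finsum_cong') (auto simp: N.smult_assoc intro!: N.smult_closed)
    also have "\<dots> = (\<Oplus>\<^bsub>S\<^esub>j\<in>I. \<rho> r i j \<otimes>\<^bsub>S\<^esub> \<tau> (v j)) \<odot>\<^bsub>N\<^esub> y"
      using i assms rho_closed v_closed tau_closed finite_I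
      by (intro N.smult_finsum_left[symmetric]) auto
    also have "(\<Oplus>\<^bsub>S\<^esub>j\<in>I. \<rho> r i j \<otimes>\<^bsub>S\<^esub> \<tau> (v j)) = \<tau> (v i \<otimes>\<^bsub>R\<^esub> r)"
      using i assms u_closed v_closed e_closed
      by (intro sum_via_resolution[where a = "e \<otimes>\<^bsub>R\<^esub> (v i \<otimes>\<^bsub>R\<^esub> r)" and b = e])
        (auto simp: rho_closed tau_closed psi_rho psi_tau R.m_assoc)
    finally show ?thesis .
  qed
  thus ?thesis by (simp add: act_def cong: restrict_cong)
qed

text \<open>The inverse is \<open>x \<mapsto> (e v\<^sub>i x)\<^sub>i\<close>: one composite is
  \<open>\<Sum> u\<^sub>i e v\<^sub>i x = x\<close>, the other the action of the matrix of
  \<open>1\<close>.\<close>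

lemma eta_bij:
  assumes "left_module R M"
  shows "bij_betw (\<eta> M) (carrier (Go (Fo M))) (carrier M)"
proof -
  interpret M: left_module R M by fact
  note F = Fo_module[OF assms]
  interpret F: left_module S "Fo M" by (rule F)
  note t = tuplesD[OF F] and d = dec_emb_tuples[OF F]
  have cl: "n i \<in> carrier M" if "n \<in> tuples (Fo M)" "i \<in> I" for n i
    using t(3)[OF that] by (simp add: Fo_sel)
  have eta: "\<eta> M (emb n) = (\<Oplus>\<^bsub>M\<^esub>i\<in>I. u i \<odot>\<^bsub>M\<^esub> n i)" if "n \<in> tuples (Fo M)" for n
    using that by (simp add: \<eta>_def Go_sel d)
  define cut where "cut = (\<lambda>x. \<lambda>i\<in>I. (e \<otimes>\<^bsub>R\<^esub> v i) \<odot>\<^bsub>M\<^esub> x)"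
  have act1: "act (Fo M) \<one>\<^bsub>R\<^esub> n i = (e \<otimes>\<^bsub>R\<^esub> v i) \<odot>\<^bsub>M\<^esub> (\<Oplus>\<^bsub>M\<^esub>j\<in>I. u j \<odot>\<^bsub>M\<^esub> n j)"
    if i: "i \<in> I" and n: "n \<in> I \<rightarrow>\<^sub>E carrier (Fo M)" for i n
  proof -
    have c: "n j \<in> carrier M" "e \<odot>\<^bsub>M\<^esub> n j = n j" "n j \<in> carrier (Fo M)" if "j \<in> I" for j
      using that n by (auto simp: Fo_sel)
    have "act (Fo M) \<one>\<^bsub>R\<^esub> n i = (\<Oplus>\<^bsub>Fo M\<^esub>j\<in>I. \<rho> \<one>\<^bsub>R\<^esub> i j \<odot>\<^bsub>Fo M\<^esub> n j)"
      using i by (simp add: act_def)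
    also have "\<dots> = (\<Oplus>\<^bsub>M\<^esub>j\<in>I. \<rho> \<one>\<^bsub>R\<^esub> i j \<odot>\<^bsub>Fo M\<^esub> n j)"
      using i c rho_closed finite_I by (intro finsum_Fo[OF assms]) (auto intro!: F.smult_closed)
    also have "\<dots> = (\<Oplus>\<^bsub>M\<^esub>j\<in>I. (e \<otimes>\<^bsub>R\<^esub> v i) \<odot>\<^bsub>M\<^esub> (u j \<odot>\<^bsub>M\<^esub> n j))"
      using i c u_closed v_closed e_closed
      by (intro M.M.finsum_cong') (auto simp: Fo_sel(4) psi_rho M.smult_assoc M.smult_closed)
    also have "\<dots> = (e \<otimes>\<^bsub>R\<^esub> v i) \<odot>\<^bsub>M\<^esub> (\<Oplus>\<^bsub>M\<^esub>j\<in>I. u j \<odot>\<^bsub>M\<^esub> n j)"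
      using i c u_closed v_closed e_closed finite_I
      by (intro M.smult_finsum_right[symmetric]) (auto intro!: M.smult_closed)
    finally show ?thesis .
  qed
  have sum: "(\<Oplus>\<^bsub>M\<^esub>i\<in>I. u i \<odot>\<^bsub>M\<^esub> cut x i) = x" if x: "x \<in> carrier M" for x
  proof -
    have "(\<Oplus>\<^bsub>M\<^esub>i\<in>I. u i \<odot>\<^bsub>M\<^esub> cut x i) = (\<Oplus>\<^bsub>M\<^esub>i\<in>I. (u i \<otimes>\<^bsub>R\<^esub> e \<otimes>\<^bsub>R\<^esub> v i) \<odot>\<^bsub>M\<^esub> x)"
      using x u_closed v_closed e_closed
      by (intro M.M.finsum_cong') (auto simp: cut_def M.smult_assoc R.m_assoc intro!: M.smult_closed)
    also have "\<dots> = (\<Oplus>\<^bsub>R\<^esub>i\<in>I. u i \<otimes>\<^bsub>R\<^esub> e \<otimes>\<^bsub>R\<^esub> v i) \<odot>\<^bsub>M\<^esub> x"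
      using x u_closed v_closed e_closed finite_I by (intro M.smult_finsum_left[symmetric]) auto
    also have "\<dots> = x"
      using x full by (simp add: M.smult_one)
    finally show ?thesis .
  qed
  have cut_PiE: "cut x \<in> I \<rightarrow>\<^sub>E carrier (Fo M)" if "x \<in> carrier M" for x
    using that e_closed v_closed
    by (auto simp: cut_def Fo_sel M.smult_closed eex simp flip: M.smult_assoc)
  have cut_tuples: "cut x \<in> tuples (Fo M)" if x: "x \<in> carrier M" for x
  proof -
    have "act (Fo M) \<one>\<^bsub>R\<^esub> (cut x) i = cut x i" for i
    proof (cases "i \<in> I")
      case True
      thus ?thesis using act1[OF True cut_PiE[OF x]] sum[OF x] by (simp add: cut_def)
    qed (simp add: act_def cut_def)
    thus ?thesis
      using cut_PiE[OF x] by (auto simp: tuples_def)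
  qed
  have cut_eta: "cut (\<eta> M (emb n)) = n" if n: "n \<in> tuples (Fo M)" for n
  proof
    fix i show "cut (\<eta> M (emb n)) i = n i"
    proof (cases "i \<in> I")
      case True
      thus ?thesis
        using act1[OF True t(1)[OF n]] t(2)[OF n] by (simp add: cut_def eta[OF n])
    next
      case False
      thus ?thesis using t(1)[OF n] by (auto simp: cut_def)
    qed
  qed
  show ?thesis
  proof (rule bij_betw_byWitness[where f' = "\<lambda>x. emb (cut x)"])
    show "\<forall>x\<in>carrier (Go (Fo M)). emb (cut (\<eta> M x)) = x"
      using cut_eta by (auto simp: Go_sel)
    show "\<forall>x\<in>carrier M. \<eta> M (emb (cut x)) = x"
      using sum cut_tuples eta by auto
    show "\<eta> M ` carrier (Go (Fo M)) \<subseteq> carrier M"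
      using module_homsD(2)[OF eta_hom[OF assms]] by auto
    show "(\<lambda>x. emb (cut x)) ` carrier M \<subseteq> carrier (Go (Fo M))"
      using cut_tuples by (auto simp: Go_sel)
  qed
qed

lemma eta_natural:
  "natural_iso_to_id R (\<lambda>M. Go (Fo M)) (\<lambda>M N f. Gm (Fo M) (Fo N) (Fm M N f)) \<eta>"
  unfolding natural_iso_to_id_def
proof (intro conjI ballI)
  fix M N :: "('r, 'u) module" and f
  assume MN: "M \<in> left_modules R" "N \<in> left_modules R" and f: "f \<in> module_homs R M N"
  note M = left_modulesD[OF MN(1)] and N = left_modulesD[OF MN(2)]
  interpret M: left_module R M by (rule M)
  interpret N: left_module R N by (rule N)
  note FM = Fo_module[OF M] and FN = Fo_module[OF N]
  let ?C = "carrier (Go (Fo M))"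
  show "compose ?C (\<eta> N) (Gm (Fo M) (Fo N) (Fm M N f)) = compose ?C f (\<eta> M)"
  proof
    fix x show "compose ?C (\<eta> N) (Gm (Fo M) (Fo N) (Fm M N f)) x = compose ?C f (\<eta> M) x"
    proof (cases "x \<in> ?C")
      case True
      then obtain n where n: "n \<in> tuples (Fo M)" "x = emb n" by (auto simp: Go_sel)
      have c: "n i \<in> carrier M" "n i \<in> carrier (Fo M)" if "i \<in> I" for i
        using tuplesD(3)[OF FM n(1) that] by (auto simp: Fo_sel)
      let ?p = "\<lambda>i\<in>I. Fm M N f (n i)"
      have p: "?p \<in> tuples (Fo N)"
        by (rule map_tuples[OF FM FN Fm_hom[OF M f] n(1)])
      have "\<eta> N (Gm (Fo M) (Fo N) (Fm M N f) x) = (\<Oplus>\<^bsub>N\<^esub>i\<in>I. u i \<odot>\<^bsub>N\<^esub> ?p i)"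
        using n p by (simp add: Gm_emb[OF FM] \<eta>_def Go_sel dec_emb_tuples[OF FN])
      also have "\<dots> = (\<Oplus>\<^bsub>N\<^esub>i\<in>I. f (u i \<odot>\<^bsub>M\<^esub> n i))"
        using c u_closed module_homsD[OF f]
        by (intro N.M.finsum_cong') (auto simp: Fm_def intro!: M.smult_closed)
      also have "\<dots> = f (\<Oplus>\<^bsub>M\<^esub>i\<in>I. u i \<odot>\<^bsub>M\<^esub> n i)"
        using c u_closed finite_I
        by (intro module_homs_finsum[OF M N f, symmetric]) (auto intro!: M.smult_closed)
      also have "\<dots> = f (\<eta> M x)"
        using n by (simp add: \<eta>_def Go_sel dec_emb_tuples[OF FM])
      finally show ?thesis
        using True by (simp add: compose_eq)
    qed (simp add: compose_def)
  qed
qed (auto simp: left_modules_def eta_hom eta_bij)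

lemma eps_hom:
  assumes "left_module S N"
  shows "\<epsilon> N \<in> module_homs S (Fo (Go N)) N"
proof -
  interpret N: left_module S N by fact
  note t = tuplesD[OF assms] and d = dec_emb_tuples[OF assms]
  have tu: "\<tau> (u i) \<in> carrier S" if "i \<in> I" for i
    using that u_closed tau_closed by auto
  have eps: "\<epsilon> N (emb n) = (\<Oplus>\<^bsub>N\<^esub>i\<in>I. \<tau> (u i) \<odot>\<^bsub>N\<^esub> n i)"
    if "n \<in> tuples N" "emb n \<in> carrier (Fo (Go N))" for n
    using that by (simp add: \<epsilon>_def d)
  interpret FG: left_module S "Fo (Go N)" by (intro Fo_module Go_module assms)
  show ?thesis
    unfolding module_homs_def
  proof (intro CollectI conjI ballI)
    show "\<epsilon> N \<in> carrier (Fo (Go N)) \<rightarrow>\<^sub>E carrier N"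
    proof (intro PiE_I)
      fix x assume x: "x \<in> carrier (Fo (Go N))"
      then obtain n where n: "n \<in> tuples N" "x = emb n" by (auto simp: Go_sel Fo_sel)
      thus "\<epsilon> N x \<in> carrier N"
        using x t tu by (auto simp: eps intro!: N.M.finsum_closed N.smult_closed)
    qed (simp add: \<epsilon>_def)
    fix x y assume x: "x \<in> carrier (Fo (Go N))" and y: "y \<in> carrier (Fo (Go N))"
    then obtain n p where n: "n \<in> tuples N" "x = emb n" and p: "p \<in> tuples N" "y = emb p"
      by (auto simp: Go_sel Fo_sel)
    have xy: "emb (\<lambda>i\<in>I. n i \<oplus>\<^bsub>N\<^esub> p i) \<in> carrier (Fo (Go N))"
      using FG.M.a_closed[OF x y] n p by (simp add: Fo_sel(3) Go_sel(3) d)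
    have "(\<Oplus>\<^bsub>N\<^esub>i\<in>I. \<tau> (u i) \<odot>\<^bsub>N\<^esub> (\<lambda>i\<in>I. n i \<oplus>\<^bsub>N\<^esub> p i) i)
        = (\<Oplus>\<^bsub>N\<^esub>i\<in>I. \<tau> (u i) \<odot>\<^bsub>N\<^esub> n i \<oplus>\<^bsub>N\<^esub> \<tau> (u i) \<odot>\<^bsub>N\<^esub> p i)"
      using t(3)[OF n(1)] t(3)[OF p(1)] tu
      by (intro N.M.finsum_cong') (auto simp: N.smult_r_distr intro!: N.M.a_closed N.smult_closed)
    also have "\<dots> = (\<Oplus>\<^bsub>N\<^esub>i\<in>I. \<tau> (u i) \<odot>\<^bsub>N\<^esub> n i) \<oplus>\<^bsub>N\<^esub> (\<Oplus>\<^bsub>N\<^esub>i\<in>I. \<tau> (u i) \<odot>\<^bsub>N\<^esub> p i)"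
      using t(3)[OF n(1)] t(3)[OF p(1)] tu by (intro N.M.finsum_addf) (auto intro!: N.smult_closed)
    finally show "\<epsilon> N (x \<oplus>\<^bsub>Fo (Go N)\<^esub> y) = \<epsilon> N x \<oplus>\<^bsub>N\<^esub> \<epsilon> N y"
      using n p x y tuples_add[OF assms n(1) p(1)] xy by (simp add: eps Go_sel(3) Fo_sel(3) d)
  next
    fix s x assume s: "s \<in> carrier S" and x: "x \<in> carrier (Fo (Go N))"
    then obtain n where n: "n \<in> tuples N" "x = emb n"
      by (auto simp: Go_sel Fo_sel)
    note ps = psi_closed[OF s]
    have sx: "emb (act N (\<psi> s) n) \<in> carrier (Fo (Go N))"
      using FG.smult_closed[OF s x] n by (simp add: Fo_sel(4) Go_sel(4) d)
    have "\<epsilon> N (s \<odot>\<^bsub>Fo (Go N)\<^esub> x) = (\<Oplus>\<^bsub>N\<^esub>i\<in>I. \<tau> (u i) \<odot>\<^bsub>N\<^esub> act N (\<psi> s) n i)"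
      using n x act_tuples[OF assms ps t(1)[OF n(1)]] sx by (simp add: Fo_sel(4) Go_sel(4) d eps)
    also have "\<dots> = (\<Oplus>\<^bsub>N\<^esub>i\<in>I. \<tau> (u i) \<odot>\<^bsub>N\<^esub> (\<Oplus>\<^bsub>N\<^esub>j\<in>I. \<rho> (\<psi> s) i j \<odot>\<^bsub>N\<^esub> n j))"
      using t(3)[OF n(1)] tu ps rho_closed
      by (intro N.M.finsum_cong') (auto simp: act_def intro!: N.smult_closed N.M.finsum_closed)
    also have "\<dots> = (\<Oplus>\<^bsub>N\<^esub>j\<in>I. (\<Oplus>\<^bsub>S\<^esub>i\<in>I. \<tau> (u i) \<otimes>\<^bsub>S\<^esub> \<rho> (\<psi> s) i j) \<odot>\<^bsub>N\<^esub> n j)"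
      using t(3)[OF n(1)] tu ps rho_closed finite_I by (intro N.matrix_action_assoc) auto
    also have "\<dots> = (\<Oplus>\<^bsub>N\<^esub>j\<in>I. s \<odot>\<^bsub>N\<^esub> (\<tau> (u j) \<odot>\<^bsub>N\<^esub> n j))"
    proof (rule N.M.finsum_cong', goal_cases)
      case (3 j)
      have "(\<Oplus>\<^bsub>S\<^esub>i\<in>I. \<tau> (u i) \<otimes>\<^bsub>S\<^esub> \<rho> (\<psi> s) i j) = s \<otimes>\<^bsub>S\<^esub> \<tau> (u j)"
      proof (rule sum_via_resolution[where a = e and b = "\<psi> s \<otimes>\<^bsub>R\<^esub> (u j \<otimes>\<^bsub>R\<^esub> e)"])
        have "\<psi> s \<otimes>\<^bsub>R\<^esub> (e \<otimes>\<^bsub>R\<^esub> (u j \<otimes>\<^bsub>R\<^esub> e)) = \<psi> s \<otimes>\<^bsub>R\<^esub> (u j \<otimes>\<^bsub>R\<^esub> e)"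
          using 3 s ps u_closed e_closed by (simp add: psi_e flip: R.m_assoc)
        moreover have "e \<otimes>\<^bsub>R\<^esub> (\<psi> s \<otimes>\<^bsub>R\<^esub> (u j \<otimes>\<^bsub>R\<^esub> e)) = \<psi> s \<otimes>\<^bsub>R\<^esub> (u j \<otimes>\<^bsub>R\<^esub> e)"
          using 3 s ps u_closed e_closed by (simp add: e_psi flip: R.m_assoc)
        ultimately show "\<psi> (s \<otimes>\<^bsub>S\<^esub> \<tau> (u j)) = e \<otimes>\<^bsub>R\<^esub> (\<psi> s \<otimes>\<^bsub>R\<^esub> (u j \<otimes>\<^bsub>R\<^esub> e))"
          using 3 s tu u_closed by (simp add: psi_mult psi_tau)
      qed (use 3 s ps tu u_closed v_closed e_closed in \<open>auto simp: psi_tau psi_rho rho_closed\<close>)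
      thus ?case
        using t(3)[OF n(1) 3] 3 s tu by (simp add: N.smult_assoc)
    qed (use t(3)[OF n(1)] s tu in \<open>auto intro!: N.smult_closed\<close>)
    also have "\<dots> = s \<odot>\<^bsub>N\<^esub> \<epsilon> N x"
      using t(3)[OF n(1)] tu s n x finite_I
      by (simp add: eps N.smult_finsum_right Pi_iff N.smult_closed)
    finally show "\<epsilon> N (s \<odot>\<^bsub>Fo (Go N)\<^esub> x) = s \<odot>\<^bsub>N\<^esub> \<epsilon> N x" .
  qed
qed

text \<open>The inverse sends \<open>y\<close> to the tuple \<open>(e v\<^sub>i e
  y)\<^sub>i\<close> of \<open>act_resolution\<close>.\<close>

lemma eps_bij:
  assumes "left_module S N"
  shows "bij_betw (\<epsilon> N) (carrier (Fo (Go N))) (carrier N)"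
proof -
  interpret N: left_module S N by fact
  note t = tuplesD[OF assms] and d = dec_emb_tuples[OF assms]
  have tu: "\<tau> (u i) \<in> carrier S" "\<tau> (v i) \<in> carrier S" if "i \<in> I" for i
    using that u_closed v_closed tau_closed by auto
  have eps: "\<epsilon> N (emb n) = (\<Oplus>\<^bsub>N\<^esub>i\<in>I. \<tau> (u i) \<odot>\<^bsub>N\<^esub> n i)"
    if "n \<in> tuples N" "emb n \<in> carrier (Fo (Go N))" for n
    using that by (simp add: \<epsilon>_def d)
  define cut where "cut = (\<lambda>y. \<lambda>i\<in>I. \<tau> (v i) \<odot>\<^bsub>N\<^esub> y)"
  have tve: "\<tau> (v i \<otimes>\<^bsub>R\<^esub> e) = \<tau> (v i)" if "i \<in> I" for i
    using that v_closed e_closed by (intro psi_eqD tau_closed) (auto simp: psi_tau R.m_assoc ee)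
  have cut_PiE: "cut y \<in> I \<rightarrow>\<^sub>E carrier N" if "y \<in> carrier N" for y
    using that tu by (auto simp: cut_def N.smult_closed)
  have cut_tuples: "cut y \<in> tuples N" if y: "y \<in> carrier N" for y
    using cut_PiE[OF y] act_resolution[OF assms R.one_closed y] v_closed
    by (simp add: tuples_def cut_def cong: restrict_cong)
  have cut_FG: "emb (cut y) \<in> carrier (Fo (Go N))" if y: "y \<in> carrier N" for y
    using cut_tuples[OF y] act_resolution[OF assms e_closed y]
    by (simp add: Fo_sel Go_sel d) (simp add: cut_def tve cong: restrict_cong)
  have sum: "(\<Oplus>\<^bsub>N\<^esub>i\<in>I. \<tau> (u i) \<odot>\<^bsub>N\<^esub> cut y i) = y" if y: "y \<in> carrier N" for y
  proof -
    have "(\<Oplus>\<^bsub>N\<^esub>i\<in>I. \<tau> (u i) \<odot>\<^bsub>N\<^esub> cut y i) = (\<Oplus>\<^bsub>N\<^esub>i\<in>I. (\<tau> (u i) \<otimes>\<^bsub>S\<^esub> \<tau> (v i)) \<odot>\<^bsub>N\<^esub> y)"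
      using y tu by (intro N.M.finsum_cong') (auto simp: cut_def N.smult_assoc intro!: N.smult_closed)
    also have "\<dots> = (\<Oplus>\<^bsub>S\<^esub>i\<in>I. \<tau> (u i) \<otimes>\<^bsub>S\<^esub> \<tau> (v i)) \<odot>\<^bsub>N\<^esub> y"
      using y tu finite_I by (intro N.smult_finsum_left[symmetric]) auto
    also have "(\<Oplus>\<^bsub>S\<^esub>i\<in>I. \<tau> (u i) \<otimes>\<^bsub>S\<^esub> \<tau> (v i)) = \<one>\<^bsub>S\<^esub>"
      using tu u_closed v_closed e_closed
      by (intro sum_via_resolution[where a = e and b = e]) (auto simp: psi_tau psi_one ee)
    finally show ?thesis
      using y by (simp add: N.smult_one)
  qed
  have cut_eps: "cut (\<epsilon> N (emb n)) = n" if n: "n \<in> tuples N" and x: "emb n \<in> carrier (Fo (Go N))" for n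
  proof
    fix i
    have "emb (act N e n) = emb n"
      using x n by (simp add: Fo_sel Go_sel d)
    hence en: "act N e n = n"
      using d[OF n] d[OF act_tuples[OF assms e_closed t(1)[OF n]]] by metis
    show "cut (\<epsilon> N (emb n)) i = n i"
    proof (cases "i \<in> I")
      case True
      have "cut (\<epsilon> N (emb n)) i = (\<Oplus>\<^bsub>N\<^esub>j\<in>I. \<tau> (v i) \<odot>\<^bsub>N\<^esub> (\<tau> (u j) \<odot>\<^bsub>N\<^esub> n j))"
        using True tu t(3)[OF n] finite_I
        by (simp add: cut_def eps[OF n x] N.smult_finsum_right Pi_iff N.smult_closed)
      also have "\<dots> = (\<Oplus>\<^bsub>N\<^esub>j\<in>I. \<rho> e i j \<odot>\<^bsub>N\<^esub> n j)"
      proof (rule N.M.finsum_cong', goal_cases)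
        case (3 j)
        have "\<tau> (v i) \<otimes>\<^bsub>S\<^esub> \<tau> (u j) = \<rho> e i j"
          using True 3 tu u_closed v_closed e_closed
          by (intro psi_eqD) (auto simp: psi_mult psi_tau psi_rho rho_closed R.m_assoc eex)
        thus ?case
          using True 3 tu t(3)[OF n] by (simp flip: N.smult_assoc)
      qed (use True t(3)[OF n] e_closed rho_closed in \<open>auto intro!: N.smult_closed\<close>)
      also have "\<dots> = act N e n i"
        using True by (simp add: act_def)
      finally show ?thesis by (simp add: en)
    qed (use t(1)[OF n] in \<open>auto simp: cut_def\<close>)
  qed
  show ?thesis
  proof (rule bij_betw_byWitness[where f' = "\<lambda>y. emb (cut y)"])
    show "\<forall>x\<in>carrier (Fo (Go N)). emb (cut (\<epsilon> N x)) = x"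
    proof
      fix x assume x: "x \<in> carrier (Fo (Go N))"
      then obtain n where "n \<in> tuples N" "x = emb n" by (auto simp: Go_sel Fo_sel)
      thus "emb (cut (\<epsilon> N x)) = x" using x cut_eps by simp
    qed
    show "\<forall>y\<in>carrier N. \<epsilon> N (emb (cut y)) = y"
      using sum cut_tuples cut_FG eps by auto
    show "\<epsilon> N ` carrier (Fo (Go N)) \<subseteq> carrier N"
      using module_homsD(2)[OF eps_hom[OF assms]] by auto
    show "(\<lambda>y. emb (cut y)) ` carrier N \<subseteq> carrier (Fo (Go N))"
      using cut_FG by auto
  qed
qed

lemma eps_natural:
  "natural_iso_to_id S (\<lambda>N. Fo (Go N)) (\<lambda>M N f. Fm (Go M) (Go N) (Gm M N f)) \<epsilon>"
  unfolding natural_iso_to_id_def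
proof (intro conjI ballI)
  fix M N :: "('s, 'u) module" and f
  assume MN: "M \<in> left_modules S" "N \<in> left_modules S" and f: "f \<in> module_homs S M N"
  note M = left_modulesD[OF MN(1)] and N = left_modulesD[OF MN(2)]
  interpret M: left_module S M by (rule M)
  interpret N: left_module S N by (rule N)
  have tu: "\<tau> (u i) \<in> carrier S" if "i \<in> I" for i
    using that u_closed tau_closed by auto
  let ?C = "carrier (Fo (Go M))"
  show "compose ?C (\<epsilon> N) (Fm (Go M) (Go N) (Gm M N f)) = compose ?C f (\<epsilon> M)"
  proof
    fix x show "compose ?C (\<epsilon> N) (Fm (Go M) (Go N) (Gm M N f)) x = compose ?C f (\<epsilon> M) x"
    proof (cases "x \<in> ?C")
      case True
      then obtain n where n: "n \<in> tuples M" "x = emb n" by (auto simp: Go_sel Fo_sel)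
      note c = tuplesD(3)[OF M n(1)]
      let ?p = "\<lambda>i\<in>I. f (n i)"
      have p: "?p \<in> tuples N"
        by (rule map_tuples[OF M N f n(1)])
      have "emb ?p \<in> carrier (Fo (Go N))"
        using module_homsD(2)[OF Fm_hom[OF Go_module[OF M] Gm_hom[OF M N f]] True] True n
        by (simp add: Fm_def Gm_emb[OF M])
      hence "\<epsilon> N (Fm (Go M) (Go N) (Gm M N f) x) = (\<Oplus>\<^bsub>N\<^esub>i\<in>I. \<tau> (u i) \<odot>\<^bsub>N\<^esub> ?p i)"
        using n p True by (simp add: Fm_def Gm_emb[OF M] \<epsilon>_def dec_emb_tuples[OF N])
      also have "\<dots> = (\<Oplus>\<^bsub>N\<^esub>i\<in>I. f (\<tau> (u i) \<odot>\<^bsub>M\<^esub> n i))"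
        using c tu module_homsD[OF f]
        by (intro N.M.finsum_cong') (auto intro!: M.smult_closed)
      also have "\<dots> = f (\<Oplus>\<^bsub>M\<^esub>i\<in>I. \<tau> (u i) \<odot>\<^bsub>M\<^esub> n i)"
        using c tu finite_I
        by (intro module_homs_finsum[OF M N f, symmetric]) (auto intro!: M.smult_closed)
      also have "\<dots> = f (\<epsilon> M x)"
        using n True by (simp add: \<epsilon>_def dec_emb_tuples[OF M])
      finally show ?thesis
        using True by (simp add: compose_eq)
    qed (simp add: compose_def)
  qed
qed (auto simp: left_modules_def eps_hom eps_bij)

lemma morita_embedded: "morita_equivalent TYPE('u) K R S"
  unfolding morita_equivalent_def
  by (intro exI conjI) (rule Fo_linear Go_linear eta_natural eps_natural)+

end

lemma corner_morita:
  assumes "corner R S K \<psi> e u v I" "infinite (UNIV :: 'u set)"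
  shows "morita_equivalent TYPE('u) K R S"
proof -
  interpret corner R S K \<psi> e u v I by fact
  obtain emb :: "(_ \<Rightarrow> 'u) \<Rightarrow> 'u" where "inj_on emb (I \<rightarrow>\<^sub>E UNIV)"
    using finite_power_embeds[OF finite_I assms(2)] .
  then interpret corner_embedded R S K \<psi> e u v I emb
    by unfold_locales
  show ?thesis by (rule morita_embedded)
qed

section \<open>Transformation algebras\<close>

text \<open>The skew group algebra of \<open>G\<close> over the functions on \<open>Z\<close>,
  equivalently the convolution algebra of the action groupoid. The value at \<open>(z, h)\<close>
  is the coefficient of \<open>\<delta>\<^sub>z h\<close>, the arrow with label \<open>h\<close>,
  target \<open>z\<close> and source \<open>h\<^sup>-\<^sup>1 z\<close>; an arrow \<open>h\<close>
  into \<open>z\<close> factors through \<open>a\<^sup>-\<^sup>1 z\<close> as \<open>a\<close>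
  after \<open>a\<^sup>-\<^sup>1 h\<close>.\<close>

definition transformation_algebra ::
    "('k, 'e) ring_scheme \<Rightarrow> ('g, 'f) monoid_scheme \<Rightarrow> 'z set \<Rightarrow> ('g \<Rightarrow> 'z \<Rightarrow> 'z)
      \<Rightarrow> ('k, 'z \<times> 'g \<Rightarrow> 'k) module" where
  "transformation_algebra K G Z \<alpha> =
    \<lparr>carrier = Z \<times> carrier G \<rightarrow>\<^sub>E carrier K,
     mult = (\<lambda>u v. \<lambda>(z, h)\<in>Z \<times> carrier G.
       \<Oplus>\<^bsub>K\<^esub>a\<in>carrier G. u (z, a) \<otimes>\<^bsub>K\<^esub> v (\<alpha> (inv\<^bsub>G\<^esub> a) z, inv\<^bsub>G\<^esub> a \<otimes>\<^bsub>G\<^esub> h)),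
     one = (\<lambda>(z, h)\<in>Z \<times> carrier G. if h = \<one>\<^bsub>G\<^esub> then \<one>\<^bsub>K\<^esub> else \<zero>\<^bsub>K\<^esub>),
     zero = (\<lambda>p\<in>Z \<times> carrier G. \<zero>\<^bsub>K\<^esub>),
     add = (\<lambda>u v. \<lambda>p\<in>Z \<times> carrier G. u p \<oplus>\<^bsub>K\<^esub> v p),
     smult = (\<lambda>c u. \<lambda>p\<in>Z \<times> carrier G. c \<otimes>\<^bsub>K\<^esub> u p)\<rparr>"

locale finite_action = K: cring K + group_action G Z \<alpha>
  for K :: "('k, 'e) ring_scheme" and G :: "('g, 'f) monoid_scheme" and Z :: "'z set"
    and \<alpha> :: "'g \<Rightarrow> 'z \<Rightarrow> 'z" +
  assumes finite_G: "finite (carrier G)" and finite_Z: "finite Z"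
begin

sublocale G: group G
  using group_hom unfolding group_hom_def by simp

lemma act_closed: "h \<in> carrier G \<Longrightarrow> z \<in> Z \<Longrightarrow> \<alpha> h z \<in> Z"
  using element_image by blast

lemma act_mult: "h \<in> carrier G \<Longrightarrow> k \<in> carrier G \<Longrightarrow> z \<in> Z \<Longrightarrow> \<alpha> (h \<otimes>\<^bsub>G\<^esub> k) z = \<alpha> h (\<alpha> k z)"
  by (rule composition_rule)

lemma act_one: "z \<in> Z \<Longrightarrow> \<alpha> \<one>\<^bsub>G\<^esub> z = z"
  using id_eq_one by (metis restrict_apply')

lemma act_inv: "h \<in> carrier G \<Longrightarrow> z \<in> Z \<Longrightarrow> \<alpha> (inv\<^bsub>G\<^esub> h) (\<alpha> h z) = z"
  "h \<in> carrier G \<Longrightarrow> z \<in> Z \<Longrightarrow> \<alpha> h (\<alpha> (inv\<^bsub>G\<^esub> h) z) = z"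
  by (simp_all add: act_one flip: act_mult)

abbreviation T where "T \<equiv> transformation_algebra K G Z \<alpha>"

lemma T_carrier: "carrier T = Z \<times> carrier G \<rightarrow>\<^sub>E carrier K"
  by (simp add: transformation_algebra_def)

lemma T_closed: "u \<in> carrier T \<Longrightarrow> z \<in> Z \<Longrightarrow> h \<in> carrier G \<Longrightarrow> u (z, h) \<in> carrier K"
  by (auto simp: T_carrier)

lemma T_eqI:
  assumes "u \<in> carrier T" "v \<in> carrier T"
    "\<And>z h. z \<in> Z \<Longrightarrow> h \<in> carrier G \<Longrightarrow> u (z, h) = v (z, h)"
  shows "u = v"
  using assms unfolding T_carrier by (intro PiE_ext) auto

lemma T_apply:
  assumes "z \<in> Z" "h \<in> carrier G"
  shows "(u \<oplus>\<^bsub>T\<^esub> v) (z, h) = u (z, h) \<oplus>\<^bsub>K\<^esub> v (z, h)" "(c \<odot>\<^bsub>T\<^esub> u) (z, h) = c \<otimes>\<^bsub>K\<^esub> u (z, h)"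
    "\<zero>\<^bsub>T\<^esub> (z, h) = \<zero>\<^bsub>K\<^esub>" "\<one>\<^bsub>T\<^esub> (z, h) = (if h = \<one>\<^bsub>G\<^esub> then \<one>\<^bsub>K\<^esub> else \<zero>\<^bsub>K\<^esub>)"
    "(u \<otimes>\<^bsub>T\<^esub> v) (z, h)
      = (\<Oplus>\<^bsub>K\<^esub>a\<in>carrier G. u (z, a) \<otimes>\<^bsub>K\<^esub> v (\<alpha> (inv\<^bsub>G\<^esub> a) z, inv\<^bsub>G\<^esub> a \<otimes>\<^bsub>G\<^esub> h))"
  using assms by (simp_all add: transformation_algebra_def)

lemma term_closed:
  assumes "u \<in> carrier T" "v \<in> carrier T" "z \<in> Z" "h \<in> carrier G" "a \<in> carrier G"
  shows "u (z, a) \<otimes>\<^bsub>K\<^esub> v (\<alpha> (inv\<^bsub>G\<^esub> a) z, inv\<^bsub>G\<^esub> a \<otimes>\<^bsub>G\<^esub> h) \<in> carrier K"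
  using assms by (intro K.m_closed T_closed act_closed) auto

lemma T_ops_closed:
  assumes "u \<in> carrier T" "v \<in> carrier T"
  shows "u \<oplus>\<^bsub>T\<^esub> v \<in> carrier T" "u \<otimes>\<^bsub>T\<^esub> v \<in> carrier T"
proof -
  show "u \<oplus>\<^bsub>T\<^esub> v \<in> carrier T"
    using assms by (auto simp: transformation_algebra_def)
  have "(u \<otimes>\<^bsub>T\<^esub> v) p \<in> carrier K" if "p \<in> Z \<times> carrier G" for p
    using that term_closed[OF assms(1,2)] by (auto simp: T_apply intro!: K.finsum_closed)
  moreover have "u \<otimes>\<^bsub>T\<^esub> v \<in> extensional (Z \<times> carrier G)"
    by (auto simp: transformation_algebra_def)
  ultimately show "u \<otimes>\<^bsub>T\<^esub> v \<in> carrier T"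
    unfolding T_carrier PiE_def by blast
qed

lemma T_smult_closed: "c \<in> carrier K \<Longrightarrow> u \<in> carrier T \<Longrightarrow> c \<odot>\<^bsub>T\<^esub> u \<in> carrier T"
  by (auto simp: transformation_algebra_def)

lemma T_units_closed: "\<zero>\<^bsub>T\<^esub> \<in> carrier T" "\<one>\<^bsub>T\<^esub> \<in> carrier T"
  by (auto simp: transformation_algebra_def)

lemma T_mult_single:
  assumes "u \<in> carrier T" "v \<in> carrier T" "z \<in> Z" "h \<in> carrier G" "b \<in> carrier G"
    and "\<And>a. a \<in> carrier G \<Longrightarrow> a \<noteq> b
      \<Longrightarrow> u (z, a) = \<zero>\<^bsub>K\<^esub> \<or> v (\<alpha> (inv\<^bsub>G\<^esub> a) z, inv\<^bsub>G\<^esub> a \<otimes>\<^bsub>G\<^esub> h) = \<zero>\<^bsub>K\<^esub>"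
  shows "(u \<otimes>\<^bsub>T\<^esub> v) (z, h) = u (z, b) \<otimes>\<^bsub>K\<^esub> v (\<alpha> (inv\<^bsub>G\<^esub> b) z, inv\<^bsub>G\<^esub> b \<otimes>\<^bsub>G\<^esub> h)"
  unfolding T_apply(5)[OF assms(3,4)]
proof (rule K.finsum_single_term[OF finite_G assms(5)])
  show "u (z, b) \<otimes>\<^bsub>K\<^esub> v (\<alpha> (inv\<^bsub>G\<^esub> b) z, inv\<^bsub>G\<^esub> b \<otimes>\<^bsub>G\<^esub> h) \<in> carrier K"
    using term_closed assms by blast
  fix a assume a: "a \<in> carrier G" "a \<noteq> b"
  have "u (z, a) \<in> carrier K" "v (\<alpha> (inv\<^bsub>G\<^esub> a) z, inv\<^bsub>G\<^esub> a \<otimes>\<^bsub>G\<^esub> h) \<in> carrier K"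
    using a assms by (auto intro!: T_closed act_closed)
  thus "u (z, a) \<otimes>\<^bsub>K\<^esub> v (\<alpha> (inv\<^bsub>G\<^esub> a) z, inv\<^bsub>G\<^esub> a \<otimes>\<^bsub>G\<^esub> h) = \<zero>\<^bsub>K\<^esub>"
    using assms(6)[OF a] by auto
qed

text \<open>Both sides sum over all factorizations of an arrow into three. After the sums are
  exchanged, the substitution \<open>a = b c\<close> replaces the label \<open>a\<close> of the
  composite of the first two arrows by the label \<open>c\<close> of the second.\<close>

lemma T_assoc:
  assumes u: "u \<in> carrier T" and v: "v \<in> carrier T" and w: "w \<in> carrier T"
  shows "u \<otimes>\<^bsub>T\<^esub> v \<otimes>\<^bsub>T\<^esub> w = u \<otimes>\<^bsub>T\<^esub> (v \<otimes>\<^bsub>T\<^esub> w)"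
proof (rule T_eqI)
  fix z h assume z: "z \<in> Z" and h: "h \<in> carrier G"
  let ?t = "\<lambda>a b. u (z, b) \<otimes>\<^bsub>K\<^esub> (v (\<alpha> (inv\<^bsub>G\<^esub> b) z, inv\<^bsub>G\<^esub> b \<otimes>\<^bsub>G\<^esub> a)
      \<otimes>\<^bsub>K\<^esub> w (\<alpha> (inv\<^bsub>G\<^esub> a) z, inv\<^bsub>G\<^esub> a \<otimes>\<^bsub>G\<^esub> h))"
  have uc: "u (z, b) \<in> carrier K" if "b \<in> carrier G" for b
    using that u z by (intro T_closed)
  have vc: "v (\<alpha> (inv\<^bsub>G\<^esub> b) z, c) \<in> carrier K" if "b \<in> carrier G" "c \<in> carrier G" for b c
    using that v z by (intro T_closed act_closed) auto
  have wc: "w (\<alpha> (inv\<^bsub>G\<^esub> a) z, inv\<^bsub>G\<^esub> a \<otimes>\<^bsub>G\<^esub> h) \<in> carrier K" if "a \<in> carrier G" for a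
    using that w z h by (intro T_closed act_closed) auto
  have tc: "?t a b \<in> carrier K" if "a \<in> carrier G" "b \<in> carrier G" for a b
    using that uc vc wc by auto
  have "(u \<otimes>\<^bsub>T\<^esub> v \<otimes>\<^bsub>T\<^esub> w) (z, h) = (\<Oplus>\<^bsub>K\<^esub>a\<in>carrier G. \<Oplus>\<^bsub>K\<^esub>b\<in>carrier G. ?t a b)"
    unfolding T_apply(5)[OF z h]
  proof (rule K.finsum_cong', goal_cases)
    case (3 a)
    have "(u \<otimes>\<^bsub>T\<^esub> v) (z, a) \<otimes>\<^bsub>K\<^esub> w (\<alpha> (inv\<^bsub>G\<^esub> a) z, inv\<^bsub>G\<^esub> a \<otimes>\<^bsub>G\<^esub> h)
        = (\<Oplus>\<^bsub>K\<^esub>b\<in>carrier G. u (z, b) \<otimes>\<^bsub>K\<^esub> v (\<alpha> (inv\<^bsub>G\<^esub> b) z, inv\<^bsub>G\<^esub> b \<otimes>\<^bsub>G\<^esub> a)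
            \<otimes>\<^bsub>K\<^esub> w (\<alpha> (inv\<^bsub>G\<^esub> a) z, inv\<^bsub>G\<^esub> a \<otimes>\<^bsub>G\<^esub> h))"
      unfolding T_apply(5)[OF z 3] using 3 wc uc vc finite_G by (intro K.finsum_ldistr) auto
    also have "\<dots> = (\<Oplus>\<^bsub>K\<^esub>b\<in>carrier G. ?t a b)"
      using 3 uc vc wc tc by (intro K.finsum_cong') (auto simp: K.m_assoc)
    finally show ?case .
  qed (use tc in \<open>auto intro!: K.finsum_closed\<close>)
  also have "\<dots> = (\<Oplus>\<^bsub>K\<^esub>b\<in>carrier G. \<Oplus>\<^bsub>K\<^esub>a\<in>carrier G. ?t a b)"
    using tc finite_G by (intro K.finsum_swap) auto
  also have "\<dots> = (u \<otimes>\<^bsub>T\<^esub> (v \<otimes>\<^bsub>T\<^esub> w)) (z, h)"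
    unfolding T_apply(5)[OF z h, of u]
  proof (rule K.finsum_cong', goal_cases)
    case (3 b)
    let ?z = "\<alpha> (inv\<^bsub>G\<^esub> b) z"
    have bz: "?z \<in> Z" using 3 z by (intro act_closed) auto
    have wc': "w (\<alpha> (inv\<^bsub>G\<^esub> c) ?z, inv\<^bsub>G\<^esub> c \<otimes>\<^bsub>G\<^esub> (inv\<^bsub>G\<^esub> b \<otimes>\<^bsub>G\<^esub> h)) \<in> carrier K"
      if "c \<in> carrier G" for c
      using that 3 w h z by (intro T_closed act_closed) auto
    have "(\<Oplus>\<^bsub>K\<^esub>a\<in>carrier G. ?t a b) = (\<Oplus>\<^bsub>K\<^esub>a\<in>(\<lambda>c. b \<otimes>\<^bsub>G\<^esub> c) ` carrier G. ?t a b)"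
      using G.surj_const_mult[OF 3] by simp
    also have "\<dots> = (\<Oplus>\<^bsub>K\<^esub>c\<in>carrier G. ?t (b \<otimes>\<^bsub>G\<^esub> c) b)"
      using tc 3 G.inj_on_cmult[OF 3] by (intro K.finsum_reindex) auto
    also have "\<dots> = (\<Oplus>\<^bsub>K\<^esub>c\<in>carrier G. u (z, b) \<otimes>\<^bsub>K\<^esub> (v (?z, c) \<otimes>\<^bsub>K\<^esub>
        w (\<alpha> (inv\<^bsub>G\<^esub> c) ?z, inv\<^bsub>G\<^esub> c \<otimes>\<^bsub>G\<^esub> (inv\<^bsub>G\<^esub> b \<otimes>\<^bsub>G\<^esub> h))))"
    proof (rule K.finsum_cong', goal_cases)
      case (3 c)
      have "inv\<^bsub>G\<^esub> b \<otimes>\<^bsub>G\<^esub> (b \<otimes>\<^bsub>G\<^esub> c) = c"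
        using 3 \<open>b \<in> carrier G\<close> by (simp add: G.m_assoc[symmetric])
      thus ?case
        using 3 \<open>b \<in> carrier G\<close> z h by (simp add: G.inv_mult_group act_mult G.m_assoc)
    qed (use 3 uc vc wc' in auto)
    also have "\<dots> = u (z, b) \<otimes>\<^bsub>K\<^esub> (v \<otimes>\<^bsub>T\<^esub> w) (?z, inv\<^bsub>G\<^esub> b \<otimes>\<^bsub>G\<^esub> h)"
      using 3 h bz uc finite_G term_closed[OF v w bz, of "inv\<^bsub>G\<^esub> b \<otimes>\<^bsub>G\<^esub> h"]
      by (subst T_apply(5)) (auto simp: K.finsum_rdistr)
    finally show ?case .
  qed (use u v w z h in \<open>auto intro!: K.m_closed T_closed T_ops_closed act_closed\<close>)
  finally show "(u \<otimes>\<^bsub>T\<^esub> v \<otimes>\<^bsub>T\<^esub> w) (z, h) = (u \<otimes>\<^bsub>T\<^esub> (v \<otimes>\<^bsub>T\<^esub> w)) (z, h)" .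
qed (use assms in \<open>auto intro!: T_ops_closed\<close>)

lemma T_one_mult:
  assumes u: "u \<in> carrier T"
  shows "\<one>\<^bsub>T\<^esub> \<otimes>\<^bsub>T\<^esub> u = u" "u \<otimes>\<^bsub>T\<^esub> \<one>\<^bsub>T\<^esub> = u"
proof -
  show "\<one>\<^bsub>T\<^esub> \<otimes>\<^bsub>T\<^esub> u = u"
  proof (rule T_eqI)
    fix z h assume z: "z \<in> Z" and h: "h \<in> carrier G"
    have "(\<one>\<^bsub>T\<^esub> \<otimes>\<^bsub>T\<^esub> u) (z, h) = \<one>\<^bsub>T\<^esub> (z, \<one>\<^bsub>G\<^esub>)
        \<otimes>\<^bsub>K\<^esub> u (\<alpha> (inv\<^bsub>G\<^esub> \<one>\<^bsub>G\<^esub>) z, inv\<^bsub>G\<^esub> \<one>\<^bsub>G\<^esub> \<otimes>\<^bsub>G\<^esub> h)"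
      using z h u T_units_closed by (intro T_mult_single) (auto simp: T_apply)
    thus "(\<one>\<^bsub>T\<^esub> \<otimes>\<^bsub>T\<^esub> u) (z, h) = u (z, h)"
      using z h T_closed[OF u z h] by (simp add: T_apply act_one)
  qed (use u T_units_closed in \<open>auto intro!: T_ops_closed\<close>)
  show "u \<otimes>\<^bsub>T\<^esub> \<one>\<^bsub>T\<^esub> = u"
  proof (rule T_eqI)
    fix z h assume z: "z \<in> Z" and h: "h \<in> carrier G"
    have "(u \<otimes>\<^bsub>T\<^esub> \<one>\<^bsub>T\<^esub>) (z, h) = u (z, h)
        \<otimes>\<^bsub>K\<^esub> \<one>\<^bsub>T\<^esub> (\<alpha> (inv\<^bsub>G\<^esub> h) z, inv\<^bsub>G\<^esub> h \<otimes>\<^bsub>G\<^esub> h)"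
    proof (rule T_mult_single[OF u T_units_closed(2) z h h])
      fix a assume a: "a \<in> carrier G" "a \<noteq> h"
      have "inv\<^bsub>G\<^esub> a \<otimes>\<^bsub>G\<^esub> h \<noteq> \<one>\<^bsub>G\<^esub>"
        using a h by (metis G.inv_closed G.inv_equality G.inv_inv)
      thus "u (z, a) = \<zero>\<^bsub>K\<^esub> \<or> \<one>\<^bsub>T\<^esub> (\<alpha> (inv\<^bsub>G\<^esub> a) z, inv\<^bsub>G\<^esub> a \<otimes>\<^bsub>G\<^esub> h) = \<zero>\<^bsub>K\<^esub>"
        using a h z by (simp add: T_apply act_closed)
    qed
    thus "(u \<otimes>\<^bsub>T\<^esub> \<one>\<^bsub>T\<^esub>) (z, h) = u (z, h)"
      using z h T_closed[OF u z h] by (simp add: T_apply act_closed)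
  qed (use u T_units_closed in \<open>auto intro!: T_ops_closed\<close>)
qed

lemma T_distrib:
  assumes "u \<in> carrier T" "v \<in> carrier T" "w \<in> carrier T"
  shows "(u \<oplus>\<^bsub>T\<^esub> v) \<otimes>\<^bsub>T\<^esub> w = u \<otimes>\<^bsub>T\<^esub> w \<oplus>\<^bsub>T\<^esub> v \<otimes>\<^bsub>T\<^esub> w"
    "w \<otimes>\<^bsub>T\<^esub> (u \<oplus>\<^bsub>T\<^esub> v) = w \<otimes>\<^bsub>T\<^esub> u \<oplus>\<^bsub>T\<^esub> w \<otimes>\<^bsub>T\<^esub> v"
proof -
  show "(u \<oplus>\<^bsub>T\<^esub> v) \<otimes>\<^bsub>T\<^esub> w = u \<otimes>\<^bsub>T\<^esub> w \<oplus>\<^bsub>T\<^esub> v \<otimes>\<^bsub>T\<^esub> w"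
  proof (rule T_eqI)
    fix z h assume z: "z \<in> Z" and h: "h \<in> carrier G"
    have c: "u (z, a) \<in> carrier K" "v (z, a) \<in> carrier K"
      "w (\<alpha> (inv\<^bsub>G\<^esub> a) z, inv\<^bsub>G\<^esub> a \<otimes>\<^bsub>G\<^esub> h) \<in> carrier K" if "a \<in> carrier G" for a
      using that assms z h by (auto intro!: T_closed act_closed)
    show "((u \<oplus>\<^bsub>T\<^esub> v) \<otimes>\<^bsub>T\<^esub> w) (z, h) = (u \<otimes>\<^bsub>T\<^esub> w \<oplus>\<^bsub>T\<^esub> v \<otimes>\<^bsub>T\<^esub> w) (z, h)"
      unfolding T_apply(1,5)[OF z h]
      using c z by (intro trans[OF K.finsum_cong' K.finsum_addf]) (auto simp: T_apply K.l_distr)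
  qed (use assms in \<open>auto intro!: T_ops_closed\<close>)
  show "w \<otimes>\<^bsub>T\<^esub> (u \<oplus>\<^bsub>T\<^esub> v) = w \<otimes>\<^bsub>T\<^esub> u \<oplus>\<^bsub>T\<^esub> w \<otimes>\<^bsub>T\<^esub> v"
  proof (rule T_eqI)
    fix z h assume z: "z \<in> Z" and h: "h \<in> carrier G"
    have c: "w (z, a) \<in> carrier K" "u (\<alpha> (inv\<^bsub>G\<^esub> a) z, inv\<^bsub>G\<^esub> a \<otimes>\<^bsub>G\<^esub> h) \<in> carrier K"
      "v (\<alpha> (inv\<^bsub>G\<^esub> a) z, inv\<^bsub>G\<^esub> a \<otimes>\<^bsub>G\<^esub> h) \<in> carrier K" if "a \<in> carrier G" for a
      using that assms z h by (auto intro!: T_closed act_closed)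
    show "(w \<otimes>\<^bsub>T\<^esub> (u \<oplus>\<^bsub>T\<^esub> v)) (z, h) = (w \<otimes>\<^bsub>T\<^esub> u \<oplus>\<^bsub>T\<^esub> w \<otimes>\<^bsub>T\<^esub> v) (z, h)"
      unfolding T_apply(1,5)[OF z h]
      using c z h by (intro trans[OF K.finsum_cong' K.finsum_addf])
        (auto simp: T_apply K.r_distr act_closed)
  qed (use assms in \<open>auto intro!: T_ops_closed\<close>)
qed

lemma T_abelian_group: "abelian_group T"
proof (rule abelian_groupI)
  fix u assume u: "u \<in> carrier T"
  let ?v = "\<lambda>p\<in>Z \<times> carrier G. \<ominus>\<^bsub>K\<^esub> u p"
  have v: "?v \<in> carrier T" using u by (auto simp: T_carrier)
  have "?v \<oplus>\<^bsub>T\<^esub> u = \<zero>\<^bsub>T\<^esub>"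
    using u v T_closed[OF u]
    by (intro T_eqI) (auto simp: T_apply K.l_neg intro!: T_ops_closed T_units_closed)
  thus "\<exists>v\<in>carrier T. v \<oplus>\<^bsub>T\<^esub> u = \<zero>\<^bsub>T\<^esub>" using v by blast
  show "\<zero>\<^bsub>T\<^esub> \<oplus>\<^bsub>T\<^esub> u = u"
    using u T_closed[OF u] by (intro T_eqI) (auto simp: T_apply intro!: T_ops_closed T_units_closed)
next
  fix u v assume u: "u \<in> carrier T" and v: "v \<in> carrier T"
  thus "u \<oplus>\<^bsub>T\<^esub> v = v \<oplus>\<^bsub>T\<^esub> u"
    using T_closed[OF u] T_closed[OF v]
    by (intro T_eqI) (auto simp: T_apply K.a_comm intro!: T_ops_closed)
next
  fix u v w assume u: "u \<in> carrier T" and v: "v \<in> carrier T" and w: "w \<in> carrier T"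
  thus "u \<oplus>\<^bsub>T\<^esub> v \<oplus>\<^bsub>T\<^esub> w = u \<oplus>\<^bsub>T\<^esub> (v \<oplus>\<^bsub>T\<^esub> w)"
    using T_closed[OF u] T_closed[OF v] T_closed[OF w]
    by (intro T_eqI) (auto simp: T_apply K.a_assoc intro!: T_ops_closed)
qed (auto intro!: T_ops_closed T_units_closed)

sublocale T: ring T
proof (intro ringI T_abelian_group Group.monoidI)
qed (auto intro!: T_ops_closed T_units_closed simp: T_assoc T_one_mult T_distrib)

lemma T_smult_mult:
  assumes "c \<in> carrier K" "u \<in> carrier T" "v \<in> carrier T"
  shows "(c \<odot>\<^bsub>T\<^esub> u) \<otimes>\<^bsub>T\<^esub> v = c \<odot>\<^bsub>T\<^esub> (u \<otimes>\<^bsub>T\<^esub> v)" "u \<otimes>\<^bsub>T\<^esub> (c \<odot>\<^bsub>T\<^esub> v) = c \<odot>\<^bsub>T\<^esub> (u \<otimes>\<^bsub>T\<^esub> v)"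
proof -
  show "(c \<odot>\<^bsub>T\<^esub> u) \<otimes>\<^bsub>T\<^esub> v = c \<odot>\<^bsub>T\<^esub> (u \<otimes>\<^bsub>T\<^esub> v)"
  proof (rule T_eqI)
    fix z h assume z: "z \<in> Z" and h: "h \<in> carrier G"
    have x: "u (z, a) \<in> carrier K" "v (\<alpha> (inv\<^bsub>G\<^esub> a) z, inv\<^bsub>G\<^esub> a \<otimes>\<^bsub>G\<^esub> h) \<in> carrier K"
      if "a \<in> carrier G" for a
      using that assms z h by (auto intro!: T_closed act_closed)
    show "((c \<odot>\<^bsub>T\<^esub> u) \<otimes>\<^bsub>T\<^esub> v) (z, h) = (c \<odot>\<^bsub>T\<^esub> (u \<otimes>\<^bsub>T\<^esub> v)) (z, h)"
      unfolding T_apply(2,5)[OF z h] using x z assms(1) finite_G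
      by (subst K.finsum_rdistr) (auto simp: T_apply K.m_assoc intro!: K.finsum_cong')
  qed (use assms in \<open>auto intro!: T_ops_closed T_smult_closed\<close>)
  show "u \<otimes>\<^bsub>T\<^esub> (c \<odot>\<^bsub>T\<^esub> v) = c \<odot>\<^bsub>T\<^esub> (u \<otimes>\<^bsub>T\<^esub> v)"
  proof (rule T_eqI)
    fix z h assume z: "z \<in> Z" and h: "h \<in> carrier G"
    have x: "u (z, a) \<in> carrier K" "v (\<alpha> (inv\<^bsub>G\<^esub> a) z, inv\<^bsub>G\<^esub> a \<otimes>\<^bsub>G\<^esub> h) \<in> carrier K"
      if "a \<in> carrier G" for a
      using that assms z h by (auto intro!: T_closed act_closed)
    show "(u \<otimes>\<^bsub>T\<^esub> (c \<odot>\<^bsub>T\<^esub> v)) (z, h) = (c \<odot>\<^bsub>T\<^esub> (u \<otimes>\<^bsub>T\<^esub> v)) (z, h)"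
      unfolding T_apply(2,5)[OF z h] using x z h assms(1) finite_G
      by (subst K.finsum_rdistr) (auto simp: T_apply K.m_lcomm act_closed intro!: K.finsum_cong')
  qed (use assms in \<open>auto intro!: T_ops_closed T_smult_closed\<close>)
qed

end

section \<open>Products and group algebras of stabilizers\<close>

lemma product_algebra_simps:
  "carrier (product_algebra I A) = (\<Pi>\<^sub>E i\<in>I. carrier (A i))"
  "i \<in> I \<Longrightarrow> (f \<otimes>\<^bsub>product_algebra I A\<^esub> h) i = f i \<otimes>\<^bsub>A i\<^esub> h i"
  "i \<in> I \<Longrightarrow> (f \<oplus>\<^bsub>product_algebra I A\<^esub> h) i = f i \<oplus>\<^bsub>A i\<^esub> h i"
  "i \<in> I \<Longrightarrow> (c \<odot>\<^bsub>product_algebra I A\<^esub> f) i = c \<odot>\<^bsub>A i\<^esub> f i"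
  "i \<in> I \<Longrightarrow> \<one>\<^bsub>product_algebra I A\<^esub> i = \<one>\<^bsub>A i\<^esub>"
  "i \<in> I \<Longrightarrow> \<zero>\<^bsub>product_algebra I A\<^esub> i = \<zero>\<^bsub>A i\<^esub>"
  by (simp_all add: product_algebra_def)

lemma product_algebra_closed:
  assumes "\<And>i. i \<in> I \<Longrightarrow> ring (A i)"
  shows "f \<in> carrier (product_algebra I A) \<Longrightarrow> h \<in> carrier (product_algebra I A)
      \<Longrightarrow> f \<otimes>\<^bsub>product_algebra I A\<^esub> h \<in> carrier (product_algebra I A)"
    "f \<in> carrier (product_algebra I A) \<Longrightarrow> h \<in> carrier (product_algebra I A)
      \<Longrightarrow> f \<oplus>\<^bsub>product_algebra I A\<^esub> h \<in> carrier (product_algebra I A)"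
    "\<one>\<^bsub>product_algebra I A\<^esub> \<in> carrier (product_algebra I A)"
    "\<zero>\<^bsub>product_algebra I A\<^esub> \<in> carrier (product_algebra I A)"
  using ring.ring_simprules(1,2,5,6)[OF assms] by (auto simp: product_algebra_def PiE_iff)

lemma product_algebra_eqI:
  assumes "f \<in> carrier (product_algebra I A)" "h \<in> carrier (product_algebra I A)"
    "\<And>i. i \<in> I \<Longrightarrow> f i = h i"
  shows "f = h"
  using assms unfolding product_algebra_simps(1) by (rule PiE_ext)

lemma product_algebra_ring:
  assumes "\<And>i. i \<in> I \<Longrightarrow> ring (A i)"
  shows "ring (product_algebra I A)"
proof -
  let ?P = "product_algebra I A"
  note cl = product_algebra_closed[of I A, OF assms]
  have mem: "f i \<in> carrier (A i)" if "f \<in> carrier ?P" "i \<in> I" for f i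
    using that by (auto simp: product_algebra_simps)
  show ?thesis
  proof (intro ringI abelian_groupI Group.monoidI)
    fix f assume f: "f \<in> carrier ?P"
    let ?g = "\<lambda>i\<in>I. \<ominus>\<^bsub>A i\<^esub> f i"
    have g: "?g \<in> carrier ?P"
      using mem[OF f] ring.ring_simprules(3)[OF assms] by (auto simp: product_algebra_simps)
    have "?g \<oplus>\<^bsub>?P\<^esub> f = \<zero>\<^bsub>?P\<^esub>"
      using mem[OF f] ring.ring_simprules(9)[OF assms] f g
      by (intro product_algebra_eqI[where I = I and A = A] cl) (auto simp: product_algebra_simps(2-))
    thus "\<exists>g\<in>carrier ?P. g \<oplus>\<^bsub>?P\<^esub> f = \<zero>\<^bsub>?P\<^esub>" using g by blast
    show "\<zero>\<^bsub>?P\<^esub> \<oplus>\<^bsub>?P\<^esub> f = f"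
      using f mem[OF f] ring.ring_simprules(8)[OF assms]
      by (intro product_algebra_eqI[where I = I and A = A] cl) (auto simp: product_algebra_simps(2-))
    show "\<one>\<^bsub>?P\<^esub> \<otimes>\<^bsub>?P\<^esub> f = f"
      using f mem[OF f] ring.ring_simprules(12)[OF assms]
      by (intro product_algebra_eqI[where I = I and A = A] cl) (auto simp: product_algebra_simps(2-))
    show "f \<otimes>\<^bsub>?P\<^esub> \<one>\<^bsub>?P\<^esub> = f"
      using f mem[OF f] monoid.r_one[OF ring.is_monoid[OF assms]]
      by (intro product_algebra_eqI[where I = I and A = A] cl) (auto simp: product_algebra_simps(2-))
  next
    fix f g assume f: "f \<in> carrier ?P" and g: "g \<in> carrier ?P"
    thus "f \<oplus>\<^bsub>?P\<^esub> g = g \<oplus>\<^bsub>?P\<^esub> f"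
      using mem[OF f] mem[OF g] ring.ring_simprules(10)[OF assms]
      by (intro product_algebra_eqI[where I = I and A = A] cl) (auto simp: product_algebra_simps(2-))
  next
    fix f g h assume f: "f \<in> carrier ?P" and g: "g \<in> carrier ?P" and h: "h \<in> carrier ?P"
    note m = mem[OF f] mem[OF g] mem[OF h]
    show "f \<oplus>\<^bsub>?P\<^esub> g \<oplus>\<^bsub>?P\<^esub> h = f \<oplus>\<^bsub>?P\<^esub> (g \<oplus>\<^bsub>?P\<^esub> h)"
      using f g h m ring.ring_simprules(7)[OF assms]
      by (intro product_algebra_eqI[where I = I and A = A] cl) (auto simp: product_algebra_simps(2-))
    show "f \<otimes>\<^bsub>?P\<^esub> g \<otimes>\<^bsub>?P\<^esub> h = f \<otimes>\<^bsub>?P\<^esub> (g \<otimes>\<^bsub>?P\<^esub> h)"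
      using f g h m ring.ring_simprules(11)[OF assms]
      by (intro product_algebra_eqI[where I = I and A = A] cl) (auto simp: product_algebra_simps(2-))
    show "(f \<oplus>\<^bsub>?P\<^esub> g) \<otimes>\<^bsub>?P\<^esub> h = f \<otimes>\<^bsub>?P\<^esub> h \<oplus>\<^bsub>?P\<^esub> g \<otimes>\<^bsub>?P\<^esub> h"
      using f g h m ring.ring_simprules(13)[OF assms]
      by (intro product_algebra_eqI[where I = I and A = A] cl) (auto simp: product_algebra_simps(2-))
    show "h \<otimes>\<^bsub>?P\<^esub> (f \<oplus>\<^bsub>?P\<^esub> g) = h \<otimes>\<^bsub>?P\<^esub> f \<oplus>\<^bsub>?P\<^esub> h \<otimes>\<^bsub>?P\<^esub> g"
      using f g h m ring.ring_simprules(23)[OF assms]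
      by (intro product_algebra_eqI[where I = I and A = A] cl) (auto simp: product_algebra_simps(2-))
  qed (auto intro!: cl)
qed

lemma (in monoid_algebra_setting) finsum_apply:
  assumes "finite D" "F \<in> D \<rightarrow> carrier \<A>"
  shows "(finsum \<A> F D) s = (\<Oplus>d\<in>D. F d s)"
proof -
  interpret A: ring \<A> by (rule ring_MA)
  show ?thesis
    using assms
    by (intro finsum_additive_map[OF A.abelian_monoid_axioms K.abelian_monoid_axioms, where h = "\<lambda>f. f s"])
      (auto simp: carrierD(1) zero_apply add_apply)
qed

context group
begin

lemma stabilizer_monoid_algebra:
  assumes "cring K" "subgroup H G"
  shows "monoid_algebra_setting K (G\<lparr>carrier := H\<rparr>)"
  using assms by (intro monoid_algebra_setting.intro group.is_monoid subgroup.subgroup_is_group is_group)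

lemma group_algebra_closedI:
  assumes "cring K" "subgroup H G" "finite H" "\<And>h. h \<in> H \<Longrightarrow> f h \<in> carrier K" "\<And>h. h \<notin> H \<Longrightarrow> f h = \<zero>\<^bsub>K\<^esub>"
  shows "f \<in> carrier (group_algebra K G H)"
proof -
  interpret monoid_algebra_setting K "G\<lparr>carrier := H\<rparr>"
    by (rule stabilizer_monoid_algebra) fact+
  have "f h \<in> carrier K" for h
    using assms(4,5)[of h] by (cases "h \<in> H") auto
  thus ?thesis
    unfolding group_algebra_def using assms by (intro carrierI[of _ H]) auto
qed

lemma group_algebra_closedD:
  assumes "cring K" "subgroup H G" "f \<in> carrier (group_algebra K G H)"
  shows "f h \<in> carrier K" "h \<notin> H \<Longrightarrow> f h = \<zero>\<^bsub>K\<^esub>"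
proof -
  interpret monoid_algebra_setting K "G\<lparr>carrier := H\<rparr>"
    by (rule stabilizer_monoid_algebra) fact+
  show "f h \<in> carrier K" "h \<notin> H \<Longrightarrow> f h = \<zero>\<^bsub>K\<^esub>"
    using carrierD(1,5)[of f h] assms(3) by (auto simp: group_algebra_def)
qed

text \<open>In a group, a pair with product \<open>s\<close> is determined by its first
  factor.\<close>

lemma group_algebra_mult_apply:
  assumes "cring K" "subgroup H G" "finite H" "f \<in> carrier (group_algebra K G H)"
    "f' \<in> carrier (group_algebra K G H)" "s \<in> H"
  shows "(f \<otimes>\<^bsub>group_algebra K G H\<^esub> f') s = (\<Oplus>\<^bsub>K\<^esub>a\<in>H. f a \<otimes>\<^bsub>K\<^esub> f' (inv a \<otimes> s))"
proof -
  have cancel: "a \<otimes> (inv a \<otimes> s) = s" if "a \<in> carrier G" "s \<in> carrier G" for a s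
    using that by (simp add: m_assoc[symmetric])
  interpret monoid_algebra_setting K "G\<lparr>carrier := H\<rparr>"
    by (rule stabilizer_monoid_algebra) fact+
  interpret H: subgroup H G by fact
  have f: "f \<in> carrier \<A>" and f': "f' \<in> carrier \<A>"
    using assms(4,5) by (simp_all add: group_algebra_def)
  note cf = carrierD(1)[OF f] and cf' = carrierD(1)[OF f']
  have HG: "a \<in> carrier G" if "a \<in> H" for a using that H.subset by auto
  have supp: "fsupp K f \<subseteq> H" "fsupp K f' \<subseteq> H"
    using carrierD(3)[OF f] carrierD(3)[OF f'] by auto
  have inner: "pairing (\<lambda>b. basis_element K s (a \<otimes> b)) f' = f' (inv a \<otimes> s)" if a: "a \<in> H" for a
  proof -
    have ib: "inv a \<otimes> s \<in> H" using a assms(6) by auto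
    have "pairing (\<lambda>b. basis_element K s (a \<otimes> b)) f' = (\<Oplus>\<^bsub>K\<^esub>b\<in>H. f' b \<otimes>\<^bsub>K\<^esub> basis_element K s (a \<otimes> b))"
      using f' supp assms(3) by (intro pairing_superset) (auto simp: basis_element_def)
    also have "\<dots> = f' (inv a \<otimes> s) \<otimes>\<^bsub>K\<^esub> basis_element K s (a \<otimes> (inv a \<otimes> s))"
    proof (rule K.finsum_single_term[OF assms(3) ib])
      fix b assume b: "b \<in> H" "b \<noteq> inv a \<otimes> s"
      have "a \<otimes> b \<noteq> s"
        using b a HG by (metis inv_solve_left assms(6))
      thus "f' b \<otimes>\<^bsub>K\<^esub> basis_element K s (a \<otimes> b) = \<zero>\<^bsub>K\<^esub>"
        using cf' by (simp add: basis_element_def)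
    qed (use cf' in \<open>auto simp: basis_element_def\<close>)
    also have "a \<otimes> (inv a \<otimes> s) = s"
      using HG[OF a] HG[OF assms(6)] by (rule cancel)
    finally show ?thesis
      using cf' by (simp add: basis_element_def)
  qed
  have "(f \<otimes>\<^bsub>\<A>\<^esub> f') s = pairing (basis_element K s) (f \<otimes>\<^bsub>\<A>\<^esub> f')"
    using f f' by (simp add: pairing_indicator mult_closed_MA)
  also have "\<dots> = pairing (\<lambda>a. pairing (\<lambda>b. basis_element K s (a \<otimes> b)) f') f"
    using pairing_mult[OF f f' basis_Pi, of s] by simp
  also have "\<dots> = (\<Oplus>\<^bsub>K\<^esub>a\<in>H. f a \<otimes>\<^bsub>K\<^esub> pairing (\<lambda>b. basis_element K s (a \<otimes> b)) f')"
    using f supp assms(3) pairing_translate_Pi[OF f' basis_Pi, of s] by (intro pairing_superset) auto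
  also have "\<dots> = (\<Oplus>\<^bsub>K\<^esub>a\<in>H. f a \<otimes>\<^bsub>K\<^esub> f' (inv a \<otimes> s))"
    using cf cf' inner by (intro K.finsum_cong') auto
  finally show ?thesis
    by (simp add: group_algebra_def)
qed

end

locale represented_action = finite_action K G Z \<alpha>
  for K :: "('k, 'e) ring_scheme" and G :: "('g, 'f) monoid_scheme" and Z :: "'z set"
    and \<alpha> :: "'g \<Rightarrow> 'z \<Rightarrow> 'z" +
  fixes r :: "'z set \<Rightarrow> 'z"
  assumes r_mem: "orb \<in> orbits G Z \<alpha> \<Longrightarrow> r orb \<in> orb"
begin

abbreviation Orb where "Orb \<equiv> orbits G Z \<alpha>"
abbreviation orb where "orb \<equiv> orbit G \<alpha>"
abbreviation stab where "stab B \<equiv> stabilizer G \<alpha> (r B)"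
abbreviation kH where "kH B \<equiv> group_algebra K G (stab B)"
abbreviation S where "S \<equiv> product_algebra Orb kH"

definition rep :: "'z \<Rightarrow> 'z" where "rep z = r (orb z)"

lemma orb_mem: "z \<in> Z \<Longrightarrow> orb z \<in> Orb"
  by (auto simp: orbits_def)

lemma orb_subset: "z \<in> Z \<Longrightarrow> orb z \<subseteq> Z"
  by (auto simp: orbit_def act_closed)

lemma orb_act: "h \<in> carrier G \<Longrightarrow> z \<in> Z \<Longrightarrow> orb (\<alpha> h z) = orb z"
proof -
  assume h: "h \<in> carrier G" and z: "z \<in> Z"
  have 1: "\<alpha> k (\<alpha> h z) = \<alpha> (k \<otimes>\<^bsub>G\<^esub> h) z" if "k \<in> carrier G" for k
    using that h z by (simp add: act_mult)
  have 2: "\<alpha> k z = \<alpha> (k \<otimes>\<^bsub>G\<^esub> inv\<^bsub>G\<^esub> h) (\<alpha> h z)" if "k \<in> carrier G" for k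
    using that h z by (simp add: act_mult act_closed act_inv)
  show "orb (\<alpha> h z) = orb z"
  proof (intro equalityI subsetI)
    fix x assume "x \<in> orb (\<alpha> h z)"
    then obtain k where k: "k \<in> carrier G" "x = \<alpha> k (\<alpha> h z)" by (auto simp: orbit_def)
    thus "x \<in> orb z" using 1[OF k(1)] h by (auto simp: orbit_def)
  next
    fix x assume "x \<in> orb z"
    then obtain k where k: "k \<in> carrier G" "x = \<alpha> k z" by (auto simp: orbit_def)
    hence "x = \<alpha> (k \<otimes>\<^bsub>G\<^esub> inv\<^bsub>G\<^esub> h) (\<alpha> h z)" using 2[OF k(1)] by simp
    thus "x \<in> orb (\<alpha> h z)" using k(1) h by (auto simp: orbit_def)
  qed
qed

lemma Orb_eq:
  assumes "B \<in> Orb" "z \<in> B"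
  shows "B = orb z" "z \<in> Z"
proof -
  obtain y where y: "y \<in> Z" "B = orb y" using assms(1) by (auto simp: orbits_def)
  then obtain k where "k \<in> carrier G" "z = \<alpha> k y" using assms(2) by (auto simp: orbit_def)
  thus "B = orb z" "z \<in> Z" using y orb_act act_closed by auto
qed

lemma rep_mem: "z \<in> Z \<Longrightarrow> rep z \<in> orb z" "z \<in> Z \<Longrightarrow> rep z \<in> Z"
  using r_mem[OF orb_mem] orb_subset by (auto simp: rep_def)

lemma orb_rep: "z \<in> Z \<Longrightarrow> orb (rep z) = orb z"
  using Orb_eq(1)[OF orb_mem rep_mem(1)] by simp

lemma rep_act: "h \<in> carrier G \<Longrightarrow> z \<in> Z \<Longrightarrow> rep (\<alpha> h z) = rep z"
  by (simp add: rep_def orb_act)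

lemma r_Z: "B \<in> Orb \<Longrightarrow> r B \<in> Z"
  using Orb_eq(2) r_mem by blast

lemma rep_orbit: "B \<in> Orb \<Longrightarrow> z \<in> B \<Longrightarrow> rep z = r B"
  using Orb_eq(1) by (simp add: rep_def)

lemma orb_r: "B \<in> Orb \<Longrightarrow> orb (r B) = B"
  using Orb_eq(1) r_mem by blast

text \<open>A transport arrow from the representative of the orbit to \<open>z\<close>.\<close>

definition \<gamma> :: "'z \<Rightarrow> 'g" where "\<gamma> z = (SOME h. h \<in> carrier G \<and> \<alpha> h (rep z) = z)"

lemma gamma:
  assumes "z \<in> Z"
  shows "\<gamma> z \<in> carrier G" "\<alpha> (\<gamma> z) (rep z) = z" "\<alpha> (inv\<^bsub>G\<^esub> \<gamma> z) z = rep z"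
proof -
  have "z \<in> orb (rep z)"
    using assms orb_rep orbit_refl by simp
  hence "\<exists>h. h \<in> carrier G \<and> \<alpha> h (rep z) = z"
    by (auto simp: orbit_def)
  thus 1: "\<gamma> z \<in> carrier G" "\<alpha> (\<gamma> z) (rep z) = z"
    unfolding \<gamma>_def by (metis (mono_tags, lifting) someI_ex)+
  show "\<alpha> (inv\<^bsub>G\<^esub> \<gamma> z) z = rep z"
    using act_inv(1)[OF 1(1) rep_mem(2)[OF assms]] 1(2) by simp
qed

lemma stab_subgroup: "B \<in> Orb \<Longrightarrow> subgroup (stab B) G"
  by (rule stabilizer_subgroup[OF r_Z])

lemma stab_iff: "h \<in> stab B \<longleftrightarrow> h \<in> carrier G \<and> \<alpha> h (r B) = r B"
  by (auto simp: stabilizer_def)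

lemma finite_stab: "finite (stab B)"
  using finite_G by (rule finite_subset[rotated]) (auto simp: stab_iff)

lemma kH_ring: "B \<in> Orb \<Longrightarrow> ring (kH B)"
  using monoid_algebra_setting.ring_MA[OF G.stabilizer_monoid_algebra[OF K.cring_axioms stab_subgroup]]
  by (simp add: group_algebra_def)

lemma S_ring: "ring S"
  by (intro product_algebra_ring kH_ring)

lemmas kH_closedI = G.group_algebra_closedI[OF K.cring_axioms stab_subgroup finite_stab]
lemmas kH_closedD = G.group_algebra_closedD[OF K.cring_axioms stab_subgroup]
lemmas kH_mult = G.group_algebra_mult_apply[OF K.cring_axioms stab_subgroup finite_stab]

lemma kH_apply:
  "(f \<oplus>\<^bsub>kH B\<^esub> f') h = f h \<oplus>\<^bsub>K\<^esub> f' h" "(c \<odot>\<^bsub>kH B\<^esub> f) h = c \<otimes>\<^bsub>K\<^esub> f h"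
  "\<zero>\<^bsub>kH B\<^esub> h = \<zero>\<^bsub>K\<^esub>" "\<one>\<^bsub>kH B\<^esub> h = (if h = \<one>\<^bsub>G\<^esub> then \<one>\<^bsub>K\<^esub> else \<zero>\<^bsub>K\<^esub>)"
  by (simp_all add: group_algebra_def monoid_algebra_def)

end

lemma matrix_algebra_closed:
  assumes "ring R"
  shows "M \<in> carrier (matrix_algebra d R) \<Longrightarrow> N \<in> carrier (matrix_algebra d R)
      \<Longrightarrow> M \<otimes>\<^bsub>matrix_algebra d R\<^esub> N \<in> carrier (matrix_algebra d R)"
    "M \<in> carrier (matrix_algebra d R) \<Longrightarrow> N \<in> carrier (matrix_algebra d R)
      \<Longrightarrow> M \<oplus>\<^bsub>matrix_algebra d R\<^esub> N \<in> carrier (matrix_algebra d R)"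
    "\<one>\<^bsub>matrix_algebra d R\<^esub> \<in> carrier (matrix_algebra d R)"
proof -
  interpret ring R by fact
  show "M \<in> carrier (matrix_algebra d R) \<Longrightarrow> N \<in> carrier (matrix_algebra d R)
      \<Longrightarrow> M \<otimes>\<^bsub>matrix_algebra d R\<^esub> N \<in> carrier (matrix_algebra d R)"
    by (auto simp: matrix_algebra_def PiE_iff intro!: finsum_closed m_closed)
  show "M \<in> carrier (matrix_algebra d R) \<Longrightarrow> N \<in> carrier (matrix_algebra d R)
      \<Longrightarrow> M \<oplus>\<^bsub>matrix_algebra d R\<^esub> N \<in> carrier (matrix_algebra d R)"
    "\<one>\<^bsub>matrix_algebra d R\<^esub> \<in> carrier (matrix_algebra d R)"
    by (auto simp: matrix_algebra_def PiE_iff)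
qed

lemma matrix_algebra_simps:
  "carrier (matrix_algebra d R) = {..<d} \<times> {..<d} \<rightarrow>\<^sub>E carrier R"
  "i < d \<Longrightarrow> j < d \<Longrightarrow> (M \<otimes>\<^bsub>matrix_algebra d R\<^esub> N) (i, j) = (\<Oplus>\<^bsub>R\<^esub>l\<in>{..<d}. M (i, l) \<otimes>\<^bsub>R\<^esub> N (l, j))"
  "i < d \<Longrightarrow> j < d \<Longrightarrow> (M \<oplus>\<^bsub>matrix_algebra d R\<^esub> N) (i, j) = M (i, j) \<oplus>\<^bsub>R\<^esub> N (i, j)"
  "i < d \<Longrightarrow> j < d \<Longrightarrow> (c \<odot>\<^bsub>matrix_algebra d R\<^esub> M) (i, j) = c \<odot>\<^bsub>R\<^esub> M (i, j)"
  "i < d \<Longrightarrow> j < d \<Longrightarrow> \<one>\<^bsub>matrix_algebra d R\<^esub> (i, j) = (if i = j then \<one>\<^bsub>R\<^esub> else \<zero>\<^bsub>R\<^esub>)"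
  by (simp_all add: matrix_algebra_def)

context represented_action
begin

section \<open>The transformation algebra as a product of matrix algebras\<close>

lemma G_cancel:
  assumes "a \<in> carrier G" "b \<in> carrier G"
  shows "inv\<^bsub>G\<^esub> a \<otimes>\<^bsub>G\<^esub> (a \<otimes>\<^bsub>G\<^esub> b) = b" "a \<otimes>\<^bsub>G\<^esub> (inv\<^bsub>G\<^esub> a \<otimes>\<^bsub>G\<^esub> b) = b"
  using assms by (simp_all add: G.m_assoc[symmetric])

text \<open>The arrow from \<open>y\<close> to \<open>x\<close> obtained from a loop
  \<open>h\<close> at the common representative by transport.\<close>

definition arrow :: "'z \<Rightarrow> 'g \<Rightarrow> 'z \<Rightarrow> 'g" where
  "arrow x h y = \<gamma> x \<otimes>\<^bsub>G\<^esub> h \<otimes>\<^bsub>G\<^esub> inv\<^bsub>G\<^esub> \<gamma> y"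

lemma arrow_closed: "x \<in> Z \<Longrightarrow> y \<in> Z \<Longrightarrow> h \<in> carrier G \<Longrightarrow> arrow x h y \<in> carrier G"
  by (simp add: arrow_def gamma)

lemma arrow_source:
  assumes "B \<in> Orb" "x \<in> B" "y \<in> B" "h \<in> stab B"
  shows "\<alpha> (inv\<^bsub>G\<^esub> arrow x h y) x = y"
proof -
  have Z: "x \<in> Z" "y \<in> Z" using Orb_eq(2) assms by blast+
  have h: "h \<in> carrier G" "\<alpha> h (r B) = r B" using assms(4) by (simp_all add: stab_iff)
  have rep: "rep x = r B" "rep y = r B" using rep_orbit assms by auto
  have "\<alpha> (arrow x h y) y = x"
    unfolding arrow_def using Z h rep gamma[OF Z(1)] gamma[OF Z(2)] r_Z[OF assms(1)]
    by (simp add: act_mult act_closed)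
  thus ?thesis
    using act_inv(1)[OF arrow_closed[OF Z h(1)] Z(2)] by simp
qed

lemma arrow_compose:
  assumes "x \<in> Z" "y \<in> Z" "w \<in> Z" "h \<in> carrier G" "k \<in> carrier G"
  shows "inv\<^bsub>G\<^esub> arrow x h y \<otimes>\<^bsub>G\<^esub> arrow x k w = arrow y (inv\<^bsub>G\<^esub> h \<otimes>\<^bsub>G\<^esub> k) w"
  using assms by (simp add: arrow_def gamma G.inv_mult_group G.m_assoc G_cancel)

lemma arrow_inverse:
  assumes "B \<in> Orb" "x \<in> B" "k \<in> carrier G"
  shows "\<alpha> (inv\<^bsub>G\<^esub> k) x \<in> B" "inv\<^bsub>G\<^esub> \<gamma> x \<otimes>\<^bsub>G\<^esub> k \<otimes>\<^bsub>G\<^esub> \<gamma> (\<alpha> (inv\<^bsub>G\<^esub> k) x) \<in> stab B"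
    "arrow x (inv\<^bsub>G\<^esub> \<gamma> x \<otimes>\<^bsub>G\<^esub> k \<otimes>\<^bsub>G\<^esub> \<gamma> (\<alpha> (inv\<^bsub>G\<^esub> k) x)) (\<alpha> (inv\<^bsub>G\<^esub> k) x) = k"
proof -
  have x: "x \<in> Z" using Orb_eq(2) assms by blast
  let ?y = "\<alpha> (inv\<^bsub>G\<^esub> k) x"
  have y: "?y \<in> Z" using x assms(3) by (simp add: act_closed)
  show "?y \<in> B"
    using orbit_refl[OF y] orb_act[of "inv\<^bsub>G\<^esub> k" x] x assms Orb_eq(1)[OF assms(1,2)] by simp
  hence rep: "rep x = r B" "rep ?y = r B" using rep_orbit assms by auto
  have "\<alpha> (\<gamma> ?y) (r B) = ?y" using gamma(2)[OF y] rep by simp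
  thus "inv\<^bsub>G\<^esub> \<gamma> x \<otimes>\<^bsub>G\<^esub> k \<otimes>\<^bsub>G\<^esub> \<gamma> ?y \<in> stab B"
    using x y assms(3) gamma[OF x] gamma[OF y] rep r_Z[OF assms(1)]
    by (simp add: stab_iff act_mult act_closed act_inv)
  show "arrow x (inv\<^bsub>G\<^esub> \<gamma> x \<otimes>\<^bsub>G\<^esub> k \<otimes>\<^bsub>G\<^esub> \<gamma> ?y) ?y = k"
    using x y assms(3) gamma(1)[OF x] gamma(1)[OF y]
    by (simp add: arrow_def G.m_assoc G_cancel)
qed

lemma arrow_label:
  assumes "x \<in> Z" "y \<in> Z" "h \<in> carrier G"
  shows "inv\<^bsub>G\<^esub> \<gamma> x \<otimes>\<^bsub>G\<^esub> arrow x h y \<otimes>\<^bsub>G\<^esub> \<gamma> y = h"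
  using assms by (simp add: arrow_def gamma G.m_assoc G_cancel)

text \<open>The group elements are the arrows into \<open>x\<close>. Such an arrow is determined
  by its source \<open>y\<close>, which ranges over the orbit, and by the loop
  \<open>\<gamma>\<^sub>x\<^sup>-\<^sup>1 k \<gamma>\<^sub>y\<close> at the
  representative.\<close>

lemma arrow_bij:
  assumes "B \<in> Orb" "x \<in> B"
  shows "bij_betw (\<lambda>p. arrow x (snd p) (fst p)) (B \<times> stab B) (carrier G)"
proof (rule bij_betw_byWitness[where f' =
      "\<lambda>k. (\<alpha> (inv\<^bsub>G\<^esub> k) x, inv\<^bsub>G\<^esub> \<gamma> x \<otimes>\<^bsub>G\<^esub> k \<otimes>\<^bsub>G\<^esub> \<gamma> (\<alpha> (inv\<^bsub>G\<^esub> k) x))"])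
  have Z: "y \<in> Z" if "y \<in> B" for y using Orb_eq(2) assms(1) that by blast
  show "\<forall>p\<in>B \<times> stab B. (\<lambda>k. (\<alpha> (inv\<^bsub>G\<^esub> k) x, inv\<^bsub>G\<^esub> \<gamma> x \<otimes>\<^bsub>G\<^esub> k \<otimes>\<^bsub>G\<^esub> \<gamma> (\<alpha> (inv\<^bsub>G\<^esub> k) x)))
      (arrow x (snd p) (fst p)) = p"
    using arrow_source[OF assms] arrow_label[OF Z[OF assms(2)] Z] by (auto simp: stab_iff)
  show "\<forall>k\<in>carrier G. (\<lambda>p. arrow x (snd p) (fst p))
      (\<alpha> (inv\<^bsub>G\<^esub> k) x, inv\<^bsub>G\<^esub> \<gamma> x \<otimes>\<^bsub>G\<^esub> k \<otimes>\<^bsub>G\<^esub> \<gamma> (\<alpha> (inv\<^bsub>G\<^esub> k) x)) = k"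
    using arrow_inverse(3)[OF assms] by simp
  show "(\<lambda>p. arrow x (snd p) (fst p)) ` (B \<times> stab B) \<subseteq> carrier G"
    using arrow_closed[OF Z[OF assms(2)] Z] by (auto simp: stab_iff)
  show "(\<lambda>k. (\<alpha> (inv\<^bsub>G\<^esub> k) x, inv\<^bsub>G\<^esub> \<gamma> x \<otimes>\<^bsub>G\<^esub> k \<otimes>\<^bsub>G\<^esub> \<gamma> (\<alpha> (inv\<^bsub>G\<^esub> k) x))) ` carrier G \<subseteq> B \<times> stab B"
    using arrow_inverse(1,2)[OF assms] by auto
qed

definition enum :: "'z set \<Rightarrow> nat \<Rightarrow> 'z" where
  "enum B = (SOME f. bij_betw f {..<card B} B)"

lemma enum: "B \<in> Orb \<Longrightarrow> bij_betw (enum B) {..<card B} B"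
proof -
  assume B: "B \<in> Orb"
  have "finite B"
    using Orb_eq(2)[OF B] finite_subset[OF _ finite_Z] by blast
  then obtain f where "bij_betw f {0..<card B} B" using ex_bij_betw_nat_finite by blast
  thus ?thesis
    unfolding enum_def atLeast0LessThan by (rule someI[of "\<lambda>f. bij_betw f {..<card B} B"])
qed

lemma enum_mem: "B \<in> Orb \<Longrightarrow> i < card B \<Longrightarrow> enum B i \<in> B"
  "B \<in> Orb \<Longrightarrow> i < card B \<Longrightarrow> enum B i \<in> Z"
  using bij_betw_apply[OF enum] Orb_eq(2) by blast+

abbreviation Mats where "Mats \<equiv> product_algebra Orb (\<lambda>B. matrix_algebra (card B) (kH B))"

text \<open>The entry \<open>(i, j)\<close> collects the coefficients of all arrows from the point
  number \<open>j\<close> to the point number \<open>i\<close> of the orbit, indexed by their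
  loops at the representative.\<close>

definition \<Theta> :: "('z \<times> 'g \<Rightarrow> 'k) \<Rightarrow> 'z set \<Rightarrow> nat \<times> nat \<Rightarrow> 'g \<Rightarrow> 'k" where
  "\<Theta> u = (\<lambda>B\<in>Orb. \<lambda>(i, j)\<in>{..<card B} \<times> {..<card B}. \<lambda>h.
     if h \<in> stab B then u (enum B i, arrow (enum B i) h (enum B j)) else \<zero>\<^bsub>K\<^esub>)"

lemma Theta_apply:
  "B \<in> Orb \<Longrightarrow> i < card B \<Longrightarrow> j < card B
    \<Longrightarrow> \<Theta> u B (i, j) = (\<lambda>h. if h \<in> stab B then u (enum B i, arrow (enum B i) h (enum B j)) else \<zero>\<^bsub>K\<^esub>)"
  by (simp add: \<Theta>_def)

lemma Theta_entry:
  assumes "u \<in> carrier T" "B \<in> Orb" "i < card B" "j < card B"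
  shows "\<Theta> u B (i, j) \<in> carrier (kH B)"
proof -
  have "u (enum B i, arrow (enum B i) h (enum B j)) \<in> carrier K" if "h \<in> stab B" for h
    using that enum_mem(2)[OF assms(2)] assms by (intro T_closed arrow_closed) (auto simp: stab_iff)
  thus ?thesis
    unfolding Theta_apply[OF assms(2-4)] using assms(2) by (intro kH_closedI) auto
qed

lemma Theta_closed: "u \<in> carrier T \<Longrightarrow> \<Theta> u \<in> carrier Mats"
  unfolding product_algebra_simps matrix_algebra_simps
  using Theta_entry[of u] by (auto simp: PiE_iff \<Theta>_def)

lemma Mats_entry:
  assumes "N \<in> carrier Mats" "B \<in> Orb" "i < card B" "j < card B"
  shows "N B (i, j) \<in> carrier (kH B)"
  using assms by (auto simp: product_algebra_simps matrix_algebra_simps PiE_iff)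

lemma Mats_eqI:
  assumes "N \<in> carrier Mats" "N' \<in> carrier Mats"
    and "\<And>B i j h. B \<in> Orb \<Longrightarrow> i < card B \<Longrightarrow> j < card B \<Longrightarrow> h \<in> stab B \<Longrightarrow> N B (i, j) h = N' B (i, j) h"
  shows "N = N'"
proof (rule product_algebra_eqI[OF assms(1,2)])
  fix B assume B: "B \<in> Orb"
  have "N B \<in> {..<card B} \<times> {..<card B} \<rightarrow>\<^sub>E carrier (kH B)"
    "N' B \<in> {..<card B} \<times> {..<card B} \<rightarrow>\<^sub>E carrier (kH B)"
    using PiE_mem[OF assms(1)[unfolded product_algebra_simps(1)] B]
      PiE_mem[OF assms(2)[unfolded product_algebra_simps(1)] B]
    by (simp_all only: matrix_algebra_simps(1))
  thus "N B = N' B"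
  proof (rule PiE_ext)
    fix p assume "p \<in> {..<card B} \<times> {..<card B}"
    then obtain i j where p: "p = (i, j)" "i < card B" "j < card B" by auto
    show "N B p = N' B p"
    proof
      fix h show "N B p h = N' B p h"
        using assms(3)[OF B p(2,3)] kH_closedD(2)[OF B Mats_entry[OF assms(1) B p(2,3)], of h]
          kH_closedD(2)[OF B Mats_entry[OF assms(2) B p(2,3)], of h] p(1)
        by (cases "h \<in> stab B") auto
    qed
  qed
qed

lemma Mats_closed:
  shows "N \<in> carrier Mats \<Longrightarrow> N' \<in> carrier Mats \<Longrightarrow> N \<otimes>\<^bsub>Mats\<^esub> N' \<in> carrier Mats"
    "N \<in> carrier Mats \<Longrightarrow> N' \<in> carrier Mats \<Longrightarrow> N \<oplus>\<^bsub>Mats\<^esub> N' \<in> carrier Mats"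
    "\<one>\<^bsub>Mats\<^esub> \<in> carrier Mats"
  using matrix_algebra_closed[OF kH_ring] by (auto simp: product_algebra_def PiE_iff)

lemma Mats_smult_closed:
  assumes "c \<in> carrier K" "N \<in> carrier Mats"
  shows "c \<odot>\<^bsub>Mats\<^esub> N \<in> carrier Mats"
proof -
  have "c \<odot>\<^bsub>kH B\<^esub> f \<in> carrier (kH B)" if B: "B \<in> Orb" and f: "f \<in> carrier (kH B)" for B f
    using kH_closedD[OF B f] assms(1) B by (intro kH_closedI) (auto simp: kH_apply)
  thus ?thesis
    using Mats_entry[OF assms(2)] by (auto simp: product_algebra_def matrix_algebra_def PiE_iff)
qed

text \<open>The product in the transformation algebra sums over the first arrows \<open>a\<close>
  into \<open>x\<close>. By \<open>arrow_bij\<close> this is a sum over intermediate points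
  \<open>w\<close> and loops: the former is the sum of the matrix product, the latter that of the
  product in the group algebra.\<close>

lemma Theta_mult:
  assumes u: "u \<in> carrier T" and v: "v \<in> carrier T"
  shows "\<Theta> (u \<otimes>\<^bsub>T\<^esub> v) = \<Theta> u \<otimes>\<^bsub>Mats\<^esub> \<Theta> v"
proof (rule Mats_eqI)
  fix B i j h assume B: "B \<in> Orb" and i: "i < card B" and j: "j < card B" and h: "h \<in> stab B"
  let ?x = "enum B i" and ?y = "enum B j" and ?d = "{..<card B}"
  have x: "?x \<in> B" "?x \<in> Z" and y: "?y \<in> B" "?y \<in> Z" using enum_mem B i j by auto
  have Z: "w \<in> Z" if "w \<in> B" for w using Orb_eq(2) B that by blast
  have hG: "h \<in> carrier G" using h by (simp add: stab_iff)
  have finB: "finite B" using enum[OF B] by (meson bij_betw_finite finite_lessThan)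
  interpret kB: monoid_algebra_setting K "G\<lparr>carrier := stab B\<rparr>"
    by (intro G.stabilizer_monoid_algebra stab_subgroup B K.cring_axioms)
  interpret sB: subgroup "stab B" G by (rule stab_subgroup[OF B])
  interpret kR: ring "kH B" by (rule kH_ring[OF B])
  let ?t = "\<lambda>w a. u (?x, arrow ?x a w) \<otimes>\<^bsub>K\<^esub> v (w, arrow w (inv\<^bsub>G\<^esub> a \<otimes>\<^bsub>G\<^esub> h) ?y)"
  have tc: "?t w a \<in> carrier K" if "w \<in> B" "a \<in> stab B" for w a
    using that u v x y Z[OF that(1)] hG by (intro K.m_closed T_closed arrow_closed) (auto simp: stab_iff)
  let ?s = "\<lambda>a. u (?x, a) \<otimes>\<^bsub>K\<^esub> v (\<alpha> (inv\<^bsub>G\<^esub> a) ?x, inv\<^bsub>G\<^esub> a \<otimes>\<^bsub>G\<^esub> arrow ?x h ?y)"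
  have st: "?s (arrow ?x (snd p) (fst p)) = ?t (fst p) (snd p)" if "p \<in> B \<times> stab B" for p
  proof -
    have p: "fst p \<in> B" "snd p \<in> stab B" "snd p \<in> carrier G" using that by (auto simp: stab_iff)
    show ?thesis
      using arrow_source[OF B x(1) p(1,2)] arrow_compose[OF x(2) Z[OF p(1)] y(2) p(3) hG] by simp
  qed
  have "\<Theta> (u \<otimes>\<^bsub>T\<^esub> v) B (i, j) h = (\<Oplus>\<^bsub>K\<^esub>a\<in>carrier G. ?s a)"
    using Theta_apply[OF B i j] h T_apply(5)[OF x(2) arrow_closed[OF x(2) y(2) hG]] by simp
  also have "\<dots> = (\<Oplus>\<^bsub>K\<^esub>a\<in>(\<lambda>p. arrow ?x (snd p) (fst p)) ` (B \<times> stab B). ?s a)"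
    using arrow_bij[OF B x(1)] by (simp add: bij_betw_def)
  also have "\<dots> = (\<Oplus>\<^bsub>K\<^esub>p\<in>B \<times> stab B. ?s (arrow ?x (snd p) (fst p)))"
    using arrow_bij[OF B x(1)] term_closed[OF u v x(2) arrow_closed[OF x(2) y(2) hG]]
    by (intro K.finsum_reindex) (auto simp: bij_betw_def)
  also have "\<dots> = (\<Oplus>\<^bsub>K\<^esub>p\<in>B \<times> stab B. ?t (fst p) (snd p))"
    using st tc by (intro K.finsum_cong') auto
  also have "\<dots> = (\<Oplus>\<^bsub>K\<^esub>w\<in>B. \<Oplus>\<^bsub>K\<^esub>a\<in>stab B. ?t w a)"
    using tc finB finite_stab by (intro K.finsum_product[symmetric]) auto
  also have "\<dots> = (\<Oplus>\<^bsub>K\<^esub>w\<in>enum B ` ?d. \<Oplus>\<^bsub>K\<^esub>a\<in>stab B. ?t w a)"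
    using enum[OF B] by (simp add: bij_betw_def)
  also have "\<dots> = (\<Oplus>\<^bsub>K\<^esub>l\<in>?d. \<Oplus>\<^bsub>K\<^esub>a\<in>stab B. ?t (enum B l) a)"
    using enum[OF B] tc by (intro K.finsum_reindex) (auto simp: bij_betw_def intro!: K.finsum_closed)
  also have "\<dots> = (\<Oplus>\<^bsub>K\<^esub>l\<in>?d. (\<Theta> u B (i, l) \<otimes>\<^bsub>kH B\<^esub> \<Theta> v B (l, j)) h)"
  proof (rule K.finsum_cong', goal_cases)
    case (3 l)
    hence l: "l < card B" by simp
    have "(\<Theta> u B (i, l) \<otimes>\<^bsub>kH B\<^esub> \<Theta> v B (l, j)) h
        = (\<Oplus>\<^bsub>K\<^esub>a\<in>stab B. \<Theta> u B (i, l) a \<otimes>\<^bsub>K\<^esub> \<Theta> v B (l, j) (inv\<^bsub>G\<^esub> a \<otimes>\<^bsub>G\<^esub> h))"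
      by (rule kH_mult[OF B Theta_entry[OF u B i l] Theta_entry[OF v B l j] h])
    also have "\<dots> = (\<Oplus>\<^bsub>K\<^esub>a\<in>stab B. ?t (enum B l) a)"
      using tc enum_mem(1)[OF B l] h by (intro K.finsum_cong') (auto simp: Theta_apply B i j l)
    finally show ?case ..
  next
    case 2
    show ?case
      using kH_closedD(1)[OF B kR.m_closed[OF Theta_entry[OF u B i] Theta_entry[OF v B _ j]]] by auto
  qed simp
  also have "\<dots> = (\<Oplus>\<^bsub>kH B\<^esub>l\<in>?d. \<Theta> u B (i, l) \<otimes>\<^bsub>kH B\<^esub> \<Theta> v B (l, j)) h"
    using kB.finsum_apply[of ?d "\<lambda>l. \<Theta> u B (i, l) \<otimes>\<^bsub>kH B\<^esub> \<Theta> v B (l, j)" h]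
      kR.m_closed[OF Theta_entry[OF u B i] Theta_entry[OF v B _ j]]
    by (auto simp: group_algebra_def)
  also have "\<dots> = (\<Theta> u \<otimes>\<^bsub>Mats\<^esub> \<Theta> v) B (i, j) h"
    using B i j by (simp add: product_algebra_simps matrix_algebra_simps)
  finally show "\<Theta> (u \<otimes>\<^bsub>T\<^esub> v) B (i, j) h = (\<Theta> u \<otimes>\<^bsub>Mats\<^esub> \<Theta> v) B (i, j) h" .
qed (use assms in \<open>auto intro!: Theta_closed Mats_closed T_ops_closed\<close>)

lemma Theta_linear:
  assumes u: "u \<in> carrier T" and v: "v \<in> carrier T" and c: "c \<in> carrier K"
  shows "\<Theta> (u \<oplus>\<^bsub>T\<^esub> v) = \<Theta> u \<oplus>\<^bsub>Mats\<^esub> \<Theta> v" "\<Theta> (c \<odot>\<^bsub>T\<^esub> u) = c \<odot>\<^bsub>Mats\<^esub> \<Theta> u"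
proof -
  have ar: "arrow (enum B i) h (enum B j) \<in> carrier G" "enum B i \<in> Z"
    if "B \<in> Orb" "i < card B" "j < card B" "h \<in> stab B" for B i j h
    using that enum_mem(2) by (auto intro!: arrow_closed simp: stab_iff)
  show "\<Theta> (u \<oplus>\<^bsub>T\<^esub> v) = \<Theta> u \<oplus>\<^bsub>Mats\<^esub> \<Theta> v"
    using u v ar
    by (intro Mats_eqI Theta_closed Mats_closed Mats_smult_closed T_ops_closed T_smult_closed)
      (auto simp: product_algebra_simps matrix_algebra_simps Theta_apply kH_apply T_apply)
  show "\<Theta> (c \<odot>\<^bsub>T\<^esub> u) = c \<odot>\<^bsub>Mats\<^esub> \<Theta> u"
    using u c ar
    by (intro Mats_eqI Theta_closed Mats_closed Mats_smult_closed T_ops_closed T_smult_closed)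
      (auto simp: product_algebra_simps matrix_algebra_simps Theta_apply kH_apply T_apply)
qed

lemma Theta_one: "\<Theta> \<one>\<^bsub>T\<^esub> = \<one>\<^bsub>Mats\<^esub>"
proof (rule Mats_eqI)
  fix B i j h assume B: "B \<in> Orb" and i: "i < card B" and j: "j < card B" and h: "h \<in> stab B"
  let ?x = "enum B i" and ?y = "enum B j"
  have x: "?x \<in> B" "?x \<in> Z" and y: "?y \<in> B" "?y \<in> Z" using enum_mem B i j by auto
  have hG: "h \<in> carrier G" using h by (simp add: stab_iff)
  have "arrow ?x h ?y = \<one>\<^bsub>G\<^esub> \<longleftrightarrow> i = j \<and> h = \<one>\<^bsub>G\<^esub>"
  proof
    assume eq: "arrow ?x h ?y = \<one>\<^bsub>G\<^esub>"
    have "?x = ?y"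
      using arrow_source[OF B x(1) y(1) h] x unfolding eq by (simp add: act_one)
    hence "i = j"
      using enum[OF B] i j by (metis bij_betw_imp_inj_on inj_onD lessThan_iff)
    moreover have "h = \<one>\<^bsub>G\<^esub>"
      using arrow_label[OF x(2) y(2) hG] eq \<open>?x = ?y\<close> gamma(1)[OF x(2)] by simp
    ultimately show "i = j \<and> h = \<one>\<^bsub>G\<^esub>" by blast
  next
    assume "i = j \<and> h = \<one>\<^bsub>G\<^esub>"
    thus "arrow ?x h ?y = \<one>\<^bsub>G\<^esub>"
      using gamma(1)[OF x(2)] by (simp add: arrow_def)
  qed
  thus "\<Theta> \<one>\<^bsub>T\<^esub> B (i, j) h = \<one>\<^bsub>Mats\<^esub> B (i, j) h"
    using B i j h x y hG
    by (simp add: product_algebra_simps matrix_algebra_simps Theta_apply kH_apply T_apply arrow_closed)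
qed (auto intro!: Theta_closed Mats_closed T_units_closed)

definition idx :: "'z \<Rightarrow> nat" where "idx z = inv_into {..<card (orb z)} (enum (orb z)) z"

lemma idx:
  assumes "B \<in> Orb" "z \<in> B"
  shows "idx z < card B" "enum B (idx z) = z"
proof -
  have B: "orb z = B" using Orb_eq(1)[OF assms] by simp
  have im: "enum B ` {..<card B} = B" using enum[OF assms(1)] by (simp add: bij_betw_def)
  have "idx z \<in> {..<card B}"
    unfolding idx_def B by (rule inv_into_into) (use assms im in simp)
  thus "idx z < card B" by simp
  show "enum B (idx z) = z"
    unfolding idx_def B by (rule f_inv_into_f) (use assms im in simp)
qed

lemma idx_enum: "B \<in> Orb \<Longrightarrow> i < card B \<Longrightarrow> idx (enum B i) = i"
  using idx[of B "enum B i"] enum enum_mem(1) by (metis bij_betw_imp_inj_on inj_onD lessThan_iff)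

text \<open>The inverse of \<open>\<Theta>\<close>: the arrow \<open>k\<close> into
  \<open>z\<close> has the source \<open>k\<^sup>-\<^sup>1 z\<close>, and its loop is
  \<open>\<gamma>\<^sub>z\<^sup>-\<^sup>1 k \<gamma>\<close> with \<open>\<gamma>\<close> taken at
  the source.\<close>

definition \<Xi> :: "('z set \<Rightarrow> nat \<times> nat \<Rightarrow> 'g \<Rightarrow> 'k) \<Rightarrow> 'z \<times> 'g \<Rightarrow> 'k" where
  "\<Xi> N = (\<lambda>(z, k)\<in>Z \<times> carrier G. N (orb z) (idx z, idx (\<alpha> (inv\<^bsub>G\<^esub> k) z))
     (inv\<^bsub>G\<^esub> \<gamma> z \<otimes>\<^bsub>G\<^esub> k \<otimes>\<^bsub>G\<^esub> \<gamma> (\<alpha> (inv\<^bsub>G\<^esub> k) z)))"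

lemma Theta_bij: "bij_betw \<Theta> (carrier T) (carrier Mats)"
proof (rule bij_betw_byWitness[where f' = \<Xi>])
  have Xi_closed: "\<Xi> N \<in> carrier T" if N: "N \<in> carrier Mats" for N
    unfolding T_carrier
  proof (rule PiE_I)
    fix p assume "p \<in> Z \<times> carrier G"
    then obtain z k where p: "p = (z, k)" "z \<in> Z" "k \<in> carrier G" by auto
    note z = orbit_refl[OF p(2)]
    show "\<Xi> N p \<in> carrier K"
      using p kH_closedD(1)[OF orb_mem[OF p(2)] Mats_entry[OF N orb_mem[OF p(2)]
            idx(1)[OF orb_mem[OF p(2)] z] idx(1)[OF orb_mem[OF p(2)] arrow_inverse(1)[OF orb_mem[OF p(2)] z p(3)]]]]
      by (simp add: \<Xi>_def)
  qed (simp add: \<Xi>_def)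
  show "\<forall>u\<in>carrier T. \<Xi> (\<Theta> u) = u"
  proof
    fix u assume u: "u \<in> carrier T"
    show "\<Xi> (\<Theta> u) = u"
    proof (rule T_eqI[OF Xi_closed[OF Theta_closed[OF u]] u])
      fix z k assume z: "z \<in> Z" and k: "k \<in> carrier G"
      note B = orb_mem[OF z] and zB = orbit_refl[OF z]
      note a = arrow_inverse[OF B zB k]
      show "\<Xi> (\<Theta> u) (z, k) = u (z, k)"
        using z k idx[OF B zB] idx[OF B a(1)] a(2,3) by (simp add: \<Xi>_def Theta_apply[OF B])
    qed
  qed
  show "\<forall>N\<in>carrier Mats. \<Theta> (\<Xi> N) = N"
  proof
    fix N assume N: "N \<in> carrier Mats"
    show "\<Theta> (\<Xi> N) = N"
    proof (rule Mats_eqI[OF Theta_closed[OF Xi_closed[OF N]] N])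
      fix B i j h assume B: "B \<in> Orb" and i: "i < card B" and j: "j < card B" and h: "h \<in> stab B"
      let ?x = "enum B i" and ?y = "enum B j"
      have x: "?x \<in> B" "?x \<in> Z" and y: "?y \<in> B" "?y \<in> Z" using enum_mem B i j by auto
      have hG: "h \<in> carrier G" using h by (simp add: stab_iff)
      show "\<Theta> (\<Xi> N) B (i, j) h = N B (i, j) h"
        using h x y hG Orb_eq(1)[OF B x(1)]
        by (simp add: Theta_apply[OF B i j] \<Xi>_def arrow_closed arrow_source[OF B x(1) y(1) h]
            idx_enum[OF B i] idx_enum[OF B j] arrow_label)
    qed
  qed
  show "\<Theta> ` carrier T \<subseteq> carrier Mats" using Theta_closed by auto
  show "\<Xi> ` carrier Mats \<subseteq> carrier T" using Xi_closed by auto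
qed

theorem Theta_iso: "\<Theta> \<in> algebra_iso K T Mats"
  using Theta_closed Theta_mult Theta_linear(1)[OF _ _ K.zero_closed] Theta_linear(2) Theta_one Theta_bij
  by (auto simp: algebra_iso_def ring_iso_def ring_hom_def)

section \<open>The corner at the orbit representatives\<close>

definition single :: "'z \<Rightarrow> 'g \<Rightarrow> 'z \<times> 'g \<Rightarrow> 'k" where
  "single x a = (\<lambda>(z, h)\<in>Z \<times> carrier G. if z = x \<and> h = a then \<one>\<^bsub>K\<^esub> else \<zero>\<^bsub>K\<^esub>)"

lemma single_closed: "single x a \<in> carrier T"
  by (auto simp: single_def T_carrier)

lemma single_apply: "z \<in> Z \<Longrightarrow> h \<in> carrier G \<Longrightarrow> single x a (z, h) = (if z = x \<and> h = a then \<one>\<^bsub>K\<^esub> else \<zero>\<^bsub>K\<^esub>)"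
  by (simp add: single_def)

text \<open>The sum of the identity arrows at the orbit representatives.\<close>

definition base :: "'z \<times> 'g \<Rightarrow> 'k" where
  "base = (\<lambda>(z, h)\<in>Z \<times> carrier G. if h = \<one>\<^bsub>G\<^esub> \<and> rep z = z then \<one>\<^bsub>K\<^esub> else \<zero>\<^bsub>K\<^esub>)"

lemma base_closed: "base \<in> carrier T"
  by (auto simp: base_def T_carrier)

lemma base_apply: "z \<in> Z \<Longrightarrow> h \<in> carrier G
    \<Longrightarrow> base (z, h) = (if h = \<one>\<^bsub>G\<^esub> \<and> rep z = z then \<one>\<^bsub>K\<^esub> else \<zero>\<^bsub>K\<^esub>)"
  by (simp add: base_def)

lemma single_mult:
  assumes "x \<in> Z" "a \<in> carrier G" "v \<in> carrier T" "z \<in> Z" "h \<in> carrier G"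
  shows "(single x a \<otimes>\<^bsub>T\<^esub> v) (z, h) = (if z = x then v (\<alpha> (inv\<^bsub>G\<^esub> a) x, inv\<^bsub>G\<^esub> a \<otimes>\<^bsub>G\<^esub> h) else \<zero>\<^bsub>K\<^esub>)"
proof -
  have "(single x a \<otimes>\<^bsub>T\<^esub> v) (z, h) = single x a (z, a) \<otimes>\<^bsub>K\<^esub> v (\<alpha> (inv\<^bsub>G\<^esub> a) z, inv\<^bsub>G\<^esub> a \<otimes>\<^bsub>G\<^esub> h)"
    using assms single_closed by (intro T_mult_single) (auto simp: single_apply)
  moreover have "v (\<alpha> (inv\<^bsub>G\<^esub> a) z, inv\<^bsub>G\<^esub> a \<otimes>\<^bsub>G\<^esub> h) \<in> carrier K"
    using assms by (intro T_closed act_closed) auto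
  ultimately show ?thesis
    using assms by (cases "z = x") (simp_all add: single_apply)
qed

lemma base_mult:
  assumes "v \<in> carrier T" "z \<in> Z" "h \<in> carrier G"
  shows "(base \<otimes>\<^bsub>T\<^esub> v) (z, h) = (if rep z = z then v (z, h) else \<zero>\<^bsub>K\<^esub>)"
proof -
  have "(base \<otimes>\<^bsub>T\<^esub> v) (z, h)
      = base (z, \<one>\<^bsub>G\<^esub>) \<otimes>\<^bsub>K\<^esub> v (\<alpha> (inv\<^bsub>G\<^esub> \<one>\<^bsub>G\<^esub>) z, inv\<^bsub>G\<^esub> \<one>\<^bsub>G\<^esub> \<otimes>\<^bsub>G\<^esub> h)"
    using assms base_closed by (intro T_mult_single) (auto simp: base_apply)
  thus ?thesis
    using assms T_closed[OF assms] by (simp add: base_apply act_one)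
qed

lemma mult_base:
  assumes "v \<in> carrier T" "z \<in> Z" "h \<in> carrier G"
  shows "(v \<otimes>\<^bsub>T\<^esub> base) (z, h) = (if rep z = \<alpha> (inv\<^bsub>G\<^esub> h) z then v (z, h) else \<zero>\<^bsub>K\<^esub>)"
proof -
  have "(v \<otimes>\<^bsub>T\<^esub> base) (z, h)
      = v (z, h) \<otimes>\<^bsub>K\<^esub> base (\<alpha> (inv\<^bsub>G\<^esub> h) z, inv\<^bsub>G\<^esub> h \<otimes>\<^bsub>G\<^esub> h)"
  proof (rule T_mult_single[OF assms(1) base_closed assms(2,3,3)])
    fix a assume a: "a \<in> carrier G" "a \<noteq> h"
    have "inv\<^bsub>G\<^esub> a \<otimes>\<^bsub>G\<^esub> h \<noteq> \<one>\<^bsub>G\<^esub>"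
      using a assms(3) by (metis G.inv_closed G.inv_equality G.inv_inv)
    thus "v (z, a) = \<zero>\<^bsub>K\<^esub> \<or> base (\<alpha> (inv\<^bsub>G\<^esub> a) z, inv\<^bsub>G\<^esub> a \<otimes>\<^bsub>G\<^esub> h) = \<zero>\<^bsub>K\<^esub>"
      using a assms by (simp add: base_apply act_closed)
  qed
  thus ?thesis
    using assms T_closed[OF assms] by (simp add: base_apply act_closed rep_act)
qed

text \<open>Multiplication by the idempotent on the left selects the arrows whose target is a
  representative, on the right those whose source is one. As an arrow stays in its orbit, only
  loops at representatives survive both.\<close>

lemma corner_apply:
  assumes "v \<in> carrier T" "z \<in> Z" "h \<in> carrier G"
  shows "(base \<otimes>\<^bsub>T\<^esub> v \<otimes>\<^bsub>T\<^esub> base) (z, h) = (if rep z = z \<and> \<alpha> h z = z then v (z, h) else \<zero>\<^bsub>K\<^esub>)"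
proof -
  have "\<alpha> (inv\<^bsub>G\<^esub> h) z = z \<longleftrightarrow> \<alpha> h z = z"
    using act_inv[OF assms(3,2)] by metis
  thus ?thesis
    using assms base_closed by (auto simp: mult_base base_mult T_ops_closed)
qed

definition \<psi> :: "('z set \<Rightarrow> 'g \<Rightarrow> 'k) \<Rightarrow> 'z \<times> 'g \<Rightarrow> 'k" where
  "\<psi> s = (\<lambda>(z, h)\<in>Z \<times> carrier G. if rep z = z \<and> \<alpha> h z = z then s (orb z) h else \<zero>\<^bsub>K\<^esub>)"

lemma psi_apply: "z \<in> Z \<Longrightarrow> h \<in> carrier G
    \<Longrightarrow> \<psi> s (z, h) = (if rep z = z \<and> \<alpha> h z = z then s (orb z) h else \<zero>\<^bsub>K\<^esub>)"
  by (simp add: \<psi>_def)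

lemma S_entry: "s \<in> carrier S \<Longrightarrow> B \<in> Orb \<Longrightarrow> s B \<in> carrier (kH B)"
  by (auto simp: product_algebra_simps)

lemma psi_closed_T: "s \<in> carrier S \<Longrightarrow> \<psi> s \<in> carrier T"
  using kH_closedD(1)[OF orb_mem S_entry[OF _ orb_mem]] by (auto simp: \<psi>_def T_carrier)

lemma psi_mult_T:
  assumes s: "s \<in> carrier S" and t: "t \<in> carrier S"
  shows "\<psi> (s \<otimes>\<^bsub>S\<^esub> t) = \<psi> s \<otimes>\<^bsub>T\<^esub> \<psi> t"
proof (rule T_eqI)
  interpret S: ring S by (rule S_ring)
  show "\<psi> (s \<otimes>\<^bsub>S\<^esub> t) \<in> carrier T" "\<psi> s \<otimes>\<^bsub>T\<^esub> \<psi> t \<in> carrier T"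
    using s t by (auto intro!: psi_closed_T T_ops_closed)
  fix z h assume z: "z \<in> Z" and h: "h \<in> carrier G"
  let ?B = "orb z"
  note B = orb_mem[OF z]
  have kc: "s ?B a \<in> carrier K" "t ?B a \<in> carrier K" for a
    using kH_closedD(1)[OF B S_entry[OF s B]] kH_closedD(1)[OF B S_entry[OF t B]] by auto
  note pc = psi_closed_T[OF s] psi_closed_T[OF t]
  let ?f = "\<lambda>a. \<psi> s (z, a) \<otimes>\<^bsub>K\<^esub> \<psi> t (\<alpha> (inv\<^bsub>G\<^esub> a) z, inv\<^bsub>G\<^esub> a \<otimes>\<^bsub>G\<^esub> h)"
  have fix1: "\<alpha> (inv\<^bsub>G\<^esub> a) z = z" if "a \<in> carrier G" "\<alpha> a z = z" for a
    using act_inv(1)[OF that(1) z] that(2) by simp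
  show "\<psi> (s \<otimes>\<^bsub>S\<^esub> t) (z, h) = (\<psi> s \<otimes>\<^bsub>T\<^esub> \<psi> t) (z, h)"
  proof (cases "rep z = z \<and> \<alpha> h z = z")
    case True
    have st: "a \<in> stab ?B \<longleftrightarrow> a \<in> carrier G \<and> \<alpha> a z = z" for a
      using True by (simp add: stabilizer_def rep_def)
    have "(\<psi> s \<otimes>\<^bsub>T\<^esub> \<psi> t) (z, h) = (\<Oplus>\<^bsub>K\<^esub>a\<in>stab ?B. ?f a)"
      unfolding T_apply(5)[OF z h]
    proof (rule K.finsum_superset[OF finite_G])
      show "stab ?B \<subseteq> carrier G" using st by blast
      show "?f a \<in> carrier K" if "a \<in> stab ?B" for a
        using term_closed[OF pc z h] st that by blast
      show "?f a = \<zero>\<^bsub>K\<^esub>" if "a \<in> carrier G - stab ?B" for a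
        using that z h T_closed[OF pc(2)] by (simp add: st psi_apply[of z _ s] act_closed)
    qed
    also have "\<dots> = (\<Oplus>\<^bsub>K\<^esub>a\<in>stab ?B. s ?B a \<otimes>\<^bsub>K\<^esub> t ?B (inv\<^bsub>G\<^esub> a \<otimes>\<^bsub>G\<^esub> h))"
      using z h True kc by (intro K.finsum_cong') (auto simp: st psi_apply fix1 act_mult)
    also have "\<dots> = (s ?B \<otimes>\<^bsub>kH ?B\<^esub> t ?B) h"
      using kH_mult[OF B S_entry[OF s B] S_entry[OF t B], of h] h True by (simp add: st)
    finally show ?thesis
      using z h True B by (simp add: psi_apply product_algebra_simps)
  next
    case False
    have "?f a = \<zero>\<^bsub>K\<^esub>" if a: "a \<in> carrier G" for a
    proof (cases "rep z = z \<and> \<alpha> a z = z")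
      case True
      hence "\<alpha> (inv\<^bsub>G\<^esub> a \<otimes>\<^bsub>G\<^esub> h) z \<noteq> z"
        using False a h z act_inv(2)[OF a act_closed[OF h z]] by (auto simp: act_mult)
      thus ?thesis
        using True a h z kc by (simp add: psi_apply fix1)
    next
      case False
      hence "\<psi> s (z, a) = \<zero>\<^bsub>K\<^esub>" using a z by (auto simp: psi_apply)
      thus ?thesis using a z h T_closed[OF pc(2)] by (simp add: act_closed)
    qed
    hence "(\<psi> s \<otimes>\<^bsub>T\<^esub> \<psi> t) (z, h) = \<zero>\<^bsub>K\<^esub>"
      unfolding T_apply(5)[OF z h] by (intro K.add.finprod_one_eqI)
    thus ?thesis using False z h by (auto simp: psi_apply)
  qed
qed

text \<open>Going from \<open>x\<close> to its representative and back along
  \<open>\<gamma>\<^sub>x\<close> is the identity arrow at \<open>x\<close>.\<close>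

lemma resolution_of_one:
  "(\<Oplus>\<^bsub>T\<^esub>x\<in>Z. single x (\<gamma> x) \<otimes>\<^bsub>T\<^esub> base \<otimes>\<^bsub>T\<^esub> single (rep x) (inv\<^bsub>G\<^esub> \<gamma> x)) = \<one>\<^bsub>T\<^esub>"
proof -
  have "single x (\<gamma> x) \<otimes>\<^bsub>T\<^esub> base \<otimes>\<^bsub>T\<^esub> single (rep x) (inv\<^bsub>G\<^esub> \<gamma> x) = single x \<one>\<^bsub>G\<^esub>" if x: "x \<in> Z" for x
  proof (rule T_eqI)
    fix z h assume z: "z \<in> Z" and h: "h \<in> carrier G"
    note g = gamma[OF x]
    have rr: "rep (rep x) = rep x" using orb_rep[OF x] by (simp add: rep_def)
    have "inv\<^bsub>G\<^esub> \<gamma> x \<otimes>\<^bsub>G\<^esub> h = inv\<^bsub>G\<^esub> \<gamma> x \<longleftrightarrow> h = \<one>\<^bsub>G\<^esub>"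
      using g(1) h by (metis G.inv_closed G.l_cancel_one)
    thus "(single x (\<gamma> x) \<otimes>\<^bsub>T\<^esub> base \<otimes>\<^bsub>T\<^esub> single (rep x) (inv\<^bsub>G\<^esub> \<gamma> x)) (z, h) = single x \<one>\<^bsub>G\<^esub> (z, h)"
      using x z h g rep_mem(2)[OF x]
      by (simp add: T.m_assoc single_closed base_closed single_mult T_ops_closed base_mult rr single_apply)
  qed (auto intro!: T_ops_closed single_closed base_closed)
  hence "(\<Oplus>\<^bsub>T\<^esub>x\<in>Z. single x (\<gamma> x) \<otimes>\<^bsub>T\<^esub> base \<otimes>\<^bsub>T\<^esub> single (rep x) (inv\<^bsub>G\<^esub> \<gamma> x))
      = (\<Oplus>\<^bsub>T\<^esub>x\<in>Z. single x \<one>\<^bsub>G\<^esub>)"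
    by (intro T.finsum_cong') (auto simp: single_closed)
  also have "\<dots> = \<one>\<^bsub>T\<^esub>"
  proof (rule T_eqI)
    fix z h assume z: "z \<in> Z" and h: "h \<in> carrier G"
    have "(\<Oplus>\<^bsub>T\<^esub>x\<in>Z. single x \<one>\<^bsub>G\<^esub>) (z, h) = (\<Oplus>\<^bsub>K\<^esub>x\<in>Z. single x \<one>\<^bsub>G\<^esub> (z, h))"
      using z h single_closed finite_Z
      by (intro finsum_additive_map[OF T.abelian_monoid_axioms K.abelian_monoid_axioms, where h = "\<lambda>f. f (z, h)"])
        (auto simp: T_apply intro!: T_closed)
    also have "\<dots> = single z \<one>\<^bsub>G\<^esub> (z, h)"
      using z h finite_Z by (intro K.finsum_single_term) (auto simp: single_apply)
    finally show "(\<Oplus>\<^bsub>T\<^esub>x\<in>Z. single x \<one>\<^bsub>G\<^esub>) (z, h) = \<one>\<^bsub>T\<^esub> (z, h)"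
      using z h by (simp add: T_apply single_apply)
  qed (auto intro!: T.finsum_closed single_closed T_units_closed)
  finally show ?thesis .
qed

text \<open>The corner consists of the loops at the representatives, which form the stabilizers;
  it is full because every orbit has a representative.\<close>

theorem stabilizer_corner:
  "corner T S K \<psi> base (\<lambda>x. single x (\<gamma> x)) (\<lambda>x. single (rep x) (inv\<^bsub>G\<^esub> \<gamma> x)) Z"
proof -
  interpret S: ring S by (rule S_ring)
  have scal: "c \<odot>\<^bsub>S\<^esub> \<one>\<^bsub>S\<^esub> \<in> carrier S" if c: "c \<in> carrier K" for c
  proof -
    have "c \<odot>\<^bsub>kH B\<^esub> \<one>\<^bsub>kH B\<^esub> \<in> carrier (kH B)" if B: "B \<in> Orb" for B
      using c B subgroup.one_closed[OF stab_subgroup[OF B]] by (intro kH_closedI) (auto simp: kH_apply)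
    thus ?thesis by (auto simp: product_algebra_def)
  qed
  show ?thesis
  proof (intro corner.intro corner_axioms.intro T.ring_axioms S.ring_axioms)
    fix s assume s: "s \<in> carrier S"
    show "\<psi> s \<in> carrier T" using s by (rule psi_closed_T)
  next
    fix s t assume s: "s \<in> carrier S" and t: "t \<in> carrier S"
    show "\<psi> (s \<otimes>\<^bsub>S\<^esub> t) = \<psi> s \<otimes>\<^bsub>T\<^esub> \<psi> t" using s t by (rule psi_mult_T)
    show "\<psi> (s \<oplus>\<^bsub>S\<^esub> t) = \<psi> s \<oplus>\<^bsub>T\<^esub> \<psi> t"
      using s t by (intro T_eqI)
        (auto simp: psi_apply T_apply product_algebra_simps orb_mem kH_apply intro!: psi_closed_T T_ops_closed)
  next
    show "\<psi> \<one>\<^bsub>S\<^esub> = base"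
      by (intro T_eqI base_closed psi_closed_T S.one_closed)
        (auto simp: psi_apply base_apply product_algebra_simps orb_mem kH_apply act_one)
  next
    show "inj_on \<psi> (carrier S)"
    proof (rule inj_onI)
      fix s t assume s: "s \<in> carrier S" and t: "t \<in> carrier S" and eq: "\<psi> s = \<psi> t"
      show "s = t"
      proof (rule product_algebra_eqI[OF s t])
        fix B assume B: "B \<in> Orb"
        have rB: "rep (r B) = r B" "orb (r B) = B" "r B \<in> Z"
          using B rep_orbit[OF B r_mem[OF B]] orb_r r_Z by auto
        show "s B = t B"
        proof
          fix h show "s B h = t B h"
          proof (cases "h \<in> stab B")
            case True
            thus ?thesis
              using fun_cong[OF eq, of "(r B, h)"] rB by (simp add: psi_apply stab_iff)
          next
            case False
            thus ?thesis
              using kH_closedD(2)[OF B S_entry[OF s B]] kH_closedD(2)[OF B S_entry[OF t B]] by simp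
          qed
        qed
      qed
    qed
  next
    fix a assume a: "a \<in> carrier T"
    define s where "s = (\<lambda>B\<in>Orb. \<lambda>h. if h \<in> stab B then a (r B, h) else \<zero>\<^bsub>K\<^esub>)"
    have "s B \<in> carrier (kH B)" if B: "B \<in> Orb" for B
      using B a r_Z[OF B] by (auto simp: s_def stab_iff intro!: kH_closedI T_closed)
    hence s: "s \<in> carrier S" by (auto simp: product_algebra_simps s_def)
    have "base \<otimes>\<^bsub>T\<^esub> a \<otimes>\<^bsub>T\<^esub> base = \<psi> s"
    proof (rule T_eqI)
      fix z h assume z: "z \<in> Z" and h: "h \<in> carrier G"
      show "(base \<otimes>\<^bsub>T\<^esub> a \<otimes>\<^bsub>T\<^esub> base) (z, h) = \<psi> s (z, h)"
        using z h a orb_mem[OF z] by (auto simp: corner_apply psi_apply s_def stab_iff rep_def)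
    qed (use a s in \<open>auto intro!: T_ops_closed base_closed psi_closed_T\<close>)
    thus "base \<otimes>\<^bsub>T\<^esub> a \<otimes>\<^bsub>T\<^esub> base \<in> \<psi> ` carrier S" using s by blast
  next
    show "finite Z" by (rule finite_Z)
    show "(\<Oplus>\<^bsub>T\<^esub>x\<in>Z. single x (\<gamma> x) \<otimes>\<^bsub>T\<^esub> base \<otimes>\<^bsub>T\<^esub> single (rep x) (inv\<^bsub>G\<^esub> \<gamma> x)) = \<one>\<^bsub>T\<^esub>"
      by (rule resolution_of_one)
  next
    fix c assume c: "c \<in> carrier K"
    show "c \<odot>\<^bsub>T\<^esub> \<one>\<^bsub>T\<^esub> \<in> carrier T" using c by (intro T_smult_closed T_units_closed)
    show "c \<odot>\<^bsub>S\<^esub> \<one>\<^bsub>S\<^esub> \<in> carrier S" using c by (rule scal)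
    show "\<psi> (c \<odot>\<^bsub>S\<^esub> \<one>\<^bsub>S\<^esub>) = (c \<odot>\<^bsub>T\<^esub> \<one>\<^bsub>T\<^esub>) \<otimes>\<^bsub>T\<^esub> base"
    proof -
      have "(c \<odot>\<^bsub>T\<^esub> \<one>\<^bsub>T\<^esub>) \<otimes>\<^bsub>T\<^esub> base = c \<odot>\<^bsub>T\<^esub> base"
        using c base_closed by (simp add: T_smult_mult)
      moreover have "\<psi> (c \<odot>\<^bsub>S\<^esub> \<one>\<^bsub>S\<^esub>) = c \<odot>\<^bsub>T\<^esub> base"
        using c scal[OF c]
        by (intro T_eqI psi_closed_T T_smult_closed base_closed)
          (auto simp: psi_apply base_apply product_algebra_simps orb_mem kH_apply act_one T_apply)
      ultimately show ?thesis by simp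
    qed
    fix a assume a: "a \<in> carrier T"
    show "(c \<odot>\<^bsub>T\<^esub> \<one>\<^bsub>T\<^esub>) \<otimes>\<^bsub>T\<^esub> a = a \<otimes>\<^bsub>T\<^esub> (c \<odot>\<^bsub>T\<^esub> \<one>\<^bsub>T\<^esub>)"
      using a c by (simp add: T_smult_mult)
  qed (auto intro: single_closed)
qed

end

section \<open>The monoid of one-hole contexts\<close>

lemma graft_Hole_right: "graft t Hole = t"
  by (induction t) (auto intro: map_idI)

lemma graft_assoc: "graft (graft s t) w = graft s (graft t w)"
  by (induction s) auto

lemma holes_graft: "holes (graft t D) = holes t * holes D"
proof (induction t)
  case (Node ts)
  thus ?case by (induction ts) (auto simp: algebra_simps)
qed auto

lemma full_tree_graft: "full_tree n A t \<Longrightarrow> full_tree n A D \<Longrightarrow> full_tree n A (graft t D)"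
  by (induction t) auto

lemma monoid_context: "Group.monoid (context_monoid n A)"
  by (intro Group.monoidI)
    (auto simp: context_monoid_def contexts_def holes_graft full_tree_graft graft_assoc graft_Hole_right)

lemma holes_Leaf_list: "sum_list (map holes (map Leaf as)) = 0"
  by (induction as) auto

lemma frame_here: "(\<lambda>t. Node (us @ t # vs)) \<in> frames"
  using frames.below[OF frames.here] .

lemma frame_Node:
  assumes "F \<in> frames"
  shows "(\<lambda>t. F (Node (us @ t # vs))) \<in> frames"
  using assms by induction (auto intro: frame_here frames.below)

lemma frame_full:
  assumes "F \<in> frames" "full_tree n A (F t)"
  shows "full_tree n A t" "full_tree n A t' \<Longrightarrow> full_tree n A (F t')"
  using assms by (induction) auto

lemma frame_holes:
  assumes "F \<in> frames"
  obtains c where "\<And>t. holes (F t) = c + holes t"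
proof -
  have "\<exists>c. \<forall>t. holes (F t) = c + holes t"
    using assms
  proof induction
    case here
    show ?case by (rule exI[of _ 0]) simp
  next
    case (below F us vs)
    then obtain c where "\<And>t. holes (F t) = c + holes t" by blast
    thus ?case
      by (intro exI[of _ "sum_list (map holes us) + c + sum_list (map holes vs)"]) auto
  qed
  thus ?thesis using that by blast
qed

lemma frame_context:
  assumes "F \<in> frames" "F t \<in> contexts n A" "full_tree n A t'" "holes t' = holes t"
  shows "F t' \<in> contexts n A"
proof -
  obtain c where "\<And>t. holes (F t) = c + holes t"
    by (rule frame_holes[OF assms(1)]) blast
  thus ?thesis
    using assms frame_full(2)[OF assms(1)] by (auto simp: contexts_def)
qed

section \<open>Quotient algebras\<close>

text \<open>The ring axioms see only the common fields of the two records. The identity is a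
  homomorphism onto its image, which supplies the ring structure without checking each
  axiom.\<close>

lemma ring_same_operations:
  assumes "ring R" "carrier S = carrier R" "mult S = mult R" "one S = one R" "zero S = zero R"
    "add S = add R"
  shows "ring S"
proof -
  have "(\<lambda>x. x) \<in> ring_hom R S"
    using assms by (auto simp: ring_hom_def)
  hence "ring (S\<lparr>carrier := (\<lambda>x. x) ` carrier R, zero := \<zero>\<^bsub>R\<^esub>\<rparr>)"
    by (rule ring.ring_hom_imp_img_ring[OF assms(1)])
  moreover have "S\<lparr>carrier := (\<lambda>x. x) ` carrier R, zero := \<zero>\<^bsub>R\<^esub>\<rparr> = S"
    using assms by simp
  ultimately show ?thesis by (simp only:)
qed

locale quotient_setting = R: ring R + L: Module.module K R + J: ideal I R
  for K :: "('k, 'e) ring_scheme" and R :: "('k, 'r) module" and I :: "'r set" +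
  assumes smult_mult: "c \<in> carrier K \<Longrightarrow> a \<in> carrier R \<Longrightarrow> b \<in> carrier R
    \<Longrightarrow> (c \<odot>\<^bsub>R\<^esub> a) \<otimes>\<^bsub>R\<^esub> b = c \<odot>\<^bsub>R\<^esub> (a \<otimes>\<^bsub>R\<^esub> b)"
begin

abbreviation \<Q> where "\<Q> \<equiv> quotient_algebra R I"

definition coset :: "'r \<Rightarrow> 'r set" where "coset a = I +>\<^bsub>R\<^esub> a"

lemma coset_hom: "coset \<in> ring_hom R \<Q>"
  using J.rcos_ring_hom by (auto simp: coset_def ring_hom_def quotient_algebra_def)

lemma coset_closed: "a \<in> carrier R \<Longrightarrow> coset a \<in> carrier \<Q>"
  and coset_add: "a \<in> carrier R \<Longrightarrow> b \<in> carrier R \<Longrightarrow> coset (a \<oplus>\<^bsub>R\<^esub> b) = coset a \<oplus>\<^bsub>\<Q>\<^esub> coset b"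
  and coset_mult: "a \<in> carrier R \<Longrightarrow> b \<in> carrier R \<Longrightarrow> coset (a \<otimes>\<^bsub>R\<^esub> b) = coset a \<otimes>\<^bsub>\<Q>\<^esub> coset b"
  and coset_one: "coset \<one>\<^bsub>R\<^esub> = \<one>\<^bsub>\<Q>\<^esub>"
  using coset_hom by (auto simp: ring_hom_def)

lemma quotient_carrier: "carrier \<Q> = coset ` carrier R"
  by (auto simp: quotient_algebra_def FactRing_simps coset_def)

lemma quotient_ring: "ring \<Q>"
  by (rule ring_same_operations[OF J.quotient_is_ring]) (simp_all add: quotient_algebra_def)

lemma coset_eq_iff:
  "a \<in> carrier R \<Longrightarrow> b \<in> carrier R \<Longrightarrow> coset a = coset b \<longleftrightarrow> a \<ominus>\<^bsub>R\<^esub> b \<in> I"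
  unfolding coset_def using R.quotient_eq_iff_same_a_r_cos[OF J.is_ideal] by blast

lemma coset_zero: "coset \<zero>\<^bsub>R\<^esub> = \<zero>\<^bsub>\<Q>\<^esub>"
proof -
  interpret Q: ring \<Q> by (rule quotient_ring)
  show ?thesis
    by (metis Q.add.l_cancel_one' R.zero_closed R.l_zero coset_add coset_closed)
qed

lemma smult_ideal: "c \<in> carrier K \<Longrightarrow> a \<in> I \<Longrightarrow> c \<odot>\<^bsub>R\<^esub> a \<in> I"
  using smult_mult[of c "\<one>\<^bsub>R\<^esub>" a] J.I_l_closed[of a "c \<odot>\<^bsub>R\<^esub> \<one>\<^bsub>R\<^esub>"] J.a_Hcarr[of a] by simp

text \<open>The scalar action on cosets is defined by a union over representatives; all of them
  give the same coset because the ideal is stable under scalars.\<close>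

lemma coset_smult:
  assumes "c \<in> carrier K" "a \<in> carrier R"
  shows "coset (c \<odot>\<^bsub>R\<^esub> a) = c \<odot>\<^bsub>\<Q>\<^esub> coset a"
proof -
  have "coset (c \<odot>\<^bsub>R\<^esub> x) = coset (c \<odot>\<^bsub>R\<^esub> a)" if x: "x \<in> coset a" for x
  proof -
    obtain i where i: "i \<in> I" "x = i \<oplus>\<^bsub>R\<^esub> a"
      using x by (auto simp: coset_def a_r_coset_def')
    have "c \<odot>\<^bsub>R\<^esub> x = c \<odot>\<^bsub>R\<^esub> i \<oplus>\<^bsub>R\<^esub> c \<odot>\<^bsub>R\<^esub> a"
      using i assms J.a_Hcarr[OF i(1)] by (simp add: L.smult_r_distr)
    hence "c \<odot>\<^bsub>R\<^esub> x \<ominus>\<^bsub>R\<^esub> c \<odot>\<^bsub>R\<^esub> a = c \<odot>\<^bsub>R\<^esub> i"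
      using i assms J.a_Hcarr[OF i(1)] by (simp add: R.minus_eq R.a_assoc R.r_neg)
    thus ?thesis
      using i assms J.a_Hcarr[OF i(1)] smult_ideal[OF assms(1) i(1)] by (subst coset_eq_iff) auto
  qed
  hence "(\<Union>x\<in>coset a. coset (c \<odot>\<^bsub>R\<^esub> x)) = (\<Union>x\<in>coset a. coset (c \<odot>\<^bsub>R\<^esub> a))"
    by (intro SUP_cong refl)
  moreover have "coset a \<noteq> {}"
    using J.a_rcos_self[OF assms(2)] by (auto simp: coset_def)
  ultimately have "(\<Union>x\<in>coset a. coset (c \<odot>\<^bsub>R\<^esub> x)) = coset (c \<odot>\<^bsub>R\<^esub> a)"
    by (simp only: UN_constant if_False)
  thus ?thesis
    by (simp add: quotient_algebra_def coset_def)
qed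

end

section \<open>Twisted words\<close>

locale envelope_setting = K: cring K + A: ring A
  for K :: "('k, 'e) ring_scheme" and A :: "('k, 'a) module" (structure) +
  fixes \<sigma> :: "'a \<Rightarrow> 'a" and m n :: nat
  assumes smult_closed_A: "c \<in> carrier K \<Longrightarrow> a \<in> carrier A \<Longrightarrow> c \<odot> a \<in> carrier A"
    and sigma_hom: "\<sigma> \<in> ring_hom A A"
    and sigma_order: "a \<in> carrier A \<Longrightarrow> (\<sigma> ^^ m) a = a"
    and m_ge_2: "m \<ge> 2" and n_eq: "n = m + 1"
begin

lemma sigma_pow_hom: "(\<sigma> ^^ i) \<in> ring_hom A A"
proof (induction i)
  case (Suc i)
  thus ?case using ring_hom_trans[OF Suc sigma_hom] by (simp add: comp_def funpow_swap1)
qed (simp add: ring_hom_def)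

lemma sigma_pow:
  "a \<in> carrier A \<Longrightarrow> (\<sigma> ^^ i) a \<in> carrier A"
  "a \<in> carrier A \<Longrightarrow> b \<in> carrier A \<Longrightarrow> (\<sigma> ^^ i) (a \<otimes> b) = (\<sigma> ^^ i) a \<otimes> (\<sigma> ^^ i) b"
  "a \<in> carrier A \<Longrightarrow> b \<in> carrier A \<Longrightarrow> (\<sigma> ^^ i) (a \<oplus> b) = (\<sigma> ^^ i) a \<oplus> (\<sigma> ^^ i) b"
  "(\<sigma> ^^ i) \<one> = \<one>"
  using sigma_pow_hom[of i] by (auto simp: ring_hom_def)

lemma sigma_pow_add: "(\<sigma> ^^ i) ((\<sigma> ^^ j) a) = (\<sigma> ^^ (i + j)) a"
  by (simp add: funpow_add)

text \<open>The index \<open>i\<close> is the position at which the word starts inside a longer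
  word; with it, the values of words multiply under concatenation
  (\<open>tw_append\<close>).\<close>

fun tw :: "nat \<Rightarrow> 'a list \<Rightarrow> 'a" where
  "tw i [] = \<one>"
| "tw i (a # as) = (\<sigma> ^^ i) a \<otimes> tw (Suc i) as"

lemma tw_closed: "set as \<subseteq> carrier A \<Longrightarrow> tw i as \<in> carrier A"
  by (induction as arbitrary: i) (auto simp: sigma_pow)

lemma tw_append:
  "set as \<subseteq> carrier A \<Longrightarrow> set bs \<subseteq> carrier A \<Longrightarrow> tw i (as @ bs) = tw i as \<otimes> tw (i + length as) bs"
  by (induction as arbitrary: i) (auto simp: sigma_pow tw_closed A.m_assoc)

lemma tw_ones: "tw i (replicate k \<one>) = \<one>"
  by (induction k arbitrary: i) (auto simp: sigma_pow)

lemma ones_closed: "set (replicate k \<one>) \<subseteq> carrier A"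
  by auto

lemma sigma_pow_tw: "set as \<subseteq> carrier A \<Longrightarrow> (\<sigma> ^^ j) (tw i as) = tw (j + i) as"
  by (induction as arbitrary: i) (auto simp: sigma_pow tw_closed sigma_pow_add)

lemma sigma_pow_mod: "a \<in> carrier A \<Longrightarrow> (\<sigma> ^^ (i + m)) a = (\<sigma> ^^ i) a"
  by (simp add: sigma_order flip: sigma_pow_add)

lemma tw_period: "set as \<subseteq> carrier A \<Longrightarrow> tw (i + m) as = tw i as"
  using sigma_pow_mod by (induction as arbitrary: i) (auto simp flip: add_Suc)

text \<open>The last factor of the \<open>n\<close>-ary product is not twisted, which agrees with
  a twist by \<open>\<sigma>\<^sup>m = 1\<close>.\<close>

lemma twisted_product_eq:
  assumes "length as = n" "set as \<subseteq> carrier A"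
  shows "twisted_product A \<sigma> n as = tw 0 as"
proof -
  have fold: "foldr (\<lambda>i p. (\<sigma> ^^ i) (bs ! i) \<otimes> p) [0..<length bs] z = tw 0 bs \<otimes> z"
    if "set bs \<subseteq> carrier A" "z \<in> carrier A" for bs z
    using that
  proof (induction bs arbitrary: z rule: rev_induct)
    case (snoc b bs)
    have "foldr (\<lambda>i p. (\<sigma> ^^ i) ((bs @ [b]) ! i) \<otimes> p) [0..<length bs] w
        = foldr (\<lambda>i p. (\<sigma> ^^ i) (bs ! i) \<otimes> p) [0..<length bs] w" for w
      by (rule foldr_cong) (auto simp: nth_append)
    thus ?case
      using snoc by (simp add: tw_append sigma_pow tw_closed A.m_assoc)
  qed simp
  obtain bs b where as: "as = bs @ [b]" "length bs = m"
    using assms(1) n_eq by (cases as rule: rev_cases) auto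
  have "twisted_product A \<sigma> n as = foldr (\<lambda>i p. (\<sigma> ^^ i) (as ! i) \<otimes> p) [0..<m] b"
    using as n_eq by (simp add: twisted_product_def nth_append)
  also have "\<dots> = foldr (\<lambda>i p. (\<sigma> ^^ i) (bs ! i) \<otimes> p) [0..<m] b"
    using as by (intro foldr_cong) (auto simp: nth_append)
  also have "\<dots> = tw 0 bs \<otimes> b"
    using fold[of bs b] as assms(2) by simp
  also have "\<dots> = tw 0 as"
    using as assms(2) by (simp add: tw_append sigma_order)
  finally show ?thesis .
qed

section \<open>Computing in the anchored envelope\<close>

abbreviation \<C> where "\<C> \<equiv> context_algebra K A n"
abbreviation ctx where "ctx \<equiv> contexts n (carrier A)"

sublocale C: monoid_algebra_setting K "context_monoid n (carrier A)"
  by (intro monoid_algebra_setting.intro K.cring_axioms monoid_context)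

lemma C_def: "\<C> = C.\<A>"
  by (simp add: context_algebra_def)

sublocale C: ring \<C>
  unfolding C_def by (rule C.ring_MA)

abbreviation bas :: "'a tree \<Rightarrow> 'a tree \<Rightarrow> 'k" where "bas \<equiv> basis_element K"

abbreviation rels where "rels \<equiv> envelope_relations K A \<sigma> n \<union> anchor_relations K A n"

definition ker :: "('a tree \<Rightarrow> 'k) set" where "ker = Idl\<^bsub>\<C>\<^esub> rels"

lemma ctx_carrier: "carrier (context_monoid n (carrier A)) = ctx"
  by (simp add: context_monoid_def)

lemma bas_closed: "t \<in> ctx \<Longrightarrow> bas t \<in> carrier \<C>"
  using C.basis_closed[of t] by (simp add: C_def ctx_carrier)

lemma tp_closed: "length as = n \<Longrightarrow> set as \<subseteq> carrier A \<Longrightarrow> twisted_product A \<sigma> n as \<in> carrier A"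
  by (simp add: twisted_product_eq tw_closed)

lemma anchor_ctx: "Node (Hole # replicate (n - 1) (Leaf \<one>)) \<in> ctx"
  "Node (replicate (n - 1) (Leaf \<one>) @ [Hole]) \<in> ctx"
  using n_eq by (auto simp: contexts_def sum_list_replicate)

lemma Hole_ctx: "Hole \<in> ctx"
  by (simp add: contexts_def)

lemma leaf_ctx:
  assumes "F \<in> frames" "F t \<in> ctx" "holes t = 0" "a \<in> carrier A"
  shows "F (Leaf a) \<in> ctx"
  using frame_context[OF assms(1,2), of "Leaf a"] assms(3,4) by simp

lemma smult_C_closed: "c \<in> carrier K \<Longrightarrow> f \<in> carrier \<C> \<Longrightarrow> c \<odot>\<^bsub>\<C>\<^esub> f \<in> carrier \<C>"
  unfolding C_def by (rule C.smult_closed_MA)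

lemma rels_closed: "rels \<subseteq> carrier \<C>"
proof
  fix x assume "x \<in> rels"
  thus "x \<in> carrier \<C>"
  proof
    assume "x \<in> envelope_relations K A \<sigma> n"
    thus ?thesis
    proof cases
      case (additive F a b)
      thus ?thesis using leaf_ctx[OF additive(2,5)] bas_closed by simp
    next
      case (homogeneous F c a)
      thus ?thesis using leaf_ctx[OF homogeneous(2,5)] bas_closed smult_C_closed by simp
    next
      case (contraction F as)
      thus ?thesis
        using leaf_ctx[OF contraction(2,5)] bas_closed tp_closed by (simp add: holes_Leaf_list)
    next
      case associativity
      thus ?thesis using bas_closed by simp
    qed
  next
    assume "x \<in> anchor_relations K A n"
    thus ?thesis
      using anchor_ctx Hole_ctx bas_closed by (auto simp: anchor_relations_def)
  qed
qed

lemma ker_ideal: "ideal ker \<C>"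
  unfolding ker_def by (rule C.genideal_ideal[OF rels_closed])

sublocale Q: quotient_setting K \<C> ker
proof (intro quotient_setting.intro quotient_setting_axioms.intro)
  show "ring \<C>" by (rule C.ring_axioms)
  show "Module.module K \<C>"
    unfolding C_def by (rule C.module_MA)
  show "ideal ker \<C>" by (rule ker_ideal)
qed (simp add: C_def C.smult_mult_MA)

abbreviation \<U> where "\<U> \<equiv> quotient_algebra \<C> ker"

lemma envelope_eq: "anchored_envelope K A \<sigma> n = \<U>"
  by (simp add: anchored_envelope_def ker_def)

sublocale U: ring \<U>
  by (rule Q.quotient_ring)

definition cls :: "'a tree \<Rightarrow> ('a tree \<Rightarrow> 'k) set" where "cls t = Q.coset (bas t)"

lemma cls_closed: "t \<in> ctx \<Longrightarrow> cls t \<in> carrier \<U>"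
  unfolding cls_def by (intro Q.coset_closed bas_closed)

lemma graft_ctx: "s \<in> ctx \<Longrightarrow> t \<in> ctx \<Longrightarrow> graft s t \<in> ctx"
  by (auto simp: contexts_def full_tree_graft holes_graft)

lemma cls_graft: "s \<in> ctx \<Longrightarrow> t \<in> ctx \<Longrightarrow> cls (graft s t) = cls s \<otimes>\<^bsub>\<U>\<^esub> cls t"
  using C.basis_mult[of s t] Q.coset_mult[of "bas s" "bas t"] bas_closed
  by (simp add: cls_def C_def ctx_carrier) (simp add: context_monoid_def)

lemma cls_Hole: "cls Hole = \<one>\<^bsub>\<U>\<^esub>"
  using Q.coset_one C.one_eq_basis by (simp add: cls_def C_def) (simp add: context_monoid_def)

lemma rel_ker: "x \<in> rels \<Longrightarrow> x \<in> ker"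
  unfolding ker_def using C.genideal_self[OF rels_closed] by blast

lemma cls_eqI:
  "s \<in> ctx \<Longrightarrow> t \<in> ctx \<Longrightarrow> bas s \<ominus>\<^bsub>\<C>\<^esub> bas t \<in> rels \<Longrightarrow> cls s = cls t"
  unfolding cls_def using Q.coset_eq_iff bas_closed rel_ker by blast

lemma cls_additive:
  assumes "F \<in> frames" "a \<in> carrier A" "b \<in> carrier A" "F (Leaf (a \<oplus> b)) \<in> ctx"
  shows "cls (F (Leaf (a \<oplus> b))) = cls (F (Leaf a)) \<oplus>\<^bsub>\<U>\<^esub> cls (F (Leaf b))"
proof -
  have c: "F (Leaf a) \<in> ctx" "F (Leaf b) \<in> ctx"
    using leaf_ctx[OF assms(1,4)] assms by auto
  have "bas (F (Leaf (a \<oplus> b))) \<ominus>\<^bsub>\<C>\<^esub> (bas (F (Leaf a)) \<oplus>\<^bsub>\<C>\<^esub> bas (F (Leaf b))) \<in> ker"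
    by (intro rel_ker UnI1 envelope_relations.additive assms)
  hence "cls (F (Leaf (a \<oplus> b))) = Q.coset (bas (F (Leaf a)) \<oplus>\<^bsub>\<C>\<^esub> bas (F (Leaf b)))"
    unfolding cls_def using c assms bas_closed by (subst Q.coset_eq_iff) auto
  thus ?thesis
    unfolding cls_def using c bas_closed by (simp add: Q.coset_add)
qed

lemma cls_homogeneous:
  assumes "F \<in> frames" "c \<in> carrier K" "a \<in> carrier A" "F (Leaf (c \<odot> a)) \<in> ctx"
  shows "cls (F (Leaf (c \<odot> a))) = c \<odot>\<^bsub>\<U>\<^esub> cls (F (Leaf a))"
proof -
  have t: "F (Leaf a) \<in> ctx"
    using leaf_ctx[OF assms(1,4)] assms by auto
  have "bas (F (Leaf (c \<odot> a))) \<ominus>\<^bsub>\<C>\<^esub> (c \<odot>\<^bsub>\<C>\<^esub> bas (F (Leaf a))) \<in> ker"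
    by (intro rel_ker UnI1 envelope_relations.homogeneous assms)
  hence "cls (F (Leaf (c \<odot> a))) = Q.coset (c \<odot>\<^bsub>\<C>\<^esub> bas (F (Leaf a)))"
    unfolding cls_def using t assms bas_closed by (subst Q.coset_eq_iff) auto
  thus ?thesis
    unfolding cls_def using t bas_closed assms by (simp add: Q.coset_smult)
qed

lemma cls_contract:
  assumes "F \<in> frames" "length as = n" "set as \<subseteq> carrier A" "F (Node (map Leaf as)) \<in> ctx"
  shows "cls (F (Node (map Leaf as))) = cls (F (Leaf (tw 0 as)))"
  unfolding twisted_product_eq[OF assms(2,3), symmetric]
  using leaf_ctx[OF assms(1,4)] tp_closed[OF assms(2,3)]
  by (intro cls_eqI UnI1 envelope_relations.contraction assms) (auto simp: holes_Leaf_list)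

lemma cls_regroup:
  assumes "us @ vs @ ws = us' @ vs' @ ws'" "length vs = n" "length vs' = n"
    "Node (us @ Node vs # ws) \<in> ctx"
  shows "cls (Node (us @ Node vs # ws)) = cls (Node (us' @ Node vs' # ws'))"
    "Node (us' @ Node vs' # ws') \<in> ctx"
proof -
  have len: "length (us' @ ws') = length (us @ ws)"
    using arg_cong[OF assms(1), of length] assms(2,3) by simp
  have set: "set us \<union> set vs \<union> set ws = set us' \<union> set vs' \<union> set ws'"
    using arg_cong[OF assms(1), of set] by auto
  have h: "sum_list (map holes us) + (sum_list (map holes vs) + sum_list (map holes ws))
     = sum_list (map holes us') + (sum_list (map holes vs') + sum_list (map holes ws'))"
    using arg_cong[OF assms(1), of "\<lambda>x. sum_list (map holes x)"] by simp
  show c: "Node (us' @ Node vs' # ws') \<in> ctx"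
    using assms(2-4) len h set by (auto simp: contexts_def)
  show "cls (Node (us @ Node vs # ws)) = cls (Node (us' @ Node vs' # ws'))"
    by (intro cls_eqI UnI1 envelope_relations.associativity[OF frames.here] assms c)
qed

end

section \<open>Generators of the envelope and normal forms\<close>

context envelope_setting
begin

abbreviation ones :: "nat \<Rightarrow> 'a list" where "ones k \<equiv> replicate k \<one>"

definition corolla :: "'a list \<Rightarrow> 'a list \<Rightarrow> 'a tree" where
  "corolla as bs = Node (map Leaf as @ Hole # map Leaf bs)"

lemma corolla_ctx:
  assumes "length as + length bs = m" "set as \<subseteq> carrier A" "set bs \<subseteq> carrier A"
  shows "corolla as bs \<in> ctx"
  using assms n_eq by (auto simp: corolla_def contexts_def holes_Leaf_list)

lemma contract_list:
  assumes "length ys = n" "set ys \<subseteq> carrier A" "Node (us @ Node (map Leaf ys) # ws) \<in> ctx"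
  shows "cls (Node (us @ Node (map Leaf ys) # ws)) = cls (Node (us @ Leaf (tw 0 ys) # ws))"
  using cls_contract[OF frame_here assms] .

lemma cls_corolla_mult:
  assumes "length as + length bs = m" "set as \<subseteq> carrier A" "set bs \<subseteq> carrier A"
    and "length as' + length bs' = m" "set as' \<subseteq> carrier A" "set bs' \<subseteq> carrier A"
  shows "cls (corolla as bs) \<otimes>\<^bsub>\<U>\<^esub> cls (corolla as' bs')
      = cls (Node (map Leaf as @ Node (map Leaf as' @ Hole # map Leaf bs') # map Leaf bs))"
    "Node (map Leaf as @ Node (map Leaf as' @ Hole # map Leaf bs') # map Leaf bs) \<in> ctx"
proof -
  have leaves: "map (\<lambda>t. graft t D) (map Leaf xs) = map Leaf xs" for D and xs :: "'a list"
    by (induction xs) auto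
  have "graft (corolla as bs) (corolla as' bs')
      = Node (map Leaf as @ Node (map Leaf as' @ Hole # map Leaf bs') # map Leaf bs)"
    using leaves by (simp add: corolla_def)
  thus "cls (corolla as bs) \<otimes>\<^bsub>\<U>\<^esub> cls (corolla as' bs')
      = cls (Node (map Leaf as @ Node (map Leaf as' @ Hole # map Leaf bs') # map Leaf bs))"
    "Node (map Leaf as @ Node (map Leaf as' @ Hole # map Leaf bs') # map Leaf bs) \<in> ctx"
    using cls_graft[OF corolla_ctx[OF assms(1-3)] corolla_ctx[OF assms(4-6)]]
      graft_ctx[OF corolla_ctx[OF assms(1-3)] corolla_ctx[OF assms(4-6)]] by simp_all
qed

text \<open>A product of two corollas is the word \<open>as as' \<star> bs' bs\<close> with the
  block around the hole bracketed. Any other block of \<open>n\<close> letters may be bracketed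
  instead; here one to the left of the hole, which contracts to a letter.\<close>

lemma corolla_mult_left:
  assumes "length as + length bs = m" "set as \<subseteq> carrier A" "set bs \<subseteq> carrier A"
    and "length as' + length bs' = m" "set as' \<subseteq> carrier A" "set bs' \<subseteq> carrier A"
    and "as @ as' = xs @ ys @ zs" "length ys = n"
  shows "cls (corolla as bs) \<otimes>\<^bsub>\<U>\<^esub> cls (corolla as' bs') = cls (corolla (xs @ [tw 0 ys] @ zs) (bs' @ bs))"
proof -
  have eq: "map Leaf as @ (map Leaf as' @ Hole # map Leaf bs') @ map Leaf bs
      = map Leaf xs @ map Leaf ys @ (map Leaf zs @ Hole # map Leaf (bs' @ bs))"
    using arg_cong[OF assms(7), of "map Leaf"] by simp
  have ys: "set ys \<subseteq> carrier A"
    using arg_cong[OF assms(7), of set] assms(2,5) by auto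
  have "length (map Leaf as' @ Hole # map Leaf bs') = n" "length (map Leaf ys) = n"
    using assms(4,8) n_eq by simp_all
  note r = cls_regroup[OF eq this cls_corolla_mult(2)[OF assms(1-6)]]
  show ?thesis
    unfolding cls_corolla_mult(1)[OF assms(1-6)]
    using r(1) contract_list[OF assms(8) ys r(2)] by (simp add: corolla_def)
qed

lemma corolla_mult_right:
  assumes "length as + length bs = m" "set as \<subseteq> carrier A" "set bs \<subseteq> carrier A"
    and "length as' + length bs' = m" "set as' \<subseteq> carrier A" "set bs' \<subseteq> carrier A"
    and "bs' @ bs = xs @ ys @ zs" "length ys = n"
  shows "cls (corolla as bs) \<otimes>\<^bsub>\<U>\<^esub> cls (corolla as' bs') = cls (corolla (as @ as') (xs @ [tw 0 ys] @ zs))"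
proof -
  have eq: "map Leaf as @ (map Leaf as' @ Hole # map Leaf bs') @ map Leaf bs
      = (map Leaf (as @ as') @ Hole # map Leaf xs) @ map Leaf ys @ map Leaf zs"
    using arg_cong[OF assms(7), of "map Leaf"] by simp
  have ys: "set ys \<subseteq> carrier A"
    using arg_cong[OF assms(7), of set] assms(3,6) by auto
  have "length (map Leaf as' @ Hole # map Leaf bs') = n" "length (map Leaf ys) = n"
    using assms(4,8) n_eq by simp_all
  note r = cls_regroup[OF eq this cls_corolla_mult(2)[OF assms(1-6)]]
  show ?thesis
    unfolding cls_corolla_mult(1)[OF assms(1-6)]
    using r(1) contract_list[OF assms(8) ys r(2)] by (simp add: corolla_def)
qed

text \<open>Here the new block again contains the hole, so the word is cut into two corollas at
  another place.\<close>

lemma corolla_mult_swap: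
  assumes "length as + length bs = m" "set as \<subseteq> carrier A" "set bs \<subseteq> carrier A"
    and "length as' + length bs' = m" "set as' \<subseteq> carrier A" "set bs' \<subseteq> carrier A"
    and "as @ as' = xs @ xs'" "bs' @ bs = ys' @ ys" "length xs + length ys = m" "length xs' + length ys' = m"
  shows "cls (corolla as bs) \<otimes>\<^bsub>\<U>\<^esub> cls (corolla as' bs') = cls (corolla xs ys) \<otimes>\<^bsub>\<U>\<^esub> cls (corolla xs' ys')"
proof -
  have eq: "map Leaf as @ (map Leaf as' @ Hole # map Leaf bs') @ map Leaf bs
      = map Leaf xs @ (map Leaf xs' @ Hole # map Leaf ys') @ map Leaf ys"
    using arg_cong[OF assms(7), of "map Leaf"] arg_cong[OF assms(8), of "map Leaf"] by simp
  have s: "set xs \<subseteq> carrier A" "set xs' \<subseteq> carrier A" "set ys \<subseteq> carrier A" "set ys' \<subseteq> carrier A"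
    using arg_cong[OF assms(7), of set] arg_cong[OF assms(8), of set] assms(2,3,5,6) by auto
  have l: "length (map Leaf as' @ Hole # map Leaf bs') = n" "length (map Leaf xs' @ Hole # map Leaf ys') = n"
    using assms(4,10) n_eq by simp_all
  show ?thesis
    unfolding cls_corolla_mult(1)[OF assms(1-6)] cls_corolla_mult(1)[OF assms(9) s(1,3) assms(10) s(2,4)]
    by (rule cls_regroup(1)[OF eq l cls_corolla_mult(2)[OF assms(1-6)]])
qed

text \<open>A letter that is a product of \<open>n\<close> letters may be expanded, and
  associativity then allows another block to be contracted in its place. Blocks padded with
  \<open>1\<close> thus move letters along the word at the price of a twist.\<close>

lemma recontract_left:
  assumes "length ys = n" "length ys' = n" "xs @ ys @ zs = xs' @ ys' @ zs'"
    and "set xs \<subseteq> carrier A" "set ys \<subseteq> carrier A" "set zs \<subseteq> carrier A" "set bs \<subseteq> carrier A" "length xs + length zs + length bs = m - 1"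
  shows "cls (corolla (xs @ [tw 0 ys] @ zs) bs) = cls (corolla (xs' @ [tw 0 ys'] @ zs') bs)"
proof -
  have eq: "map Leaf xs @ map Leaf ys @ (map Leaf zs @ Hole # map Leaf bs)
      = map Leaf xs' @ map Leaf ys' @ (map Leaf zs' @ Hole # map Leaf bs)"
    using arg_cong[OF assms(3), of "map Leaf"] by simp
  have ys: "set ys \<subseteq> carrier A" "set ys' \<subseteq> carrier A"
    using arg_cong[OF assms(3), of set] assms(4-6) by auto
  have t: "Node (map Leaf xs @ Node (map Leaf ys) # map Leaf zs @ Hole # map Leaf bs) \<in> ctx"
    using assms(1,4-8) m_ge_2 n_eq by (auto simp: contexts_def holes_Leaf_list)
  have "length (map Leaf ys) = n" "length (map Leaf ys') = n"
    using assms(1,2) by simp_all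
  note r = cls_regroup[OF eq this t]
  have "cls (Node (map Leaf xs @ Leaf (tw 0 ys) # map Leaf zs @ Hole # map Leaf bs))
      = cls (Node (map Leaf xs' @ Leaf (tw 0 ys') # map Leaf zs' @ Hole # map Leaf bs))"
    using r contract_list[OF assms(1) ys(1) t] contract_list[OF assms(2) ys(2) r(2)] assms(1,2) by simp
  thus ?thesis by (simp add: corolla_def)
qed

lemma recontract_right:
  assumes "length ys = n" "length ys' = n" "xs @ ys @ zs = xs' @ ys' @ zs'"
    and "set xs \<subseteq> carrier A" "set ys \<subseteq> carrier A" "set zs \<subseteq> carrier A" "set as \<subseteq> carrier A" "length xs + length zs + length as = m - 1"
  shows "cls (corolla as (xs @ [tw 0 ys] @ zs)) = cls (corolla as (xs' @ [tw 0 ys'] @ zs'))"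
proof -
  have eq: "(map Leaf as @ Hole # map Leaf xs) @ map Leaf ys @ map Leaf zs
      = (map Leaf as @ Hole # map Leaf xs') @ map Leaf ys' @ map Leaf zs'"
    using arg_cong[OF assms(3), of "map Leaf"] by simp
  have ys: "set ys \<subseteq> carrier A" "set ys' \<subseteq> carrier A"
    using arg_cong[OF assms(3), of set] assms(4-6) by auto
  have t: "Node ((map Leaf as @ Hole # map Leaf xs) @ Node (map Leaf ys) # map Leaf zs) \<in> ctx"
    using assms(1,4-8) m_ge_2 n_eq by (auto simp: contexts_def holes_Leaf_list)
  have "length (map Leaf ys) = n" "length (map Leaf ys') = n"
    using assms(1,2) by simp_all
  note r = cls_regroup[OF eq this t]
  have "cls (Node ((map Leaf as @ Hole # map Leaf xs) @ Leaf (tw 0 ys) # map Leaf zs))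
      = cls (Node ((map Leaf as @ Hole # map Leaf xs') @ Leaf (tw 0 ys') # map Leaf zs'))"
    using r contract_list[OF assms(1) ys(1) t] contract_list[OF assms(2) ys(2) r(2)] assms(1,2) by simp
  thus ?thesis by (simp add: corolla_def)
qed

text \<open>Under the reading of contexts as operators these are \<open>x \<mapsto> a x\<close>,
  \<open>x \<mapsto> x b\<close> and \<open>x \<mapsto> \<sigma>(x)\<close>.\<close>

definition lmul :: "'a \<Rightarrow> ('a tree \<Rightarrow> 'k) set" where "lmul a = cls (corolla (a # ones (m - 1)) [])"
definition rmul :: "'a \<Rightarrow> ('a tree \<Rightarrow> 'k) set" where "rmul b = cls (corolla [] (ones (m - 1) @ [b]))"
definition shift :: "('a tree \<Rightarrow> 'k) set" where "shift = cls (corolla [\<one>] (ones (m - 1)))"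

lemma lmul_closed: "a \<in> carrier A \<Longrightarrow> lmul a \<in> carrier \<U>"
  and rmul_closed: "a \<in> carrier A \<Longrightarrow> rmul a \<in> carrier \<U>"
  and shift_closed: "shift \<in> carrier \<U>"
  using m_ge_2 by (auto simp: lmul_def rmul_def shift_def intro!: cls_closed corolla_ctx)

lemma lmul_corolla:
  assumes "a \<in> carrier A" "a' \<in> carrier A" "set as \<subseteq> carrier A" "set bs \<subseteq> carrier A"
    "length as + length bs = m - 1"
  shows "lmul a \<otimes>\<^bsub>\<U>\<^esub> cls (corolla (a' # as) bs) = cls (corolla ((a \<otimes> a') # as) bs)"
proof -
  have "lmul a \<otimes>\<^bsub>\<U>\<^esub> cls (corolla (a' # as) bs)
      = cls (corolla ([] @ [tw 0 (a # ones (m - 1) @ [a'])] @ as) (bs @ []))"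
    unfolding lmul_def using assms m_ge_2 n_eq by (intro corolla_mult_left) auto
  also have "tw 0 (a # ones (m - 1) @ [a']) = a \<otimes> a'"
    using assms m_ge_2
    by (simp add: tw_append tw_ones ones_closed sigma_order[of a', simplified] flip: funpow.simps(2))
  finally show ?thesis by simp
qed

lemma rmul_corolla:
  assumes "b \<in> carrier A" "b' \<in> carrier A" "set as \<subseteq> carrier A" "set bs \<subseteq> carrier A"
    "length as + length bs = m - 1"
  shows "rmul b \<otimes>\<^bsub>\<U>\<^esub> cls (corolla as (bs @ [b'])) = cls (corolla as (bs @ [b' \<otimes> b]))"
proof -
  have "rmul b \<otimes>\<^bsub>\<U>\<^esub> cls (corolla as (bs @ [b']))
      = cls (corolla ([] @ as) (bs @ [tw 0 (b' # ones (m - 1) @ [b])] @ []))"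
    unfolding rmul_def using assms m_ge_2 n_eq by (intro corolla_mult_right) auto
  also have "tw 0 (b' # ones (m - 1) @ [b]) = b' \<otimes> b"
    using assms m_ge_2
    by (simp add: tw_append tw_ones ones_closed sigma_order[of b, simplified] flip: funpow.simps(2))
  finally show ?thesis by simp
qed

lemma lmul_one: "lmul \<one> = \<one>\<^bsub>\<U>\<^esub>"
proof -
  have "\<one> # ones (m - 1) = ones (n - 1)"
    using m_ge_2 n_eq by (simp flip: replicate_Suc)
  hence "corolla (\<one> # ones (m - 1)) [] = Node (replicate (n - 1) (Leaf \<one>) @ [Hole])"
    by (simp add: corolla_def)
  moreover have "cls (Node (replicate (n - 1) (Leaf \<one>) @ [Hole])) = cls Hole"
    by (rule cls_eqI[OF anchor_ctx(2) Hole_ctx]) (simp add: anchor_relations_def)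
  ultimately show ?thesis
    by (simp only: lmul_def cls_Hole)
qed

lemma rmul_one: "rmul \<one> = \<one>\<^bsub>\<U>\<^esub>"
proof -
  have "ones (m - 1) @ [\<one>] = ones (n - 1)"
    using m_ge_2 n_eq by (simp add: replicate_append_same flip: replicate_Suc)
  hence "corolla [] (ones (m - 1) @ [\<one>]) = Node (Hole # replicate (n - 1) (Leaf \<one>))"
    unfolding corolla_def by (simp only: map_replicate list.map append_Nil)
  moreover have "cls (Node (Hole # replicate (n - 1) (Leaf \<one>))) = cls Hole"
    by (rule cls_eqI[OF anchor_ctx(1) Hole_ctx]) (simp add: anchor_relations_def)
  ultimately show ?thesis
    by (simp only: rmul_def cls_Hole)
qed

lemma lmul_mult: "a \<in> carrier A \<Longrightarrow> b \<in> carrier A \<Longrightarrow> lmul a \<otimes>\<^bsub>\<U>\<^esub> lmul b = lmul (a \<otimes> b)"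
  unfolding lmul_def[of b] lmul_def[of "a \<otimes> b"] by (rule lmul_corolla) auto

lemma rmul_mult: "a \<in> carrier A \<Longrightarrow> b \<in> carrier A \<Longrightarrow> rmul a \<otimes>\<^bsub>\<U>\<^esub> rmul b = rmul (b \<otimes> a)"
  unfolding rmul_def[of b] rmul_def[of "b \<otimes> a"] by (rule rmul_corolla) auto

text \<open>Both products bracket the word \<open>a 1 \<dots> 1 \<star> 1 \<dots> 1
  b\<close>.\<close>

lemma lmul_rmul:
  assumes "a \<in> carrier A" "b \<in> carrier A"
  shows "lmul a \<otimes>\<^bsub>\<U>\<^esub> rmul b = rmul b \<otimes>\<^bsub>\<U>\<^esub> lmul a"
  unfolding lmul_def rmul_def using assms m_ge_2 by (intro corolla_mult_swap) auto

text \<open>The word of \<open>s l\<^sub>a\<close> begins with \<open>1, a\<close>; contracting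
  its first \<open>n\<close> letters twists \<open>a\<close> once, because \<open>a\<close> stands
  in second place.\<close>

lemma shift_lmul:
  assumes "a \<in> carrier A"
  shows "shift \<otimes>\<^bsub>\<U>\<^esub> lmul a = lmul (\<sigma> a) \<otimes>\<^bsub>\<U>\<^esub> shift"
proof -
  have s: "\<sigma> a \<in> carrier A" using sigma_pow(1)[OF assms, of 1] by simp
  have "shift \<otimes>\<^bsub>\<U>\<^esub> lmul a
      = cls (corolla ([] @ [tw 0 (\<one> # a # ones (m - 1))] @ []) ([] @ ones (m - 1)))"
    unfolding lmul_def shift_def using assms m_ge_2 n_eq by (intro corolla_mult_left) auto
  also have "tw 0 (\<one> # a # ones (m - 1)) = \<sigma> a \<otimes> \<one>"
    using s by (simp add: tw_ones)
  also have "cls (corolla ([] @ [\<sigma> a \<otimes> \<one>] @ []) ([] @ ones (m - 1))) = lmul (\<sigma> a) \<otimes>\<^bsub>\<U>\<^esub> shift"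
    unfolding shift_def using s m_ge_2 by (subst lmul_corolla) auto
  finally show ?thesis .
qed

text \<open>The last \<open>n\<close> letters of the word of \<open>s r\<^sub>b\<close> are
  \<open>1, b, 1, \<dots>, 1\<close>, in which \<open>b\<close> again stands in second
  place.\<close>

lemma shift_rmul:
  assumes "b \<in> carrier A"
  shows "shift \<otimes>\<^bsub>\<U>\<^esub> rmul b = rmul (\<sigma> b) \<otimes>\<^bsub>\<U>\<^esub> shift"
proof -
  have s: "\<sigma> b \<in> carrier A" using sigma_pow(1)[OF assms, of 1] by simp
  have o: "ones (m - 1) = ones (m - 2) @ [\<one>]"
    using m_ge_2 by (simp add: replicate_append_same Suc_diff_Suc numeral_2_eq_2 flip: replicate_Suc)
  have w: "(ones (m - 1) @ [b]) @ ones (m - 1) = ones (m - 2) @ (\<one> # b # ones (m - 1)) @ []"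
    by (subst (1) o) simp
  have "shift \<otimes>\<^bsub>\<U>\<^esub> rmul b
      = cls (corolla ([\<one>] @ []) (ones (m - 2) @ [tw 0 (\<one> # b # ones (m - 1))] @ []))"
    unfolding rmul_def shift_def using assms m_ge_2 n_eq
    by (intro corolla_mult_right[OF _ _ _ _ _ _ w]) auto
  also have "tw 0 (\<one> # b # ones (m - 1)) = \<one> \<otimes> \<sigma> b"
    using s by (simp add: tw_ones)
  also have "cls (corolla ([\<one>] @ []) (ones (m - 2) @ [\<one> \<otimes> \<sigma> b] @ [])) = rmul (\<sigma> b) \<otimes>\<^bsub>\<U>\<^esub> shift"
    unfolding shift_def o append_Nil2 using s m_ge_2
    by (intro rmul_corolla[symmetric]) (auto simp: Suc_diff_Suc numeral_2_eq_2)
  finally show ?thesis .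
qed

lemma shift_pow_corolla:
  "k \<le> m \<Longrightarrow> shift [^]\<^bsub>\<U>\<^esub> k = cls (corolla (ones k) (ones (m - k)))"
proof (induction k)
  case 0
  have "ones m = ones (m - 1) @ [\<one>]"
    using m_ge_2 by (simp add: replicate_append_same flip: replicate_Suc)
  thus ?case using rmul_one by (simp add: rmul_def)
next
  case (Suc k)
  have comm: "shift [^]\<^bsub>\<U>\<^esub> Suc k = shift \<otimes>\<^bsub>\<U>\<^esub> shift [^]\<^bsub>\<U>\<^esub> k"
    using U.nat_pow_Suc2[OF shift_closed] by simp
  show ?case
  proof (cases "Suc k = m")
    case True
    have o: "ones m = \<one> # ones (m - 1)" "ones m = ones (m - 1) @ [\<one>]"
      using m_ge_2 by (simp_all add: replicate_append_same flip: replicate_Suc)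
    (* The word has m units on either side of the hole, so it also brackets as a product of the
       two anchors; this is where the powers of the shift close up. *)
    have "shift \<otimes>\<^bsub>\<U>\<^esub> cls (corolla (ones k) (ones (m - k)))
        = cls (corolla [] (ones m)) \<otimes>\<^bsub>\<U>\<^esub> cls (corolla (ones m) [])"
      unfolding shift_def using m_ge_2 True
      by (intro corolla_mult_swap) (auto simp flip: replicate_Suc replicate_add)
    also have "cls (corolla [] (ones m)) = \<one>\<^bsub>\<U>\<^esub>"
      using rmul_one unfolding rmul_def o(2)[symmetric] .
    also have "cls (corolla (ones m) []) = \<one>\<^bsub>\<U>\<^esub>"
      using lmul_one unfolding lmul_def o(1)[symmetric] .
    also have "\<one>\<^bsub>\<U>\<^esub> \<otimes>\<^bsub>\<U>\<^esub> \<one>\<^bsub>\<U>\<^esub> = cls (corolla (ones (Suc k)) (ones (m - Suc k)))"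
      using lmul_one True unfolding lmul_def o(1)[symmetric] by simp
    finally show ?thesis
      using Suc by (simp only: comm)
  next
    case False
    have "m - k + (m - 1) = n + (m - Suc k - 1)"
      using False Suc.prems n_eq by simp
    hence w: "ones (m - k) @ ones (m - 1) = [] @ ones n @ ones (m - Suc k - 1)"
      by (metis append_Nil replicate_add)
    have "shift \<otimes>\<^bsub>\<U>\<^esub> cls (corolla (ones k) (ones (m - k)))
        = cls (corolla ([\<one>] @ ones k) ([] @ [tw 0 (ones n)] @ ones (m - Suc k - 1)))"
      unfolding shift_def using m_ge_2 Suc.prems
      by (intro corolla_mult_right[OF _ _ _ _ _ _ w]) auto
    also have "[] @ [tw 0 (ones n)] @ ones (m - Suc k - 1) = ones (m - Suc k)"
      using False Suc.prems by (simp add: tw_ones flip: replicate_Suc)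
    finally show ?thesis
      unfolding comm using Suc.IH Suc.prems by simp
  qed
qed

lemma shift_order: "shift [^]\<^bsub>\<U>\<^esub> m = \<one>\<^bsub>\<U>\<^esub>"
proof -
  have "ones m = \<one> # ones (m - 1)"
    using m_ge_2 by (simp flip: replicate_Suc)
  thus ?thesis
    using shift_pow_corolla[of m] lmul_one by (simp add: lmul_def)
qed

definition monomial :: "'a \<Rightarrow> 'a \<Rightarrow> nat \<Rightarrow> ('a tree \<Rightarrow> 'k) set" where
  "monomial a b p = lmul a \<otimes>\<^bsub>\<U>\<^esub> rmul b \<otimes>\<^bsub>\<U>\<^esub> shift [^]\<^bsub>\<U>\<^esub> p"

lemma monomial_closed: "a \<in> carrier A \<Longrightarrow> b \<in> carrier A \<Longrightarrow> monomial a b p \<in> carrier \<U>"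
  by (simp add: monomial_def lmul_closed rmul_closed shift_closed)

lemma sigma_closed: "a \<in> carrier A \<Longrightarrow> \<sigma> a \<in> carrier A"
  using sigma_pow(1)[of a 1] by simp

lemma sigma_one: "\<sigma> \<one> = \<one>"
  using sigma_pow(4)[of 1] by simp

text \<open>All letters to the left of the hole can be collected in the first one. Let
  \<open>p\<close> be their number and \<open>a\<close> the last of them. Writing \<open>a\<close>
  as the product of the block \<open>1, \<dots>, 1, \<sigma>\<^sup>p\<^sup>-\<^sup>1(a), 1,
  \<dots>, 1\<close> with \<open>p - 1\<close> trailing units makes room to contract the first
  \<open>n\<close> letters, in which \<open>\<sigma>\<^sup>p\<^sup>-\<^sup>1(a)\<close> is last
  and so keeps precisely the twist that \<open>a\<close> has in the word.\<close>

lemma gather_left: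
  assumes "length as + length bs = m" "set as \<subseteq> carrier A" "set bs \<subseteq> carrier A" "as \<noteq> []"
  shows "cls (corolla as bs) = cls (corolla (tw 0 as # ones (length as - 1)) bs)"
proof -
  obtain as0 a where as: "as = as0 @ [a]"
    using assms(4) by (cases as rule: rev_cases) auto
  let ?p = "length as"
  let ?c = "(\<sigma> ^^ (?p - 1)) a"
  have a: "a \<in> carrier A" "?c \<in> carrier A" "set as0 \<subseteq> carrier A"
    using assms(2) as by (auto simp: sigma_pow)
  have p: "?p \<ge> 1" "?p \<le> m" using assms(1) as by auto
  have "tw 0 (ones (m - ?p + 1) @ [?c] @ ones (?p - 1)) = (\<sigma> ^^ (m - ?p + 1)) ?c"
    using a by (simp add: tw_append tw_ones ones_closed sigma_pow sigma_closed)
  also have "\<dots> = (\<sigma> ^^ (m - ?p + 1 + (?p - 1))) a"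
    by (rule sigma_pow_add)
  also have "m - ?p + 1 + (?p - 1) = m"
    using p by simp
  finally have 1: "tw 0 (ones (m - ?p + 1) @ [?c] @ ones (?p - 1)) = a"
    using a by (simp add: sigma_order)
  have "tw 0 (as0 @ ones (m - ?p + 1) @ [?c]) = tw 0 as0 \<otimes> (\<sigma> ^^ m) ?c"
    using a p as by (simp add: tw_append tw_ones ones_closed sigma_pow tw_closed)
  also have "\<dots> = tw 0 as"
    using a as by (simp add: tw_append sigma_order)
  finally have 2: "tw 0 (as0 @ ones (m - ?p + 1) @ [?c]) = tw 0 as" .
  have "cls (corolla (as0 @ [tw 0 (ones (m - ?p + 1) @ [?c] @ ones (?p - 1))] @ []) bs)
      = cls (corolla ([] @ [tw 0 (as0 @ ones (m - ?p + 1) @ [?c])] @ ones (?p - 1)) bs)"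
    using assms a p as n_eq by (intro recontract_left) auto
  thus ?thesis
    unfolding 1 2 by (simp add: as)
qed

text \<open>The mirror image: the first letter \<open>b\<close> to the right of the hole is
  expanded to a block containing \<open>\<sigma>\<^sup>p\<^sup>+\<^sup>1(b)\<close>, which then
  opens the block of the last \<open>n\<close> letters. The exponent is \<open>p + 1\<close>
  because the hole occupies position \<open>p\<close>.\<close>

lemma gather_right:
  assumes "length as + length bs = m" "set as \<subseteq> carrier A" "set bs \<subseteq> carrier A" "bs \<noteq> []"
  shows "cls (corolla as bs) = cls (corolla as (ones (length bs - 1) @ [tw (Suc (length as)) bs]))"
proof -
  obtain b bs0 where bs: "bs = b # bs0"
    using assms(4) by (cases bs) auto
  let ?q = "length bs"
  let ?c = "(\<sigma> ^^ Suc (length as)) b"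
  have b: "b \<in> carrier A" "?c \<in> carrier A" "set bs0 \<subseteq> carrier A"
    using assms(3) bs sigma_pow(1)[of b "Suc (length as)"] by auto
  have q: "?q \<ge> 1" "?q \<le> m" using assms(1) bs by auto
  have "tw 0 (ones (?q - 1) @ [?c] @ ones (m - ?q + 1)) = (\<sigma> ^^ (?q - 1)) ?c"
    using b by (simp add: tw_append tw_ones ones_closed sigma_pow del: funpow.simps)
  also have "\<dots> = (\<sigma> ^^ (?q - 1 + Suc (length as))) b"
    by (rule sigma_pow_add)
  also have "?q - 1 + Suc (length as) = m"
    using q assms(1) by simp
  finally have 1: "tw 0 (ones (?q - 1) @ [?c] @ ones (m - ?q + 1)) = b"
    using b by (simp add: sigma_order)
  have "m - ?q + 2 = Suc (Suc (length as))"
    using q assms(1) by simp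
  hence 2: "tw 0 ([?c] @ ones (m - ?q + 1) @ bs0) = tw (Suc (length as)) bs"
    using b bs by (simp add: tw_append tw_ones ones_closed tw_closed del: funpow.simps) (simp add: sigma_one tw_closed)
  have "cls (corolla as ([] @ [tw 0 (ones (?q - 1) @ [?c] @ ones (m - ?q + 1))] @ bs0))
      = cls (corolla as (ones (?q - 1) @ [tw 0 ([?c] @ ones (m - ?q + 1) @ bs0)] @ []))"
    using assms b q bs n_eq by (intro recontract_right) auto
  thus ?thesis
    unfolding 1 2 by (simp add: bs)
qed

text \<open>After gathering on both sides the word is \<open>L 1 \<dots> 1 \<star> 1 \<dots> 1
  R\<close>, from which the outer letters split off as \<open>l\<^sub>L\<close> and
  \<open>r\<^sub>R\<close> and leave a power of \<open>s\<close>.\<close>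

lemma corolla_monomial:
  assumes "length as + length bs = m" "set as \<subseteq> carrier A" "set bs \<subseteq> carrier A"
  shows "cls (corolla as bs) = monomial (tw 0 as) (tw (Suc (length as)) bs) (length as)"
proof -
  let ?L = "tw 0 as" and ?R = "tw (Suc (length as)) bs" and ?p = "length as"
  have c: "?L \<in> carrier A" "?R \<in> carrier A" using assms tw_closed by auto
  consider "as = []" | "bs = []" | "as \<noteq> []" "bs \<noteq> []" by blast
  thus ?thesis
  proof cases
    case 1
    have "cls (corolla as bs) = rmul ?R"
    proof -
      have "length bs = m" "bs \<noteq> []" using 1 assms(1) m_ge_2 by auto
      thus ?thesis using gather_right[OF assms] 1 by (simp add: rmul_def)
    qed
    thus ?thesis using 1 c by (simp add: monomial_def lmul_one rmul_closed)
  next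
    case 2
    have "cls (corolla as bs) = lmul ?L"
    proof -
      have "length as = m" "as \<noteq> []" using 2 assms(1) m_ge_2 by auto
      thus ?thesis using gather_left[OF assms] 2 by (simp add: lmul_def)
    qed
    thus ?thesis using 2 c assms(1) by (simp add: monomial_def rmul_one lmul_closed shift_order)
  next
    case 3
    let ?q = "length bs"
    have o: "\<one> # ones (?p - 1) = ones ?p" "ones (?q - 1) @ [\<one>] = ones ?q"
      using 3 by (simp_all add: replicate_append_same Suc_le_eq flip: replicate_Suc)
    have "cls (corolla as bs) = cls (corolla (?L # ones (?p - 1)) bs)"
      using gather_left assms 3 by blast
    also have "\<dots> = cls (corolla (?L # ones (?p - 1)) (ones (?q - 1) @ [?R]))"
      using gather_right[of "?L # ones (?p - 1)" bs] assms 3 c ones_closed[of "?p - 1"] by simp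
    also have "\<dots> = lmul ?L \<otimes>\<^bsub>\<U>\<^esub> cls (corolla (\<one> # ones (?p - 1)) (ones (?q - 1) @ [?R]))"
      using assms 3 c by (subst lmul_corolla) (auto simp: Suc_le_eq)
    also have "cls (corolla (\<one> # ones (?p - 1)) (ones (?q - 1) @ [?R]))
        = rmul ?R \<otimes>\<^bsub>\<U>\<^esub> cls (corolla (\<one> # ones (?p - 1)) (ones (?q - 1) @ [\<one>]))"
      using assms 3 c by (subst rmul_corolla) (auto simp: Suc_le_eq)
    also have "cls (corolla (\<one> # ones (?p - 1)) (ones (?q - 1) @ [\<one>])) = shift [^]\<^bsub>\<U>\<^esub> ?p"
    proof -
      have "m - ?p = ?q" "?p \<le> m" using assms(1) by auto
      thus ?thesis unfolding o using shift_pow_corolla[of ?p] by simp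
    qed
    finally show ?thesis
      using c by (simp add: monomial_def U.m_assoc lmul_closed rmul_closed shift_closed)
  qed
qed

lemma shift_pow_lmul:
  "a \<in> carrier A \<Longrightarrow> shift [^]\<^bsub>\<U>\<^esub> p \<otimes>\<^bsub>\<U>\<^esub> lmul a = lmul ((\<sigma> ^^ p) a) \<otimes>\<^bsub>\<U>\<^esub> shift [^]\<^bsub>\<U>\<^esub> (p::nat)"
proof (induction p arbitrary: a)
  case (Suc p)
  have s: "\<sigma> a \<in> carrier A" "(\<sigma> ^^ p) (\<sigma> a) \<in> carrier A"
    using sigma_pow(1)[OF Suc.prems, of 1] sigma_pow(1)[of "\<sigma> a" p] by auto
  have "shift [^]\<^bsub>\<U>\<^esub> Suc p \<otimes>\<^bsub>\<U>\<^esub> lmul a = shift [^]\<^bsub>\<U>\<^esub> p \<otimes>\<^bsub>\<U>\<^esub> lmul (\<sigma> a) \<otimes>\<^bsub>\<U>\<^esub> shift"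
    using Suc.prems s by (simp add: U.m_assoc shift_lmul shift_closed lmul_closed)
  also have "\<dots> = lmul ((\<sigma> ^^ p) (\<sigma> a)) \<otimes>\<^bsub>\<U>\<^esub> shift [^]\<^bsub>\<U>\<^esub> Suc p"
    using Suc.IH[OF s(1)] s by (simp add: U.m_assoc shift_closed lmul_closed)
  finally show ?case by (simp add: funpow_swap1)
qed (simp add: lmul_closed)

lemma shift_pow_rmul:
  "a \<in> carrier A \<Longrightarrow> shift [^]\<^bsub>\<U>\<^esub> p \<otimes>\<^bsub>\<U>\<^esub> rmul a = rmul ((\<sigma> ^^ p) a) \<otimes>\<^bsub>\<U>\<^esub> shift [^]\<^bsub>\<U>\<^esub> (p::nat)"
proof (induction p arbitrary: a)
  case (Suc p)
  have s: "\<sigma> a \<in> carrier A" "(\<sigma> ^^ p) (\<sigma> a) \<in> carrier A"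
    using sigma_pow(1)[OF Suc.prems, of 1] sigma_pow(1)[of "\<sigma> a" p] by auto
  have "shift [^]\<^bsub>\<U>\<^esub> Suc p \<otimes>\<^bsub>\<U>\<^esub> rmul a = shift [^]\<^bsub>\<U>\<^esub> p \<otimes>\<^bsub>\<U>\<^esub> rmul (\<sigma> a) \<otimes>\<^bsub>\<U>\<^esub> shift"
    using Suc.prems s by (simp add: U.m_assoc shift_rmul shift_closed rmul_closed)
  also have "\<dots> = rmul ((\<sigma> ^^ p) (\<sigma> a)) \<otimes>\<^bsub>\<U>\<^esub> shift [^]\<^bsub>\<U>\<^esub> Suc p"
    using Suc.IH[OF s(1)] s by (simp add: U.m_assoc shift_closed rmul_closed)
  finally show ?case by (simp add: funpow_swap1)
qed (simp add: rmul_closed)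

lemma monomial_mult:
  assumes "a \<in> carrier A" "b \<in> carrier A" "a' \<in> carrier A" "b' \<in> carrier A"
  shows "monomial a b p \<otimes>\<^bsub>\<U>\<^esub> monomial a' b' q
    = monomial (a \<otimes> (\<sigma> ^^ p) a') ((\<sigma> ^^ p) b' \<otimes> b) (p + q)"
proof -
  note c = lmul_closed[OF assms(1)] rmul_closed[OF assms(2)] lmul_closed[OF assms(3)] rmul_closed[OF assms(4)]
    shift_closed lmul_closed[OF sigma_pow(1)[OF assms(3), of p]] rmul_closed[OF sigma_pow(1)[OF assms(4), of p]]
  let ?s = "\<lambda>p::nat. shift [^]\<^bsub>\<U>\<^esub> p"
  have "monomial a b p \<otimes>\<^bsub>\<U>\<^esub> monomial a' b' q
      = lmul a \<otimes>\<^bsub>\<U>\<^esub> rmul b \<otimes>\<^bsub>\<U>\<^esub> (?s p \<otimes>\<^bsub>\<U>\<^esub> lmul a') \<otimes>\<^bsub>\<U>\<^esub> rmul b' \<otimes>\<^bsub>\<U>\<^esub> ?s q"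
    using c by (simp add: monomial_def U.m_assoc)
  also have "\<dots> = lmul a \<otimes>\<^bsub>\<U>\<^esub> (rmul b \<otimes>\<^bsub>\<U>\<^esub> lmul ((\<sigma> ^^ p) a')) \<otimes>\<^bsub>\<U>\<^esub> (?s p \<otimes>\<^bsub>\<U>\<^esub> rmul b') \<otimes>\<^bsub>\<U>\<^esub> ?s q"
    using c assms by (simp add: shift_pow_lmul U.m_assoc)
  also have "\<dots> = (lmul a \<otimes>\<^bsub>\<U>\<^esub> lmul ((\<sigma> ^^ p) a')) \<otimes>\<^bsub>\<U>\<^esub> (rmul b \<otimes>\<^bsub>\<U>\<^esub> rmul ((\<sigma> ^^ p) b')) \<otimes>\<^bsub>\<U>\<^esub> (?s p \<otimes>\<^bsub>\<U>\<^esub> ?s q)"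
    using c assms by (simp add: shift_pow_rmul lmul_rmul[symmetric] sigma_pow U.m_assoc)
  finally show ?thesis
    using c assms by (simp add: lmul_mult rmul_mult sigma_pow monomial_def U.nat_pow_mult)
qed

lemma monomial_one: "monomial \<one> \<one> 0 = \<one>\<^bsub>\<U>\<^esub>"
  by (simp add: monomial_def lmul_one rmul_one)

lemma collapse_list:
  assumes "F \<in> frames" "F (Node (pre @ us @ post)) \<in> ctx"
    and "\<And>u F. u \<in> set us \<Longrightarrow> F \<in> frames \<Longrightarrow> F u \<in> ctx \<Longrightarrow> \<exists>a\<in>carrier A. cls (F u) = cls (F (Leaf a))"
    and "\<And>u. u \<in> set us \<Longrightarrow> holes u = 0"
  shows "\<exists>as. length as = length us \<and> set as \<subseteq> carrier A
    \<and> cls (F (Node (pre @ us @ post))) = cls (F (Node (pre @ map Leaf as @ post)))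
    \<and> F (Node (pre @ map Leaf as @ post)) \<in> ctx"
  using assms(2-4)
proof (induction us arbitrary: pre)
  case (Cons u us)
  have f: "(\<lambda>t. F (Node (pre @ t # us @ post))) \<in> frames"
    by (rule frame_Node[OF assms(1)])
  obtain a where a: "a \<in> carrier A"
    "cls (F (Node (pre @ u # us @ post))) = cls (F (Node (pre @ Leaf a # us @ post)))"
    using Cons.prems(2)[OF _ f] Cons.prems(1) by auto
  have "F (Node (pre @ Leaf a # us @ post)) \<in> ctx"
    using leaf_ctx[OF f, of u a] Cons.prems a by simp
  then obtain as where "length as = length us" "set as \<subseteq> carrier A"
    "cls (F (Node ((pre @ [Leaf a]) @ us @ post))) = cls (F (Node ((pre @ [Leaf a]) @ map Leaf as @ post)))"
    "F (Node ((pre @ [Leaf a]) @ map Leaf as @ post)) \<in> ctx"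
    using Cons.IH[of "pre @ [Leaf a]"] Cons.prems(2,3) by auto
  thus ?case
    using a by (intro exI[of _ "a # as"]) auto
qed (auto intro!: exI[of _ "[]"])

text \<open>Contraction from the leaves upwards. The frame is arbitrary, since contractions of
  inner vertices take place inside a larger context.\<close>

lemma collapse_holeless:
  assumes "holes t = 0" "F \<in> frames" "F t \<in> ctx"
  shows "\<exists>a\<in>carrier A. cls (F t) = cls (F (Leaf a))"
  using assms
proof (induction t arbitrary: F)
  case (Leaf a)
  have "a \<in> carrier A"
    using frame_full(1)[OF Leaf(2), of n "carrier A" "Leaf a"] Leaf(3) by (simp add: contexts_def)
  thus ?case by blast
next
  case (Node ts)
  have h: "holes u = 0" if "u \<in> set ts" for u
    using that Node.prems(1) by (simp add: sum_list_eq_0_iff)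
  have len: "length ts = n"
    using frame_full(1)[OF Node.prems(2), of n "carrier A" "Node ts"] Node.prems(3) by (simp add: contexts_def)
  obtain as where as: "length as = length ts" "set as \<subseteq> carrier A"
    "cls (F (Node ts)) = cls (F (Node (map Leaf as)))" "F (Node (map Leaf as)) \<in> ctx"
    using collapse_list[OF Node.prems(2), of "[]" ts "[]"] Node.prems(3) Node.IH h by auto
  have "cls (F (Node (map Leaf as))) = cls (F (Leaf (tw 0 as)))"
    using cls_contract[OF Node.prems(2) _ as(2,4)] as(1) len by simp
  thus ?case
    using as tw_closed[OF as(2), of 0] by auto
qed simp

text \<open>The monomials form a submonoid containing every corolla; they exhaust the contexts
  because a context is a product of corollas once the subtrees off the path to the hole are
  contracted.\<close>

theorem context_is_monomial:
  assumes "t \<in> ctx"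
  shows "\<exists>a\<in>carrier A. \<exists>b\<in>carrier A. \<exists>p. cls t = monomial a b p"
  using assms
proof (induction t)
  case (Leaf a)
  thus ?case by (simp add: contexts_def)
next
  case Hole
  show ?case using monomial_one cls_Hole by (metis A.one_closed)
next
  case (Node ts)
  have "sum_list (map holes ts) \<noteq> 0"
    using Node.prems by (simp add: contexts_def)
  hence "\<exists>u\<in>set ts. holes u \<noteq> 0"
    by (auto simp only: sum_list_eq_0_iff set_map)
  then obtain us u vs where ts: "ts = us @ u # vs" "holes u \<noteq> 0"
    by (metis split_list)
  have "holes u + (sum_list (map holes us) + sum_list (map holes vs)) = 1"
    using Node.prems ts(1) by (simp add: contexts_def)
  hence "holes u = 1" "sum_list (map holes us) = 0" "sum_list (map holes vs) = 0"
    using ts(2) by linarith+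
  hence h: "holes u = 1" "\<And>w. w \<in> set us \<union> set vs \<Longrightarrow> holes w = 0"
    by (auto simp only: sum_list_eq_0_iff set_map)
  have u: "u \<in> ctx"
    using Node.prems ts(1) h(1) by (auto simp: contexts_def)
  obtain as where as: "length as = length us" "set as \<subseteq> carrier A"
    "cls (Node ts) = cls (Node (map Leaf as @ u # vs))" "Node (map Leaf as @ u # vs) \<in> ctx"
    using collapse_list[OF frames.here, of "[]" us "u # vs"] Node.prems ts(1) h(2) collapse_holeless
    by auto
  obtain bs where bs: "length bs = length vs" "set bs \<subseteq> carrier A"
    "cls (Node (map Leaf as @ u # vs)) = cls (Node (map Leaf as @ u # map Leaf bs))"
    using collapse_list[OF frames.here, of "map Leaf as @ [u]" vs "[]"] as(4) h(2) collapse_holeless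
    by auto
  have len: "length as + length bs = m"
    using Node.prems ts(1) as(1) bs(1) n_eq by (simp add: contexts_def)
  have leaves: "map (\<lambda>t. graft t u) (map Leaf xs) = map Leaf xs" for xs :: "'a list"
    by (induction xs) auto
  have "graft (corolla as bs) u = Node (map Leaf as @ u # map Leaf bs)"
    using leaves by (simp add: corolla_def)
  hence "cls (Node ts) = cls (corolla as bs) \<otimes>\<^bsub>\<U>\<^esub> cls u"
    using as(3) bs(3) cls_graft[OF corolla_ctx[OF len as(2) bs(2)] u] by simp
  moreover obtain a b p where "a \<in> carrier A" "b \<in> carrier A" "cls u = monomial a b p"
    using Node.IH[of u] ts(1) u by auto
  ultimately show ?case
    using corolla_monomial[OF len as(2) bs(2)] monomial_mult tw_closed[OF as(2)] tw_closed[OF bs(2)]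
    by (metis A.m_closed sigma_pow(1))
qed

lemma lmul_add: "a \<in> carrier A \<Longrightarrow> b \<in> carrier A \<Longrightarrow> lmul (a \<oplus> b) = lmul a \<oplus>\<^bsub>\<U>\<^esub> lmul b"
  and lmul_smult: "c \<in> carrier K \<Longrightarrow> a \<in> carrier A \<Longrightarrow> lmul (c \<odot> a) = c \<odot>\<^bsub>\<U>\<^esub> lmul a"
proof -
  let ?F = "\<lambda>t. Node ([] @ t # (map Leaf (ones (m - 1)) @ [Hole]))"
  have F: "?F \<in> frames" by (rule frame_here)
  have eq: "corolla (a # ones (m - 1)) [] = ?F (Leaf a)" for a by (simp add: corolla_def)
  have c: "?F (Leaf a) \<in> ctx" if "a \<in> carrier A" for a
    unfolding eq[symmetric] using that m_ge_2 by (intro corolla_ctx) auto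
  show "a \<in> carrier A \<Longrightarrow> b \<in> carrier A \<Longrightarrow> lmul (a \<oplus> b) = lmul a \<oplus>\<^bsub>\<U>\<^esub> lmul b"
    unfolding lmul_def eq by (rule cls_additive[OF F]) (assumption | rule c A.a_closed)+
  show "c \<in> carrier K \<Longrightarrow> a \<in> carrier A \<Longrightarrow> lmul (c \<odot> a) = c \<odot>\<^bsub>\<U>\<^esub> lmul a"
    unfolding lmul_def eq by (rule cls_homogeneous[OF F]) (assumption | rule c smult_closed_A)+
qed

lemma rmul_add: "a \<in> carrier A \<Longrightarrow> b \<in> carrier A \<Longrightarrow> rmul (a \<oplus> b) = rmul a \<oplus>\<^bsub>\<U>\<^esub> rmul b"
  and rmul_smult: "c \<in> carrier K \<Longrightarrow> a \<in> carrier A \<Longrightarrow> rmul (c \<odot> a) = c \<odot>\<^bsub>\<U>\<^esub> rmul a"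
proof -
  let ?F = "\<lambda>t. Node ((Hole # map Leaf (ones (m - 1))) @ t # [])"
  have F: "?F \<in> frames" by (rule frame_here)
  have eq: "corolla [] (ones (m - 1) @ [a]) = ?F (Leaf a)" for a by (simp add: corolla_def)
  have c: "?F (Leaf a) \<in> ctx" if "a \<in> carrier A" for a
    unfolding eq[symmetric] using that m_ge_2 by (intro corolla_ctx) auto
  show "a \<in> carrier A \<Longrightarrow> b \<in> carrier A \<Longrightarrow> rmul (a \<oplus> b) = rmul a \<oplus>\<^bsub>\<U>\<^esub> rmul b"
    unfolding rmul_def eq by (rule cls_additive[OF F]) (assumption | rule c A.a_closed)+
  show "c \<in> carrier K \<Longrightarrow> a \<in> carrier A \<Longrightarrow> rmul (c \<odot> a) = c \<odot>\<^bsub>\<U>\<^esub> rmul a"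
    unfolding rmul_def eq by (rule cls_homogeneous[OF F]) (assumption | rule c smult_closed_A)+
qed

end

context quotient_setting
begin

lemma quotient_smult_mult:
  assumes "c \<in> carrier K" "x \<in> carrier \<Q>" "y \<in> carrier \<Q>"
  shows "(c \<odot>\<^bsub>\<Q>\<^esub> x) \<otimes>\<^bsub>\<Q>\<^esub> y = c \<odot>\<^bsub>\<Q>\<^esub> (x \<otimes>\<^bsub>\<Q>\<^esub> y)"
proof -
  obtain a b where "a \<in> carrier R" "x = coset a" "b \<in> carrier R" "y = coset b"
    using assms(2,3) by (auto simp: quotient_carrier)
  thus ?thesis
    using assms(1) smult_mult by (simp flip: coset_smult coset_mult)
qed

lemma quotient_module: "Module.module K \<Q>"
proof (rule Module.moduleI, goal_cases)
  case 1 show ?case by (rule L.R.is_cring)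
next
  case 2 show ?case using quotient_ring by (rule ring.is_abelian_group)
next
  case (3 c x)
  thus ?case by (auto simp: quotient_carrier simp flip: coset_smult)
next
  case (4 c d x)
  thus ?case by (auto simp: quotient_carrier L.smult_l_distr simp flip: coset_smult coset_add)
next
  case (5 c x y)
  thus ?case by (auto simp: quotient_carrier L.smult_r_distr simp flip: coset_smult coset_add)
next
  case (6 c d x)
  thus ?case by (auto simp: quotient_carrier L.smult_assoc1 simp flip: coset_smult)
next
  case (7 x)
  thus ?case by (auto simp: quotient_carrier simp flip: coset_smult)
qed

end

section \<open>Leaf words\<close>

fun leaves :: "'a tree \<Rightarrow> 'a option list" where
  "leaves (Leaf a) = [Some a]"
| "leaves Hole = [None]"
| "leaves (Node ts) = concat (map leaves ts)"

abbreviation gaps :: "'a option list \<Rightarrow> nat" where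
  "gaps w \<equiv> length (filter (\<lambda>x. x = None) w)"

lemma gaps_leaves: "gaps (leaves t) = holes t"
proof (induction t)
  case (Node ts)
  thus ?case by (induction ts) auto
qed auto

lemma leaves_labels: "full_tree n A t \<Longrightarrow> Some a \<in> set (leaves t) \<Longrightarrow> a \<in> A"
  by (induction t) auto

text \<open>Every vertex replaces one letter by \<open>n = m + 1\<close> letters.\<close>

lemma leaves_length:
  assumes "n = m + 1" "full_tree n A t"
  shows "\<exists>k. length (leaves t) = 1 + m * k"
  using assms(2)
proof (induction t)
  case (Node ts)
  have "\<exists>k. length (concat (map leaves us)) = length us + m * k" if "set us \<subseteq> set ts" for us
    using that
  proof (induction us)
    case (Cons u us)
    obtain k where "length (leaves u) = 1 + m * k"
      using Node.IH[of u] Node.prems Cons.prems by auto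
    moreover obtain k' where "length (concat (map leaves us)) = length us + m * k'"
      using Cons.IH Cons.prems by auto
    ultimately show ?case by (intro exI[of _ "k + k'"]) (simp add: algebra_simps)
  qed auto
  then obtain k where "length (leaves (Node ts)) = length ts + m * k" by auto
  thus ?case
    using Node.prems assms(1) by (intro exI[of _ "Suc k"]) simp
qed (auto intro: exI[of _ 0])

lemma no_gap_word: "gaps w = 0 \<Longrightarrow> \<exists>as. w = map Some as"
proof (induction w)
  case (Cons x w)
  then obtain a as where "x = Some a" "w = map Some as" by (cases x) auto
  thus ?case by (intro exI[of _ "a # as"]) simp
qed simp

lemma one_gap_word: "gaps w = 1 \<Longrightarrow> \<exists>as bs. w = map Some as @ None # map Some bs"
proof (induction w)
  case (Cons x w)
  show ?case
  proof (cases x)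
    case None
    hence "gaps w = 0" using Cons.prems by simp
    then obtain bs where "w = map Some bs" using no_gap_word by blast
    thus ?thesis using None by (intro exI[of _ "[]"] exI[of _ bs]) simp
  next
    case (Some a)
    hence "gaps w = 1" using Cons.prems by simp
    then obtain as bs where "w = map Some as @ None # map Some bs" using Cons.IH by blast
    thus ?thesis using Some by (intro exI[of _ "a # as"] exI[of _ bs]) simp
  qed
qed simp

lemma frame_leaves:
  assumes "F \<in> frames"
  obtains pre post where "\<And>t. leaves (F t) = pre @ leaves t @ post"
proof -
  have "\<exists>pre post. \<forall>t. leaves (F t) = pre @ leaves t @ post"
    using assms
  proof induction
    case here
    show ?case by (intro exI[of _ "[]"]) simp
  next
    case (below F us vs)
    then obtain pre post where "\<And>t. leaves (F t) = pre @ leaves t @ post" by blast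
    thus ?case
      by (intro exI[of _ "concat (map leaves us) @ pre"] exI[of _ "post @ concat (map leaves vs)"]) simp
  qed
  thus ?thesis using that by blast
qed

definition lword :: "'a tree \<Rightarrow> 'a list" where
  "lword t = map the (takeWhile (\<lambda>x. x \<noteq> None) (leaves t))"

definition rword :: "'a tree \<Rightarrow> 'a list" where
  "rword t = map the (tl (dropWhile (\<lambda>x. x \<noteq> None) (leaves t)))"

lemma word_eq:
  assumes "leaves t = map Some as @ None # map Some bs"
  shows "lword t = as" "rword t = bs"
proof -
  have "takeWhile (\<lambda>x. x \<noteq> None) (map Some as @ None # map Some bs) = map Some as"
    "dropWhile (\<lambda>x. x \<noteq> None) (map Some as @ None # map Some bs) = None # map Some bs"
    by (subst takeWhile_append2 dropWhile_append2; auto)+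
  thus "lword t = as" "rword t = bs"
    using assms by (simp_all add: lword_def rword_def comp_def)
qed

lemma leaves_graft:
  "leaves (graft s D) = concat (map (\<lambda>x. case x of None \<Rightarrow> leaves D | Some a \<Rightarrow> [Some a]) (leaves s))"
proof (induction s)
  case (Node ts)
  thus ?case by (induction ts) auto
qed auto

context envelope_setting
begin

lemma ctx_word:
  assumes "t \<in> ctx"
  shows "leaves t = map Some (lword t) @ None # map Some (rword t)"
    "set (lword t) \<subseteq> carrier A" "set (rword t) \<subseteq> carrier A" "m dvd length (lword t) + length (rword t)"
proof -
  have t: "full_tree n (carrier A) t" "gaps (leaves t) = 1"
    using assms by (auto simp: contexts_def gaps_leaves)
  obtain as bs where w: "leaves t = map Some as @ None # map Some bs"
    using one_gap_word[OF t(2)] by blast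
  note lr = word_eq[OF w]
  show "leaves t = map Some (lword t) @ None # map Some (rword t)" using w lr by simp
  show "set (lword t) \<subseteq> carrier A" "set (rword t) \<subseteq> carrier A"
    using leaves_labels[OF t(1)] w lr by auto
  obtain k where "length (leaves t) = 1 + m * k"
    using leaves_length[OF n_eq t(1)] by blast
  hence "length as + length bs = m * k" using w by simp
  thus "m dvd length (lword t) + length (rword t)" using lr by simp
qed

abbreviation deg :: "'a tree \<Rightarrow> nat" where "deg t \<equiv> length (lword t)"

text \<open>The hole has position \<open>deg t\<close> in the word, so the first letter after it
  is twisted by the successor of the degree.\<close>

definition Lval :: "'a tree \<Rightarrow> 'a" where "Lval t = tw 0 (lword t)"
definition Rval :: "'a tree \<Rightarrow> 'a" where "Rval t = tw (Suc (deg t)) (rword t)"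

lemma val_closed: "t \<in> ctx \<Longrightarrow> Lval t \<in> carrier A" "t \<in> ctx \<Longrightarrow> Rval t \<in> carrier A"
  using ctx_word tw_closed by (auto simp: Lval_def Rval_def)

lemma tw_periods: "set as \<subseteq> carrier A \<Longrightarrow> m dvd k \<Longrightarrow> tw (i + k) as = tw i as"
proof -
  assume as: "set as \<subseteq> carrier A" and "m dvd k"
  then obtain j where k: "k = m * j" by auto
  have "tw (i + m * j) as = tw i as"
  proof (induction j)
    case (Suc j)
    have "i + m * Suc j = i + m * j + m" by simp
    thus ?case using Suc tw_period[OF as, of "i + m * j"] by (simp only:)
  qed simp
  thus ?thesis by (simp add: k)
qed

text \<open>Contracting \<open>n\<close> letters to one shifts the later positions by
  \<open>m\<close>, a period of the twist.\<close>

lemma tw_contract: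
  assumes "length as = n" "set as \<subseteq> carrier A" "set xs \<subseteq> carrier A" "set ys \<subseteq> carrier A"
  shows "tw i (xs @ [tw 0 as] @ ys) = tw i (xs @ as @ ys)"
proof -
  have "tw (i + length xs + n) ys = tw (i + length xs + 1) ys"
    using tw_period[OF assms(4), of "i + length xs + 1"] n_eq by simp
  thus ?thesis
    using assms sigma_pow_tw[OF assms(2), of "i + length xs" 0]
    by (simp add: tw_append tw_closed sigma_pow A.m_assoc add.assoc)
qed

lemma graft_word:
  assumes "s \<in> ctx" "t \<in> ctx"
  shows "lword (graft s t) = lword s @ lword t" "rword (graft s t) = rword t @ rword s"
proof -
  have c: "concat (map (\<lambda>x. case x of None \<Rightarrow> w | Some a \<Rightarrow> [Some a]) (map Some cs)) = map Some cs"
    for w :: "'a option list" and cs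
    by (induction cs) auto
  have "leaves (graft s t) = map Some (lword s) @ leaves t @ map Some (rword s)"
    unfolding leaves_graft by (subst ctx_word(1)[OF assms(1)]) (simp add: c del: map_map)
  also have "leaves t = map Some (lword t) @ None # map Some (rword t)"
    by (rule ctx_word(1)[OF assms(2)])
  finally have "leaves (graft s t) = map Some (lword s @ lword t) @ None # map Some (rword t @ rword s)"
    by simp
  thus "lword (graft s t) = lword s @ lword t" "rword (graft s t) = rword t @ rword s"
    by (rule word_eq)+
qed

text \<open>The word of the inner context stands inside that of the outer one, at the position of
  the hole. On the right of the inner word the positions of the outer one are shifted by the
  number of inner letters, a multiple of \<open>m\<close>.\<close>

lemma graft_val:
  assumes "s \<in> ctx" "t \<in> ctx"
  shows "Lval (graft s t) = Lval s \<otimes> (\<sigma> ^^ deg s) (Lval t)"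
    "Rval (graft s t) = (\<sigma> ^^ deg s) (Rval t) \<otimes> Rval s" "deg (graft s t) = deg s + deg t"
proof -
  note w = ctx_word[OF assms(1)] ctx_word[OF assms(2)]
  show "Lval (graft s t) = Lval s \<otimes> (\<sigma> ^^ deg s) (Lval t)"
    using w by (simp add: Lval_def graft_word[OF assms] tw_append sigma_pow_tw)
  have "tw (Suc (deg s) + (deg t + length (rword t))) (rword s) = tw (Suc (deg s)) (rword s)"
    using w by (intro tw_periods) auto
  thus "Rval (graft s t) = (\<sigma> ^^ deg s) (Rval t) \<otimes> Rval s"
    using w by (simp add: Rval_def graft_word[OF assms] tw_append sigma_pow_tw add.assoc)
qed (simp add: graft_word[OF assms])

lemma corolla_word: "lword (corolla as bs) = as" "rword (corolla as bs) = bs"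
proof -
  have "concat (map leaves (map Leaf cs)) = map Some cs" for cs :: "'a list"
    by (induction cs) auto
  hence "leaves (corolla as bs) = map Some as @ None # map Some bs"
    by (simp add: corolla_def)
  thus "lword (corolla as bs) = as" "rword (corolla as bs) = bs"
    by (rule word_eq)+
qed

lemma Hole_word: "lword Hole = []" "rword Hole = []"
  using word_eq[of Hole "[]" "[]"] by auto

text \<open>A frame adds a prefix and a suffix to the word of its argument. If the argument has no
  hole, the gap lies in one of them, and the argument falls entirely to one side of it.\<close>

lemma frame_word:
  assumes "F \<in> frames" "F t \<in> ctx" "leaves t = map Some cs"
  obtains (left) xs ys bs where
      "\<And>u ds. leaves u = map Some ds \<Longrightarrow> lword (F u) = xs @ ds @ ys \<and> rword (F u) = bs"
      "set xs \<subseteq> carrier A" "set ys \<subseteq> carrier A" "set bs \<subseteq> carrier A"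
  | (right) as xs ys where
      "\<And>u ds. leaves u = map Some ds \<Longrightarrow> lword (F u) = as \<and> rword (F u) = xs @ ds @ ys"
      "set as \<subseteq> carrier A" "set xs \<subseteq> carrier A" "set ys \<subseteq> carrier A"
proof -
  obtain pre post where F: "\<And>t. leaves (F t) = pre @ leaves t @ post"
    using frame_leaves[OF assms(1)] by metis
  have "gaps (leaves (F t)) = 1" using assms(2) by (simp add: gaps_leaves contexts_def)
  hence "gaps pre + gaps post = 1" using assms(3) by (simp add: F filter_map comp_def)
  then consider "gaps pre = 0" "gaps post = 1" | "gaps pre = 1" "gaps post = 0" by linarith
  thus ?thesis
  proof cases
    case 1
    obtain xs ys bs where w: "pre = map Some xs" "post = map Some ys @ None # map Some bs"
      using no_gap_word[OF 1(1)] one_gap_word[OF 1(2)] by blast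
    have lr: "lword (F u) = xs @ ds @ ys \<and> rword (F u) = bs" if "leaves u = map Some ds" for u ds
    proof -
      have "leaves (F u) = map Some (xs @ ds @ ys) @ None # map Some bs"
        using that w by (simp add: F)
      thus ?thesis using word_eq by blast
    qed
    show ?thesis
      using left[OF lr] ctx_word(2,3)[OF assms(2)] lr[OF assms(3)] by auto
  next
    case 2
    obtain as xs ys where w: "pre = map Some as @ None # map Some xs" "post = map Some ys"
      using one_gap_word[OF 2(1)] no_gap_word[OF 2(2)] by blast
    have lr: "lword (F u) = as \<and> rword (F u) = xs @ ds @ ys" if "leaves u = map Some ds" for u ds
    proof -
      have "leaves (F u) = map Some as @ None # map Some (xs @ ds @ ys)"
        using that w by (simp add: F)
      thus ?thesis using word_eq by blast
    qed
    show ?thesis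
      using right[OF lr] ctx_word(2,3)[OF assms(2)] lr[OF assms(3)] by auto
  qed
qed

lemma leaves_Leaf_list: "leaves (Node (map Leaf as)) = map Some as"
  by (induction as) auto

lemma contract_val:
  assumes "F \<in> frames" "length as = n" "set as \<subseteq> carrier A" "F (Node (map Leaf as)) \<in> ctx"
  shows "Lval (F (Leaf (tw 0 as))) = Lval (F (Node (map Leaf as)))"
    "Rval (F (Leaf (tw 0 as))) = Rval (F (Node (map Leaf as)))"
    "deg (F (Node (map Leaf as))) = deg (F (Leaf (tw 0 as))) \<or>
     deg (F (Node (map Leaf as))) = deg (F (Leaf (tw 0 as))) + m"
proof -
  have "Lval (F (Leaf (tw 0 as))) = Lval (F (Node (map Leaf as))) \<and>
    Rval (F (Leaf (tw 0 as))) = Rval (F (Node (map Leaf as))) \<and>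
    (deg (F (Node (map Leaf as))) = deg (F (Leaf (tw 0 as))) \<or>
     deg (F (Node (map Leaf as))) = deg (F (Leaf (tw 0 as))) + m)"
    using assms(1,4) leaves_Leaf_list[of as]
  proof (cases rule: frame_word)
    case (left xs ys bs)
    have 1: "lword (F (Leaf (tw 0 as))) = xs @ [tw 0 as] @ ys" "rword (F (Leaf (tw 0 as))) = bs"
      using left(1)[of "Leaf (tw 0 as)" "[tw 0 as]"] by auto
    have 2: "lword (F (Node (map Leaf as))) = xs @ as @ ys" "rword (F (Node (map Leaf as))) = bs"
      using left(1)[OF leaves_Leaf_list] by auto
    have d: "length (xs @ as @ ys) = length (xs @ [tw 0 as] @ ys) + m"
      using assms(2) n_eq by simp
    show ?thesis
      using tw_contract[OF assms(2,3) left(2,3), of 0] tw_period[OF left(4), of "Suc (length (xs @ [tw 0 as] @ ys))"]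
      unfolding Lval_def Rval_def 1 2 d by simp
  next
    case (right cs xs ys)
    have 1: "lword (F (Leaf (tw 0 as))) = cs" "rword (F (Leaf (tw 0 as))) = xs @ [tw 0 as] @ ys"
      using right(1)[of "Leaf (tw 0 as)" "[tw 0 as]"] by auto
    have 2: "lword (F (Node (map Leaf as))) = cs" "rword (F (Node (map Leaf as))) = xs @ as @ ys"
      using right(1)[OF leaves_Leaf_list] by auto
    show ?thesis
      using tw_contract[OF assms(2,3) right(3,4)] unfolding Lval_def Rval_def 1 2 by simp
  qed
  thus "Lval (F (Leaf (tw 0 as))) = Lval (F (Node (map Leaf as)))"
    "Rval (F (Leaf (tw 0 as))) = Rval (F (Node (map Leaf as)))"
    "deg (F (Node (map Leaf as))) = deg (F (Leaf (tw 0 as))) \<or>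
     deg (F (Node (map Leaf as))) = deg (F (Leaf (tw 0 as))) + m" by auto
qed

text \<open>A tree whose class is a prescribed monomial. Its degree is \<open>m + p\<close>
  because the hole of the first corolla comes after \<open>m\<close> letters.\<close>

definition mono_tree :: "'a \<Rightarrow> 'a \<Rightarrow> nat \<Rightarrow> 'a tree" where
  "mono_tree a b p = graft (corolla (a # ones (m - 1)) [])
     (graft (corolla [] (ones (m - 1) @ [b])) (corolla (ones p) (ones (m - p))))"

lemma mono_tree:
  assumes "a \<in> carrier A" "b \<in> carrier A" "p \<le> m"
  shows "mono_tree a b p \<in> ctx" "cls (mono_tree a b p) = monomial a b p"
    "Lval (mono_tree a b p) = a" "Rval (mono_tree a b p) = b" "deg (mono_tree a b p) = m + p"
proof -
  have c: "corolla (a # ones (m - 1)) [] \<in> ctx" "corolla [] (ones (m - 1) @ [b]) \<in> ctx"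
    "corolla (ones p) (ones (m - p)) \<in> ctx"
    using assms m_ge_2 by (auto intro!: corolla_ctx)
  show "mono_tree a b p \<in> ctx" unfolding mono_tree_def by (intro graft_ctx c)
  have "cls (mono_tree a b p) = lmul a \<otimes>\<^bsub>\<U>\<^esub> (rmul b \<otimes>\<^bsub>\<U>\<^esub> shift [^]\<^bsub>\<U>\<^esub> p)"
    unfolding mono_tree_def lmul_def rmul_def shift_pow_corolla[OF assms(3)]
    using c by (simp only: cls_graft graft_ctx)
  thus "cls (mono_tree a b p) = monomial a b p"
    using assms by (simp add: monomial_def U.m_assoc lmul_closed rmul_closed shift_closed)
  have 1: "Lval (corolla (a # ones (m - 1)) []) = a" "Rval (corolla (a # ones (m - 1)) []) = \<one>"
    using assms by (simp_all add: Lval_def Rval_def corolla_word tw_ones)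
  have "tw (Suc 0) (ones (m - 1) @ [b]) = b"
    using assms m_ge_2 by (simp add: tw_append tw_ones ones_closed sigma_order sigma_pow)
  hence 2: "Lval (corolla [] (ones (m - 1) @ [b])) = \<one>" "Rval (corolla [] (ones (m - 1) @ [b])) = b"
    by (simp_all add: Lval_def Rval_def corolla_word)
  have 3: "Lval (corolla (ones p) (ones (m - p))) = \<one>" "Rval (corolla (ones p) (ones (m - p))) = \<one>"
    by (simp_all add: Lval_def Rval_def corolla_word tw_ones)
  show "Lval (mono_tree a b p) = a" "Rval (mono_tree a b p) = b" "deg (mono_tree a b p) = m + p"
    using c assms m_ge_2 sigma_order[of b]
    by (simp_all add: mono_tree_def graft_val graft_ctx 1[simplified] 2[simplified] 3 corolla_word sigma_pow del: funpow.simps)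
qed

end

section \<open>Function algebras and the diagonal action\<close>

lemma diagonal_group_action:
  assumes "group_action G X \<phi>"
  shows "group_action G (X \<times> X) (diagonal_action X \<phi>)"
proof -
  interpret group_action G X \<phi> by fact
  interpret G: group G using group_hom unfolding group_hom_def by simp
  have cl: "\<phi> h x \<in> X" if "h \<in> carrier G" "x \<in> X" for h x
    using element_image that by blast
  have inv: "\<phi> (inv\<^bsub>G\<^esub> h) (\<phi> h x) = x" "\<phi> h (\<phi> (inv\<^bsub>G\<^esub> h) x) = x" if "h \<in> carrier G" "x \<in> X" for h x
    using that id_eq_one by (simp_all flip: composition_rule) (metis restrict_apply')+
  have bij: "diagonal_action X \<phi> h \<in> Bij (X \<times> X)" if h: "h \<in> carrier G" for h
    unfolding Bij_def
  proof (intro IntI CollectI)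
    show "diagonal_action X \<phi> h \<in> extensional (X \<times> X)"
      by (simp add: diagonal_action_def)
    show "bij_betw (diagonal_action X \<phi> h) (X \<times> X) (X \<times> X)"
      using h cl inv
      by (intro bij_betw_byWitness[where f' = "diagonal_action X \<phi> (inv\<^bsub>G\<^esub> h)"])
        (auto simp: diagonal_action_def)
  qed
  have "diagonal_action X \<phi> \<in> hom G (BijGroup (X \<times> X))"
  proof (rule homI)
    fix h k assume h: "h \<in> carrier G" and k: "k \<in> carrier G"
    have "diagonal_action X \<phi> (h \<otimes>\<^bsub>G\<^esub> k) = compose (X \<times> X) (diagonal_action X \<phi> h) (diagonal_action X \<phi> k)"
      using h k cl by (auto simp: fun_eq_iff diagonal_action_def compose_def composition_rule)
    thus "diagonal_action X \<phi> (h \<otimes>\<^bsub>G\<^esub> k)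
        = diagonal_action X \<phi> h \<otimes>\<^bsub>BijGroup (X \<times> X)\<^esub> diagonal_action X \<phi> k"
      using bij[OF h] bij[OF k] by (simp add: BijGroup_def)
  qed (use bij in \<open>auto simp: BijGroup_def\<close>)
  thus ?thesis
    by (intro group_action.intro group_hom.intro group_hom_axioms.intro G.is_group group_BijGroup)
qed

lemma function_algebra_ring:
  assumes "cring K"
  shows "ring (function_algebra K X)"
proof -
  interpret K: cring K by fact
  let ?K = "\<lparr>carrier = carrier K, mult = mult K, one = one K, zero = zero K, add = add K, smult = mult K\<rparr>"
  have "ring ?K"
    by (rule ring_same_operations[OF K.ring_axioms]) simp_all
  hence "ring (product_algebra X (\<lambda>_. ?K))"
    by (rule product_algebra_ring)
  thus ?thesis
    by (rule ring_same_operations) (simp_all add: function_algebra_def product_algebra_def)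
qed

text \<open>Induction on the support, over which a function is a sum of multiples of
  indicators.\<close>

lemma function_space_induct [consumes 3, case_names zero add scale]:
  assumes "cring K" "finite J" and f: "f \<in> J \<rightarrow>\<^sub>E carrier K"
    and zero: "P (\<lambda>j\<in>J. \<zero>\<^bsub>K\<^esub>)"
    and add: "\<And>f h. f \<in> J \<rightarrow>\<^sub>E carrier K \<Longrightarrow> h \<in> J \<rightarrow>\<^sub>E carrier K \<Longrightarrow> P f \<Longrightarrow> P h \<Longrightarrow> P (\<lambda>j\<in>J. f j \<oplus>\<^bsub>K\<^esub> h j)"
    and scale: "\<And>c i. c \<in> carrier K \<Longrightarrow> i \<in> J \<Longrightarrow> P (\<lambda>j\<in>J. if j = i then c else \<zero>\<^bsub>K\<^esub>)"
  shows "P f"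
proof -
  interpret K: cring K by fact
  have "f \<in> J \<rightarrow>\<^sub>E carrier K \<Longrightarrow> (\<forall>j\<in>J - D. f j = \<zero>\<^bsub>K\<^esub>) \<Longrightarrow> P f" if "finite D" "D \<subseteq> J" for D f
    using that
  proof (induction D arbitrary: f)
    case empty
    have "f = (\<lambda>j\<in>J. \<zero>\<^bsub>K\<^esub>)"
      using empty.prems by (auto simp: fun_eq_iff PiE_def extensional_def)
    thus ?case using zero by (simp only:)
  next
    case (insert i D)
    let ?h = "\<lambda>j\<in>J. if j = i then \<zero>\<^bsub>K\<^esub> else f j"
    let ?s = "\<lambda>j\<in>J. if j = i then f i else \<zero>\<^bsub>K\<^esub>"
    have i: "i \<in> J" "f i \<in> carrier K" using insert.prems by auto
    have h: "?h \<in> J \<rightarrow>\<^sub>E carrier K" "?s \<in> J \<rightarrow>\<^sub>E carrier K" using insert.prems i by auto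
    have "P ?h" using insert.prems h(1) by (intro insert.IH) auto
    hence "P (\<lambda>j\<in>J. ?s j \<oplus>\<^bsub>K\<^esub> ?h j)"
      using scale[OF i(2,1)] h by (intro add)
    moreover have "(\<lambda>j\<in>J. ?s j \<oplus>\<^bsub>K\<^esub> ?h j) = f"
    proof
      fix j show "(\<lambda>j\<in>J. ?s j \<oplus>\<^bsub>K\<^esub> ?h j) j = f j"
        using insert.prems(1) PiE_mem[OF insert.prems(1), of j] by (cases "j \<in> J") auto
    qed
    ultimately show ?case by (simp only:)
  qed
  from this[OF assms(2) subset_refl f] show ?thesis by simp
qed

locale permutation_setting = K: cring K + group_action G X \<phi>
  for K :: "('k, 'e) ring_scheme" and G :: "('g, 'f) monoid_scheme" and X :: "'x set"
    and \<phi> :: "'g \<Rightarrow> 'x \<Rightarrow> 'x" +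
  fixes g :: 'g and m n :: nat and r :: "('x \<times> 'x) set \<Rightarrow> 'x \<times> 'x"
  assumes m_ge_2: "m \<ge> 2" and n_eq: "n = m + 1" and order_G: "order G = m"
    and g_closed: "g \<in> carrier G" and g_gen: "generate G {g} = carrier G"
    and finite_X: "finite X" and X_ne: "X \<noteq> {}"
    and r_mem: "orb \<in> diagonal_orbits G X \<phi> \<Longrightarrow> r orb \<in> orb"
begin

sublocale G: group G
  using group_hom unfolding group_hom_def by simp

abbreviation A where "A \<equiv> function_algebra K X"
abbreviation \<sigma> where "\<sigma> \<equiv> induced_automorphism G X \<phi> g"
abbreviation Z where "Z \<equiv> X \<times> X"
abbreviation act where "act \<equiv> diagonal_action X \<phi>"

lemma finite_G: "finite (carrier G)"
  using order_G m_ge_2 by (metis card.infinite not_numeral_le_zero order_def)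

lemma ord_g: "G.ord g = m"
  using G.generate_pow_card[OF g_closed] g_gen order_G by (simp add: order_def)

lemma g_pow_eq: "g [^]\<^bsub>G\<^esub> (i::nat) = g [^]\<^bsub>G\<^esub> (j::nat) \<longleftrightarrow> i mod m = j mod m"
proof -
  have "g [^]\<^bsub>G\<^esub> i = g [^]\<^bsub>G\<^esub> j \<longleftrightarrow> int m dvd int j - int i"
    using G.int_pow_eq[OF g_closed, of "int i" "int j"] ord_g by (simp add: int_pow_int)
  also have "\<dots> \<longleftrightarrow> int j mod int m = int i mod int m"
    by (rule mod_eq_dvd_iff[symmetric])
  also have "\<dots> \<longleftrightarrow> i mod m = j mod m"
    by (auto simp flip: zmod_int)
  finally show ?thesis .
qed

lemma g_pow_surj:
  assumes "h \<in> carrier G"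
  shows "\<exists>i<m. h = g [^]\<^bsub>G\<^esub> i"
proof -
  have "h \<in> {g [^]\<^bsub>G\<^esub> i |i. i \<in> {0..G.ord g - 1}}"
    using G.generate_pow_on_finite_carrier[OF finite_G g_closed] G.ord_elems[OF finite_G g_closed] g_gen assms
    by auto
  then obtain i where "h = g [^]\<^bsub>G\<^esub> i" "i \<le> m - 1" using ord_g by auto
  thus ?thesis using m_ge_2 by (intro exI[of _ i]) auto
qed

lemma phi_closed: "h \<in> carrier G \<Longrightarrow> x \<in> X \<Longrightarrow> \<phi> h x \<in> X"
  using element_image by blast

lemma phi_one: "x \<in> X \<Longrightarrow> \<phi> \<one>\<^bsub>G\<^esub> x = x"
  using id_eq_one by (metis restrict_apply')

sublocale D: represented_action K G Z act r
proof (intro represented_action.intro finite_action.intro represented_action_axioms.intro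
    finite_action_axioms.intro)
  show "cring K" ..
  show "group_action G Z act" by (rule diagonal_group_action) unfold_locales
  show "finite (carrier G)" by (rule finite_G)
  show "finite Z" using finite_X by simp
qed (use r_mem in \<open>simp add: diagonal_orbits_def\<close>)

lemma act_apply: "x \<in> X \<Longrightarrow> y \<in> X \<Longrightarrow> act h (x, y) = (\<phi> h x, \<phi> h y)"
  by (simp add: diagonal_action_def)

lemma A_apply:
  "x \<in> X \<Longrightarrow> (a \<otimes>\<^bsub>A\<^esub> b) x = a x \<otimes>\<^bsub>K\<^esub> b x" "x \<in> X \<Longrightarrow> (a \<oplus>\<^bsub>A\<^esub> b) x = a x \<oplus>\<^bsub>K\<^esub> b x"
  "x \<in> X \<Longrightarrow> (c \<odot>\<^bsub>A\<^esub> a) x = c \<otimes>\<^bsub>K\<^esub> a x" "x \<in> X \<Longrightarrow> \<one>\<^bsub>A\<^esub> x = \<one>\<^bsub>K\<^esub>" "x \<in> X \<Longrightarrow> \<zero>\<^bsub>A\<^esub> x = \<zero>\<^bsub>K\<^esub>"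
  by (simp_all add: function_algebra_def)

lemma A_carrier: "carrier A = X \<rightarrow>\<^sub>E carrier K"
  by (simp add: function_algebra_def)

lemma A_closed: "a \<in> carrier A \<Longrightarrow> x \<in> X \<Longrightarrow> a x \<in> carrier K"
  by (auto simp: A_carrier)

lemma sigma_apply: "x \<in> X \<Longrightarrow> \<sigma> a x = a (\<phi> (inv\<^bsub>G\<^esub> g) x)"
  by (simp add: induced_automorphism_def)

lemma sigma_pow_apply: "x \<in> X \<Longrightarrow> (\<sigma> ^^ i) a x = a (\<phi> (inv\<^bsub>G\<^esub> (g [^]\<^bsub>G\<^esub> i)) x)"
proof (induction i arbitrary: x)
  case (Suc i)
  have g': "inv\<^bsub>G\<^esub> g \<in> carrier G" "inv\<^bsub>G\<^esub> (g [^]\<^bsub>G\<^esub> i) \<in> carrier G" using g_closed by auto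
  have "inv\<^bsub>G\<^esub> (g [^]\<^bsub>G\<^esub> Suc i) = inv\<^bsub>G\<^esub> (g [^]\<^bsub>G\<^esub> i) \<otimes>\<^bsub>G\<^esub> inv\<^bsub>G\<^esub> g"
    using g_closed by (simp only: G.nat_pow_Suc2 G.inv_mult_group G.nat_pow_closed)
  thus ?case
    using Suc g' by (simp add: sigma_apply phi_closed composition_rule)
qed (simp add: phi_one)

lemma sigma_hom: "\<sigma> \<in> ring_hom A A"
proof (rule ring_hom_memI)
  have p: "\<phi> (inv\<^bsub>G\<^esub> g) x \<in> X" if "x \<in> X" for x using that g_closed by (simp add: phi_closed)
  show "\<sigma> a \<in> carrier A" if "a \<in> carrier A" for a
    using that p by (auto simp: A_carrier induced_automorphism_def)
  show "\<sigma> (a \<otimes>\<^bsub>A\<^esub> b) = \<sigma> a \<otimes>\<^bsub>A\<^esub> \<sigma> b" "\<sigma> (a \<oplus>\<^bsub>A\<^esub> b) = \<sigma> a \<oplus>\<^bsub>A\<^esub> \<sigma> b" for a b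
    using p by (auto simp: induced_automorphism_def function_algebra_def fun_eq_iff)
  show "\<sigma> \<one>\<^bsub>A\<^esub> = \<one>\<^bsub>A\<^esub>"
    using p by (auto simp: induced_automorphism_def function_algebra_def fun_eq_iff)
qed

sublocale E: envelope_setting K A \<sigma> m n
proof (intro envelope_setting.intro envelope_setting_axioms.intro)
  show "cring K" ..
  show "ring A" by (rule function_algebra_ring) unfold_locales
  show "c \<odot>\<^bsub>A\<^esub> a \<in> carrier A" if "c \<in> carrier K" "a \<in> carrier A" for c a
    using that by (auto simp: function_algebra_def)
  show "\<sigma> \<in> ring_hom A A" by (rule sigma_hom)
  show "(\<sigma> ^^ m) a = a" if a: "a \<in> carrier A" for a
  proof
    have gm: "g [^]\<^bsub>G\<^esub> m = \<one>\<^bsub>G\<^esub>" using G.pow_ord_eq_1[OF g_closed] ord_g by simp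
    have m: "m = Suc (m - 1)" using m_ge_2 by simp
    have ext: "(\<sigma> ^^ m) a x = undefined" if "x \<notin> X" for x
      using that by (subst m) (simp add: induced_automorphism_def)
    fix x show "(\<sigma> ^^ m) a x = a x"
      using a ext[of x] by (cases "x \<in> X") (auto simp: sigma_pow_apply gm phi_one A_carrier PiE_def extensional_def)
  qed
  show "m \<ge> 2" "n = m + 1" by (rule m_ge_2, rule n_eq)
qed

section \<open>From contexts to the transformation algebra\<close>

text \<open>The coefficient at \<open>(z, h)\<close> of the image of a context: a context with the
  values \<open>L\<close>, \<open>R\<close> and degree \<open>p\<close> corresponds to the
  function \<open>L(x) R(y)\<close> times \<open>g\<^sup>p\<close>.\<close>

definition \<chi> :: "'x \<times> 'x \<Rightarrow> 'g \<Rightarrow> ('x \<Rightarrow> 'k) tree \<Rightarrow> 'k" where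
  "\<chi> z h t = (if h = g [^]\<^bsub>G\<^esub> length (lword t) then E.Lval t (fst z) \<otimes>\<^bsub>K\<^esub> E.Rval t (snd z) else \<zero>\<^bsub>K\<^esub>)"

lemma chi_closed: "z \<in> Z \<Longrightarrow> t \<in> E.ctx \<Longrightarrow> \<chi> z h t \<in> carrier K"
  using A_closed[OF E.val_closed(1)] A_closed[OF E.val_closed(2)] by (auto simp: \<chi>_def)

lemma chi_Pi: "z \<in> Z \<Longrightarrow> \<chi> z h \<in> carrier (context_monoid n (carrier A)) \<rightarrow> carrier K"
  by (auto simp: E.ctx_carrier chi_closed)

text \<open>Only \<open>a = g\<^sup>p\<close> contributes, for \<open>p\<close> the degree of the
  outer context. For this term the twist by \<open>\<sigma>\<^sup>p\<close> in
  \<open>graft_val\<close> is the translation of the argument by \<open>g\<^sup>-\<^sup>p\<close>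
  in the product of the transformation algebra.\<close>

lemma chi_graft:
  assumes s: "s \<in> E.ctx" and t: "t \<in> E.ctx" and z: "z \<in> Z" and h: "h \<in> carrier G"
  shows "\<chi> z h (graft s t)
    = (\<Oplus>\<^bsub>K\<^esub>a\<in>carrier G. \<chi> z a s \<otimes>\<^bsub>K\<^esub> \<chi> (act (inv\<^bsub>G\<^esub> a) z) (inv\<^bsub>G\<^esub> a \<otimes>\<^bsub>G\<^esub> h) t)"
proof -
  obtain x y where xy: "z = (x, y)" "x \<in> X" "y \<in> X" using z by auto
  let ?a = "g [^]\<^bsub>G\<^esub> length (lword s)"
  have a: "?a \<in> carrier G" using g_closed by simp
  note az = D.act_closed[OF G.inv_closed[OF a] z]
  note v = E.val_closed[OF s] E.val_closed[OF t]
  have c: "\<chi> z b s \<in> carrier K" "\<chi> (act (inv\<^bsub>G\<^esub> b) z) k t \<in> carrier K" if "b \<in> carrier G" for b k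
    using that s t z by (auto intro!: chi_closed D.act_closed)
  have "(\<Oplus>\<^bsub>K\<^esub>a\<in>carrier G. \<chi> z a s \<otimes>\<^bsub>K\<^esub> \<chi> (act (inv\<^bsub>G\<^esub> a) z) (inv\<^bsub>G\<^esub> a \<otimes>\<^bsub>G\<^esub> h) t)
      = \<chi> z ?a s \<otimes>\<^bsub>K\<^esub> \<chi> (act (inv\<^bsub>G\<^esub> ?a) z) (inv\<^bsub>G\<^esub> ?a \<otimes>\<^bsub>G\<^esub> h) t"
  proof (rule K.finsum_single_term[OF finite_G a])
    fix b assume "b \<in> carrier G" "b \<noteq> ?a"
    thus "\<chi> z b s \<otimes>\<^bsub>K\<^esub> \<chi> (act (inv\<^bsub>G\<^esub> b) z) (inv\<^bsub>G\<^esub> b \<otimes>\<^bsub>G\<^esub> h) t = \<zero>\<^bsub>K\<^esub>"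
      using c(2) by (simp add: \<chi>_def[of z b s])
  qed (use a c in auto)
  moreover have "inv\<^bsub>G\<^esub> ?a \<otimes>\<^bsub>G\<^esub> h = g [^]\<^bsub>G\<^esub> length (lword t)
      \<longleftrightarrow> h = g [^]\<^bsub>G\<^esub> (length (lword s) + length (lword t))"
    using a h g_closed D.G_cancel[OF a] by (metis G.m_closed G.nat_pow_closed G.nat_pow_mult)
  moreover have "E.Lval t (\<phi> (inv\<^bsub>G\<^esub> ?a) x) \<in> carrier K" "E.Rval t (\<phi> (inv\<^bsub>G\<^esub> ?a) y) \<in> carrier K"
    "E.Lval s x \<in> carrier K" "E.Rval s y \<in> carrier K"
    using v xy a by (auto intro!: A_closed phi_closed)
  ultimately show ?thesis
    using xy a by (simp add: \<chi>_def E.graft_val[OF s t] A_apply sigma_pow_apply act_apply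
        K.m_assoc K.m_lcomm K.m_comm)
qed

lemma tw_insert:
  assumes "set xs \<subseteq> carrier A" "set ys \<subseteq> carrier A" "a \<in> carrier A" "x \<in> X"
  shows "E.tw i (xs @ [a] @ ys) x = E.tw i xs x \<otimes>\<^bsub>K\<^esub>
    (a (\<phi> (inv\<^bsub>G\<^esub> (g [^]\<^bsub>G\<^esub> (i + length xs))) x) \<otimes>\<^bsub>K\<^esub> E.tw (Suc (i + length xs)) ys x)"
  using assms by (simp add: E.tw_append A_apply sigma_pow_apply del: funpow.simps)

lemma tw_linear:
  assumes "set xs \<subseteq> carrier A" "set ys \<subseteq> carrier A" "a \<in> carrier A" "b \<in> carrier A" "c \<in> carrier K" "x \<in> X"
  shows "E.tw i (xs @ [a \<oplus>\<^bsub>A\<^esub> b] @ ys) x = E.tw i (xs @ [a] @ ys) x \<oplus>\<^bsub>K\<^esub> E.tw i (xs @ [b] @ ys) x"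
    "E.tw i (xs @ [c \<odot>\<^bsub>A\<^esub> a] @ ys) x = c \<otimes>\<^bsub>K\<^esub> E.tw i (xs @ [a] @ ys) x"
proof -
  let ?y = "\<phi> (inv\<^bsub>G\<^esub> (g [^]\<^bsub>G\<^esub> (i + length xs))) x"
  have y: "?y \<in> X" using assms g_closed by (intro phi_closed) auto
  have cl: "a ?y \<in> carrier K" "b ?y \<in> carrier K" "E.tw i xs x \<in> carrier K"
    "E.tw (Suc (i + length xs)) ys x \<in> carrier K"
    using assms y E.tw_closed by (auto intro!: A_closed)
  note ins = tw_insert[OF assms(1,2) _ assms(6)]
  show "E.tw i (xs @ [a \<oplus>\<^bsub>A\<^esub> b] @ ys) x = E.tw i (xs @ [a] @ ys) x \<oplus>\<^bsub>K\<^esub> E.tw i (xs @ [b] @ ys) x"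
    using assms y cl unfolding ins[OF E.A.a_closed[OF assms(3,4)]] ins[OF assms(3)] ins[OF assms(4)]
    by (simp add: A_apply K.l_distr K.r_distr)
  show "E.tw i (xs @ [c \<odot>\<^bsub>A\<^esub> a] @ ys) x = c \<otimes>\<^bsub>K\<^esub> E.tw i (xs @ [a] @ ys) x"
    using assms y cl unfolding ins[OF E.smult_closed_A[OF assms(5,3)]] ins[OF assms(3)]
    by (simp add: A_apply K.m_assoc K.m_lcomm)
qed

lemma chi_linear:
  assumes "F \<in> frames" "a \<in> carrier A" "b \<in> carrier A" "F (Leaf a) \<in> E.ctx" "z \<in> Z" "c \<in> carrier K"
  shows "\<chi> z h (F (Leaf (a \<oplus>\<^bsub>A\<^esub> b))) = \<chi> z h (F (Leaf a)) \<oplus>\<^bsub>K\<^esub> \<chi> z h (F (Leaf b))"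
    "\<chi> z h (F (Leaf (c \<odot>\<^bsub>A\<^esub> a))) = c \<otimes>\<^bsub>K\<^esub> \<chi> z h (F (Leaf a))"
proof -
  have z: "fst z \<in> X" "snd z \<in> X" using assms(5) by auto
  have "leaves (Leaf a) = map Some [a]" by simp
  with assms(1,4) have "\<chi> z h (F (Leaf (a \<oplus>\<^bsub>A\<^esub> b))) = \<chi> z h (F (Leaf a)) \<oplus>\<^bsub>K\<^esub> \<chi> z h (F (Leaf b)) \<and>
    \<chi> z h (F (Leaf (c \<odot>\<^bsub>A\<^esub> a))) = c \<otimes>\<^bsub>K\<^esub> \<chi> z h (F (Leaf a))"
  proof (cases rule: E.frame_word)
    case (left xs ys bs)
    have w: "lword (F (Leaf d)) = xs @ [d] @ ys" "rword (F (Leaf d)) = bs" for d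
      using left(1)[of "Leaf d" "[d]"] by auto
    have cl: "E.tw i (xs @ [d] @ ys) (fst z) \<in> carrier K" "E.tw i bs (snd z) \<in> carrier K"
      if "d \<in> carrier A" for d i
      using that left(2-4) z E.tw_closed[of "xs @ [d] @ ys"] E.tw_closed[of bs] by (auto intro!: A_closed)
    have len: "length (xs @ [d] @ ys) = Suc (length xs + length ys)" for d by simp
    show ?thesis
      unfolding \<chi>_def E.Lval_def E.Rval_def w len tw_linear[OF left(2,3) assms(2,3,6) z(1)]
      using cl[OF assms(2)] cl[OF assms(3)] assms(6) by (simp del: append.simps add: K.l_distr K.m_assoc)
  next
    case (right as xs ys)
    have w: "lword (F (Leaf d)) = as" "rword (F (Leaf d)) = xs @ [d] @ ys" for d
      using right(1)[of "Leaf d" "[d]"] by auto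
    have cl: "E.tw i (xs @ [d] @ ys) (snd z) \<in> carrier K" "E.tw i as (fst z) \<in> carrier K"
      if "d \<in> carrier A" for d i
      using that right(2-4) z E.tw_closed[of "xs @ [d] @ ys"] E.tw_closed[of as] by (auto intro!: A_closed)
    show ?thesis
      unfolding \<chi>_def E.Lval_def E.Rval_def w tw_linear[OF right(3,4) assms(2,3,6) z(2)]
      using cl[OF assms(2)] cl[OF assms(3)] assms(6) by (simp del: append.simps add: K.r_distr K.m_lcomm)
  qed
  thus "\<chi> z h (F (Leaf (a \<oplus>\<^bsub>A\<^esub> b))) = \<chi> z h (F (Leaf a)) \<oplus>\<^bsub>K\<^esub> \<chi> z h (F (Leaf b))"
    "\<chi> z h (F (Leaf (c \<odot>\<^bsub>A\<^esub> a))) = c \<otimes>\<^bsub>K\<^esub> \<chi> z h (F (Leaf a))" by auto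
qed

lemma chi_cong:
  assumes "E.Lval s = E.Lval t" "E.Rval s = E.Rval t" "length (lword s) mod m = length (lword t) mod m"
  shows "\<chi> z h s = \<chi> z h t"
  using assms g_pow_eq[of "length (lword s)" "length (lword t)"] by (simp add: \<chi>_def)

definition \<Phi> :: "(('x \<Rightarrow> 'k) tree \<Rightarrow> 'k) \<Rightarrow> ('x \<times> 'x) \<times> 'g \<Rightarrow> 'k" where
  "\<Phi> f = (\<lambda>(z, h)\<in>Z \<times> carrier G. E.C.pairing (\<chi> z h) f)"

lemma Phi_apply: "z \<in> Z \<Longrightarrow> h \<in> carrier G \<Longrightarrow> \<Phi> f (z, h) = E.C.pairing (\<chi> z h) f"
  by (auto simp: \<Phi>_def)

lemma Phi_closed: "f \<in> carrier E.\<C> \<Longrightarrow> \<Phi> f \<in> carrier D.T"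
  unfolding \<Phi>_def D.T_carrier using E.C.pairing_closed[OF _ chi_Pi] by (auto simp: E.C_def)

lemma Phi_basis:
  "t \<in> E.ctx \<Longrightarrow> z \<in> Z \<Longrightarrow> h \<in> carrier G \<Longrightarrow> \<Phi> (E.bas t) (z, h) = \<chi> z h t"
  using E.C.pairing_basis[OF _ chi_Pi] by (simp add: Phi_apply E.ctx_carrier)

lemma Phi_add:
  assumes "f \<in> carrier E.\<C>" "f' \<in> carrier E.\<C>"
  shows "\<Phi> (f \<oplus>\<^bsub>E.\<C>\<^esub> f') = \<Phi> f \<oplus>\<^bsub>D.T\<^esub> \<Phi> f'"
proof (rule D.T_eqI)
  fix z h assume z: "z \<in> Z" and h: "h \<in> carrier G"
  show "\<Phi> (f \<oplus>\<^bsub>E.\<C>\<^esub> f') (z, h) = (\<Phi> f \<oplus>\<^bsub>D.T\<^esub> \<Phi> f') (z, h)"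
    using E.C.pairing_add_left[OF _ _ chi_Pi[OF z], of f f' h] assms
    by (simp only: D.T_apply[OF z h] Phi_apply[OF z h] E.C_def)
qed (intro Phi_closed D.T_ops_closed E.C.a_closed assms)+

lemma Phi_smult:
  assumes "c \<in> carrier K" "f \<in> carrier E.\<C>"
  shows "\<Phi> (c \<odot>\<^bsub>E.\<C>\<^esub> f) = c \<odot>\<^bsub>D.T\<^esub> \<Phi> f"
proof (rule D.T_eqI)
  fix z h assume z: "z \<in> Z" and h: "h \<in> carrier G"
  show "\<Phi> (c \<odot>\<^bsub>E.\<C>\<^esub> f) (z, h) = (c \<odot>\<^bsub>D.T\<^esub> \<Phi> f) (z, h)"
    using E.C.pairing_smult_left[OF _ _ chi_Pi[OF z], of f c h] assms
    by (simp only: D.T_apply[OF z h] Phi_apply[OF z h] E.C_def)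
qed (intro Phi_closed D.T_smult_closed E.smult_C_closed assms)+

text \<open>By \<open>pairing_mult\<close> it suffices to compare basis elements, where the claim
  is \<open>chi_graft\<close>.\<close>

lemma Phi_mult:
  assumes f: "f \<in> carrier E.\<C>" and f': "f' \<in> carrier E.\<C>"
  shows "\<Phi> (f \<otimes>\<^bsub>E.\<C>\<^esub> f') = \<Phi> f \<otimes>\<^bsub>D.T\<^esub> \<Phi> f'"
proof (rule D.T_eqI)
  fix z h assume z: "z \<in> Z" and h: "h \<in> carrier G"
  let ?S = "context_monoid n (carrier A)"
  note fA = f[unfolded E.C_def] and fA' = f'[unfolded E.C_def]
  let ?\<chi>' = "\<lambda>a. \<chi> (act (inv\<^bsub>G\<^esub> a) z) (inv\<^bsub>G\<^esub> a \<otimes>\<^bsub>G\<^esub> h)"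
  have x': "?\<chi>' a \<in> carrier ?S \<rightarrow> carrier K" if "a \<in> carrier G" for a
    using that z by (intro chi_Pi D.act_closed) auto
  have xc: "\<chi> z a s \<in> carrier K" if "s \<in> carrier ?S" for a s
    using that z by (simp add: chi_closed E.ctx_carrier)
  have p': "\<Phi> f' (act (inv\<^bsub>G\<^esub> a) z, inv\<^bsub>G\<^esub> a \<otimes>\<^bsub>G\<^esub> h) = E.C.pairing (?\<chi>' a) f'"
    "E.C.pairing (?\<chi>' a) f' \<in> carrier K" if "a \<in> carrier G" for a
    using that z h E.C.pairing_closed[OF fA' x'[OF that]] by (simp_all add: Phi_apply D.act_closed)
  have inner: "E.C.pairing (\<lambda>t. \<chi> z h (s \<otimes>\<^bsub>?S\<^esub> t)) f'
      = (\<Oplus>\<^bsub>K\<^esub>a\<in>carrier G. E.C.pairing (?\<chi>' a) f' \<otimes>\<^bsub>K\<^esub> \<chi> z a s)" if s: "s \<in> carrier ?S" for s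
  proof -
    have "E.C.pairing (\<lambda>t. \<chi> z h (s \<otimes>\<^bsub>?S\<^esub> t)) f'
        = E.C.pairing (\<lambda>t. \<Oplus>\<^bsub>K\<^esub>a\<in>carrier G. \<chi> z a s \<otimes>\<^bsub>K\<^esub> ?\<chi>' a t) f'"
    proof (rule E.C.pairing_cong[OF fA'])
      show "(\<lambda>t. \<Oplus>\<^bsub>K\<^esub>a\<in>carrier G. \<chi> z a s \<otimes>\<^bsub>K\<^esub> ?\<chi>' a t) \<in> carrier ?S \<rightarrow> carrier K"
        using x' xc[OF s] by (auto intro!: K.finsum_closed)
      show "\<chi> z h (s \<otimes>\<^bsub>?S\<^esub> t) = (\<Oplus>\<^bsub>K\<^esub>a\<in>carrier G. \<chi> z a s \<otimes>\<^bsub>K\<^esub> ?\<chi>' a t)"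
        if "t \<in> carrier ?S" for t
        using chi_graft[OF _ _ z h, of s t] s that by (simp add: context_monoid_def)
    qed
    also have "\<dots> = (\<Oplus>\<^bsub>K\<^esub>a\<in>carrier G. E.C.pairing (\<lambda>t. \<chi> z a s \<otimes>\<^bsub>K\<^esub> ?\<chi>' a t) f')"
      using x' xc[OF s] by (intro E.C.pairing_finsum_right[OF fA' finite_G]) auto
    also have "\<dots> = (\<Oplus>\<^bsub>K\<^esub>a\<in>carrier G. E.C.pairing (?\<chi>' a) f' \<otimes>\<^bsub>K\<^esub> \<chi> z a s)"
      using x' xc[OF s] p'(2)
      by (intro K.finsum_cong') (auto simp: E.C.pairing_smult_right[OF fA'] K.m_comm)
    finally show ?thesis .
  qed
  have "\<Phi> (f \<otimes>\<^bsub>E.\<C>\<^esub> f') (z, h) = E.C.pairing (\<lambda>s. E.C.pairing (\<lambda>t. \<chi> z h (s \<otimes>\<^bsub>?S\<^esub> t)) f') f"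
    using E.C.pairing_mult[OF fA fA' chi_Pi[OF z]] z h by (simp add: Phi_apply E.C_def)
  also have "\<dots> = E.C.pairing (\<lambda>s. \<Oplus>\<^bsub>K\<^esub>a\<in>carrier G. E.C.pairing (?\<chi>' a) f' \<otimes>\<^bsub>K\<^esub> \<chi> z a s) f"
    using inner xc p'(2) by (intro E.C.pairing_cong[OF fA]) (auto intro!: K.finsum_closed)
  also have "\<dots> = (\<Oplus>\<^bsub>K\<^esub>a\<in>carrier G. E.C.pairing (\<lambda>s. E.C.pairing (?\<chi>' a) f' \<otimes>\<^bsub>K\<^esub> \<chi> z a s) f)"
    using xc p'(2) by (intro E.C.pairing_finsum_right[OF fA finite_G]) auto
  also have "\<dots> = (\<Oplus>\<^bsub>K\<^esub>a\<in>carrier G. \<Phi> f (z, a) \<otimes>\<^bsub>K\<^esub> \<Phi> f' (act (inv\<^bsub>G\<^esub> a) z, inv\<^bsub>G\<^esub> a \<otimes>\<^bsub>G\<^esub> h))"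
    using p' z E.C.pairing_closed[OF fA chi_Pi[OF z]]
    by (intro K.finsum_cong') (auto simp: E.C.pairing_smult_right[OF fA chi_Pi[OF z]] Phi_apply K.m_comm)
  finally show "\<Phi> (f \<otimes>\<^bsub>E.\<C>\<^esub> f') (z, h) = (\<Phi> f \<otimes>\<^bsub>D.T\<^esub> \<Phi> f') (z, h)"
    by (simp only: D.T_apply(5)[OF z h])
qed (intro Phi_closed D.T_ops_closed E.C.m_closed assms)+

lemma Phi_hom: "\<Phi> \<in> ring_hom E.\<C> D.T"
proof (rule ring_hom_memI)
  show "\<Phi> \<one>\<^bsub>E.\<C>\<^esub> = \<one>\<^bsub>D.T\<^esub>"
  proof (rule D.T_eqI)
    have one: "\<one>\<^bsub>E.\<C>\<^esub> = E.bas Hole"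
      using E.C.one_eq_basis by (simp add: E.C_def) (simp add: context_monoid_def)
    fix z h assume z: "z \<in> Z" and h: "h \<in> carrier G"
    show "\<Phi> \<one>\<^bsub>E.\<C>\<^esub> (z, h) = \<one>\<^bsub>D.T\<^esub> (z, h)"
      unfolding one Phi_basis[OF E.Hole_ctx z h] using z h
      by (auto simp: \<chi>_def E.Hole_word E.Lval_def E.Rval_def A_apply D.T_apply)
  qed (intro Phi_closed E.C.one_closed D.T_units_closed)+
qed (use Phi_closed Phi_mult Phi_add in auto)

sublocale Phi: ring_hom_ring E.\<C> D.T \<Phi>
  by (intro ring_hom_ringI2 E.C.ring_axioms D.T.ring_axioms Phi_hom)

text \<open>Rebracketing does not change the word of a context; contraction preserves both values
  and the degree modulo \<open>m\<close>; the values depend linearly on each letter; and the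
  anchors have values \<open>1\<close> and degree \<open>0\<close> or \<open>m\<close>.\<close>

lemma rels_kernel: "E.rels \<subseteq> a_kernel E.\<C> D.T \<Phi>"
proof -
  have eq: "a \<ominus>\<^bsub>E.\<C>\<^esub> b \<in> a_kernel E.\<C> D.T \<Phi>"
    if "a \<in> carrier E.\<C>" "b \<in> carrier E.\<C>" "\<And>z h. z \<in> Z \<Longrightarrow> h \<in> carrier G \<Longrightarrow> \<Phi> a (z, h) = \<Phi> b (z, h)" for a b
  proof -
    have "\<Phi> a = \<Phi> b" using that by (intro D.T_eqI Phi_closed)
    hence "\<Phi> (a \<ominus>\<^bsub>E.\<C>\<^esub> b) = \<zero>\<^bsub>D.T\<^esub>"
      using that Phi_closed[OF that(2)] by (simp add: E.C.minus_eq D.T.r_neg)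
    thus ?thesis
      unfolding a_kernel_def' using that(1,2) by (intro CollectI conjI E.C.minus_closed)
  qed
  note sm = E.smult_C_closed
  show ?thesis
  proof
    fix x assume "x \<in> E.rels"
    thus "x \<in> a_kernel E.\<C> D.T \<Phi>"
    proof
      assume "x \<in> envelope_relations K A \<sigma> n"
      thus ?thesis
      proof cases
        case (additive F a b)
        have c: "F (Leaf a) \<in> E.ctx" "F (Leaf b) \<in> E.ctx"
          using E.leaf_ctx[OF additive(2,5)] additive by auto
        show ?thesis
          unfolding additive(1)
          using c E.bas_closed additive chi_linear(1)[OF additive(2,3,4) c(1) _ K.zero_closed]
          by (intro eq) (auto simp: Phi_add D.T_apply Phi_basis)
      next
        case (homogeneous F c a)
        have t: "F (Leaf a) \<in> E.ctx" using E.leaf_ctx[OF homogeneous(2,5)] homogeneous by auto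
        show ?thesis
          unfolding homogeneous(1)
          using t E.bas_closed homogeneous sm chi_linear(2)[OF homogeneous(2,4,4) t _ homogeneous(3)]
          by (intro eq) (auto simp: Phi_smult D.T_apply Phi_basis)
      next
        case (contraction F as)
        have t: "F (Leaf (E.tw 0 as)) \<in> E.ctx"
          using E.leaf_ctx[OF contraction(2,5)] E.tw_closed[OF contraction(4)] by (simp add: holes_Leaf_list)
        have "\<chi> z h (F (Node (map Leaf as))) = \<chi> z h (F (Leaf (E.tw 0 as)))" for z h
          using E.contract_val[OF contraction(2-5)] by (intro chi_cong) auto
        thus ?thesis
          unfolding contraction(1) E.twisted_product_eq[OF contraction(3,4)]
          using t E.bas_closed contraction(5) by (intro eq) (auto simp: Phi_basis)
      next
        case (associativity F us vs ws us' vs' ws')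
        let ?s = "Node (us @ Node vs # ws)" and ?t = "Node (us' @ Node vs' # ws')"
        have "leaves ?s = concat (map leaves (us @ vs @ ws))" "leaves ?t = concat (map leaves (us' @ vs' @ ws'))"
          by simp_all
        hence "leaves ?s = leaves ?t" using associativity(3) by (simp only:)
        moreover obtain pre post where "\<And>t. leaves (F t) = pre @ leaves t @ post"
          using frame_leaves[OF associativity(2)] by metis
        ultimately have "leaves (F ?s) = leaves (F ?t)"
          by (simp only:)
        hence "\<chi> z h (F ?s) = \<chi> z h (F ?t)" for z h
          by (intro chi_cong) (simp_all add: E.Lval_def E.Rval_def lword_def rword_def)
        thus ?thesis
          unfolding associativity(1)
          using E.bas_closed associativity(6,7) by (intro eq) (auto simp: Phi_basis)
      qed
    next
      assume "x \<in> anchor_relations K A n"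
      moreover have "\<chi> z h (Node (Hole # replicate (n - 1) (Leaf \<one>\<^bsub>A\<^esub>))) = \<chi> z h Hole"
        "\<chi> z h (Node (replicate (n - 1) (Leaf \<one>\<^bsub>A\<^esub>) @ [Hole])) = \<chi> z h Hole" for z h
      proof -
        have e: "Node (Hole # replicate (n - 1) (Leaf \<one>\<^bsub>A\<^esub>)) = E.corolla [] (E.ones m)"
          "Node (replicate (n - 1) (Leaf \<one>\<^bsub>A\<^esub>) @ [Hole]) = E.corolla (E.ones m) []"
          using n_eq by (simp_all add: E.corolla_def)
        show "\<chi> z h (Node (Hole # replicate (n - 1) (Leaf \<one>\<^bsub>A\<^esub>))) = \<chi> z h Hole"
          "\<chi> z h (Node (replicate (n - 1) (Leaf \<one>\<^bsub>A\<^esub>) @ [Hole])) = \<chi> z h Hole"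
          unfolding e
          by (rule chi_cong; simp add: E.corolla_word E.Hole_word E.Lval_def E.Rval_def E.tw_ones)+
      qed
      ultimately show ?thesis
        using E.anchor_ctx E.Hole_ctx E.bas_closed
        by (auto simp: anchor_relations_def Phi_basis intro!: eq)
    qed
  qed
qed

lemma ker_subset: "E.ker \<subseteq> a_kernel E.\<C> D.T \<Phi>"
  unfolding E.ker_def by (rule E.C.genideal_minimal[OF Phi.kernel_is_ideal rels_kernel])

end

section \<open>Isomorphisms of algebras\<close>

lemma algebra_iso_compose:
  assumes "f \<in> algebra_iso K A B" "h \<in> algebra_iso K B C"
  shows "h \<circ> f \<in> algebra_iso K A C"
proof -
  have "f a \<in> carrier B" if "a \<in> carrier A" for a
    using that assms(1) by (auto simp: algebra_iso_def ring_iso_def ring_hom_def)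
  thus ?thesis
    using assms ring_iso_set_trans[of f A B h C] by (auto simp: algebra_iso_def)
qed

text \<open>An isomorphism identifies its source with the corner at the idempotent
  \<open>1\<close>.\<close>

lemma algebra_iso_morita:
  assumes "ring A" "ring B" "\<theta> \<in> algebra_iso K A B" "infinite (UNIV :: 'u set)"
    and "\<And>c. c \<in> carrier K \<Longrightarrow> c \<odot>\<^bsub>A\<^esub> \<one>\<^bsub>A\<^esub> \<in> carrier A"
    and "\<And>c b. c \<in> carrier K \<Longrightarrow> b \<in> carrier B
      \<Longrightarrow> (c \<odot>\<^bsub>B\<^esub> \<one>\<^bsub>B\<^esub>) \<otimes>\<^bsub>B\<^esub> b = b \<otimes>\<^bsub>B\<^esub> (c \<odot>\<^bsub>B\<^esub> \<one>\<^bsub>B\<^esub>)"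
  shows "morita_equivalent TYPE('u) K B A"
proof -
  interpret A: ring A by fact
  interpret B: ring B by fact
  have \<theta>: "\<theta> a \<in> carrier B" "\<theta> (a \<otimes>\<^bsub>A\<^esub> b) = \<theta> a \<otimes>\<^bsub>B\<^esub> \<theta> b" "\<theta> (a \<oplus>\<^bsub>A\<^esub> b) = \<theta> a \<oplus>\<^bsub>B\<^esub> \<theta> b"
    "\<theta> \<one>\<^bsub>A\<^esub> = \<one>\<^bsub>B\<^esub>" "c \<in> carrier K \<Longrightarrow> \<theta> (c \<odot>\<^bsub>A\<^esub> a) = c \<odot>\<^bsub>B\<^esub> \<theta> a"
    if "a \<in> carrier A" "b \<in> carrier A" for a b c
    using that assms(3) by (auto simp: algebra_iso_def ring_iso_def ring_hom_def)
  note \<theta>_closed = \<theta>(1)[OF _ A.one_closed]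
  have bij: "bij_betw \<theta> (carrier A) (carrier B)"
    using assms(3) by (auto simp: algebra_iso_def ring_iso_def)
  have sB: "c \<odot>\<^bsub>B\<^esub> \<one>\<^bsub>B\<^esub> = \<theta> (c \<odot>\<^bsub>A\<^esub> \<one>\<^bsub>A\<^esub>)" if "c \<in> carrier K" for c
    using \<theta>(4,5)[OF A.one_closed A.one_closed] that by simp
  have "corner B A K \<theta> \<one>\<^bsub>B\<^esub> (\<lambda>_. \<one>\<^bsub>B\<^esub>) (\<lambda>_. \<one>\<^bsub>B\<^esub>) {()}"
  proof (intro corner.intro corner_axioms.intro A.ring_axioms B.ring_axioms)
    show "inj_on \<theta> (carrier A)" using bij by (rule bij_betw_imp_inj_on)
    show "\<one>\<^bsub>B\<^esub> \<otimes>\<^bsub>B\<^esub> b \<otimes>\<^bsub>B\<^esub> \<one>\<^bsub>B\<^esub> \<in> \<theta> ` carrier A" if "b \<in> carrier B" for b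
      using that bij by (simp add: bij_betw_def)
    show "c \<odot>\<^bsub>B\<^esub> \<one>\<^bsub>B\<^esub> \<in> carrier B" if "c \<in> carrier K" for c
      using that assms(5) \<theta>_closed by (simp add: sB)
    show "\<theta> (c \<odot>\<^bsub>A\<^esub> \<one>\<^bsub>A\<^esub>) = c \<odot>\<^bsub>B\<^esub> \<one>\<^bsub>B\<^esub> \<otimes>\<^bsub>B\<^esub> \<one>\<^bsub>B\<^esub>" if "c \<in> carrier K" for c
      using that assms(5) \<theta>_closed by (simp add: sB)
  qed (use \<theta>_closed \<theta>(2,3) \<theta>(4)[OF A.one_closed A.one_closed] assms(5,6) in \<open>auto simp: B.finsum_insert\<close>)
  thus ?thesis using assms(4) by (rule corner_morita)
qed

lemma (in corner) corner_scalar_central: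
  assumes "c \<in> carrier K" "s \<in> carrier S"
  shows "(c \<odot>\<^bsub>S\<^esub> \<one>\<^bsub>S\<^esub>) \<otimes>\<^bsub>S\<^esub> s = s \<otimes>\<^bsub>S\<^esub> (c \<odot>\<^bsub>S\<^esub> \<one>\<^bsub>S\<^esub>)"
proof (rule psi_eqD)
  note c = scalar_closed[OF assms(1)] and s = psi_closed[OF assms(2)]
  have "\<psi> (s \<otimes>\<^bsub>S\<^esub> (c \<odot>\<^bsub>S\<^esub> \<one>\<^bsub>S\<^esub>)) = \<psi> s \<otimes>\<^bsub>R\<^esub> (c \<odot>\<^bsub>R\<^esub> \<one>\<^bsub>R\<^esub>) \<otimes>\<^bsub>R\<^esub> e"
    using c s assms e_closed by (simp add: psi_mult psi_scalar R.m_assoc)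
  also have "\<dots> = (c \<odot>\<^bsub>R\<^esub> \<one>\<^bsub>R\<^esub>) \<otimes>\<^bsub>R\<^esub> \<psi> s \<otimes>\<^bsub>R\<^esub> e"
    using scalar_central[OF assms(1) s] by simp
  also have "\<dots> = \<psi> ((c \<odot>\<^bsub>S\<^esub> \<one>\<^bsub>S\<^esub>) \<otimes>\<^bsub>S\<^esub> s)"
    using c s assms e_closed by (simp add: psi_mult psi_scalar R.m_assoc e_psi psi_e)
  finally show "\<psi> ((c \<odot>\<^bsub>S\<^esub> \<one>\<^bsub>S\<^esub>) \<otimes>\<^bsub>S\<^esub> s) = \<psi> (s \<otimes>\<^bsub>S\<^esub> (c \<odot>\<^bsub>S\<^esub> \<one>\<^bsub>S\<^esub>))" ..
qed (use assms scalar_closed in auto)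

lemma product_algebra_reindex:
  assumes "bij_betw \<beta> I J" "\<And>i. i \<in> I \<Longrightarrow> B (\<beta> i) = A i"
    and "\<And>i. i \<in> I \<Longrightarrow> ring (A i)"
    and "\<And>c f. c \<in> carrier K \<Longrightarrow> f \<in> carrier (product_algebra I A) \<Longrightarrow> c \<odot>\<^bsub>product_algebra I A\<^esub> f \<in> carrier (product_algebra I A)"
  shows "(\<lambda>f. \<lambda>j\<in>J. f (inv_into I \<beta> j)) \<in> algebra_iso K (product_algebra I A) (product_algebra J B)"
proof -
  let ?i = "inv_into I \<beta>"
  have i: "?i j \<in> I" "\<beta> (?i j) = j" if "j \<in> J" for j
    using assms(1) that by (auto simp: bij_betw_inv_into_right intro: bij_betw_apply[OF bij_betw_inv_into])
  have b: "\<beta> x \<in> J" "?i (\<beta> x) = x" if "x \<in> I" for x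
    using assms(1) that by (auto simp: bij_betw_inv_into_left intro: bij_betw_apply)
  have BA: "B j = A (?i j)" if "j \<in> J" for j using assms(2)[OF i(1)[OF that]] i(2)[OF that] by simp
  have "bij_betw (\<lambda>f. \<lambda>j\<in>J. f (?i j)) (carrier (product_algebra I A)) (carrier (product_algebra J B))"
  proof (rule bij_betw_byWitness[where f' = "\<lambda>f. \<lambda>x\<in>I. f (\<beta> x)"])
    show "\<forall>f\<in>carrier (product_algebra I A). (\<lambda>x\<in>I. (\<lambda>j\<in>J. f (?i j)) (\<beta> x)) = f"
      using b by (auto simp: product_algebra_simps fun_eq_iff PiE_def extensional_def)
    show "\<forall>f\<in>carrier (product_algebra J B). (\<lambda>j\<in>J. (\<lambda>x\<in>I. f (\<beta> x)) (?i j)) = f"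
      using i by (auto simp: product_algebra_simps fun_eq_iff PiE_def extensional_def)
    show "(\<lambda>f. \<lambda>j\<in>J. f (?i j)) ` carrier (product_algebra I A) \<subseteq> carrier (product_algebra J B)"
      using i BA by (auto simp: product_algebra_simps PiE_iff)
    show "(\<lambda>f. \<lambda>x\<in>I. f (\<beta> x)) ` carrier (product_algebra J B) \<subseteq> carrier (product_algebra I A)"
      using b assms(2) by (auto simp: product_algebra_simps PiE_iff) metis
  qed
  moreover have "(\<lambda>j\<in>J. f (?i j)) \<in> carrier (product_algebra J B)" if "f \<in> carrier (product_algebra I A)" for f
    using that i BA by (auto simp: product_algebra_simps PiE_iff)
  ultimately show ?thesis
    using i BA by (auto simp: algebra_iso_def ring_iso_def ring_hom_def) (auto simp: product_algebra_def fun_eq_iff)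
qed

context permutation_setting
begin

section \<open>The kernel and the image\<close>

definition delta :: "'x \<Rightarrow> 'x \<Rightarrow> 'k" where
  "delta x = (\<lambda>y\<in>X. if y = x then \<one>\<^bsub>K\<^esub> else \<zero>\<^bsub>K\<^esub>)"

lemma delta_closed: "delta x \<in> carrier A"
  by (auto simp: delta_def A_carrier)

lemma delta_apply: "y \<in> X \<Longrightarrow> delta x y = (if y = x then \<one>\<^bsub>K\<^esub> else \<zero>\<^bsub>K\<^esub>)"
  by (simp add: delta_def)

definition ix :: "'g \<Rightarrow> nat" where "ix h = (SOME i. i < m \<and> h = g [^]\<^bsub>G\<^esub> i)"

lemma ix: "h \<in> carrier G \<Longrightarrow> ix h < m" "h \<in> carrier G \<Longrightarrow> g [^]\<^bsub>G\<^esub> ix h = h"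
  unfolding ix_def using g_pow_surj[of h] by (metis (mono_tags, lifting) someI_ex)+

lemma ix_pow: "i < m \<Longrightarrow> ix (g [^]\<^bsub>G\<^esub> i) = i"
  using ix[of "g [^]\<^bsub>G\<^esub> i"] g_closed g_pow_eq[of "ix (g [^]\<^bsub>G\<^esub> i)" i] by simp

text \<open>The monomial that corresponds to
  \<open>\<delta>\<^sub>(\<^sub>x\<^sub>,\<^sub>y\<^sub>) h\<close>. The exponent of the shift is
  a discrete logarithm of \<open>h\<close> to the base \<open>g\<close>.\<close>

definition vec :: "('x \<times> 'x) \<times> 'g \<Rightarrow> (('x \<Rightarrow> 'k) tree \<Rightarrow> 'k) set" where
  "vec p = E.monomial (delta (fst (fst p))) (delta (snd (fst p))) (ix (snd p))"

lemma vec_closed: "vec p \<in> carrier E.\<U>"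
  by (simp add: vec_def E.monomial_closed delta_closed)

interpretation UM: Module.module K E.\<U>
  by (rule E.Q.quotient_module)

definition \<Psi> :: "(('x \<times> 'x) \<times> 'g \<Rightarrow> 'k) \<Rightarrow> (('x \<Rightarrow> 'k) tree \<Rightarrow> 'k) set" where
  "\<Psi> u = (\<Oplus>\<^bsub>E.\<U>\<^esub>p\<in>Z \<times> carrier G. u p \<odot>\<^bsub>E.\<U>\<^esub> vec p)"

lemma T_value: "u \<in> carrier D.T \<Longrightarrow> p \<in> Z \<times> carrier G \<Longrightarrow> u p \<in> carrier K"
  unfolding D.T_carrier by (rule PiE_mem)

lemma Psi_add:
  assumes "u \<in> carrier D.T" "v \<in> carrier D.T"
  shows "\<Psi> (u \<oplus>\<^bsub>D.T\<^esub> v) = \<Psi> u \<oplus>\<^bsub>E.\<U>\<^esub> \<Psi> v"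
proof -
  have "\<Psi> (u \<oplus>\<^bsub>D.T\<^esub> v) = (\<Oplus>\<^bsub>E.\<U>\<^esub>p\<in>Z \<times> carrier G. u p \<odot>\<^bsub>E.\<U>\<^esub> vec p \<oplus>\<^bsub>E.\<U>\<^esub> v p \<odot>\<^bsub>E.\<U>\<^esub> vec p)"
    unfolding \<Psi>_def using T_value[OF assms(1)] T_value[OF assms(2)] vec_closed
    by (intro E.U.finsum_cong') (auto simp: D.T_apply UM.smult_l_distr)
  also have "\<dots> = \<Psi> u \<oplus>\<^bsub>E.\<U>\<^esub> \<Psi> v"
    unfolding \<Psi>_def using T_value[OF assms(1)] T_value[OF assms(2)] vec_closed
    by (intro E.U.finsum_addf) auto
  finally show ?thesis .
qed

lemma Psi_smult:
  assumes "c \<in> carrier K" "u \<in> carrier D.T"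
  shows "\<Psi> (c \<odot>\<^bsub>D.T\<^esub> u) = c \<odot>\<^bsub>E.\<U>\<^esub> \<Psi> u"
proof -
  have "\<Psi> (c \<odot>\<^bsub>D.T\<^esub> u) = (\<Oplus>\<^bsub>E.\<U>\<^esub>p\<in>Z \<times> carrier G. c \<odot>\<^bsub>E.\<U>\<^esub> (u p \<odot>\<^bsub>E.\<U>\<^esub> vec p))"
    unfolding \<Psi>_def using T_value[OF assms(2)] vec_closed assms(1)
    by (intro E.U.finsum_cong') (auto simp: D.T_apply UM.smult_assoc1)
  also have "\<dots> = c \<odot>\<^bsub>E.\<U>\<^esub> \<Psi> u"
    unfolding \<Psi>_def using T_value[OF assms(2)] vec_closed assms(1) finite_X finite_G
    by (intro UM.finsum_smult_ldistr[symmetric]) auto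
  finally show ?thesis .
qed

lemma Psi_point:
  assumes "c \<in> carrier K" "p \<in> Z \<times> carrier G"
  shows "\<Psi> (\<lambda>q\<in>Z \<times> carrier G. if q = p then c else \<zero>\<^bsub>K\<^esub>) = c \<odot>\<^bsub>E.\<U>\<^esub> vec p"
proof -
  have "\<Psi> (\<lambda>q\<in>Z \<times> carrier G. if q = p then c else \<zero>\<^bsub>K\<^esub>)
      = (\<lambda>q\<in>Z \<times> carrier G. if q = p then c else \<zero>\<^bsub>K\<^esub>) p \<odot>\<^bsub>E.\<U>\<^esub> vec p"
    unfolding \<Psi>_def using assms finite_X finite_G vec_closed
    by (intro E.U.finsum_single_term) auto
  thus ?thesis using assms by simp
qed

lemma Phi_mono_tree:
  assumes "x \<in> X" "y \<in> X" "p < m"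
  shows "\<Phi> (E.bas (E.mono_tree (delta x) (delta y) p))
    = (\<lambda>q\<in>Z \<times> carrier G. if q = ((x, y), g [^]\<^bsub>G\<^esub> p) then \<one>\<^bsub>K\<^esub> else \<zero>\<^bsub>K\<^esub>)"
proof -
  note t = E.mono_tree[OF delta_closed delta_closed less_imp_le[OF assms(3)], of x y]
  have "(if P then \<one>\<^bsub>K\<^esub> else \<zero>\<^bsub>K\<^esub>) \<otimes>\<^bsub>K\<^esub> (if Q then \<one>\<^bsub>K\<^esub> else \<zero>\<^bsub>K\<^esub>) = (if P \<and> Q then \<one>\<^bsub>K\<^esub> else \<zero>\<^bsub>K\<^esub>)" for P Q
    by simp
  moreover have "g [^]\<^bsub>G\<^esub> (m + p) = g [^]\<^bsub>G\<^esub> p"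
    using g_pow_eq[of "m + p" p] by simp
  ultimately have "\<chi> z h (E.mono_tree (delta x) (delta y) p) = (if (z, h) = ((x, y), g [^]\<^bsub>G\<^esub> p) then \<one>\<^bsub>K\<^esub> else \<zero>\<^bsub>K\<^esub>)"
    if "z \<in> Z" for z h
    unfolding \<chi>_def t(3-5) using that by (auto simp: delta_apply split: if_splits)
  hence "\<Phi> (E.bas (E.mono_tree (delta x) (delta y) p)) q
      = (if q = ((x, y), g [^]\<^bsub>G\<^esub> p) then \<one>\<^bsub>K\<^esub> else \<zero>\<^bsub>K\<^esub>)" if "q \<in> Z \<times> carrier G" for q
    using that Phi_basis[OF t(1)] by (cases q) auto
  thus ?thesis
    using Phi_closed[OF E.bas_closed[OF t(1)]]
    by (auto simp: fun_eq_iff D.T_carrier PiE_def extensional_def)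
qed

lemma coset_determines_Phi:
  assumes "f \<in> carrier E.\<C>" "f' \<in> carrier E.\<C>" "E.Q.coset f = E.Q.coset f'"
  shows "\<Phi> f = \<Phi> f'"
proof -
  have "f \<ominus>\<^bsub>E.\<C>\<^esub> f' \<in> a_kernel E.\<C> D.T \<Phi>"
    using E.Q.coset_eq_iff[OF assms(1,2)] assms(3) ker_subset by auto
  hence "\<Phi> (f \<ominus>\<^bsub>E.\<C>\<^esub> f') = \<zero>\<^bsub>D.T\<^esub>" unfolding a_kernel_def' by blast
  moreover have "\<Phi> f = \<Phi> (f \<ominus>\<^bsub>E.\<C>\<^esub> f' \<oplus>\<^bsub>E.\<C>\<^esub> f')"
    using assms by (simp only: E.C.minus_eq E.C.a_assoc E.C.a_inv_closed E.C.l_neg E.C.r_zero)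
  moreover have "\<dots> = \<Phi> (f \<ominus>\<^bsub>E.\<C>\<^esub> f') \<oplus>\<^bsub>D.T\<^esub> \<Phi> f'"
    using assms by (intro Phi_add E.C.minus_closed)
  ultimately show ?thesis
    using Phi_closed[OF assms(2)] by simp
qed

text \<open>Asking for one representative makes this property pass to sums and multiples of
  classes; it does not depend on the representative by
  \<open>coset_determines_Phi\<close>.\<close>

definition recovered :: "(('x \<Rightarrow> 'k) tree \<Rightarrow> 'k) set \<Rightarrow> bool" where
  "recovered q \<longleftrightarrow> (\<exists>f\<in>carrier E.\<C>. E.Q.coset f = q \<and> \<Psi> (\<Phi> f) = q)"

lemma recovered_add:
  assumes "recovered q" "recovered q'"
  shows "recovered (q \<oplus>\<^bsub>E.\<U>\<^esub> q')"
proof -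
  obtain f f' where "f \<in> carrier E.\<C>" "E.Q.coset f = q" "\<Psi> (\<Phi> f) = q"
    "f' \<in> carrier E.\<C>" "E.Q.coset f' = q'" "\<Psi> (\<Phi> f') = q'"
    using assms by (auto simp: recovered_def)
  thus ?thesis
    unfolding recovered_def
    by (intro bexI[of _ "f \<oplus>\<^bsub>E.\<C>\<^esub> f'"]) (simp_all add: E.Q.coset_add Phi_add Psi_add Phi_closed)
qed

lemma recovered_smult:
  assumes "c \<in> carrier K" "recovered q"
  shows "recovered (c \<odot>\<^bsub>E.\<U>\<^esub> q)"
proof -
  obtain f where "f \<in> carrier E.\<C>" "E.Q.coset f = q" "\<Psi> (\<Phi> f) = q"
    using assms(2) by (auto simp: recovered_def)
  thus ?thesis
    unfolding recovered_def using assms(1)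
    by (intro bexI[of _ "c \<odot>\<^bsub>E.\<C>\<^esub> f"])
      (simp_all add: E.Q.coset_smult Phi_smult Psi_smult Phi_closed E.smult_C_closed)
qed

lemma recovered_delta:
  assumes "x \<in> X" "y \<in> X"
  shows "recovered (E.monomial (delta x) (delta y) p)"
proof -
  let ?p = "p mod m"
  have p: "?p < m" using m_ge_2 by simp
  have "E.shift [^]\<^bsub>E.\<U>\<^esub> p = E.shift [^]\<^bsub>E.\<U>\<^esub> (m * (p div m) + ?p)"
    by (simp only: mult_div_mod_eq)
  also have "\<dots> = (E.shift [^]\<^bsub>E.\<U>\<^esub> m) [^]\<^bsub>E.\<U>\<^esub> (p div m) \<otimes>\<^bsub>E.\<U>\<^esub> E.shift [^]\<^bsub>E.\<U>\<^esub> ?p"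
    using E.shift_closed by (simp only: E.U.nat_pow_mult[symmetric] E.U.nat_pow_pow)
  finally have "E.shift [^]\<^bsub>E.\<U>\<^esub> p = E.shift [^]\<^bsub>E.\<U>\<^esub> ?p"
    using E.shift_closed by (simp add: E.shift_order E.U.nat_pow_one)
  hence mono: "E.monomial (delta x) (delta y) p = E.monomial (delta x) (delta y) ?p"
    by (simp add: E.monomial_def)
  note t = E.mono_tree[OF delta_closed delta_closed less_imp_le[OF p], of x y]
  let ?f = "E.bas (E.mono_tree (delta x) (delta y) ?p)"
  have "\<Psi> (\<Phi> ?f) = \<one>\<^bsub>K\<^esub> \<odot>\<^bsub>E.\<U>\<^esub> vec ((x, y), g [^]\<^bsub>G\<^esub> ?p)"
    unfolding Phi_mono_tree[OF assms p] using assms g_closed by (intro Psi_point) auto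
  hence "\<Psi> (\<Phi> ?f) = E.monomial (delta x) (delta y) p"
    using vec_closed by (simp add: mono) (simp add: vec_def ix_pow[OF p])
  moreover have "E.Q.coset ?f = E.monomial (delta x) (delta y) p"
    using t(2) mono by (simp add: E.cls_def)
  ultimately show ?thesis
    unfolding recovered_def using E.bas_closed[OF t(1)] by blast
qed

lemma point_delta: "c \<in> carrier K \<Longrightarrow> (\<lambda>y\<in>X. if y = x then c else \<zero>\<^bsub>K\<^esub>) = c \<odot>\<^bsub>A\<^esub> delta x"
  by (auto simp: fun_eq_iff delta_def function_algebra_def)

lemma zero_delta: "(\<lambda>y\<in>X. \<zero>\<^bsub>K\<^esub>) = \<zero>\<^bsub>K\<^esub> \<odot>\<^bsub>A\<^esub> delta x"
  by (auto simp: fun_eq_iff delta_def function_algebra_def)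

lemma sum_A: "(\<lambda>y\<in>X. a y \<oplus>\<^bsub>K\<^esub> b y) = a \<oplus>\<^bsub>A\<^esub> b"
  by (simp add: function_algebra_def)

lemma monomial_linear_left:
  assumes "a \<in> carrier A" "a' \<in> carrier A" "b \<in> carrier A" "c \<in> carrier K"
  shows "E.monomial (a \<oplus>\<^bsub>A\<^esub> a') b p = E.monomial a b p \<oplus>\<^bsub>E.\<U>\<^esub> E.monomial a' b p"
    "E.monomial (c \<odot>\<^bsub>A\<^esub> a) b p = c \<odot>\<^bsub>E.\<U>\<^esub> E.monomial a b p"
  using assms E.lmul_closed E.rmul_closed E.shift_closed
  by (simp_all add: E.monomial_def E.lmul_add E.lmul_smult E.U.l_distr E.Q.quotient_smult_mult)

lemma monomial_linear_right:
  assumes "a \<in> carrier A" "b \<in> carrier A" "b' \<in> carrier A" "c \<in> carrier K"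
  shows "E.monomial a (b \<oplus>\<^bsub>A\<^esub> b') p = E.monomial a b p \<oplus>\<^bsub>E.\<U>\<^esub> E.monomial a b' p"
    "E.monomial a (c \<odot>\<^bsub>A\<^esub> b) p = c \<odot>\<^bsub>E.\<U>\<^esub> E.monomial a b p"
proof -
  have swap: "E.monomial a b p = E.rmul b \<otimes>\<^bsub>E.\<U>\<^esub> E.lmul a \<otimes>\<^bsub>E.\<U>\<^esub> E.shift [^]\<^bsub>E.\<U>\<^esub> p" if "b \<in> carrier A" for b
    using assms(1) that by (simp only: E.monomial_def E.lmul_rmul)
  show "E.monomial a (b \<oplus>\<^bsub>A\<^esub> b') p = E.monomial a b p \<oplus>\<^bsub>E.\<U>\<^esub> E.monomial a b' p"
    "E.monomial a (c \<odot>\<^bsub>A\<^esub> b) p = c \<odot>\<^bsub>E.\<U>\<^esub> E.monomial a b p"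
    using assms E.lmul_closed E.rmul_closed E.shift_closed E.smult_closed_A
    by (simp_all add: swap E.rmul_add E.rmul_smult E.U.l_distr E.Q.quotient_smult_mult)
qed

text \<open>A monomial is linear in each of its two functions, and functions are combinations of
  characteristic functions.\<close>

lemma recovered_monomial:
  assumes a: "a \<in> carrier A" and b: "b \<in> carrier A"
  shows "recovered (E.monomial a b p)"
proof -
  obtain x0 where x0: "x0 \<in> X" using X_ne by blast
  have 1: "recovered (E.monomial a (delta y) p)" if y: "y \<in> X" for y
    using K.cring_axioms finite_X a[unfolded A_carrier]
  proof (induction a rule: function_space_induct)
    case zero
    show ?case
      unfolding zero_delta[of x0] using recovered_delta[OF x0 y] delta_closed
      by (simp add: monomial_linear_left(2)[OF _ delta_closed] recovered_smult)
  next
    case (add a a')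
    thus ?case
      unfolding sum_A by (simp add: monomial_linear_left(1)[OF _ _ delta_closed K.zero_closed] A_carrier recovered_add)
  next
    case (scale c x)
    thus ?case
      using recovered_delta[OF _ y] delta_closed
      by (simp add: point_delta monomial_linear_left(2)[OF _ delta_closed] recovered_smult)
  qed
  show ?thesis
    using K.cring_axioms finite_X b[unfolded A_carrier]
  proof (induction b rule: function_space_induct)
    case zero
    show ?case
      unfolding zero_delta[of x0] using 1[OF x0] a
      by (simp add: monomial_linear_right(2)[OF _ _ delta_closed] delta_closed recovered_smult)
  next
    case (add b b')
    thus ?case
      unfolding sum_A using a by (simp add: monomial_linear_right(1)[OF _ _ _ K.zero_closed] A_carrier recovered_add)
  next
    case (scale c y)
    thus ?case
      using 1 a by (simp add: point_delta monomial_linear_right(2)[OF _ _ delta_closed] delta_closed recovered_smult)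
  qed
qed

lemma Psi_Phi:
  assumes "f \<in> carrier E.\<C>"
  shows "\<Psi> (\<Phi> f) = E.Q.coset f"
proof -
  have "recovered (E.Q.coset f)"
    using assms unfolding E.C_def
  proof (induction f rule: E.C.MA_induct)
    case zero
    obtain x0 where x0: "x0 \<in> X" using X_ne by blast
    have "E.Q.coset \<zero>\<^bsub>E.\<C>\<^esub> = \<zero>\<^bsub>K\<^esub> \<odot>\<^bsub>E.\<U>\<^esub> E.monomial (delta x0) (delta x0) 0"
      using E.monomial_closed[OF delta_closed delta_closed] by (simp add: E.Q.coset_zero)
    thus ?case
      using recovered_smult[OF K.zero_closed recovered_delta[OF x0 x0]] by (simp add: E.C_def)
  next
    case (add f h)
    thus ?case
      using recovered_add E.Q.coset_add[of f h] by (simp add: E.C_def)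
  next
    case (scale c t)
    have t: "t \<in> E.ctx" using scale by (simp add: E.ctx_carrier)
    obtain a b p where "a \<in> carrier A" "b \<in> carrier A" "E.cls t = E.monomial a b p"
      using E.context_is_monomial[OF t] by blast
    hence "recovered (c \<odot>\<^bsub>E.\<U>\<^esub> E.cls t)"
      using scale recovered_monomial recovered_smult by simp
    thus ?case
      using E.Q.coset_smult[OF scale(1) E.bas_closed[OF t]] by (simp add: E.C_def E.cls_def)
  qed
  then obtain f' where f': "f' \<in> carrier E.\<C>" "E.Q.coset f' = E.Q.coset f" "\<Psi> (\<Phi> f') = E.Q.coset f"
    unfolding recovered_def by blast
  thus ?thesis
    using coset_determines_Phi[OF assms f'(1)] by simp
qed

text \<open>If \<open>\<Phi> f = 0\<close>, then \<open>f\<close> has the class \<open>\<Psi> 0 =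
  0\<close>.\<close>

lemma kernel_eq: "a_kernel E.\<C> D.T \<Phi> = E.ker"
proof (rule antisym[OF subsetI ker_subset])
  fix f assume "f \<in> a_kernel E.\<C> D.T \<Phi>"
  hence f: "f \<in> carrier E.\<C>" "\<Phi> f = \<zero>\<^bsub>D.T\<^esub>" unfolding a_kernel_def' by auto
  have "E.Q.coset f = \<Psi> (\<Phi> f)" using Psi_Phi[OF f(1)] by simp
  also have "\<dots> = \<Psi> (\<Phi> \<zero>\<^bsub>E.\<C>\<^esub>)" using f(2) by simp
  also have "\<dots> = E.Q.coset \<zero>\<^bsub>E.\<C>\<^esub>" by (rule Psi_Phi[OF E.C.zero_closed])
  finally have "f \<ominus>\<^bsub>E.\<C>\<^esub> \<zero>\<^bsub>E.\<C>\<^esub> \<in> E.ker"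
    using E.Q.coset_eq_iff[OF f(1) E.C.zero_closed] by simp
  thus "f \<in> E.ker" using f(1) by (simp add: E.C.minus_eq)
qed

text \<open>The indicator of \<open>((x, y), g\<^sup>i)\<close> is the image of the context of the
  monomial \<open>l\<^sub>\<delta>\<^sub>x r\<^sub>\<delta>\<^sub>y s\<^sup>i\<close>.\<close>

lemma Phi_surj: "\<Phi> ` carrier E.\<C> = carrier D.T"
proof (rule antisym)
  show "\<Phi> ` carrier E.\<C> \<subseteq> carrier D.T" using Phi_closed by auto
  have "u \<in> \<Phi> ` carrier E.\<C>" if "u \<in> carrier D.T" for u
    using K.cring_axioms finite_cartesian_product[OF D.finite_Z finite_G] that[unfolded D.T_carrier]
  proof (induction u rule: function_space_induct)
    case zero
    have "(\<lambda>j\<in>Z \<times> carrier G. \<zero>\<^bsub>K\<^esub>) = \<Phi> \<zero>\<^bsub>E.\<C>\<^esub>"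
      using Phi.hom_zero by (simp add: transformation_algebra_def)
    thus ?case using E.C.zero_closed by (rule image_eqI[where f = \<Phi>])
  next
    case (add u v)
    then obtain f h where fh: "f \<in> carrier E.\<C>" "u = \<Phi> f" "h \<in> carrier E.\<C>" "v = \<Phi> h" by blast
    have "(\<lambda>j\<in>Z \<times> carrier G. u j \<oplus>\<^bsub>K\<^esub> v j) = u \<oplus>\<^bsub>D.T\<^esub> v"
      by (simp add: transformation_algebra_def)
    also have "\<dots> = \<Phi> (f \<oplus>\<^bsub>E.\<C>\<^esub> h)" using fh by (simp only: Phi_add)
    finally show ?case
      using E.C.a_closed[OF fh(1,3)] by (rule image_eqI[where f = \<Phi>])
  next
    case (scale c q)
    then obtain x y h where q: "q = ((x, y), h)" "x \<in> X" "y \<in> X" "h \<in> carrier G" by auto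
    note i = ix[OF q(4)]
    note t = E.mono_tree[OF delta_closed delta_closed less_imp_le[OF i(1)], of x y]
    have "(\<lambda>j\<in>Z \<times> carrier G. if j = q then c else \<zero>\<^bsub>K\<^esub>)
        = c \<odot>\<^bsub>D.T\<^esub> \<Phi> (E.bas (E.mono_tree (delta x) (delta y) (ix h)))"
      unfolding Phi_mono_tree[OF q(2,3) i(1)] i(2) q(1)[symmetric]
      using scale by (auto simp: transformation_algebra_def fun_eq_iff)
    also have "\<dots> = \<Phi> (c \<odot>\<^bsub>E.\<C>\<^esub> E.bas (E.mono_tree (delta x) (delta y) (ix h)))"
      using scale E.bas_closed[OF t(1)] by (simp only: Phi_smult)
    finally show ?case
      using E.smult_C_closed[OF scale(1) E.bas_closed[OF t(1)]] by (rule image_eqI[where f = \<Phi>])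
  qed
  thus "carrier D.T \<subseteq> \<Phi> ` carrier E.\<C>" by blast
qed

theorem envelope_iso: "(\<lambda>C. the_elem (\<Phi> ` C)) \<in> algebra_iso K E.\<U> D.T"
proof -
  have "(\<lambda>C. the_elem (\<Phi> ` C)) \<in> ring_iso (E.\<C> Quot E.ker) D.T"
    using Phi.FactRing_iso_set[OF Phi_surj] by (simp only: kernel_eq)
  hence "(\<lambda>C. the_elem (\<Phi> ` C)) \<in> ring_iso E.\<U> D.T"
    by (simp add: ring_iso_def ring_hom_def quotient_algebra_def)
  moreover have "the_elem (\<Phi> ` (c \<odot>\<^bsub>E.\<U>\<^esub> C)) = c \<odot>\<^bsub>D.T\<^esub> the_elem (\<Phi> ` C)"
    if c: "c \<in> carrier K" and C: "C \<in> carrier E.\<U>" for c C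
  proof -
    have el: "the_elem (\<Phi> ` E.Q.coset f) = \<Phi> f" if f: "f \<in> carrier E.\<C>" for f
    proof -
      have "\<Phi> f' = \<Phi> f" if f': "f' \<in> E.Q.coset f" for f'
      proof -
        obtain i where i: "i \<in> E.ker" "f' = i \<oplus>\<^bsub>E.\<C>\<^esub> f"
          using f' by (auto simp: E.Q.coset_def a_r_coset_def')
        have "i \<in> carrier E.\<C>" "\<Phi> i = \<zero>\<^bsub>D.T\<^esub>"
          using i(1) ker_subset unfolding a_kernel_def' by auto
        thus ?thesis
          unfolding i(2) using f Phi_closed[OF f] by (simp only: Phi_add D.T.l_zero)
      qed
      moreover have "E.Q.coset f \<noteq> {}"
        using E.Q.J.a_rcos_self[OF f] by (auto simp: E.Q.coset_def)
      ultimately show ?thesis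
        by (intro the_elem_image_unique)
    qed
    obtain f where f: "f \<in> carrier E.\<C>" "C = E.Q.coset f" using C by (auto simp: E.Q.quotient_carrier)
    show ?thesis
      using f c by (simp add: el E.smult_C_closed Phi_smult flip: E.Q.coset_smult)
  qed
  ultimately show ?thesis by (simp add: algebra_iso_def)
qed

lemma envelope_unfold: "permutation_envelope K G X \<phi> g n = E.\<U>"
  by (simp only: permutation_envelope_def E.envelope_eq)

lemma stabilizer_product:
  "product_algebra (diagonal_orbits G X \<phi>) (\<lambda>orb. group_algebra K G (diagonal_stabilizer G X \<phi> (r orb))) = D.S"
  by (simp only: diagonal_orbits_def diagonal_stabilizer_def)

theorem envelope_matrix_decomposition:
  "algebra_isomorphic K (permutation_envelope K G X \<phi> g n)
     (product_algebra (diagonal_orbits G X \<phi>)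
        (\<lambda>orb. matrix_algebra (card orb) (group_algebra K G (diagonal_stabilizer G X \<phi> (r orb)))))"
  using algebra_iso_compose[OF envelope_iso D.Theta_iso]
  unfolding envelope_unfold diagonal_orbits_def diagonal_stabilizer_def algebra_isomorphic_def by blast

sublocale St: corner D.T D.S K D.\<psi> D.base "\<lambda>x. D.single x (D.\<gamma> x)" "\<lambda>x. D.single (D.rep x) (inv\<^bsub>G\<^esub> D.\<gamma> x)" Z
  by (rule D.stabilizer_corner)

theorem envelope_morita:
  assumes "infinite (UNIV :: 'u set)"
  shows "morita_equivalent TYPE('u) K (permutation_envelope K G X \<phi> g n) D.S"
proof -
  have "morita_equivalent TYPE('u) K D.T E.\<U>"
  proof (rule algebra_iso_morita[OF E.Q.quotient_ring D.T.ring_axioms envelope_iso assms])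
    show "c \<odot>\<^bsub>E.\<U>\<^esub> \<one>\<^bsub>E.\<U>\<^esub> \<in> carrier E.\<U>" if "c \<in> carrier K" for c
      using that by simp
  qed (rule St.scalar_central)
  hence "morita_equivalent TYPE('u) K E.\<U> D.T" by (rule morita_equivalent_sym)
  moreover have "morita_equivalent TYPE('u) K D.T D.S"
    by (rule corner_morita[OF D.stabilizer_corner assms])
  ultimately show ?thesis
    unfolding envelope_unfold by (rule morita_equivalent_trans)
qed

lemma S_smult_closed:
  assumes "c \<in> carrier K" "s \<in> carrier D.S"
  shows "c \<odot>\<^bsub>D.S\<^esub> s \<in> carrier D.S"
proof -
  have "c \<odot>\<^bsub>D.kH B\<^esub> s B \<in> carrier (D.kH B)" if B: "B \<in> D.Orb" for B
    using D.kH_closedD[OF B D.S_entry[OF assms(2) B]] assms(1) B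
    by (intro D.kH_closedI) (auto simp: D.kH_apply)
  thus ?thesis by (auto simp: product_algebra_def)
qed

end

section \<open>The decomposition and the Morita class\<close>

theorem theorem4p1:
  fixes K :: "('k, 'e) ring_scheme"
    and G :: "('g, 'f) monoid_scheme" and g :: 'g
    and X :: "'x set" and \<phi> :: "'g \<Rightarrow> 'x \<Rightarrow> 'x"
    and r :: "('x \<times> 'x) set \<Rightarrow> 'x \<times> 'x"
    and m n :: nat
  assumes "cring K"
    and "m \<ge> 2" and "n = m + 1"
    and "group G" and "order G = m" and "g \<in> carrier G" and "generate G {g} = carrier G"
    and "group_action G X \<phi>" and "finite X" and "X \<noteq> {}"
    and "\<forall>orb \<in> diagonal_orbits G X \<phi>. r orb \<in> orb"
    and "infinite (UNIV :: 'u set)"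
  shows "algebra_isomorphic K
           (permutation_envelope K G X \<phi> g n)
           (product_algebra (diagonal_orbits G X \<phi>)
              (\<lambda>orb. matrix_algebra (card orb)
                 (group_algebra K G (diagonal_stabilizer G X \<phi> (r orb)))))
    \<and> morita_equivalent TYPE('u) K
           (permutation_envelope K G X \<phi> g n)
           (product_algebra (diagonal_orbits G X \<phi>)
              (\<lambda>orb. group_algebra K G (diagonal_stabilizer G X \<phi> (r orb))))
    \<and> (\<forall>(Y :: 'y set) \<psi> g' r' \<beta>.
         group_action G Y \<psi> \<and> finite Y \<and> Y \<noteq> {} \<and>
         g' \<in> carrier G \<and> generate G {g'} = carrier G \<and>
         (\<forall>orb \<in> diagonal_orbits G Y \<psi>. r' orb \<in> orb) \<and>
         bij_betw \<beta> (diagonal_orbits G X \<phi>) (diagonal_orbits G Y \<psi>) \<and>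
         (\<forall>orb \<in> diagonal_orbits G X \<phi>.
            diagonal_stabilizer G Y \<psi> (r' (\<beta> orb)) = diagonal_stabilizer G X \<phi> (r orb))
         \<longrightarrow> morita_equivalent TYPE('u) K
               (permutation_envelope K G X \<phi> g n)
               (permutation_envelope K G Y \<psi> g' n))"
proof (intro conjI allI impI)
  interpret P: permutation_setting K G X \<phi> g m n r
    using assms by (intro permutation_setting.intro permutation_setting_axioms.intro) auto
  show "algebra_isomorphic K
           (permutation_envelope K G X \<phi> g n)
           (product_algebra (diagonal_orbits G X \<phi>)
              (\<lambda>orb. matrix_algebra (card orb)
                 (group_algebra K G (diagonal_stabilizer G X \<phi> (r orb)))))"
    by (rule P.envelope_matrix_decomposition)
  show "morita_equivalent TYPE('u) K
           (permutation_envelope K G X \<phi> g n)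
           (product_algebra (diagonal_orbits G X \<phi>)
              (\<lambda>orb. group_algebra K G (diagonal_stabilizer G X \<phi> (r orb))))"
    unfolding P.stabilizer_product by (rule P.envelope_morita) fact
  fix Y :: "'y set" and \<psi> g' r' \<beta>
  assume Y: "group_action G Y \<psi> \<and> finite Y \<and> Y \<noteq> {} \<and>
         g' \<in> carrier G \<and> generate G {g'} = carrier G \<and>
         (\<forall>orb \<in> diagonal_orbits G Y \<psi>. r' orb \<in> orb) \<and>
         bij_betw \<beta> (diagonal_orbits G X \<phi>) (diagonal_orbits G Y \<psi>) \<and>
         (\<forall>orb \<in> diagonal_orbits G X \<phi>.
            diagonal_stabilizer G Y \<psi> (r' (\<beta> orb)) = diagonal_stabilizer G X \<phi> (r orb))"
  interpret Q: permutation_setting K G Y \<psi> g' m n r'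
    using assms Y by (intro permutation_setting.intro permutation_setting_axioms.intro) auto
  let ?SX = "P.D.S" and ?SY = "Q.D.S"
  (* Both envelopes are Morita equivalent to products of group algebras of stabilizers, and these
     products differ only by the reindexing of orbits along \<beta>. *)
  have "(\<lambda>f. \<lambda>j\<in>Q.D.Orb. f (inv_into P.D.Orb \<beta> j)) \<in> algebra_iso K ?SX ?SY"
  proof (rule product_algebra_reindex)
    show "bij_betw \<beta> P.D.Orb Q.D.Orb" using Y by (simp add: diagonal_orbits_def)
    show "Q.D.kH (\<beta> B) = P.D.kH B" if "B \<in> P.D.Orb" for B
      using Y that by (simp add: diagonal_orbits_def diagonal_stabilizer_def)
  qed (auto intro: P.D.kH_ring P.S_smult_closed)
  hence "morita_equivalent TYPE('u) K ?SY ?SX"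
    using P.D.S_ring Q.D.S_ring assms(12) P.St.scalar_closed(2) Q.St.corner_scalar_central
    by (intro algebra_iso_morita)
  moreover have "morita_equivalent TYPE('u) K (permutation_envelope K G X \<phi> g n) ?SX"
    by (rule P.envelope_morita) fact
  moreover have "morita_equivalent TYPE('u) K (permutation_envelope K G Y \<psi> g' n) ?SY"
    by (rule Q.envelope_morita) fact
  ultimately show "morita_equivalent TYPE('u) K
               (permutation_envelope K G X \<phi> g n)
               (permutation_envelope K G Y \<psi> g' n)"
    by (meson morita_equivalent_sym morita_equivalent_trans)
qed

end
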